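(* Let $\mathbb{G}$ be a Carnot group (with the structure described in the context), let $j\in\{1,\dots,n_1\}$, let $E\subseteq\mathbb{G}$ and let $\varphi:E\to\mathbb{G}$ be Lipschitz continuous with respect to the Carnot--Carath\'eodory distance $\rho$. Then for every measurable $A\subseteq E$ the function \[ p\mapsto \mathcal{H}^1\big((\mathrm{Pr}_j\circ\varphi)^{-1}(p)\cap A\big),\qquad p\in\Pi_j, \] is measurable and \[ \int_{\Pi_j}\mathcal{H}^1\big((\mathrm{Pr}_j\circ\varphi)^{-1}(p)\cap A\big)\,d\mathcal{H}^{\nu-1}(p)\le \frac{\Theta_{\Pi_j}}{\Theta_{\mathbb{G}}}\int_A \big|\mathrm{adj}\,\widehat{D}\varphi(x)\langle X_j\rangle\big|\,d\mathcal{H}^\nu(x). \]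
   Context: $\mathbb{G}$ is a Carnot group: a connected simply connected nilpotent Lie group whose Lie algebra $\mathfrak{g}$ of left-invariant vector fields splits as $\mathfrak{g}=V_1\oplus\dots\oplus V_m$ with $[V_1,V_k]=V_{k+1}$ for $k=1,\dots,m$ ($V_{m+1}=\{0\}$). Let $n_k=\dim V_k$, $N=\dim\mathfrak g$. Fix a basis $X_1,\dots,X_N$ of $\mathfrak g$, ordered by degree, such that each $V_k$ is spanned by a subcollection; set $\sigma_i=k$ if $X_i\in V_k$ (so $X_1,\dots,X_{n_1}$ span $V_1$). Points are identified with canonical coordinates of the first kind: $(x_1,\dots,x_N)=\exp(\sum_i x_iX_i)(e)$. Dilations: $\delta_\lambda(x)=(\lambda^{\sigma_1}x_1,\dots,\lambda^{\sigma_N}x_N)$; homogeneous dimension $\nu=\sum_i\sigma_i$. A scalar product on $V_1$ defines the Carnot--Carath\'eodory distance $\rho$ (infimum of lengths of horizontal curves); the scalar product is extended to $\mathfrak g$ so that $X_1,\dots,X_N$ is orthonormal, and $|\cdot|$ denotes the resulting norm on $\mathfrak g$. $B_r(x)$ is the open $\rho$-ball. For $s\ge0$, $\varepsilon>0$: $\mathcal H^s_\varepsilon(F)=\beta_s\inf\{\sum_k r_k^s: F\subseteq\bigcup_k B_{r_k}(x_k),\ \sup_k r_k\le\varepsilon\}$ with normalizing constants $\beta_s>0$, $\beta_1=2$, and $\mathcal H^s=\sup_{\varepsilon>0}\mathcal H^s_\varepsilon$ (spherical Hausdorff measure w.r.t. $\rho$). $\mathcal L^N$ is Lebesgue measure in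 coordinates and $\mathcal H^\nu=\Theta_{\mathbb G}\mathcal L^N$ for a constant $\Theta_{\mathbb G}>0$. Projections: for $j\in\{1,\dots,n_1\}$, $\Pi_j=\{x\in\mathbb G: x_j=0\}$ (a normal subgroup); every $x\in\mathbb G$ is uniquely written $x=p\exp(x_jX_j)$ with $p\in\Pi_j$, and $\mathrm{Pr}_j(x):=p$ (projection onto $\Pi_j$ along integral lines of $X_j$). On $\Pi_j$, $\mathcal H^{\nu-1}=\Theta_{\Pi_j}\mathcal L^{N-1}$ for a constant $\Theta_{\Pi_j}>0$, $\mathcal L^{N-1}$ being Lebesgue measure on $\Pi_j$ in the coordinates. Pansu differential: a contactomorphism $L:\mathbb G\to\mathbb G$ is a Lie group homomorphism with $DL\langle V_1\rangle\subset V_1$; $\widehat L=\log\circ L\circ\exp:\mathfrak g\to\mathfrak g$ is the associated linear map. $\varphi:E\to\mathbb G$ is Pansu differentiable at $x_0\in E$ if there is a contactomorphism $L$ with $\rho(\varphi(x_0)^{-1}\varphi(x),L(x_0^{-1}x))=o(\rho(x_0,x))$ as $x\to x_0$, $x\in E$; then $\widehat D\varphi(x_0):=\widehat L$. Lipschitz maps are Pansu differentiable $\mathcal H^\nu$-a.e. For a linear map $M$ of $\mathfrak g$, $\mathrm{adj}\,M$ is its adjugate (transposed cofactor matrix), so $M\circ\mathrm{adj}\,M=\mathrm{adj}\,M\circ M=\det M\cdot\mathrm{Id}$. *)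

theory Defs
  imports "HOL-Analysis.Analysis"
begin

text \<open>Points of the Carnot group are identified with their canonical (exponential) coordinates of
the first kind, i.e. with vectors in real^'n (N = CARD('n)).  The group law is gm, the degree of
the basis vector X_i (= axis i 1 at the identity) is sigma i.\<close>

definition dil :: "('n::finite \<Rightarrow> nat) \<Rightarrow> real \<Rightarrow> real^'n \<Rightarrow> real^'n" where
  "dil \<sigma> lam x = (\<chi> i. lam ^ \<sigma> i * x $ i)"

definition layer :: "('n::finite \<Rightarrow> nat) \<Rightarrow> nat \<Rightarrow> (real^'n) set" where
  "layer \<sigma> k = span {axis i 1 | i. \<sigma> i = k}"

text \<open>Group commutator; in exponential coordinates the inverse of x is -x.\<close>
definition gcomm :: "(real^'n \<Rightarrow> real^'n \<Rightarrow> real^'n) \<Rightarrow> real^'n \<Rightarrow> real^'n \<Rightarrow> real^'n" where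
  "gcomm gm a b = gm (gm (gm a b) (- a)) (- b)"

definition lie_bracket :: "(real^'n::finite \<Rightarrow> real^'n \<Rightarrow> real^'n) \<Rightarrow> real^'n \<Rightarrow> real^'n \<Rightarrow> real^'n" where
  "lie_bracket gm v w = Lim (at 0) (\<lambda>t::real. (1 / t^2) *\<^sub>R gcomm gm (t *\<^sub>R v) (t *\<^sub>R w))"

definition carnot_group :: "(real^'n::finite \<Rightarrow> real^'n \<Rightarrow> real^'n) \<Rightarrow> ('n \<Rightarrow> nat) \<Rightarrow> bool" where
  "carnot_group gm \<sigma> \<longleftrightarrow>
     \<comment> \<open>group axioms (inverses follow from the one-parameter property)\<close>
     (\<forall>x y z. gm (gm x y) z = gm x (gm y z)) \<and>
     (\<forall>x. gm 0 x = x \<and> gm x 0 = x) \<and>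
     \<comment> \<open>canonical coordinates of the first kind: t \<mapsto> t x is the one-parameter subgroup exp(t x)\<close>
     (\<forall>x s t. gm (s *\<^sub>R x) (t *\<^sub>R x) = (s + t) *\<^sub>R x) \<and>
     \<comment> \<open>the group law is C^1 (hence a Lie group)\<close>
     (\<exists>D. (\<forall>z. ((\<lambda>z. gm (fst z) (snd z)) has_derivative blinfun_apply (D z)) (at z)) \<and>
          continuous_on UNIV D) \<and>
     \<comment> \<open>degrees and dilations\<close>
     (\<forall>i. 1 \<le> \<sigma> i) \<and>
     (\<forall>lam>0. \<forall>x y. gm (dil \<sigma> lam x) (dil \<sigma> lam y) = dil \<sigma> lam (gm x y)) \<and>
     \<comment> \<open>the bracket exists, and the stratification [V_1, V_k] = V_(k+1)\<close>
     (\<forall>v w. ((\<lambda>t::real. (1 / t^2) *\<^sub>R gcomm gm (t *\<^sub>R v) (t *\<^sub>R w)) \<longlongrightarrow> lie_bracket gm v w) (at 0)) \<and>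
     (\<forall>k\<ge>1. span {lie_bracket gm v w | v w. v \<in> layer \<sigma> 1 \<and> w \<in> layer \<sigma> k} = layer \<sigma> (Suc k))"

definition lvf :: "(real^'n::finite \<Rightarrow> real^'n \<Rightarrow> real^'n) \<Rightarrow> 'n \<Rightarrow> real^'n \<Rightarrow> real^'n" where
  "lvf gm i x = frechet_derivative (gm x) (at 0) (axis i 1)"

text \<open>Horizontal curves on [0,1] with control h (h_i = 0 unless X_i is in V_1); since
X_1..X_N is orthonormal, the length is the integral of |h|.\<close>
definition horizontal :: "(real^'n::finite \<Rightarrow> real^'n \<Rightarrow> real^'n) \<Rightarrow> ('n \<Rightarrow> nat) \<Rightarrow>
    (real \<Rightarrow> real^'n) \<Rightarrow> (real \<Rightarrow> real^'n) \<Rightarrow> bool" where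
  "horizontal gm \<sigma> \<gamma> h \<longleftrightarrow>
     (\<exists>C. C-lipschitz_on {0..1} \<gamma>) \<and>
     (\<forall>t i. \<sigma> i \<noteq> 1 \<longrightarrow> h t $ i = 0) \<and>
     (\<lambda>t. norm (h t)) integrable_on {0..1} \<and>
     (AE t in lebesgue. t \<in> {0..1} \<longrightarrow>
        (\<gamma> has_vector_derivative (\<Sum>i\<in>{i. \<sigma> i = 1}. h t $ i *\<^sub>R lvf gm i (\<gamma> t))) (at t within {0..1}))"

definition cc_dist :: "(real^'n::finite \<Rightarrow> real^'n \<Rightarrow> real^'n) \<Rightarrow> ('n \<Rightarrow> nat) \<Rightarrow>
    real^'n \<Rightarrow> real^'n \<Rightarrow> real" where
  "cc_dist gm \<sigma> x y = Inf {integral {0..1} (\<lambda>t. norm (h t)) | \<gamma> h.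
      horizontal gm \<sigma> \<gamma> h \<and> \<gamma> 0 = x \<and> \<gamma> 1 = y}"

definition cc_ball :: "(real^'n::finite \<Rightarrow> real^'n \<Rightarrow> real^'n) \<Rightarrow> ('n \<Rightarrow> nat) \<Rightarrow>
    real^'n \<Rightarrow> real \<Rightarrow> (real^'n) set" where
  "cc_ball gm \<sigma> x r = {y. cc_dist gm \<sigma> x y < r}"

definition sph_hausdorff :: "(real^'n::finite \<Rightarrow> real^'n \<Rightarrow> real^'n) \<Rightarrow> ('n \<Rightarrow> nat) \<Rightarrow>
    real \<Rightarrow> real \<Rightarrow> (real^'n) set \<Rightarrow> ennreal" where
  "sph_hausdorff gm \<sigma> \<beta> s F = (SUP \<epsilon>\<in>{0<..}. ennreal \<beta> *
      Inf {(\<Sum>k. ennreal (r k powr s)) | r c. (\<forall>k. 0 \<le> r k \<and> r k \<le> \<epsilon>) \<and>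
                F \<subseteq> (\<Union>k. cc_ball gm \<sigma> (c k) (r k))})"

definition H1 :: "(real^'n::finite \<Rightarrow> real^'n \<Rightarrow> real^'n) \<Rightarrow> ('n \<Rightarrow> nat) \<Rightarrow> (real^'n) set \<Rightarrow> ennreal" where
  "H1 gm \<sigma> F = sph_hausdorff gm \<sigma> 2 1 F"

definition cc_lipschitz_on :: "(real^'n::finite \<Rightarrow> real^'n \<Rightarrow> real^'n) \<Rightarrow> ('n \<Rightarrow> nat) \<Rightarrow>
    (real^'n) set \<Rightarrow> (real^'n \<Rightarrow> real^'n) \<Rightarrow> bool" where
  "cc_lipschitz_on gm \<sigma> E \<phi> \<longleftrightarrow>
     (\<exists>C. \<forall>x\<in>E. \<forall>y\<in>E. cc_dist gm \<sigma> (\<phi> x) (\<phi> y) \<le> C * cc_dist gm \<sigma> x y)"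

text \<open>Projection onto \<Pi>_j = {x_j = 0} along integral lines of X_j: x = p exp(t X_j).\<close>
definition proj :: "(real^'n::finite \<Rightarrow> real^'n \<Rightarrow> real^'n) \<Rightarrow> 'n \<Rightarrow> real^'n \<Rightarrow> real^'n" where
  "proj gm j x = (THE p. p $ j = 0 \<and> (\<exists>t. gm p (t *\<^sub>R axis j 1) = x))"

text \<open>Contactomorphisms, in exponential coordinates (where L coincides with \<widehat>L = log o L o exp,
a linear map): linear group homomorphisms whose differential preserves V_1.\<close>
definition contactomorphism :: "(real^'n::finite \<Rightarrow> real^'n \<Rightarrow> real^'n) \<Rightarrow> ('n \<Rightarrow> nat) \<Rightarrow>
    (real^'n \<Rightarrow> real^'n) \<Rightarrow> bool" where
  "contactomorphism gm \<sigma> L \<longleftrightarrow> linear L \<and> (\<forall>x y. L (gm x y) = gm (L x) (L y)) \<and>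
     L ` layer \<sigma> 1 \<subseteq> layer \<sigma> 1"

definition pansu_diff_with :: "(real^'n::finite \<Rightarrow> real^'n \<Rightarrow> real^'n) \<Rightarrow> ('n \<Rightarrow> nat) \<Rightarrow>
    (real^'n) set \<Rightarrow> (real^'n \<Rightarrow> real^'n) \<Rightarrow> real^'n \<Rightarrow> (real^'n \<Rightarrow> real^'n) \<Rightarrow> bool" where
  "pansu_diff_with gm \<sigma> E \<phi> x0 L \<longleftrightarrow> contactomorphism gm \<sigma> L \<and>
     (\<forall>\<epsilon>>0. \<exists>\<delta>>0. \<forall>x\<in>E. cc_dist gm \<sigma> x0 x < \<delta> \<longrightarrow>
        cc_dist gm \<sigma> (gm (- \<phi> x0) (\<phi> x)) (L (gm (- x0) x)) \<le> \<epsilon> * cc_dist gm \<sigma> x0 x)"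

text \<open>The Pansu differential \<widehat>D\<phi>(x0) (meaningful where \<phi> is Pansu differentiable).\<close>
definition pansu_diff :: "(real^'n::finite \<Rightarrow> real^'n \<Rightarrow> real^'n) \<Rightarrow> ('n \<Rightarrow> nat) \<Rightarrow>
    (real^'n) set \<Rightarrow> (real^'n \<Rightarrow> real^'n) \<Rightarrow> real^'n \<Rightarrow> (real^'n \<Rightarrow> real^'n)" where
  "pansu_diff gm \<sigma> E \<phi> x0 = (SOME L. pansu_diff_with gm \<sigma> E \<phi> x0 L)"

text \<open>Adjugate (transposed cofactor matrix): entry (i,k) is the (k,i) cofactor, i.e. the
determinant of M with its i-th column replaced by the k-th standard basis vector.\<close>
definition adjugate :: "real^'n^'n \<Rightarrow> real^'n^'n" where
  "adjugate M = (\<chi> i k. det (\<chi> r c. if c = i then (if r = k then 1 else 0) else M $ r $ c))"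

definition hyp_emb :: "'n::finite \<Rightarrow> ('n \<Rightarrow> real) \<Rightarrow> real^'n" where
  "hyp_emb j q = (\<chi> i. if i = j then 0 else q i)"

end

theory Submission
  imports Defs
begin

text \<open>
  At a point of Pansu differentiability the blow-ups of \<open>\<phi>\<close> converge to a homomorphism L. Some horizontal unit vector v is mapped
  by L into the line of \<open>X\<^sub>j\<close>, so the fibres of the projected homomorphism are unions of lines in direction v. Replacing the j-th row
  of L by v gives a map that carries these lines isometrically to integral lines of \<open>X\<^sub>j\<close>; it commutes with dilations, hence has a
  constant Jacobian, which equals \<open>v \<bullet> adj L X\<^sub>j\<close> and is at most \<open>|adj L X\<^sub>j|\<close>. By Fubini along the lines of \<open>X\<^sub>j\<close> this is the
  inequality for L on the unit ball. The spherical premeasure of the fibres of compact sets is upper semicontinuous in the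
  base point and the perturbation, so the inequality persists, up to a small error, for \<open>\<phi>\<close> on all small balls around the point. A
  Vitali covering by such balls, the fact that negligible sets have null fibres over almost every base point, and Fatou's lemma as the mesh
  of the premeasure tends to 0 give the theorem.

  Pansu differentiability almost everywhere is obtained from a Rademacher theorem for the horizontal coordinates along the
  fields \<open>X\<^sub>i\<close>, together with the compactness of the family of blow-ups: a cluster point whose horizontal coordinates are linear is
  a homomorphism and is determined by these coordinates.
\<close>

section \<open>Change of variables for maps with constant Jacobian\<close>

text \<open>Replacing both Hausdorff measures by multiples of Lebesgue measure cancels the constants
  Theta, so the inequality to prove is one between Lebesgue integrals. The only Hausdorff measure
  left is the one-dimensional one, whose normalisation 2 matches the fact that a horizontal segment
  of length 2 r fits in a ball of radius r. The group law is merely C^1, so homogeneity takes the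
  place of the Baker-Campbell-Hausdorff formula: an expression that scales under dilations is
  determined by its limit at the identity. This yields triangular derivatives, unit Jacobians of
  translations and constant Jacobians of maps commuting with dilations. Moreover every point is a
  finite product of horizontal exponentials, so facts about homomorphisms are proved by induction on
  such words. Two obstacles shape the rest. Neither the fibre measure nor the integrand is known in
  advance to be measurable, so bounds pass through measurable majorants of the former and minorants
  of the latter. And E is arbitrary, so blow-ups are sampled at approximate nearest points of E and
  controlled where E is not porous.\<close>

text \<open>The change-of-variables theorem of HOL-Analysis requires a wellordered index type; the type \<open>'a wo\<close> is a copy of
  a finite type with an arbitrary linear order.\<close>

typedef 'a wo = "UNIV :: 'a set" by simp

lemma Rep_wo_inverse' [simp]: "Abs_wo (Rep_wo x) = x" "Rep_wo (Abs_wo y) = y"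
  by (simp_all add: Rep_wo_inverse Abs_wo_inverse)

lemma bij_Rep_wo: "bij Rep_wo" "bij Abs_wo"
  by (rule bijI'; (metis Rep_wo_inverse'))+

definition rank_fun :: "'a \<Rightarrow> nat" where "rank_fun = (SOME f. inj f)"

lemma inj_rank_fun: "inj (rank_fun :: 'a::finite \<Rightarrow> nat)"
proof -
  have "\<exists>f :: 'a \<Rightarrow> nat. inj f" using finite_imp_inj_to_nat_seg[of "UNIV :: 'a set"] by auto
  then show ?thesis unfolding rank_fun_def by (rule someI_ex)
qed

instantiation wo :: (finite) linorder
begin
definition "x \<le> y \<longleftrightarrow> rank_fun (Rep_wo x) \<le> rank_fun (Rep_wo y)"
definition "x < y \<longleftrightarrow> rank_fun (Rep_wo x) < rank_fun (Rep_wo y)"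
instance
proof
  fix x y z :: "'a wo"
  assume "x \<le> y" "y \<le> x"
  then have "rank_fun (Rep_wo x) = rank_fun (Rep_wo y)" unfolding less_eq_wo_def by (rule order_antisym)
  then have "Rep_wo x = Rep_wo y" by (rule injD[OF inj_rank_fun])
  then show "x = y" by (simp only: Rep_wo_inject)
qed (auto simp: less_eq_wo_def less_wo_def)
end

instance wo :: (finite) wellorder
proof
  fix P :: "'a wo \<Rightarrow> bool" and x :: "'a wo"
  assume step: "(\<And>x. (\<And>y. y < x \<Longrightarrow> P y) \<Longrightarrow> P x)"
  show "P x"
  proof (induction x rule: measure_induct_rule[where f = "\<lambda>x. rank_fun (Rep_wo x)"])
    case (less x)
    show ?case by (rule step, rule less) (simp add: less_wo_def)
  qed
qed

instance wo :: (finite) finite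
proof
  have "(UNIV :: 'a wo set) = Abs_wo ` UNIV" by (metis bij_Rep_wo(2) bij_is_surj)
  then show "finite (UNIV :: 'a wo set)" by (metis finite finite_imageI)
qed

definition to_wo :: "real^'n \<Rightarrow> real^('n wo)" where "to_wo x = (\<chi> i. x $ Rep_wo i)"
definition of_wo :: "real^('n wo) \<Rightarrow> real^'n" where "of_wo x = (\<chi> i. x $ Abs_wo i)"

lemma to_of_wo [simp]: "to_wo (of_wo x) = x" "of_wo (to_wo y) = y"
  by (simp_all add: to_wo_def of_wo_def vec_eq_iff)

lemma linear_wo: "linear (to_wo :: real^'n::finite \<Rightarrow> _)" "linear (of_wo :: _ \<Rightarrow> real^'n::finite)"
  by (rule linearI; simp add: to_wo_def of_wo_def vec_eq_iff)+

lemma continuous_wo: "continuous_on S (to_wo :: real^'n::finite \<Rightarrow> _)" "continuous_on T (of_wo :: _ \<Rightarrow> real^'n::finite)"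
  using linear_wo by (auto intro!: linear_continuous_on simp: linear_conv_bounded_linear[symmetric])

text \<open>Renaming the indices conjugates every permutation by the bijection
  \<open>Rep_wo\<close>. Conjugation takes transpositions to transpositions, hence preserves signs,
  and the two Leibniz sums agree term by term.\<close>

lemma det_wo:
  fixes f :: "real^'n::finite \<Rightarrow> real^'n"
  assumes "linear f"
  shows "det (matrix (to_wo \<circ> f \<circ> of_wo)) = det (matrix f)"
proof -
  have ax: "of_wo (axis k 1) = axis (Rep_wo k) 1" for k :: "'n wo"
    by (auto simp: of_wo_def vec_eq_iff axis_def)
  have ent: "matrix (to_wo \<circ> f \<circ> of_wo) $ i $ k = matrix f $ Rep_wo i $ Rep_wo k" for i k
    by (simp add: matrix_def ax) (simp add: to_wo_def)
  let ?h = "\<lambda>p. Rep_wo \<circ> p \<circ> Abs_wo" let ?h' = "\<lambda>p. Abs_wo \<circ> p \<circ> Rep_wo"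
  have hp: "?h p permutes UNIV" if "p permutes UNIV" for p :: "'n wo \<Rightarrow> 'n wo"
    using permutes_bij[OF that] bij_Rep_wo by (intro bij_imp_permutes) (auto intro: bij_comp)
  have h'p: "?h' p permutes UNIV" if "p permutes UNIV" for p :: "'n \<Rightarrow> 'n"
    using permutes_bij[OF that] bij_Rep_wo by (intro bij_imp_permutes) (auto intro: bij_comp)
  have sgn: "sign (?h p) = sign p" if "p permutes UNIV" for p :: "'n wo \<Rightarrow> 'n wo"
    using that finite
  proof (induction p rule: permutes_induct)
    case id
    then show ?case by (simp add: o_def sign_id[unfolded id_def])
  next
    case (swap a b p)
    have "?h (Transposition.transpose a b \<circ> p) = Transposition.transpose (Rep_wo a) (Rep_wo b) \<circ> ?h p"
      by (auto simp: fun_eq_iff Transposition.transpose_def Rep_wo_inject)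
    moreover have "permutation (?h p)" "permutation p"
      using hp[OF swap(4)] swap(4) by (auto simp: permutation_permutes)
    ultimately show ?case using swap(3,5)
      by (simp only: sign_compose permutation_swap_id sign_swap_id Rep_wo_inject)
  qed
  have "det (matrix f) = (\<Sum>p\<in>{p. p permutes (UNIV :: 'n wo set)}. of_int (sign (?h p)) * (\<Prod>i\<in>UNIV. matrix f $ i $ ?h p i))"
    unfolding det_def
    by (rule sum.reindex_bij_witness[where i = ?h and j = ?h']) (simp_all add: hp[unfolded o_def] h'p[unfolded o_def] o_def)
  also have "\<dots> = det (matrix (to_wo \<circ> f \<circ> of_wo))"
    unfolding det_def
  proof (rule sum.cong[OF refl])
    fix p :: "'n wo \<Rightarrow> 'n wo" assume p: "p \<in> {p. p permutes UNIV}"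
    have "(\<Prod>i\<in>UNIV. matrix f $ i $ ?h p i) = (\<Prod>i\<in>UNIV. matrix f $ Rep_wo i $ Rep_wo (p i))"
      by (rule prod.reindex_bij_witness[where i = Rep_wo and j = Abs_wo]) auto
    then show "of_int (sign (?h p)) * (\<Prod>i\<in>UNIV. matrix f $ i $ ?h p i) =
        of_int (sign p) * (\<Prod>i\<in>UNIV. matrix (to_wo \<circ> f \<circ> of_wo) $ i $ p i)"
      using p by (simp add: sgn ent)
  qed
  finally show ?thesis by simp
qed

lemma emeasure_lborel_cbox_cart:
  fixes l u :: "real^'n::finite"
  assumes "\<And>i. l $ i \<le> u $ i"
  shows "emeasure lborel (box l u) = ennreal (\<Prod>i\<in>UNIV. u $ i - l $ i)"
proof -
  have "(\<Prod>b\<in>Basis. (u - l) \<bullet> b) = (\<Prod>i\<in>UNIV. u $ i - l $ i)"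
  proof -
    have B: "(Basis :: (real^'n) set) = (\<lambda>i. axis i 1) ` UNIV" by (auto simp: Basis_vec_def)
    have "inj (\<lambda>i::'n. axis i (1::real))" by (auto simp: inj_def axis_eq_axis)
    then show ?thesis unfolding B by (simp add: prod.reindex inner_axis)
  qed
  moreover have "\<And>b. b \<in> Basis \<Longrightarrow> l \<bullet> b \<le> u \<bullet> b"
    using assms by (auto simp: Basis_vec_def inner_axis)
  ultimately show ?thesis by (simp add: emeasure_lborel_box)
qed

lemma lborel_of_wo: "(lborel :: (real^'n::finite) measure) = distr lborel borel of_wo"
proof (rule lborel_eqI)
  fix l u :: "real^'n" assume lu: "\<And>b. b \<in> Basis \<Longrightarrow> l \<bullet> b \<le> u \<bullet> b"
  have lu': "l $ i \<le> u $ i" for i using lu[of "axis i 1"] by (auto simp: Basis_vec_def inner_axis)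
  have ev: "of_wo -` box l u = box (to_wo l) (to_wo u)"
  proof (rule set_eqI)
    fix x
    have "(\<forall>i::'n. P i) \<longleftrightarrow> (\<forall>i. P (Rep_wo i))" for P by (metis Rep_wo_inverse'(2))
    from this[of "\<lambda>i. l $ i < x $ Abs_wo i \<and> x $ Abs_wo i < u $ i"]
    show "x \<in> of_wo -` box l u \<longleftrightarrow> x \<in> box (to_wo l) (to_wo u)"
      by (simp add: mem_box_cart to_wo_def of_wo_def)
  qed
  have m: "(of_wo :: _ \<Rightarrow> real^'n) \<in> borel_measurable borel"
    using continuous_wo by (intro borel_measurable_continuous_onI)
  have "emeasure (distr lborel borel of_wo) (box l u) = ennreal (\<Prod>i\<in>UNIV. to_wo u $ i - to_wo l $ i)"
    using m by (simp add: emeasure_distr ev emeasure_lborel_cbox_cart lu' to_wo_def)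
  also have "(\<Prod>i\<in>UNIV. to_wo u $ i - to_wo l $ i) = (\<Prod>i\<in>UNIV. u $ i - l $ i)"
    by (rule prod.reindex_bij_witness[where i = Abs_wo and j = Rep_wo]) (auto simp: to_wo_def)
  also have "ennreal \<dots> = ennreal (\<Prod>b\<in>Basis. (u - l) \<bullet> b)"
    using emeasure_lborel_cbox_cart[OF lu'] emeasure_lborel_box[OF lu] by simp
  finally show "emeasure (distr lborel borel of_wo) (box l u) = ennreal (\<Prod>b\<in>Basis. (u - l) \<bullet> b)" .
qed simp

lemma emeasure_to_wo:
  assumes "S \<in> sets borel" shows "emeasure lborel (to_wo ` S) = emeasure lborel (S :: (real^'n::finite) set)"
proof -
  have m: "(of_wo :: _ \<Rightarrow> real^'n) \<in> borel_measurable borel"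
    using continuous_wo by (intro borel_measurable_continuous_onI)
  have "of_wo -` S = to_wo ` S" by (auto simp: image_iff) (metis to_of_wo)
  then show ?thesis using assms m by (subst (2) lborel_of_wo) (simp add: emeasure_distr)
qed

text \<open>The image may overlap itself, hence an inequality only. The degenerate case c = 0 is
  included on purpose: the straightening map of a contactomorphism, to which this is applied, may
  have vanishing Jacobian. A constant Jacobian is integrable over S at once.\<close>

lemma emeasure_C1_image_le:
  fixes f :: "real^'n::finite \<Rightarrow> real^'n"
  assumes S: "compact S" and d: "\<And>x. (f has_derivative f' x) (at x)" and c: "\<And>x. \<bar>det (matrix (f' x))\<bar> = c"
  shows "emeasure lborel (f ` S) \<le> ennreal c * emeasure lborel S"
proof -
  let ?f = "to_wo \<circ> f \<circ> of_wo" and ?S = "to_wo ` S"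
  have bl: "bounded_linear (to_wo :: real^'n \<Rightarrow> _)" "bounded_linear (of_wo :: _ \<Rightarrow> real^'n)"
    using linear_wo by (simp_all add: linear_conv_bounded_linear)
  have S': "compact ?S" using S bl(1) by (intro compact_continuous_image linear_continuous_on)
  have fS: "compact (f ` S)" using S d
    by (intro compact_continuous_image) (auto intro!: continuous_at_imp_continuous_on has_derivative_continuous)
  have d': "(?f has_derivative (to_wo \<circ> f' (of_wo y) \<circ> of_wo)) (at y within ?S)" for y
    unfolding o_def
    by (rule bounded_linear.has_derivative[OF bl(1)])
       (rule has_derivative_compose[OF bounded_linear_imp_has_derivative[OF bl(2)] d])
  have det: "\<bar>det (matrix (to_wo \<circ> f' (of_wo y) \<circ> of_wo))\<bar> = c" for y
    using det_wo[of "f' (of_wo y)"] c[of "of_wo y"] d[of "of_wo y"] by (simp add: has_derivative_linear)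
  have c0: "c \<ge> 0" using c[of 0] by simp
  have lm: "?S \<in> lmeasurable" using S' by (rule lmeasurable_compact)
  have int: "(\<lambda>y. \<bar>det (matrix (to_wo \<circ> f' (of_wo y) \<circ> of_wo))\<bar>) integrable_on ?S"
    unfolding det using lm by (rule integrable_on_const)
  have im: "?f ` ?S = to_wo ` (f ` S)" by (auto simp: image_image)
  have "measure lebesgue (?f ` ?S) \<le> c * measure lebesgue ?S"
    by (rule measure_bounded_differentiable_image[OF lm d' int]) (simp add: det[unfolded o_def] o_def)
  then have "measure lborel (to_wo ` (f ` S)) \<le> c * measure lborel ?S"
    unfolding im using borel_compact[OF compact_continuous_image[OF continuous_wo(1)[where 'n='n] fS]] S'
    by (simp add: borel_compact)
  then have "measure lborel (f ` S) \<le> c * measure lborel S"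
    using emeasure_to_wo[of "f ` S"] emeasure_to_wo[of S] S fS by (simp add: measure_def borel_compact)
  then have "ennreal (measure lborel (f ` S)) \<le> ennreal c * ennreal (measure lborel S)"
    using c0 by (simp add: ennreal_mult'[symmetric] ennreal_leI)
  then show ?thesis
    using emeasure_compact_finite[OF S] emeasure_compact_finite[OF fS]
    by (simp add: emeasure_eq_ennreal_measure less_top[symmetric])
qed

text \<open>The image inequality for g and for its inverse f gives equality on compact sets; boxes
  then identify the image measure with a multiple of Lebesgue measure.\<close>

lemma nn_integral_lborel_diffeo:
  fixes f g :: "real^'n::finite \<Rightarrow> real^'n"
  assumes gd: "\<And>y. (g has_derivative g' y) (at y)" and detg: "\<And>y. \<bar>det (matrix (g' y))\<bar> = c" and c: "c > 0"
    and fd: "\<And>y. (f has_derivative f' y) (at y)" and detf: "\<And>y. \<bar>det (matrix (f' y))\<bar> = 1/c"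
    and fg: "\<And>y. f (g y) = y" and gf: "\<And>x. g (f x) = x"
    and h: "h \<in> borel_measurable borel"
  shows "(\<integral>\<^sup>+x. h (f x) \<partial>lborel) = ennreal c * (\<integral>\<^sup>+x. h x \<partial>lborel)"
proof -
  have fm: "f \<in> borel_measurable borel" using fd
    by (intro borel_measurable_continuous_onI) (auto intro!: continuous_at_imp_continuous_on has_derivative_continuous)
  have ev: "f -` S = g ` S" for S using fg gf by (auto simp: image_iff) metis
  have comp: "emeasure lborel (f -` S) = ennreal c * emeasure lborel S" if "compact S" for S
  proof (rule antisym)
    show "emeasure lborel (f -` S) \<le> ennreal c * emeasure lborel S"
      unfolding ev by (rule emeasure_C1_image_le[OF that gd detg])
    have cg: "compact (g ` S)" using that gd
      by (intro compact_continuous_image) (auto intro!: continuous_at_imp_continuous_on has_derivative_continuous)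
    have "f ` g ` S = S" using fg by (auto simp: image_image)
    then have "ennreal c * emeasure lborel S \<le> ennreal c * (ennreal (1/c) * emeasure lborel (g ` S))"
      using emeasure_C1_image_le[OF cg fd detf] by (simp add: mult_left_mono)
    also have "\<dots> = emeasure lborel (g ` S)"
      using c by (simp add: mult.assoc[symmetric] ennreal_mult'[symmetric])
    finally show "ennreal c * emeasure lborel S \<le> emeasure lborel (f -` S)" by (simp add: ev)
  qed
  let ?M = "scale_measure (ennreal (1/c)) (distr lborel borel f)"
  have "lborel = ?M"
  proof (rule lborel_eqI)
    fix l u :: "real^'n" assume lu: "\<And>b. b \<in> Basis \<Longrightarrow> l \<bullet> b \<le> u \<bullet> b"
    \<comment> \<open>\<open>comp\<close> speaks of compact sets while \<open>lborel_eqI\<close>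
      asks for open boxes. The boundary of a box is compact and null, so its preimage is null and
      the two kinds of box can be exchanged.\<close>
    have fr: "compact (cbox l u - box l u)" using compact_diff[OF compact_cbox open_box] .
    have fr0: "emeasure lborel (cbox l u - box l u) = 0"
      using lu by (subst emeasure_Diff) (auto simp: emeasure_lborel_box emeasure_lborel_cbox box_subset_cbox)
    have "emeasure lborel (f -` (cbox l u - box l u)) = 0"
      by (subst comp[OF fr]) (simp add: fr0)
    moreover have "f -` cbox l u = f -` box l u \<union> f -` (cbox l u - box l u)"
      using box_subset_cbox[of l u] by blast
    moreover have "f -` S \<in> sets borel" if "S \<in> sets borel" for S
      using measurable_sets_borel[OF fm that] by simp
    ultimately have "emeasure lborel (f -` box l u) = emeasure lborel (f -` cbox l u)"
      by (simp add: emeasure_Un_null_set null_sets_def)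
    also have "\<dots> = ennreal c * emeasure lborel (cbox l u)" by (rule comp) simp
    finally have "emeasure ?M (box l u) = ennreal (1/c) * (ennreal c * emeasure lborel (cbox l u))"
      using fm by (simp add: emeasure_distr)
    also have "\<dots> = emeasure lborel (cbox l u)"
      using c by (simp add: mult.assoc[symmetric] ennreal_mult'[symmetric])
    finally show "emeasure ?M (box l u) = ennreal (\<Prod>b\<in>Basis. (u - l) \<bullet> b)"
      using lu by (simp add: emeasure_lborel_cbox)
  qed simp
  then have "(\<integral>\<^sup>+x. h x \<partial>lborel) = (\<integral>\<^sup>+x. h x \<partial>?M)" by simp
  also have "\<dots> = ennreal (1/c) * (\<integral>\<^sup>+x. h (f x) \<partial>lborel)"
    using fm h by (simp add: nn_integral_scale_measure nn_integral_distr)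
  finally have "ennreal c * (\<integral>\<^sup>+x. h x \<partial>lborel) = (ennreal c * ennreal (1/c)) * (\<integral>\<^sup>+x. h (f x) \<partial>lborel)"
    by (simp add: mult.assoc)
  also have "ennreal c * ennreal (1/c) = 1" using c by (simp add: ennreal_mult'[symmetric])
  finally show ?thesis by simp
qed

section \<open>Group law, dilations and invariance of Lebesgue measure\<close>

locale carnot =
  fixes gm :: "real^'n::finite \<Rightarrow> real^'n \<Rightarrow> real^'n" (infixl "\<odot>" 70) and \<sigma> :: "'n \<Rightarrow> nat"
  assumes cg: "carnot_group gm \<sigma>"
begin

abbreviation dl :: "real \<Rightarrow> real^'n \<Rightarrow> real^'n" where "dl \<equiv> dil \<sigma>"

lemma gm_assoc: "(x \<odot> y) \<odot> z = x \<odot> (y \<odot> z)"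
  and gm_0_left [simp]: "0 \<odot> x = x" and gm_0_right [simp]: "x \<odot> 0 = x"
  and gm_scaleR: "(s *\<^sub>R x) \<odot> (t *\<^sub>R x) = (s + t) *\<^sub>R x"
  and sigma_ge1: "1 \<le> \<sigma> i"
  and dl_gm: "lam > 0 \<Longrightarrow> dl lam x \<odot> dl lam y = dl lam (x \<odot> y)"
  and bracket_lim: "((\<lambda>t::real. (1 / t^2) *\<^sub>R gcomm gm (t *\<^sub>R v) (t *\<^sub>R w)) \<longlongrightarrow> lie_bracket gm v w) (at 0)"
  and strat: "k \<ge> 1 \<Longrightarrow> span {lie_bracket gm v w | v w. v \<in> layer \<sigma> 1 \<and> w \<in> layer \<sigma> k} = layer \<sigma> (Suc k)"
  using cg unfolding carnot_group_def by blast+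

lemma gm_inv_right [simp]: "x \<odot> (- x) = 0"
  using gm_scaleR[of 1 x "-1"] by simp

lemma gm_inv_left [simp]: "(- x) \<odot> x = 0"
  using gm_scaleR[of "-1" x "1"] by simp

lemma gm_cancel_left [simp]: "(- x) \<odot> (x \<odot> y) = y" "x \<odot> ((- x) \<odot> y) = y"
  by (simp_all add: gm_assoc[symmetric])

lemma gm_cancel_right [simp]: "x \<odot> y \<odot> (- y) = x" "x \<odot> (- y) \<odot> y = x"
  by (simp_all add: gm_assoc)

lemma gm_left_inj [simp]: "x \<odot> y = x \<odot> z \<longleftrightarrow> y = z"
  by (metis gm_cancel_left(1))

lemma gm_right_inj [simp]: "y \<odot> x = z \<odot> x \<longleftrightarrow> y = z"
  by (metis gm_cancel_right(1))

lemma gm_uminus: "- (x \<odot> y) = (- y) \<odot> (- x)"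
  by (metis gm_cancel_left(1) gm_assoc gm_inv_right gm_0_right)

lemma dl_nth [simp]: "dl lam x $ i = lam ^ \<sigma> i * x $ i"
  by (simp add: dil_def)

lemma dl_dl: "dl a (dl b x) = dl (a * b) x"
  by (simp add: vec_eq_iff power_mult_distrib)

lemma dl_1 [simp]: "dl 1 x = x"
  by (simp add: vec_eq_iff)

lemma dl_0 [simp]: "dl a 0 = 0"
  by (simp add: vec_eq_iff)

lemma dl_0' [simp]: "dl 0 x = 0"
  using sigma_ge1 by (auto simp: vec_eq_iff intro: Suc_le_lessD)

lemma dl_uminus: "dl a (- x) = - dl a x"
  by (simp add: vec_eq_iff)

lemma dl_inverse: "a \<noteq> 0 \<Longrightarrow> dl a (dl (1/a) x) = x" "a \<noteq> 0 \<Longrightarrow> dl (1/a) (dl a x) = x"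
  by (simp_all add: dl_dl)

lemma linear_dl: "linear (dl a)"
  by (rule linearI) (simp_all add: vec_eq_iff algebra_simps)

lemma norm_dl_le: assumes "0 \<le> a" "a \<le> 1" shows "norm (dl a x) \<le> a * norm x"
proof -
  have "a ^ \<sigma> i \<le> a" for i using assms sigma_ge1[of i] power_decreasing[of 1 "\<sigma> i" a] by simp
  then have "norm (dl a x) \<le> norm (a *\<^sub>R x)"
    using assms by (intro norm_le_componentwise_cart) (auto simp: abs_mult intro!: mult_right_mono)
  then show ?thesis using assms by simp
qed

lemma continuous_dl [continuous_intros]:
  assumes "continuous_on S f" "continuous_on S g"
  shows "continuous_on S (\<lambda>x. dl (f x) (g x))"
  unfolding dil_def using assms by (intro continuous_intros)

lemma tendsto_dl [tendsto_intros]: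
  assumes "(f \<longlongrightarrow> a) F" "(g \<longlongrightarrow> b) F"
  shows "((\<lambda>x. dl (f x) (g x)) \<longlongrightarrow> dl a b) F"
  unfolding dil_def using assms by (intro tendsto_intros)

lemma dl_has_derivative: "(dl a has_derivative dl a) (at x within S)"
  using linear_dl by (simp add: linear_imp_has_derivative)

lemma dl_horiz: assumes "\<And>i. \<sigma> i \<noteq> 1 \<Longrightarrow> x $ i = 0" shows "dl a x = a *\<^sub>R x"
proof (rule vec_eq_iff[THEN iffD2], rule allI)
  fix i show "dl a x $ i = (a *\<^sub>R x) $ i" by (cases "\<sigma> i = 1") (simp_all add: assms)
qed

section \<open>Derivative of the group law and its homogeneity\<close>

definition Dg :: "(real^'n) \<times> (real^'n) \<Rightarrow> (((real^'n) \<times> (real^'n)) \<Rightarrow>\<^sub>L (real^'n))" where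
  "Dg = (SOME D. (\<forall>z. ((\<lambda>z. gm (fst z) (snd z)) has_derivative blinfun_apply (D z)) (at z)) \<and>
          continuous_on UNIV D)"

lemma Dg_deriv: "((\<lambda>z. fst z \<odot> snd z) has_derivative blinfun_apply (Dg z)) (at z)"
  and Dg_cont: "continuous_on UNIV Dg"
proof -
  have "\<exists>D. (\<forall>z. ((\<lambda>z. gm (fst z) (snd z)) has_derivative blinfun_apply (D z)) (at z)) \<and>
          continuous_on UNIV D" using cg unfolding carnot_group_def by blast
  from someI_ex[OF this] show "((\<lambda>z. fst z \<odot> snd z) has_derivative blinfun_apply (Dg z)) (at z)" "continuous_on UNIV Dg"
    unfolding Dg_def by blast+
qed

lemma gm_has_derivative:
  assumes "(f has_derivative f') (at x within S)" "(g has_derivative g') (at x within S)"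
  shows "((\<lambda>x. f x \<odot> g x) has_derivative (\<lambda>k. Dg (f x, g x) (f' k, g' k))) (at x within S)"
  using has_derivative_compose[OF has_derivative_Pair[OF assms] Dg_deriv[of "(f x, g x)"]] by simp

lemma linear_Dg: assumes "linear f" "linear g" shows "linear (\<lambda>k. Dg z (f k, g k))"
proof -
  have "linear (\<lambda>k. (f k, g k))"
    using assms by (intro linearI) (simp_all add: linear_add linear_scale)
  moreover have "linear (blinfun_apply (Dg z))"
    using blinfun.bounded_linear_right bounded_linear.linear by blast
  ultimately show ?thesis using linear_compose unfolding o_def by blast
qed

lemma continuous_gm [continuous_intros]:
  assumes "continuous_on S f" "continuous_on S g"
  shows "continuous_on S (\<lambda>x. f x \<odot> g x)"
proof -
  have "continuous_on UNIV (\<lambda>z. fst z \<odot> snd z)"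
    using Dg_deriv by (meson continuous_at_imp_continuous_on has_derivative_continuous)
  from continuous_on_compose2[OF this continuous_on_Pair[OF assms]] show ?thesis by simp
qed

lemma tendsto_gm [tendsto_intros]:
  assumes "(f \<longlongrightarrow> a) F" "(g \<longlongrightarrow> b) F"
  shows "((\<lambda>x. f x \<odot> g x) \<longlongrightarrow> a \<odot> b) F"
proof -
  have "isCont (\<lambda>z. fst z \<odot> snd z) (a,b)"
    using Dg_deriv has_derivative_continuous by blast
  from isCont_tendsto_compose[OF this tendsto_Pair[OF assms]] show ?thesis by simp
qed

lemma Dg_0: "Dg (0,0) (k, l) = k + l"
proof -
  have id: "((\<lambda>x. x) has_derivative (\<lambda>k::real^'n. k)) (at 0)" by simp
  have z: "((\<lambda>x. 0) has_derivative (\<lambda>k::real^'n. 0)) (at (0::real^'n))" by simp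
  have "(\<lambda>k. Dg (0,0) (k,0)) = (\<lambda>k. k)"
    using has_derivative_unique[OF gm_has_derivative[OF id z]] id by simp
  moreover have "(\<lambda>k. Dg (0,0) (0,k)) = (\<lambda>k. k)"
    using has_derivative_unique[OF gm_has_derivative[OF z id]] id by simp
  moreover have "Dg (0,0) (k, l) = Dg (0,0) (k,0) + Dg (0,0) (0,l)"
    by (simp add: blinfun.add_right[symmetric])
  ultimately show ?thesis by metis
qed

text \<open>Chain rule on both sides of the automorphism law \<open>dl_gm\<close>; it makes every
  matrix entry of the derivative homogeneous under dilations.\<close>

lemma Dg_dl:
  assumes "a > 0"
  shows "Dg (dl a x, dl a y) (dl a k, dl a l) = dl a (Dg (x,y) (k,l))"
proof -
  have 1: "((\<lambda>z. dl a (fst z) \<odot> dl a (snd z)) has_derivative (\<lambda>z. Dg (dl a x, dl a y) (dl a (fst z), dl a (snd z)))) (at (x,y))"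
    using gm_has_derivative[OF has_derivative_compose[OF has_derivative_fst[OF has_derivative_ident] dl_has_derivative]
      has_derivative_compose[OF has_derivative_snd[OF has_derivative_ident] dl_has_derivative], where x = "(x,y)" and S = UNIV] by simp
  have 2: "((\<lambda>z. dl a (fst z \<odot> snd z)) has_derivative (\<lambda>z. dl a (Dg (x,y) z))) (at (x,y))"
    by (rule has_derivative_compose[OF Dg_deriv dl_has_derivative])
  show ?thesis
    using has_derivative_unique[OF 1[unfolded dl_gm[OF assms]] 2] by (metis fst_conv snd_conv)
qed

lemma Dg_apply_tendsto:
  "((\<lambda>a. Dg (dl a x, dl a y) z) \<longlongrightarrow> Dg (0,0) z) (at_right 0)"
proof -
  have "((\<lambda>a. (dl a x, dl a y)) \<longlongrightarrow> (dl 0 x, dl 0 y)) (at_right 0)"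
    by (intro tendsto_intros)
  then have "((\<lambda>a. Dg (dl a x, dl a y)) \<longlongrightarrow> Dg (0,0)) (at_right 0)"
    using continuous_on_tendsto_compose[OF Dg_cont, of _ "(0,0)"] by simp
  then show ?thesis by (intro tendsto_intros)
qed

text \<open>A function of homogeneous degree \<sigma> i - \<sigma> k \<le> 0 that has a limit at the
  identity is constant, and zero if the degree is negative. This carries information from the
  identity, where the derivative is known, to all points.\<close>

lemma homogeneous_limit:
  assumes "\<And>a. a > 0 \<Longrightarrow> a ^ \<sigma> k * f a = a ^ \<sigma> i * (c::real)" and "(f \<longlongrightarrow> l) (at_right 0)" and "\<sigma> k \<ge> \<sigma> i"
  shows "c = (if \<sigma> k = \<sigma> i then l else 0)"
proof -
  have eq: "a ^ (\<sigma> k - \<sigma> i) * f a = c" if "a > 0" for a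
  proof -
    have "a ^ \<sigma> i * (a ^ (\<sigma> k - \<sigma> i) * f a) = a ^ \<sigma> i * c"
      using assms(1)[OF that] assms(3) by (simp add: mult.assoc[symmetric] power_add[symmetric])
    then show ?thesis using that by simp
  qed
  have "((\<lambda>a. a ^ (\<sigma> k - \<sigma> i) * f a) \<longlongrightarrow> 0 ^ (\<sigma> k - \<sigma> i) * l) (at_right 0)"
    by (intro tendsto_intros assms)
  moreover have "((\<lambda>a. a ^ (\<sigma> k - \<sigma> i) * f a) \<longlongrightarrow> c) (at_right 0)"
    by (rule tendsto_eventually) (auto simp: eventually_at_right_field eq intro!: exI[of _ 1])
  ultimately have "c = 0 ^ (\<sigma> k - \<sigma> i) * l"
    using tendsto_unique trivial_limit_at_right_real by blast
  then show ?thesis using assms(3) by auto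
qed

lemma dl_axis: "dl a (axis k 1) = a ^ \<sigma> k *\<^sub>R axis k 1"
  by (simp add: vec_eq_iff axis_def)

text \<open>The entry (i,k) of the derivative in the second variable has homogeneous degree \<sigma>
  i - \<sigma> k, and at the identity that derivative is the identity matrix. The derivative is
  thereby block triangular with respect to degree.\<close>

lemma Dg_right_partial:
  assumes "\<sigma> k \<ge> \<sigma> i" shows "Dg (x,y) (0, axis k 1) $ i = axis k 1 $ i"
proof -
  have "a ^ \<sigma> k * Dg (dl a x, dl a y) (0, axis k 1) $ i = a ^ \<sigma> i * (Dg (x,y) (0, axis k 1) $ i)" if "a > 0" for a
  proof -
    have "Dg (dl a x, dl a y) (0, dl a (axis k 1)) = a ^ \<sigma> k *\<^sub>R Dg (dl a x, dl a y) (0, axis k 1)"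
      using blinfun.scaleR_right[of "Dg (dl a x, dl a y)" "a ^ \<sigma> k" "(0, axis k 1)"] by (simp add: dl_axis)
    then show ?thesis using Dg_dl[OF that, of x y 0 "axis k 1"] by (metis dl_0 dl_nth vector_scaleR_component real_scaleR_def)
  qed
  from homogeneous_limit[OF this tendsto_vec_nth[OF Dg_apply_tendsto] assms]
  show ?thesis by (auto simp: Dg_0 axis_def)
qed

section \<open>Filtration by degree and the coordinates of a product\<close>

definition filt :: "nat \<Rightarrow> (real^'n) set" where "filt k = {x. \<forall>i. \<sigma> i < k \<longrightarrow> x $ i = 0}"

lemma linear_nth_basis_expansion:
  assumes "linear (f :: real^'n \<Rightarrow> real)" and "\<And>k. y $ k \<noteq> 0 \<Longrightarrow> f (axis k 1) = axis k 1 $ i"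
  shows "f y = y $ i"
proof -
  have "f y = f (\<Sum>k\<in>UNIV. y $ k *\<^sub>R axis k 1)"
    using basis_expansion[of y] by (simp add: scalar_mult_eq_scaleR)
  also have "\<dots> = (\<Sum>k\<in>UNIV. y $ k * f (axis k 1))"
    using assms(1) by (simp add: linear_sum linear_scale)
  also have "\<dots> = (\<Sum>k\<in>UNIV. if k = i then y $ i else 0)"
  proof (rule sum.cong[OF refl])
    fix k show "y $ k * f (axis k 1) = (if k = i then y $ i else 0)"
      using assms(2)[of k] by (cases "y $ k = 0") (auto simp: axis_def[of k] if_distrib)
  qed
  finally show ?thesis by simp
qed

text \<open>Along t \<mapsto> x \<odot> t y only basis directions of degree at least k \<ge>
  \<sigma> i enter, and in those the i-th coordinate of the product has the same derivative as a
  sum. So its difference from t y_i is constant in t.\<close>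

lemma gm_nth_right: assumes "y \<in> filt k" "\<sigma> i \<le> k" shows "(x \<odot> y) $ i = x $ i + y $ i"
proof -
  have lin: "linear (\<lambda>l. Dg (x, t *\<^sub>R y) (0, l) $ i)" for t
    using linear_compose[OF linear_Dg[OF linear_zero linear_ident] bounded_linear.linear[OF bounded_linear_vec_nth]]
    unfolding o_def by blast
  have D: "Dg (x, t *\<^sub>R y) (0, y) $ i = y $ i" for t
    by (rule linear_nth_basis_expansion[OF lin]) (use assms in \<open>auto simp: filt_def not_less intro!: Dg_right_partial\<close>, metis le_trans not_le)
  have "((\<lambda>t. (x \<odot> (t *\<^sub>R y)) $ i - t * y $ i) has_derivative (\<lambda>s. 0)) (at t within UNIV)" for t
  proof -
    have "((\<lambda>t. x \<odot> (t *\<^sub>R y)) has_derivative (\<lambda>s. Dg (x, t *\<^sub>R y) (0, s *\<^sub>R y))) (at t)"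
      by (rule gm_has_derivative) (auto intro!: derivative_eq_intros)
    then have "((\<lambda>t. (x \<odot> (t *\<^sub>R y)) $ i - t * y $ i) has_derivative (\<lambda>s. Dg (x, t *\<^sub>R y) (0, s *\<^sub>R y) $ i - s * y $ i)) (at t)"
      by (auto intro!: derivative_eq_intros bounded_linear.has_derivative[OF bounded_linear_vec_nth])
    moreover have "Dg (x, t *\<^sub>R y) (0, s *\<^sub>R y) $ i - s * y $ i = 0" for s
      using linear_scale[OF lin, of t s y] D[of t] by simp
    ultimately show ?thesis by simp
  qed
  then have "\<exists>c. \<forall>t\<in>UNIV. (x \<odot> (t *\<^sub>R y)) $ i - t * y $ i = c"
    by (intro has_derivative_zero_constant) auto
  then obtain c where c: "\<And>t. (x \<odot> (t *\<^sub>R y)) $ i - t * y $ i = c" by auto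
  from c[of 0] c[of 1] show ?thesis by simp
qed

lemma filt_uminus: "x \<in> filt k \<Longrightarrow> - x \<in> filt k"
  by (auto simp: filt_def)

lemma gm_nth_left: assumes "x \<in> filt k" "\<sigma> i \<le> k" shows "(x \<odot> y) $ i = x $ i + y $ i"
proof -
  have "(- (x \<odot> y)) $ i = (- y) $ i + (- x) $ i"
    unfolding gm_uminus by (rule gm_nth_right[OF filt_uminus[OF assms(1)] assms(2)])
  then show ?thesis by simp
qed

lemma filt_1: "x \<in> filt 1" "x \<in> filt (Suc 0)"
proof -
  have "\<not> \<sigma> i < 1" for i using sigma_ge1[of i] by simp
  then show "x \<in> filt 1" "x \<in> filt (Suc 0)" unfolding filt_def One_nat_def by blast+
qed

lemma gm_nth_horiz: "\<sigma> i = 1 \<Longrightarrow> (x \<odot> y) $ i = x $ i + y $ i"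
  by (rule gm_nth_left[OF filt_1(1)]) simp

lemma filt_dl: "x \<in> filt k \<Longrightarrow> dl a x \<in> filt k"
  by (auto simp: filt_def)

lemma filt_gm: "x \<in> filt k \<Longrightarrow> y \<in> filt k \<Longrightarrow> x \<odot> y \<in> filt k"
  using gm_nth_left[of x k] by (auto simp: filt_def)

lemma mem_filt_Suc: "x \<in> filt (Suc k) \<longleftrightarrow> x \<in> filt k \<and> (\<forall>i. \<sigma> i = k \<longrightarrow> x $ i = 0)"
  by (auto simp: filt_def less_Suc_eq)

lemma filt_top: assumes "\<And>i. \<sigma> i < k" "x \<in> filt k" shows "x = 0"
  using assms by (auto simp: filt_def vec_eq_iff)

lemma layer_iff: "x \<in> layer \<sigma> k \<longleftrightarrow> (\<forall>i. \<sigma> i \<noteq> k \<longrightarrow> x $ i = 0)"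
proof
  assume "x \<in> layer \<sigma> k"
  then show "\<forall>i. \<sigma> i \<noteq> k \<longrightarrow> x $ i = 0" unfolding layer_def
  proof (induction rule: span_induct_alt)
    case (step c x y)
    then show ?case by (auto simp: axis_def) metis
  qed simp
next
  assume a: "\<forall>i. \<sigma> i \<noteq> k \<longrightarrow> x $ i = 0"
  have "x = (\<Sum>i\<in>UNIV. x $ i *\<^sub>R axis i 1)"
    using basis_expansion[of x] by (simp add: scalar_mult_eq_scaleR)
  also have "\<dots> \<in> layer \<sigma> k" unfolding layer_def
  proof (rule span_sum)
    fix i :: 'n
    show "x $ i *\<^sub>R axis i 1 \<in> span {axis i 1 |i. \<sigma> i = k}"
    proof (cases "\<sigma> i = k")
      case True
      then show ?thesis by (intro span_scale span_base) blast
    qed (use a in \<open>simp add: span_zero\<close>)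
  qed
  finally show "x \<in> layer \<sigma> k" .
qed

text \<open>Conjugation by the invertible dilation matrix shows that det (M a) does not depend on a
  > 0; letting a tend to 0 evaluates it at the identity.\<close>

lemma det_homogeneous_const:
  assumes "\<And>a. a > 0 \<Longrightarrow> M a ** matrix (dl a) = matrix (dl a) ** (M1 :: real^'n^'n)" and "(M \<longlongrightarrow> M0) (at_right 0)"
  shows "det M1 = det M0"
proof -
  have nz: "det (matrix (dl a)) \<noteq> 0" if "a > 0" for a
  proof -
    have "matrix (dl a) ** matrix (dl (1/a)) = mat 1"
      using that by (simp add: matrix_compose[symmetric] linear_dl o_def dl_inverse matrix_id_mat_1[unfolded id_def])
    then show ?thesis by (metis det_I det_mul mult_zero_left zero_neq_one)
  qed
  have "((\<lambda>a. det (M a)) \<longlongrightarrow> det M0) (at_right 0)"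
    using assms(2) unfolding det_def
    by (intro tendsto_intros) auto
  moreover have "((\<lambda>a. det (M a)) \<longlongrightarrow> det M1) (at_right 0)"
  proof (rule tendsto_eventually)
    have "det (M a) = det M1" if "a > 0" for a
      using arg_cong[OF assms(1)[OF that], of det] nz[OF that] by (simp add: det_mul)
    then show "\<forall>\<^sub>F a in at_right 0. det (M a) = det M1"
      by (auto simp: eventually_at_right_field intro!: exI[of _ 1])
  qed
  ultimately show ?thesis using tendsto_unique trivial_limit_at_right_real by blast
qed

lemma matrix_tendsto:
  assumes "\<And>x. ((\<lambda>a. f a x) \<longlongrightarrow> g x) F"
  shows "((\<lambda>a. matrix (f a) :: real^'n^'n) \<longlongrightarrow> matrix g) F"
  unfolding matrix_def by (intro vec_tendstoI) (auto intro!: tendsto_vec_nth assms)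

section \<open>Lebesgue measure under translations and dilations\<close>

lemma det_Dg_right: "det (matrix (\<lambda>k. Dg (x,y) (0,k))) = 1"
proof -
  have "det (matrix (\<lambda>k. Dg (x,y) (0,k))) = det (matrix (\<lambda>k::real^'n. k))"
  proof (rule det_homogeneous_const[where M = "\<lambda>a. matrix (\<lambda>k. Dg (dl a x, dl a y) (0,k))"])
    fix a :: real assume a: "a > 0"
    show "matrix (\<lambda>k. Dg (dl a x, dl a y) (0, k)) ** matrix (dl a) = matrix (dl a) ** matrix (\<lambda>k. Dg (x, y) (0, k))"
      using Dg_dl[OF a, of x y 0]
      by (subst (1 2) matrix_compose[symmetric]) (auto intro!: linear_Dg linear_dl linear_ident linear_zero simp: o_def)
  next
    show "((\<lambda>a. matrix (\<lambda>k. Dg (dl a x, dl a y) (0, k))) \<longlongrightarrow> matrix (\<lambda>k. k)) (at_right 0)"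
      by (rule matrix_tendsto) (use Dg_apply_tendsto[of x y "(0,_)"] in \<open>simp add: Dg_0\<close>)
  qed
  then show ?thesis by (simp add: matrix_id_mat_1[unfolded id_def])
qed

lemma det_Dg_left: "det (matrix (\<lambda>k. Dg (x,y) (k,0))) = 1"
proof -
  have "det (matrix (\<lambda>k. Dg (x,y) (k,0))) = det (matrix (\<lambda>k::real^'n. k))"
  proof (rule det_homogeneous_const[where M = "\<lambda>a. matrix (\<lambda>k. Dg (dl a x, dl a y) (k,0))"])
    fix a :: real assume a: "a > 0"
    show "matrix (\<lambda>k. Dg (dl a x, dl a y) (k,0)) ** matrix (dl a) = matrix (dl a) ** matrix (\<lambda>k. Dg (x, y) (k,0))"
      using Dg_dl[OF a, of x y _ 0]
      by (subst (1 2) matrix_compose[symmetric]) (auto intro!: linear_Dg linear_dl linear_ident linear_zero simp: o_def)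
  next
    show "((\<lambda>a. matrix (\<lambda>k. Dg (dl a x, dl a y) (k,0))) \<longlongrightarrow> matrix (\<lambda>k. k)) (at_right 0)"
      by (rule matrix_tendsto) (use Dg_apply_tendsto[of x y "(_,0)"] in \<open>simp add: Dg_0\<close>)
  qed
  then show ?thesis by (simp add: matrix_id_mat_1[unfolded id_def])
qed

lemma gm_right_has_derivative: "((\<lambda>y. x \<odot> y) has_derivative (\<lambda>k. Dg (x,y) (0,k))) (at y within S)"
  by (rule gm_has_derivative) auto

lemma gm_left_has_derivative: "((\<lambda>x. x \<odot> y) has_derivative (\<lambda>k. Dg (x,y) (k,0))) (at x within S)"
  by (rule gm_has_derivative) auto

lemma nn_integral_left_translate:
  assumes "h \<in> borel_measurable borel" shows "(\<integral>\<^sup>+x. h (a \<odot> x) \<partial>lborel) = (\<integral>\<^sup>+x. h x \<partial>lborel)"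
  using nn_integral_lborel_diffeo[of "\<lambda>x. (- a) \<odot> x" "\<lambda>y k. Dg (- a, y) (0,k)" 1 "\<lambda>x. a \<odot> x" "\<lambda>y k. Dg (a, y) (0,k)" h] assms
  by (auto simp: gm_right_has_derivative det_Dg_right intro!: borel_measurable_continuous_onI continuous_intros)

lemma nn_integral_right_translate:
  assumes "h \<in> borel_measurable borel" shows "(\<integral>\<^sup>+x. h (x \<odot> a) \<partial>lborel) = (\<integral>\<^sup>+x. h x \<partial>lborel)"
  using nn_integral_lborel_diffeo[of "\<lambda>x. x \<odot> (- a)" "\<lambda>y k. Dg (y, - a) (k,0)" 1 "\<lambda>x. x \<odot> a" "\<lambda>y k. Dg (y, a) (k,0)" h] assms
  by (auto simp: gm_left_has_derivative det_Dg_left intro!: borel_measurable_continuous_onI continuous_intros)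

definition nu :: nat where "nu = (\<Sum>i\<in>UNIV. \<sigma> i)"

lemma det_dl: "det (matrix (dl a)) = a ^ nu"
proof -
  have "det (matrix (dl a)) = (\<Prod>i\<in>UNIV. matrix (dl a) $ i $ i)"
    by (rule det_diagonal) (simp add: matrix_def axis_def)
  then show ?thesis by (simp add: matrix_def nu_def power_sum)
qed

lemma nn_integral_dl:
  assumes "h \<in> borel_measurable borel" "a > 0"
  shows "ennreal (a ^ nu) * (\<integral>\<^sup>+x. h (dl a x) \<partial>lborel) = (\<integral>\<^sup>+x. h x \<partial>lborel)"
proof -
  have "(\<integral>\<^sup>+x. h (dl a x) \<partial>lborel) = ennreal ((1/a) ^ nu) * (\<integral>\<^sup>+x. h x \<partial>lborel)"
    by (rule nn_integral_lborel_diffeo[of "dl (1/a)" "\<lambda>y. dl (1/a)" _ _ "\<lambda>y. dl a"])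
      (use assms in \<open>auto simp: dl_has_derivative det_dl dl_inverse power_one_over intro!: borel_measurable_continuous_onI continuous_intros\<close>)
  then show ?thesis using assms by (simp add: mult.assoc[symmetric] ennreal_mult'[symmetric] power_one_over)
qed

end

section \<open>Lipschitz curves and functions of one real variable\<close>

lemma negligible_outer_open:
  fixes N :: "'a::euclidean_space set"
  assumes "negligible N" "e > 0"
  obtains U where "open U" "N \<subseteq> U" "U \<in> lmeasurable" "measure lebesgue U < e"
proof -
  have N: "N \<in> sets lebesgue" "N \<in> null_sets lebesgue" using assms(1) by (auto simp: negligible_iff_null_sets)
  obtain U where U: "open U" "N \<subseteq> U" "U - N \<in> lmeasurable" "emeasure lebesgue (U - N) < ennreal e"
    using sets_lebesgue_outer_open[OF N(1) assms(2)] .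
  have Ueq: "U = (U - N) \<union> N" using U(2) by blast
  have em: "emeasure lebesgue U = emeasure lebesgue (U - N)"
    using emeasure_Un_null_set[of "U - N" lebesgue N] U(3) N(2) Ueq by (simp add: fmeasurable_def)
  have "U \<in> lmeasurable" using U(1,4) em by (intro fmeasurableI) (auto simp: less_top[symmetric] dest: order.strict_trans)
  moreover have "measure lebesgue U < e"
    using U(4) assms(2) unfolding em[symmetric] emeasure_eq_measure2[OF \<open>U \<in> lmeasurable\<close>] by (simp add: ennreal_less_iff)
  ultimately show ?thesis using that U(1,2) by blast
qed

text \<open>The derivative exists only off N and need not be integrable. A gauge partition separates
  two kinds of tags: outside N the increment is bounded by g up to \<epsilon>, and intervals tagged
  in N lie in an open set U of small measure, where the Lipschitz constant suffices.\<close>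

lemma norm_diff_le_integral_lipschitz:
  fixes f :: "real \<Rightarrow> 'a::real_normed_vector"
  assumes ab: "a \<le> b" and lip: "C-lipschitz_on {a..b} f" and N: "negligible N"
    and der: "\<And>t. t \<in> {a..b} - N \<Longrightarrow> (f has_vector_derivative f' t) (at t within {a..b})"
    and le: "\<And>t. t \<in> {a..b} - N \<Longrightarrow> norm (f' t) \<le> g t"
    and g0: "\<And>t. t \<in> {a..b} \<Longrightarrow> 0 \<le> g t" and gi: "g integrable_on {a..b}"
  shows "norm (f b - f a) \<le> integral {a..b} g"
proof (rule field_le_epsilon)
  fix e :: real assume e: "e > 0"
  have C0: "C \<ge> 0" using lip lipschitz_on_nonneg by blast
  \<comment> \<open>Three errors arise: \<epsilon> from the Riemann sum of g, \<epsilon> (b - a)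
    from differentiability and C \<epsilon> from the intervals tagged in N. The divisor makes their
    sum equal to e.\<close>
  define \<epsilon> where "\<epsilon> = e / (1 + (b - a) + C)"
  have den: "1 + (b - a) + C > 0" using ab C0 by simp
  have \<epsilon>: "\<epsilon> > 0" using e den by (simp add: \<epsilon>_def)
  obtain U where U: "open U" "N \<subseteq> U" "U \<in> lmeasurable" "measure lebesgue U < \<epsilon>"
    using negligible_outer_open[OF N \<epsilon>] .
  have "(g has_integral integral {a..b} g) {a..b}" using gi by (rule integrable_integral)
  from this[unfolded has_integral_real, rule_format, OF \<epsilon>]
  obtain \<gamma>0 where \<gamma>0: "gauge \<gamma>0" and
    \<gamma>0i: "\<And>\<D>. \<D> tagged_division_of {a..b} \<and> \<gamma>0 fine \<D> \<Longrightarrow> norm ((\<Sum>(x,k)\<in>\<D>. measure lborel k *\<^sub>R g x) - integral {a..b} g) < \<epsilon>"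
    by (elim exE conjE) (rule that, assumption, drule spec, erule mp)
  have "\<exists>d>0. \<forall>y\<in>{a..b}. \<bar>y - t\<bar> < d \<longrightarrow> norm (f y - f t - (y - t) *\<^sub>R f' t) \<le> \<epsilon> * \<bar>y - t\<bar>" if "t \<in> {a..b} - N" for t
    using der[OF that] \<epsilon> unfolding has_vector_derivative_def has_derivative_within_alt by simp
  then obtain d where d: "\<And>t. t \<in> {a..b} - N \<Longrightarrow> d t > 0"
      "\<And>t y. t \<in> {a..b} - N \<Longrightarrow> y \<in> {a..b} \<Longrightarrow> \<bar>y - t\<bar> < d t \<Longrightarrow> norm (f y - f t - (y - t) *\<^sub>R f' t) \<le> \<epsilon> * \<bar>y - t\<bar>"
    by metis
  define \<gamma> where "\<gamma> x = \<gamma>0 x \<inter> (if x \<in> N then U else if x \<in> {a..b} then ball x (d x) else ball x 1)" for x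
  have "gauge \<gamma>" using \<gamma>0 U d(1) unfolding gauge_def \<gamma>_def by auto
  then obtain p where p: "p tagged_division_of {a..b}" "\<gamma> fine p"
    using fine_division_exists_real by blast
  have fin: "finite p" using p(1) by blast
  have "\<gamma>0 fine p" using p(2) unfolding fine_def \<gamma>_def by blast
  from \<gamma>0i[OF conjI[OF p(1) this]] have sg: "(\<Sum>(x,k)\<in>p. measure lborel k * g x) \<le> integral {a..b} g + \<epsilon>"
    by (simp add: abs_less_iff)
  have K: "\<exists>u v. K = {u..v} \<and> u \<le> v \<and> u \<le> x \<and> x \<le> v \<and> a \<le> u \<and> v \<le> b" if xK: "(x,K) \<in> p" for x K
  proof -
    obtain u v where "K = cbox u v" "x \<in> K" "K \<subseteq> {a..b}"
      using tagged_division_ofD(2,3,4)[OF p(1) xK] by blast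
    then show ?thesis by auto
  qed
  have each: "norm (f (Sup K) - f (Inf K)) \<le> measure lborel K * g x + \<epsilon> * measure lborel K + (if x \<in> N then C * measure lborel K else 0)"
    if xK: "(x,K) \<in> p" for x K
  proof -
    obtain u v where uv: "K = {u..v}" "u \<le> v" "u \<le> x" "x \<le> v" "a \<le> u" "v \<le> b" using K[OF xK] by blast
    have KU: "K \<subseteq> \<gamma> x" using p(2) xK unfolding fine_def by blast
    have gx: "0 \<le> measure lborel K * g x" using g0[of x] uv by simp
    have eq: "f (Sup K) - f (Inf K) = f v - f u" "measure lborel K = v - u" using uv by simp_all
    show ?thesis
    proof (cases "x \<in> N")
      case True
      have "norm (f v - f u) \<le> C * (v - u)"
        using lipschitz_onD[OF lip, of v u] uv by (simp add: dist_norm)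
      then show ?thesis using True gx \<epsilon> uv(2) by (simp add: eq(1)) (simp add: eq(2) add_increasing)
    next
      case False
      then have xI: "x \<in> {a..b} - N" using uv by auto
      have KB: "K \<subseteq> ball x (d x)" using KU False xI unfolding \<gamma>_def by auto
      have "u \<in> ball x (d x)" "v \<in> ball x (d x)" by (rule subsetD[OF KB], simp add: uv)+
      then have "norm (f v - f x - (v - x) *\<^sub>R f' x) \<le> \<epsilon> * (v - x)" "norm (f u - f x - (u - x) *\<^sub>R f' x) \<le> \<epsilon> * (x - u)"
        using d(2)[OF xI, of v] d(2)[OF xI, of u] uv by (auto simp: dist_real_def)
      moreover have "f v - f u = (f v - f x - (v - x) *\<^sub>R f' x) - (f u - f x - (u - x) *\<^sub>R f' x) + (v - u) *\<^sub>R f' x"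
        by (simp add: algebra_simps)
      moreover have "norm ((v - u) *\<^sub>R f' x) \<le> (v - u) * g x"
        using le[OF xI] uv(2) by (simp add: mult_left_mono)
      ultimately have "norm (f v - f u) \<le> \<epsilon> * (v - x) + \<epsilon> * (x - u) + (v - u) * g x"
        by (metis (no_types, opaque_lifting) add_mono norm_triangle_le norm_triangle_le_diff)
      then show ?thesis unfolding eq using False by (simp add: algebra_simps)
    qed
  qed
  let ?q = "{z \<in> p. fst z \<in> N}"
  \<comment> \<open>The interiors of the partition intervals are disjoint and those tagged in N lie
    in U; endpoints do not affect lengths.\<close>
  have sN: "(\<Sum>(x,K)\<in>?q. measure lborel K) \<le> \<epsilon>"
  proof -
    have int: "interior (snd z) \<in> lmeasurable" "measure lebesgue (interior (snd z)) = measure lborel (snd z)" if "z \<in> p" for z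
      using K[of "fst z" "snd z"] that by auto
    have "(\<Sum>(x,K)\<in>?q. measure lborel K) = (\<Sum>z\<in>?q. measure lebesgue (interior (snd z)))"
    proof (rule sum.cong[OF refl])
      fix z assume "z \<in> ?q"
      then show "(case z of (x,K) \<Rightarrow> measure lborel K) = measure lebesgue (interior (snd z))"
        using int(2)[of z] by (simp add: case_prod_beta)
    qed
    also have "\<dots> = measure lebesgue (\<Union>z\<in>?q. interior (snd z))"
    proof (rule measure_finite_Union[symmetric])
      show "disjoint_family_on (\<lambda>z. interior (snd z)) ?q"
        using tagged_division_ofD(5)[OF p(1)] unfolding disjoint_family_on_def
        by (metis (no_types, lifting) mem_Collect_eq prod.collapse)
    qed (use fin int in \<open>auto simp: fmeasurable_def less_top[symmetric]\<close>)
    also have "\<dots> \<le> measure lebesgue U"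
    proof (rule measure_mono_fmeasurable)
      show "(\<Union>z\<in>?q. interior (snd z)) \<subseteq> U"
        using p(2) interior_subset unfolding fine_def \<gamma>_def by fastforce
      show "(\<Union>z\<in>?q. interior (snd z)) \<in> sets lebesgue" by (auto intro!: borel_open[THEN lborelD] open_UN)
    qed (use U in auto)
    finally show ?thesis using U(4) by simp
  qed
  have "norm (f b - f a) = norm (\<Sum>(x,K)\<in>p. f (Sup K) - f (Inf K))"
    using additive_tagged_division_1[OF ab p(1), of f] by simp
  also have "\<dots> \<le> (\<Sum>(x,K)\<in>p. measure lborel K * g x + \<epsilon> * measure lborel K + (if x \<in> N then C * measure lborel K else 0))"
    by (rule order.trans[OF norm_sum]) (intro sum_mono, use each in auto)
  also have "\<dots> = (\<Sum>(x,K)\<in>p. measure lborel K * g x) + \<epsilon> * (\<Sum>(x,K)\<in>p. measure lborel K) + C * (\<Sum>(x,K)\<in>?q. measure lborel K)"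
  proof -
    have "(\<Sum>(x,K)\<in>p. if x \<in> N then C * measure lborel K else 0) = C * (\<Sum>(x,K)\<in>?q. measure lborel K)"
      unfolding sum_distrib_left using fin
      by (subst sum.inter_filter) (auto intro!: sum.cong)
    then show ?thesis by (simp add: sum.distrib case_prod_beta sum_distrib_left)
  qed
  also have "(\<Sum>(x,K)\<in>p. measure lborel K) = b - a"
    using additive_content_tagged_division[of p a b] p(1) ab by simp
  also have "(\<Sum>(x,K)\<in>p. measure lborel K * g x) + \<epsilon> * (b - a) + C * (\<Sum>(x,K)\<in>?q. measure lborel K)
      \<le> (integral {a..b} g + \<epsilon>) + \<epsilon> * (b - a) + C * \<epsilon>"
    using sg sN C0 \<epsilon> ab by (intro add_mono mult_left_mono) auto
  also have "\<dots> = integral {a..b} g + \<epsilon> * (1 + (b - a) + C)" by (simp add: algebra_simps)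
  also have "\<dots> = integral {a..b} g + e" using den by (simp add: \<epsilon>_def)
  finally show "norm (f b - f a) \<le> integral {a..b} g + e" .
qed

section \<open>Differentiability almost everywhere on the line\<close>

definition quot :: "(real \<Rightarrow> real) \<Rightarrow> real \<Rightarrow> real \<Rightarrow> real" where "quot g t h = (g (t + h) - g t) / h"

text \<open>The core of Lebesgue's theorem on monotone functions. Intervals of slope below a cover
  almost all of Z by an open set V whose g-measure is at most about a times the outer measure s of
  Z; intervals of slope above b inside V show that it is at least b s. With a < b this forces s =
  0.\<close>

lemma lipschitz_mono_dini_negligible:
  fixes g :: "real \<Rightarrow> real"
  assumes mono: "mono g" and cont: "continuous_on UNIV g" and ab: "0 < a" "a < b"
    and Zb: "bounded Z"
    and Za: "\<And>t d. t \<in> Z \<Longrightarrow> d > 0 \<Longrightarrow> \<exists>h. h \<noteq> 0 \<and> \<bar>h\<bar> < d \<and> quot g t h < a"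
    and Zbb: "\<And>t d. t \<in> Z \<Longrightarrow> d > 0 \<Longrightarrow> \<exists>h. h \<noteq> 0 \<and> \<bar>h\<bar> < d \<and> quot g t h > b"
  shows "negligible Z"
proof -
  let ?m = "interval_measure g"
  \<comment> \<open>The increment h may have either sign. \<open>lo\<close> and \<open>hi\<close>
    are the ends of the interval between t and t + h, and \<open>ce\<close>, \<open>rd\<close>
    present it as a ball for the covering theorem.\<close>
  define lo hi where "lo = (\<lambda>(t,h). min t (t + h) :: real)" and "hi = (\<lambda>(t,h). max t (t + h) :: real)"
  define ce rd where "ce = (\<lambda>(t,h). t + h/2 :: real)" and "rd = (\<lambda>(t::real,h). \<bar>h\<bar>/2 :: real)"
  have cb: "cball (ce i) (rd i) = {lo i..hi i}" for i
    by (cases i) (auto simp: ce_def rd_def lo_def hi_def cball_eq_atLeastAtMost min_def max_def)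
  have mI: "emeasure ?m {lo (t,h)..hi (t,h)} = ennreal (\<bar>h\<bar> * quot g t h)" if "h \<noteq> 0" for t h
  proof -
    have "emeasure ?m {lo (t,h)..hi (t,h)} = ennreal (g (hi (t,h)) - g (lo (t,h)))"
      using mono cont by (intro emeasure_interval_measure_Icc) (auto simp: mono_def lo_def hi_def)
    also have "g (hi (t,h)) - g (lo (t,h)) = \<bar>h\<bar> * quot g t h"
      using that by (cases "h > 0") (auto simp: lo_def hi_def quot_def)
    finally show ?thesis .
  qed
  have lI: "emeasure lborel {lo (t,h)..hi (t,h)} = ennreal \<bar>h\<bar>" for t h
    by (auto simp: lo_def hi_def min_def max_def)
  have UNm: "emeasure M (\<Union>i\<in>C. {lo i..hi i}) = (\<integral>\<^sup>+i. emeasure M {lo i..hi i} \<partial>count_space C)"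
    if "countable C" "pairwise (\<lambda>i j. disjnt (cball (ce i) (rd i)) (cball (ce j) (rd j))) C" "sets M = sets borel" for C M
    using that by (intro emeasure_UN_countable) (auto simp: disjoint_family_on_def pairwise_def disjnt_def cb)
  obtain H where H: "H \<in> sets lebesgue" "Z \<subseteq> H" "outer_measure_of lebesgue Z = emeasure lebesgue H"
    using outer_measure_of_attain[of Z lebesgue] by auto
  let ?s = "outer_measure_of lebesgue Z"
  obtain B where B: "bounded B" "open B" "Z \<subseteq> B" using Zb bounded_subset_ballD[OF Zb, of 0] by (metis bounded_ball open_ball)
  have sfin: "?s < top"
  proof -
    have "?s \<le> emeasure lebesgue B" using B unfolding outer_measure_of_def by (intro INF_lower) auto
    also have "\<dots> < top" using B emeasure_bounded_finite[of B] by (simp add: less_top)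
    finally show ?thesis .
  qed
  have key: "ennreal b * ?s \<le> ennreal a * (?s + ennreal e)" if e: "e > 0" for e
  proof -
    obtain U where U: "open U" "H \<subseteq> U" "U - H \<in> lmeasurable" "emeasure lebesgue (U - H) < ennreal e"
      using sets_lebesgue_outer_open[OF H(1) e] .
    have LU: "emeasure lborel U \<le> ?s + ennreal e"
    proof -
      have "emeasure lebesgue U \<le> emeasure lebesgue H + emeasure lebesgue (U - H)"
        using U H emeasure_subadditive[of H lebesgue "U - H"] by (simp add: Un_absorb1 fmeasurable_def)
      then show ?thesis using U(1,4) H(3) by (simp add: add_left_mono order.trans)
    qed
    define K where "K = {(t,h). t \<in> Z \<and> h \<noteq> 0 \<and> quot g t h < a \<and> {lo (t,h)..hi (t,h)} \<subseteq> U}"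
    obtain C where C: "countable C" "C \<subseteq> K" "pairwise (\<lambda>i j. disjnt (cball (ce i) (rd i)) (cball (ce j) (rd j))) C"
       "negligible (Z - (\<Union>i \<in> C. cball (ce i) (rd i)))"
    proof (rule Vitali_covering_theorem_cballs[of K rd Z ce])
      show "0 < rd i" if "i \<in> K" for i using that by (auto simp: K_def rd_def)
      fix x d :: real assume x: "x \<in> Z" and d: "0 < d"
      obtain r where r: "r > 0" "ball x r \<subseteq> U" using U H(2) x by (meson open_contains_ball subsetD)
      obtain h where h: "h \<noteq> 0" "\<bar>h\<bar> < min r d" "quot g x h < a" using Za[OF x, of "min r d"] r d by auto
      have "{lo (x,h)..hi (x,h)} \<subseteq> ball x r" using h by (auto simp: lo_def hi_def dist_real_def)
      then have "(x,h) \<in> K" using x h r by (auto simp: K_def)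
      moreover have "x \<in> cball (ce (x,h)) (rd (x,h))" by (simp add: cb lo_def hi_def)
      moreover have "rd (x,h) < d" using h d by (auto simp: rd_def)
      ultimately show "\<exists>i. i \<in> K \<and> x \<in> cball (ce i) (rd i) \<and> rd i < d" by blast
    qed
    \<comment> \<open>Dropping the endpoints loses only a countable set and makes V open, so that
      the second family of intervals can be chosen inside V.\<close>
    define V where "V = (\<Union>i\<in>C. {lo i<..<hi i})"
    have "open V" by (auto simp: V_def)
    have ZV: "negligible (Z - V)"
    proof (rule negligible_subset)
      show "negligible ((Z - (\<Union>i \<in> C. cball (ce i) (rd i))) \<union> (lo ` C \<union> hi ` C))"
        using C(1,4) by (simp add: negligible_iff_null_sets[of "_ ` _"] countable_imp_null_set_lborel null_sets_completionI)
      show "Z - V \<subseteq> (Z - (\<Union>i \<in> C. cball (ce i) (rd i))) \<union> (lo ` C \<union> hi ` C)"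
        unfolding cb V_def by (fastforce simp: less_le)
    qed
    have "emeasure ?m V \<le> emeasure ?m (\<Union>i\<in>C. {lo i..hi i})"
      using C(1) by (intro emeasure_mono) (auto simp: V_def)
    also have "\<dots> = (\<integral>\<^sup>+i. emeasure ?m {lo i..hi i} \<partial>count_space C)" by (rule UNm[OF C(1,3)]) simp
    also have "\<dots> \<le> (\<integral>\<^sup>+i. ennreal a * emeasure lborel {lo i..hi i} \<partial>count_space C)"
    proof (rule nn_integral_mono)
      fix i assume "i \<in> space (count_space C)"
      then obtain t h where i: "i = (t,h)" "h \<noteq> 0" "quot g t h < a" using C(2) by (auto simp: K_def)
      show "emeasure ?m {lo i..hi i} \<le> ennreal a * emeasure lborel {lo i..hi i}"
        unfolding i(1) mI[OF i(2)] lI using i ab by (simp add: ennreal_mult'[symmetric] ennreal_leI mult.commute mult_right_mono less_imp_le)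
    qed
    also have "\<dots> = ennreal a * emeasure lborel (\<Union>i\<in>C. {lo i..hi i})"
      by (subst UNm[OF C(1,3)]) (auto simp: nn_integral_cmult)
    also have "\<dots> \<le> ennreal a * emeasure lborel U"
      using C U by (intro mult_left_mono emeasure_mono) (auto simp: K_def)
    also have "\<dots> \<le> ennreal a * (?s + ennreal e)" using LU by (rule mult_left_mono) simp
    finally have mV: "emeasure ?m V \<le> ennreal a * (?s + ennreal e)" .
    define K' where "K' = {(t,h). t \<in> Z \<inter> V \<and> h \<noteq> 0 \<and> quot g t h > b \<and> {lo (t,h)..hi (t,h)} \<subseteq> V}"
    obtain C' where C': "countable C'" "C' \<subseteq> K'" "pairwise (\<lambda>i j. disjnt (cball (ce i) (rd i)) (cball (ce j) (rd j))) C'"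
       "negligible (Z \<inter> V - (\<Union>i \<in> C'. cball (ce i) (rd i)))"
    proof (rule Vitali_covering_theorem_cballs[of K' rd "Z \<inter> V" ce])
      show "0 < rd i" if "i \<in> K'" for i using that by (auto simp: K'_def rd_def)
      fix x d :: real assume x: "x \<in> Z \<inter> V" and d: "0 < d"
      obtain r where r: "r > 0" "ball x r \<subseteq> V" using \<open>open V\<close> x by (meson open_contains_ball IntD2)
      obtain h where h: "h \<noteq> 0" "\<bar>h\<bar> < min r d" "quot g x h > b" using Zbb[of x "min r d"] r d x by auto
      have "{lo (x,h)..hi (x,h)} \<subseteq> ball x r" using h by (auto simp: lo_def hi_def dist_real_def)
      then have "(x,h) \<in> K'" using x h r by (auto simp: K'_def)
      moreover have "x \<in> cball (ce (x,h)) (rd (x,h))" by (simp add: cb lo_def hi_def)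
      moreover have "rd (x,h) < d" using h d by (auto simp: rd_def)
      ultimately show "\<exists>i. i \<in> K' \<and> x \<in> cball (ce i) (rd i) \<and> rd i < d" by blast
    qed
    let ?W = "\<Union>i\<in>C'. {lo i..hi i}"
    have Wb: "?W \<in> sets borel" using C'(1) by auto
    have "negligible (Z - ?W)"
      by (rule negligible_subset[of "(Z - V) \<union> (Z \<inter> V - ?W)"]) (use ZV C'(4) in \<open>auto simp: cb\<close>)
    then have nl: "Z - ?W \<in> null_sets lebesgue" by (simp add: negligible_iff_null_sets)
    have "?s \<le> emeasure lebesgue (?W \<union> (Z - ?W))"
    proof -
      have "?W \<union> (Z - ?W) \<in> sets lebesgue" by (rule sets.Un) (use Wb nl in auto)
      then show ?thesis unfolding outer_measure_of_def by (intro INF_lower) blast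
    qed
    also have "\<dots> = emeasure lborel ?W" using emeasure_Un_null_set[OF _ nl, of ?W] Wb by simp
    finally have "ennreal b * ?s \<le> ennreal b * emeasure lborel ?W" by (rule mult_left_mono) simp
    also have "\<dots> = (\<integral>\<^sup>+i. ennreal b * emeasure lborel {lo i..hi i} \<partial>count_space C')"
      by (subst UNm[OF C'(1,3)]) (auto simp: nn_integral_cmult)
    also have "\<dots> \<le> (\<integral>\<^sup>+i. emeasure ?m {lo i..hi i} \<partial>count_space C')"
    proof (rule nn_integral_mono)
      fix i assume "i \<in> space (count_space C')"
      then obtain t h where i: "i = (t,h)" "h \<noteq> 0" "quot g t h > b" using C'(2) by (auto simp: K'_def)
      show "ennreal b * emeasure lborel {lo i..hi i} \<le> emeasure ?m {lo i..hi i}"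
        unfolding i(1) mI[OF i(2)] lI using i ab by (simp add: ennreal_mult'[symmetric] ennreal_leI mult.commute mult_right_mono less_imp_le)
    qed
    also have "\<dots> = emeasure ?m ?W" by (rule UNm[OF C'(1,3), symmetric]) simp
    also have "\<dots> \<le> emeasure ?m V"
      using C' \<open>open V\<close> by (intro emeasure_mono) (auto simp: K'_def)
    finally show ?thesis using mV by (rule order.trans)
  qed
  \<comment> \<open>Cancelling s requires it to be finite, which is why Z is bounded.\<close>
  obtain s where s: "?s = ennreal s" "s \<ge> 0" using sfin by (metis ennreal_cases less_irrefl top_neq_ennreal less_top)
  have "b * s \<le> a * s"
  proof (rule field_le_epsilon)
    fix e :: real assume e: "e > 0"
    have "ennreal (b * s) \<le> ennreal (a * (s + e/a))"
      using key[of "e/a"] s ab e by (simp add: ennreal_mult'[symmetric] ennreal_plus[symmetric] del: ennreal_plus)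
    moreover have "0 \<le> a * (s + e/a)" using s ab e by simp
    ultimately have "b * s \<le> a * (s + e/a)" using ennreal_le_iff by blast
    then show "b * s \<le> a * s + e" using ab by (simp add: algebra_simps)
  qed
  then have "s = 0" using ab s(2) by (metis mult_le_cancel_right not_less order_antisym)
  then have "H \<in> null_sets lebesgue" using H s by auto
  then show ?thesis using H(2) negligible_iff_null_sets negligible_subset by blast
qed

lemma lipschitz_real_ae_differentiable:
  fixes f :: "real \<Rightarrow> real"
  assumes lip: "\<And>x y. \<bar>f x - f y\<bar> \<le> C * \<bar>x - y\<bar>"
  shows "negligible {t. \<not> (\<exists>l. (quot f t \<longlongrightarrow> l) (at 0))}"
proof -
  \<comment> \<open>Adding the slope D makes the function increasing with all difference quotients
    between 1 and 2 D, so that the thresholds a < b separating its lower and upper derivatives are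
    positive.\<close>
  define D where "D = \<bar>C\<bar> + 1"
  have lipD: "\<bar>f x - f y\<bar> \<le> \<bar>C\<bar> * \<bar>x - y\<bar>" for x y
    by (rule order.trans[OF lip]) (simp add: mult_right_mono)
  define g where "g t = f t + D * t" for t
  have qg: "quot g t h = quot f t h + D" if "h \<noteq> 0" for t h
    using that by (simp add: quot_def g_def field_simps)
  have qf: "\<bar>quot f t h\<bar> \<le> \<bar>C\<bar>" if "h \<noteq> 0" for t h
  proof -
    have "\<bar>f (t + h) - f t\<bar> \<le> \<bar>C\<bar> * \<bar>h\<bar>" using lipD[of "t + h" t] by simp
    then show ?thesis unfolding quot_def abs_divide using that by (simp add: pos_divide_le_eq)
  qed
  have q1: "1 \<le> quot g t h" "quot g t h \<le> 2 * D" if "h \<noteq> 0" for t h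
    using qf[OF that, of t] qg[OF that, of t] by (auto simp: D_def)
  have mono: "mono g"
  proof (rule monoI)
    fix x y :: real assume xy: "x \<le> y"
    have "f x - f y \<le> \<bar>C\<bar> * (y - x)" using lipD[of x y] xy by (simp add: abs_le_iff)
    moreover have "\<bar>C\<bar> * (y - x) \<le> D * (y - x)" using xy by (intro mult_right_mono) (auto simp: D_def)
    ultimately show "g x \<le> g y" by (simp add: g_def algebra_simps)
  qed
  have "continuous_on UNIV f"
    by (rule lipschitz_on_continuous_on[where L = "\<bar>C\<bar>"], rule lipschitz_onI) (use lipD in \<open>auto simp: dist_real_def\<close>)
  then have cont: "continuous_on UNIV g" unfolding g_def by (intro continuous_intros)
  define Z where "Z a b n = {t. \<bar>t\<bar> \<le> real n \<and> (\<forall>d>0. \<exists>h. h \<noteq> 0 \<and> \<bar>h\<bar> < d \<and> quot g t h < a)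
      \<and> (\<forall>d>0. \<exists>h. h \<noteq> 0 \<and> \<bar>h\<bar> < d \<and> quot g t h > b)}" for a b n
  have neg: "negligible (Z a b n)" if "0 < a" "a < b" for a b n
    by (rule lipschitz_mono_dini_negligible[OF mono cont that]) (auto simp: Z_def bounded_real)
  have neg_all: "negligible (\<Union>(a,b,n)\<in>{(a,b,n). a \<in> \<rat> \<and> b \<in> \<rat> \<and> 0 < a \<and> a < b}. Z a b n)"
  proof (rule negligible_countable_Union)
    have "countable (\<rat> \<times> \<rat> \<times> (UNIV :: nat set) :: (real \<times> real \<times> nat) set)" by (intro countable_SIGMA) (auto simp: countable_rat)
    then have "countable {(a::real,b::real,n::nat). a \<in> \<rat> \<and> b \<in> \<rat> \<and> 0 < a \<and> a < b}"
      by (rule countable_subset[rotated]) auto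
    then show "countable ((\<lambda>(a,b,n). Z a b n) ` {(a,b,n). a \<in> \<rat> \<and> b \<in> \<rat> \<and> 0 < a \<and> a < b})" by (rule countable_image)
  qed (use neg in auto)
  show ?thesis
  proof (rule negligible_subset[OF neg_all], intro subsetI, rule ccontr)
    fix t assume t: "t \<in> {t. \<not> (\<exists>l. (quot f t \<longlongrightarrow> l) (at 0))}"
      and nZ: "t \<notin> (\<Union>(a,b,n)\<in>{(a,b,n). a \<in> \<rat> \<and> b \<in> \<rat> \<and> 0 < a \<and> a < b}. Z a b n)"
    obtain n where n: "\<bar>t\<bar> \<le> real n" using real_arch_simple by blast
    let ?Q = "\<lambda>h. ereal (quot g t h)"
    have ev: "eventually (\<lambda>h. h \<noteq> 0) (at (0::real))" by (simp add: eventually_at_filter)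
    have freq: "\<exists>h. h \<noteq> 0 \<and> \<bar>h\<bar> < d \<and> P h" if "\<not> eventually (\<lambda>h. \<not> P h) (at (0::real))" "d > 0" for P d
      using that by (auto simp: eventually_at dist_real_def)
    have l1: "1 \<le> Liminf (at 0) ?Q"
      by (rule Liminf_bounded) (use ev in \<open>auto elim!: eventually_mono simp: q1 one_ereal_def\<close>)
    \<comment> \<open>A gap between the lower and the upper limit contains two rational thresholds,
      which puts t into one of the countably many null sets Z.\<close>
    have "\<not> Liminf (at 0) ?Q < Limsup (at 0) ?Q"
    proof
      assume lu: "Liminf (at 0) ?Q < Limsup (at 0) ?Q"
      obtain b where b: "Liminf (at 0) ?Q < ereal (real_of_rat b)" "ereal (real_of_rat b) < Limsup (at 0) ?Q"
        using ereal_dense3[OF lu] by blast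
      obtain a where a: "Liminf (at 0) ?Q < ereal (real_of_rat a)" "ereal (real_of_rat a) < ereal (real_of_rat b)"
        using ereal_dense3[OF b(1)] by blast
      have na: "\<not> eventually (\<lambda>h. \<not> quot g t h < real_of_rat a) (at 0)"
      proof
        assume "eventually (\<lambda>h. \<not> quot g t h < real_of_rat a) (at 0)"
        then have "ereal (real_of_rat a) \<le> Liminf (at 0) ?Q"
          by (intro Liminf_bounded) (auto elim!: eventually_mono)
        then show False using a by simp
      qed
      have nb: "\<not> eventually (\<lambda>h. \<not> quot g t h > real_of_rat b) (at 0)"
      proof
        assume "eventually (\<lambda>h. \<not> quot g t h > real_of_rat b) (at 0)"
        then have "Limsup (at 0) ?Q \<le> ereal (real_of_rat b)"
          by (intro Limsup_bounded) (auto elim!: eventually_mono)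
        then show False using b by simp
      qed
      have "t \<in> Z (real_of_rat a) (real_of_rat b) n"
        unfolding Z_def by (intro CollectI conjI allI impI n) (erule freq[OF na], erule freq[OF nb])
      moreover have "1 < ereal (real_of_rat a)" using l1 a(1) by (rule order.strict_trans1)
      then have "(real_of_rat a, real_of_rat b, n) \<in> {(a,b,n). a \<in> \<rat> \<and> b \<in> \<rat> \<and> 0 < a \<and> a < b}"
        using a(2) by (simp add: one_ereal_def)
      ultimately show False using nZ by blast
    qed
    then have "Liminf (at 0) ?Q = Limsup (at 0) ?Q"
      using Liminf_le_Limsup[of "at (0::real)" ?Q] by (simp add: order.antisym not_less)
    then have lim: "(?Q \<longlongrightarrow> Liminf (at 0) ?Q) (at 0)" by (simp add: tendsto_iff_Liminf_eq_Limsup)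
    have "Liminf (at 0) ?Q \<le> ereal (2 * D)"
      by (rule tendsto_upperbound[OF lim]) (use ev in \<open>auto elim!: eventually_mono simp: q1\<close>)
    then obtain l where l: "Liminf (at 0) ?Q = ereal l" using l1 by (cases "Liminf (at 0) ?Q") auto
    then have "(quot g t \<longlongrightarrow> l) (at 0)" using lim by simp
    then have "((\<lambda>h. quot g t h - D) \<longlongrightarrow> l - D) (at 0)" by (intro tendsto_intros)
    then have "(quot f t \<longlongrightarrow> l - D) (at 0)"
      by (rule Lim_transform_eventually) (use ev in \<open>auto elim!: eventually_mono simp: qg\<close>)
    then show False using t by blast
  qed
qed

section \<open>Horizontal curves\<close>

context carnot begin

lemma lvf_eq: "lvf gm i x = Dg (x,0) (0, axis i 1)"
  unfolding lvf_def by (rule fun_cong[OF frechet_derivative_at[OF gm_right_has_derivative[of x 0 UNIV]], symmetric])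

text \<open>The left-invariant field with value v at the identity, evaluated at x.\<close>

definition hv :: "real^'n \<Rightarrow> real^'n \<Rightarrow> real^'n" where "hv x v = Dg (x,0) (0,v)"

lemma linear_hv: "linear (hv x)"
  unfolding hv_def by (rule linear_Dg[OF linear_zero linear_ident])

lemma gm_has_derivative_hv: "((\<lambda>y. x \<odot> y) has_derivative hv x) (at 0)"
  using gm_right_has_derivative[of x 0 UNIV] by (simp add: hv_def[abs_def])

lemma sum_lvf:
  assumes "\<And>i. \<sigma> i \<noteq> 1 \<Longrightarrow> h $ i = 0"
  shows "(\<Sum>i\<in>{i. \<sigma> i = 1}. h $ i *\<^sub>R lvf gm i x) = hv x h"
proof -
  have "hv x h = hv x (\<Sum>i\<in>UNIV. h $ i *\<^sub>R axis i 1)"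
    using basis_expansion[of h] by (simp add: scalar_mult_eq_scaleR)
  also have "\<dots> = (\<Sum>i\<in>UNIV. h $ i *\<^sub>R hv x (axis i 1))"
    by (simp add: linear_sum[OF linear_hv] linear_scale[OF linear_hv])
  also have "\<dots> = (\<Sum>i\<in>{i. \<sigma> i = 1}. h $ i *\<^sub>R hv x (axis i 1))"
    by (rule sum.mono_neutral_right) (use assms in auto)
  finally show ?thesis by (simp add: lvf_eq hv_def)
qed

lemma hv_left: "hv (a \<odot> x) v = Dg (a,x) (0, hv x v)"
proof -
  have 1: "((\<lambda>y. (a \<odot> x) \<odot> y) has_derivative hv (a \<odot> x)) (at 0)"
    by (rule gm_has_derivative_hv)
  have "((\<lambda>y. x \<odot> y) has_derivative hv x) (at 0)"
    by (rule gm_has_derivative_hv)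
  from gm_has_derivative[OF has_derivative_const this]
  have 2: "((\<lambda>y. a \<odot> (x \<odot> y)) has_derivative (\<lambda>k. Dg (a,x) (0, hv x k))) (at 0)" by simp
  show ?thesis using has_derivative_unique[OF 1[unfolded gm_assoc] 2] by metis
qed

lemma hv_dl: "r > 0 \<Longrightarrow> hv (dl r x) (dl r v) = dl r (hv x v)"
  using Dg_dl[of r x 0 0 v] by (simp add: hv_def)

lemma hv_line: "hv (t *\<^sub>R v) v = v"
proof -
  have "((\<lambda>s. s *\<^sub>R v) has_derivative (\<lambda>s. s *\<^sub>R v)) (at 0)" by (auto intro!: derivative_eq_intros)
  from gm_has_derivative[OF has_derivative_const this]
  have 1: "((\<lambda>s. (t *\<^sub>R v) \<odot> (s *\<^sub>R v)) has_derivative (\<lambda>k. Dg (t *\<^sub>R v, 0) (0, k *\<^sub>R v))) (at 0)" by simp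
  have 2: "((\<lambda>s. (t + s) *\<^sub>R v) has_derivative (\<lambda>k. k *\<^sub>R v)) (at 0)" by (auto intro!: derivative_eq_intros)
  from fun_cong[OF has_derivative_unique[OF 1[unfolded gm_scaleR] 2], of 1] show ?thesis by (simp add: hv_def)
qed

lemma Dg_bounded_on_compact: assumes "compact S" obtains M where "M > 0" "\<And>z. z \<in> S \<Longrightarrow> norm (Dg z) \<le> M"
proof -
  have "bounded (Dg ` S)"
    using assms Dg_cont by (intro compact_imp_bounded compact_continuous_image) (auto intro: continuous_on_subset)
  then show ?thesis using that by (auto simp: bounded_pos)
qed

lemma hv_bounded: obtains M where "M > 0" "\<And>x v. norm x \<le> 1 \<Longrightarrow> norm (hv x v) \<le> M * norm v"
proof -
  obtain M where M: "M > 0" "\<And>z. z \<in> cball 0 1 \<times> {0} \<Longrightarrow> norm (Dg z) \<le> M"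
    using Dg_bounded_on_compact[OF compact_Times[OF compact_cball[of 0 1] compact_sing[of 0]]] by blast
  have "norm (hv x v) \<le> M * norm v" if "norm x \<le> 1" for x v
  proof -
    have "norm (hv x v) \<le> norm (Dg (x,0)) * norm (0::real^'n, v)" unfolding hv_def by (rule norm_blinfun)
    also have "\<dots> \<le> M * norm v" using M that by (auto simp: norm_Pair intro!: mult_right_mono)
    finally show ?thesis .
  qed
  then show ?thesis using that M by blast
qed

text \<open>The endpoints are absorbed into the null set, which leaves ordinary two-sided
  derivatives; these can be transported by the chain rule and glued when curves are
  concatenated.\<close>

lemma horizontal_iff:
  "horizontal gm \<sigma> \<gamma> h \<longleftrightarrow> (\<exists>C. C-lipschitz_on {0..1} \<gamma>) \<and> (\<forall>t i. \<sigma> i \<noteq> 1 \<longrightarrow> h t $ i = 0) \<and>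
     (\<lambda>t. norm (h t)) integrable_on {0..1} \<and>
     (\<exists>N. negligible N \<and> (\<forall>t\<in>{0<..<1} - N. (\<gamma> has_vector_derivative hv (\<gamma> t) (h t)) (at t)))"
  (is "?L \<longleftrightarrow> ?A \<and> ?B \<and> ?C \<and> ?D")
proof -
  have "(AE t in lebesgue. t \<in> {0..1} \<longrightarrow>
        (\<gamma> has_vector_derivative (\<Sum>i\<in>{i. \<sigma> i = 1}. h t $ i *\<^sub>R lvf gm i (\<gamma> t))) (at t within {0..1})) \<longleftrightarrow> ?D"
    (is "?AE \<longleftrightarrow> _") if B: ?B
  proof -
    have eq: "(\<Sum>i\<in>{i. \<sigma> i = 1}. h t $ i *\<^sub>R lvf gm i (\<gamma> t)) = hv (\<gamma> t) (h t)" for t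
      by (rule sum_lvf) (use B in blast)
    show ?thesis
    proof
    assume ae: ?AE
    from ae[unfolded eq eventually_ae_filter]
    obtain N where N0: "N \<in> null_sets lebesgue" "{t \<in> space lebesgue. \<not> (t \<in> {0..1} \<longrightarrow>
        (\<gamma> has_vector_derivative hv (\<gamma> t) (h t)) (at t within {0..1}))} \<subseteq> N" by blast
    have N: "N \<in> null_sets lebesgue" "\<And>t. t \<notin> N \<Longrightarrow> t \<in> {0..1} \<longrightarrow>
        (\<gamma> has_vector_derivative hv (\<gamma> t) (h t)) (at t within {0..1})" using N0 by auto
    show ?D
    proof (intro exI[of _ N] conjI ballI)
      fix t assume t: "t \<in> {0<..<1::real} - N"
      have "at t within {0..1} = at t" using t by (intro at_within_Icc_at) auto
      then show "(\<gamma> has_vector_derivative hv (\<gamma> t) (h t)) (at t)" using N(2)[of t] t by auto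
    qed (use N in \<open>simp add: negligible_iff_null_sets\<close>)
  next
    assume ?D
    then obtain N where N: "negligible N" "\<And>t. t \<in> {0<..<1} - N \<Longrightarrow> (\<gamma> has_vector_derivative hv (\<gamma> t) (h t)) (at t)" by blast
    have "N \<union> {0,1} \<in> null_sets lebesgue" using N(1) by (simp add: negligible_iff_null_sets[symmetric])
    moreover have "t \<in> {0..1} \<longrightarrow> (\<gamma> has_vector_derivative (\<Sum>i\<in>{i. \<sigma> i = 1}. h t $ i *\<^sub>R lvf gm i (\<gamma> t))) (at t within {0..1})"
      if "t \<notin> N \<union> {0,1}" for t
      unfolding eq using N(2)[of t] that by (auto simp: less_le intro: has_vector_derivative_at_within)
    ultimately show ?AE unfolding eventually_ae_filter by blast
    qed
  qed
  then show ?thesis unfolding horizontal_def by blast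
qed

definition hpath :: "real^'n \<Rightarrow> real^'n \<Rightarrow> real \<Rightarrow> bool" where
  "hpath x y l \<longleftrightarrow> (\<exists>\<gamma> h. horizontal gm \<sigma> \<gamma> h \<and> \<gamma> 0 = x \<and> \<gamma> 1 = y \<and> integral {0..1} (\<lambda>t. norm (h t)) = l)"

lemma cc_dist_hpath: "cc_dist gm \<sigma> x y = Inf {l. hpath x y l}"
  unfolding cc_dist_def hpath_def by (rule arg_cong[where f = Inf]) auto

lemma hpath_nonneg: "hpath x y l \<Longrightarrow> 0 \<le> l"
  unfolding hpath_def horizontal_def by (auto intro!: integral_nonneg)

text \<open>Left translations are controlled in the Euclidean norm on bounded sets; a Lipschitz
  curve on the unit interval stays in such a set.\<close>

lemma gm_lipschitz_bounded:
  obtains C where "C \<ge> 0" "\<And>y y'. norm y \<le> R \<Longrightarrow> norm y' \<le> R \<Longrightarrow> norm (a \<odot> y - a \<odot> y') \<le> C * norm (y - y')"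
proof -
  obtain M where M: "M > 0" "\<And>z. z \<in> {a} \<times> cball 0 R \<Longrightarrow> norm (Dg z) \<le> M"
    using Dg_bounded_on_compact[OF compact_Times[OF compact_sing[of a] compact_cball[of 0 R]]] by blast
  have on: "onorm (\<lambda>k. Dg (a,y) (0,k)) \<le> M" if "y \<in> cball 0 R" for y
  proof (rule onorm_le)
    fix k :: "real^'n"
    have "norm (Dg (a,y) (0,k)) \<le> norm (Dg (a,y)) * norm (0::real^'n, k)" by (rule norm_blinfun)
    also have "\<dots> \<le> M * norm k" using M that by (auto simp: norm_Pair intro!: mult_right_mono)
    finally show "norm (Dg (a,y) (0,k)) \<le> M * norm k" .
  qed
  have "norm (a \<odot> y - a \<odot> y') \<le> M * norm (y - y')" if "norm y \<le> R" "norm y' \<le> R" for y y'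
    by (rule differentiable_bound[OF convex_cball[of 0 R] gm_right_has_derivative on]) (use that in auto)
  then show ?thesis using that M by (metis less_imp_le)
qed

lemma hpath_left: assumes "hpath x y l" shows "hpath (a \<odot> x) (a \<odot> y) l"
proof -
  obtain \<gamma> h where g: "horizontal gm \<sigma> \<gamma> h" "\<gamma> 0 = x" "\<gamma> 1 = y" "integral {0..1} (\<lambda>t. norm (h t)) = l"
    using assms unfolding hpath_def by blast
  obtain C N where C: "C-lipschitz_on {0..1} \<gamma>" and N: "negligible N"
    "\<And>t. t \<in> {0<..<1} - N \<Longrightarrow> (\<gamma> has_vector_derivative hv (\<gamma> t) (h t)) (at t)"
    using g(1) unfolding horizontal_iff by blast
  have "bounded (\<gamma> ` {0..1})"
    using C by (intro compact_imp_bounded compact_continuous_image lipschitz_on_continuous_on) auto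
  then obtain R where "\<forall>x\<in>\<gamma> ` {0..1}. norm x \<le> R" unfolding bounded_iff by blast
  then have R: "\<And>t. t \<in> {0..1} \<Longrightarrow> norm (\<gamma> t) \<le> R" by blast
  obtain K where K: "K \<ge> 0" "\<And>y y'. norm y \<le> R \<Longrightarrow> norm y' \<le> R \<Longrightarrow> norm (a \<odot> y - a \<odot> y') \<le> K * norm (y - y')"
    using gm_lipschitz_bounded[of R a] by blast
  have "(K * C)-lipschitz_on {0..1} (\<lambda>t. a \<odot> \<gamma> t)"
  proof (rule lipschitz_onI)
    fix s t :: real assume st: "s \<in> {0..1}" "t \<in> {0..1}"
    have "dist (a \<odot> \<gamma> s) (a \<odot> \<gamma> t) \<le> K * dist (\<gamma> s) (\<gamma> t)" using K(2) R st by (simp add: dist_norm)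
    also have "\<dots> \<le> K * (C * dist s t)" using lipschitz_onD[OF C st] K(1) by (rule mult_left_mono)
    finally show "dist (a \<odot> \<gamma> s) (a \<odot> \<gamma> t) \<le> K * C * dist s t" by simp
  qed (use K lipschitz_on_nonneg[OF C] in auto)
  moreover have "((\<lambda>t. a \<odot> \<gamma> t) has_vector_derivative hv (a \<odot> \<gamma> t) (h t)) (at t)" if "t \<in> {0<..<1} - N" for t
  proof -
    have "((\<lambda>t. a \<odot> \<gamma> t) has_derivative (\<lambda>s. Dg (a, \<gamma> t) (0, s *\<^sub>R hv (\<gamma> t) (h t)))) (at t)"
      by (rule gm_has_derivative[OF has_derivative_const N(2)[OF that, unfolded has_vector_derivative_def]])
    moreover have "Dg (a, \<gamma> t) (0, s *\<^sub>R v) = s *\<^sub>R Dg (a, \<gamma> t) (0, v)" for s v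
      using blinfun.scaleR_right[of "Dg (a, \<gamma> t)" s "(0,v)"] by simp
    ultimately show ?thesis unfolding has_vector_derivative_def hv_left by simp
  qed
  ultimately have "horizontal gm \<sigma> (\<lambda>t. a \<odot> \<gamma> t) h" using g(1) N(1) unfolding horizontal_iff by blast
  then show ?thesis unfolding hpath_def using g by blast
qed

text \<open>A dilation acts on horizontal vectors as multiplication by r, so it multiplies the
  control and hence the length by r.\<close>

lemma hpath_dl: assumes "hpath x y l" "r > 0" shows "hpath (dl r x) (dl r y) (r * l)"
proof -
  obtain \<gamma> h where g: "horizontal gm \<sigma> \<gamma> h" "\<gamma> 0 = x" "\<gamma> 1 = y" "integral {0..1} (\<lambda>t. norm (h t)) = l"
    using assms unfolding hpath_def by blast
  obtain C N where C: "C-lipschitz_on {0..1} \<gamma>" and N: "negligible N"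
    "\<And>t. t \<in> {0<..<1} - N \<Longrightarrow> (\<gamma> has_vector_derivative hv (\<gamma> t) (h t)) (at t)"
    and h0: "\<And>t i. \<sigma> i \<noteq> 1 \<Longrightarrow> h t $ i = 0" and hi: "(\<lambda>t. norm (h t)) integrable_on {0..1}"
    using g(1) unfolding horizontal_iff by blast
  have bl: "bounded_linear (dl r)" using linear_dl linear_conv_bounded_linear by blast
  obtain K where K: "K > 0" "\<And>y. norm (dl r y) \<le> norm y * K" using bounded_linear.pos_bounded[OF bl] by blast
  have "(K * C)-lipschitz_on {0..1} (\<lambda>t. dl r (\<gamma> t))"
  proof (rule lipschitz_onI)
    fix s t :: real assume st: "s \<in> {0..1}" "t \<in> {0..1}"
    have "dist (dl r (\<gamma> s)) (dl r (\<gamma> t)) \<le> K * dist (\<gamma> s) (\<gamma> t)"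
      using K(2)[of "\<gamma> s - \<gamma> t"] by (simp add: dist_norm linear_diff[OF linear_dl] mult.commute)
    also have "\<dots> \<le> K * (C * dist s t)" using lipschitz_onD[OF C st] K(1) by (simp add: mult_left_mono)
    finally show "dist (dl r (\<gamma> s)) (dl r (\<gamma> t)) \<le> K * C * dist s t" by simp
  qed (use K lipschitz_on_nonneg[OF C] in auto)
  moreover have "((\<lambda>t. dl r (\<gamma> t)) has_vector_derivative hv (dl r (\<gamma> t)) (r *\<^sub>R h t)) (at t)" if "t \<in> {0<..<1} - N" for t
    using bounded_linear.has_vector_derivative[OF bl N(2)[OF that]] hv_dl[OF assms(2), of "\<gamma> t" "h t"] dl_horiz[of "h t" r] h0
    by simp
  moreover have "(\<lambda>t. norm (r *\<^sub>R h t)) integrable_on {0..1}" using integrable_on_mult_right[OF hi, of r] assms(2) by simp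
  ultimately have "horizontal gm \<sigma> (\<lambda>t. dl r (\<gamma> t)) (\<lambda>t. r *\<^sub>R h t)" using h0 N(1) unfolding horizontal_iff by auto
  moreover have "integral {0..1} (\<lambda>t. norm (r *\<^sub>R h t)) = r * l" using g(4) assms(2) by simp
  ultimately show ?thesis unfolding hpath_def using g by blast
qed

lemma negligible_affine_real: "negligible N \<Longrightarrow> negligible ((\<lambda>t::real. m * t + c) ` N)"
  by (rule negligible_differentiable_image_negligible) (auto simp: differentiable_on_def intro!: derivative_intros)

lemma hpath_sym: assumes "hpath x y l" shows "hpath y x l"
proof -
  obtain \<gamma> h where g: "horizontal gm \<sigma> \<gamma> h" "\<gamma> 0 = x" "\<gamma> 1 = y" "integral {0..1} (\<lambda>t. norm (h t)) = l"
    using assms unfolding hpath_def by blast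
  obtain C N where C: "C-lipschitz_on {0..1} \<gamma>" and N: "negligible N"
    "\<And>t. t \<in> {0<..<1} - N \<Longrightarrow> (\<gamma> has_vector_derivative hv (\<gamma> t) (h t)) (at t)"
    and h0: "\<And>t i. \<sigma> i \<noteq> 1 \<Longrightarrow> h t $ i = 0" and hi: "(\<lambda>t. norm (h t)) integrable_on {0..1}"
    using g(1) unfolding horizontal_iff by blast
  have "C-lipschitz_on {0..1} (\<lambda>t. \<gamma> (1 - t))"
  proof (rule lipschitz_onI)
    fix s t :: real assume st: "s \<in> {0..1}" "t \<in> {0..1}"
    show "dist (\<gamma> (1 - s)) (\<gamma> (1 - t)) \<le> C * dist s t"
      using lipschitz_onD[OF C, of "1 - s" "1 - t"] st by (simp add: dist_real_def abs_minus_commute)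
  qed (use lipschitz_on_nonneg[OF C] in auto)
  moreover have "((\<lambda>t. \<gamma> (1 - t)) has_vector_derivative hv (\<gamma> (1 - t)) (- h (1 - t))) (at t)"
    if t: "t \<in> {0<..<1} - (\<lambda>t. (-1) * t + 1) ` N" for t
  proof -
    have "1 - t \<in> {0<..<1} - N"
    proof -
      have "1 - t \<notin> N" using t imageI[of "1 - t" N "\<lambda>t. (-1) * t + 1"] by auto
      then show ?thesis using t by auto
    qed
    from N(2)[OF this] have "(\<gamma> \<circ> (\<lambda>t. 1 - t) has_vector_derivative (- 1) *\<^sub>R hv (\<gamma> (1 - t)) (h (1 - t))) (at t)"
      by (intro vector_diff_chain_at) (auto intro!: derivative_eq_intros)
    then show ?thesis by (simp add: o_def linear_neg[OF linear_hv])
  qed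
  moreover have int: "((\<lambda>t. norm (- h (1 - t))) has_integral l) {0..1}"
  proof -
    have "((\<lambda>t. norm (h t)) has_integral l) {0..1}" using hi g(4) by (metis integrable_integral)
    from has_integral_affinity01[OF this, of "-1" 1]
    have "((\<lambda>t. norm (h (1 - t))) has_integral l) ((\<lambda>x. - x + 1) ` {0..1})" by simp
    moreover have "(\<lambda>x. - x + 1) ` {0..1} = {0..1::real}"
    proof
      show "{0..1} \<subseteq> (\<lambda>x. - x + 1) ` {0..1::real}"
      proof
        fix x :: real assume "x \<in> {0..1}"
        then show "x \<in> (\<lambda>x. - x + 1) ` {0..1::real}" by (intro image_eqI[of _ _ "1 - x"]) auto
      qed
    qed auto
    ultimately show ?thesis by simp
  qed
  moreover have "negligible ((\<lambda>t. (-1) * t + 1) ` N)" using N(1) by (rule negligible_affine_real)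
  ultimately have "horizontal gm \<sigma> (\<lambda>t. \<gamma> (1 - t)) (\<lambda>t. - h (1 - t))"
    using h0 unfolding horizontal_iff by (intro conjI exI[of _ "(\<lambda>t. (-1) * t + 1) ` N"] exI[of _ C]) (auto simp: integrable_on_def)
  moreover have "integral {0..1} (\<lambda>t. norm (- h (1 - t))) = l" using int by (rule integral_unique)
  ultimately show ?thesis unfolding hpath_def using g by (intro exI[of _ "\<lambda>t. \<gamma> (1 - t)"] exI[of _ "\<lambda>t. - h (1 - t)"]) auto
qed

lemma hpath_trans: assumes "hpath x y l" "hpath y z m" shows "hpath x z (l + m)"
proof -
  obtain \<gamma> h where g: "horizontal gm \<sigma> \<gamma> h" "\<gamma> 0 = x" "\<gamma> 1 = y" "integral {0..1} (\<lambda>t. norm (h t)) = l"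
    using assms unfolding hpath_def by blast
  obtain C N where C: "C-lipschitz_on {0..1} \<gamma>" and N: "negligible N"
    "\<And>t. t \<in> {0<..<1} - N \<Longrightarrow> (\<gamma> has_vector_derivative hv (\<gamma> t) (h t)) (at t)"
    and h0: "\<And>t i. \<sigma> i \<noteq> 1 \<Longrightarrow> h t $ i = 0" and hi: "(\<lambda>t. norm (h t)) integrable_on {0..1}"
    using g(1) unfolding horizontal_iff by blast
  obtain \<gamma>' h' where g': "horizontal gm \<sigma> \<gamma>' h'" "\<gamma>' 0 = y" "\<gamma>' 1 = z" "integral {0..1} (\<lambda>t. norm (h' t)) = m"
    using assms unfolding hpath_def by blast
  obtain C' N' where C': "C'-lipschitz_on {0..1} \<gamma>'" and N': "negligible N'"
    "\<And>t. t \<in> {0<..<1} - N' \<Longrightarrow> (\<gamma>' has_vector_derivative hv (\<gamma>' t) (h' t)) (at t)"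
    and h0': "\<And>t i. \<sigma> i \<noteq> 1 \<Longrightarrow> h' t $ i = 0" and hi': "(\<lambda>t. norm (h' t)) integrable_on {0..1}"
    using g'(1) unfolding horizontal_iff by blast
  define K where "K = 2 * max C C'"
  have K: "2 * C \<le> K" "2 * C' \<le> K" "0 \<le> K" using lipschitz_on_nonneg[OF C] by (auto simp: K_def)
  define G where "G t = (if t \<le> 1/2 then \<gamma> (2 * t) else \<gamma>' (2 * t - 1))" for t
  define H where "H t = (if t \<le> 1/2 then 2 *\<^sub>R h (2 * t) else 2 *\<^sub>R h' (2 * t - 1))" for t
  have "K-lipschitz_on {0..1} G" unfolding G_def
  proof (rule lipschitz_on_concat)
    show "K-lipschitz_on {0..1/2} (\<lambda>t. \<gamma> (2 * t))"
    proof (rule lipschitz_onI)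
      fix s t :: real assume st: "s \<in> {0..1/2}" "t \<in> {0..1/2}"
      have "dist (\<gamma> (2 * s)) (\<gamma> (2 * t)) \<le> C * dist (2 * s) (2 * t)" using st by (intro lipschitz_onD[OF C]) auto
      also have "\<dots> = (2 * C) * dist s t" by (auto simp: dist_real_def abs_if algebra_simps)
      also have "\<dots> \<le> K * dist s t" using K(1) by (rule mult_right_mono) simp
      finally show "dist (\<gamma> (2 * s)) (\<gamma> (2 * t)) \<le> K * dist s t" .
    qed (rule K)
    show "K-lipschitz_on {1/2..1} (\<lambda>t. \<gamma>' (2 * t - 1))"
    proof (rule lipschitz_onI)
      fix s t :: real assume st: "s \<in> {1/2..1}" "t \<in> {1/2..1}"
      have "dist (\<gamma>' (2 * s - 1)) (\<gamma>' (2 * t - 1)) \<le> C' * dist (2 * s - 1) (2 * t - 1)" using st by (intro lipschitz_onD[OF C']) auto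
      also have "\<dots> = (2 * C') * dist s t" by (auto simp: dist_real_def abs_if algebra_simps)
      also have "\<dots> \<le> K * dist s t" using K(2) by (rule mult_right_mono) simp
      finally show "dist (\<gamma>' (2 * s - 1)) (\<gamma>' (2 * t - 1)) \<le> K * dist s t" .
    qed (rule K)
  qed (use g g' in simp)
  moreover have "negligible ((\<lambda>t. (1/2) * t + 0) ` N \<union> (\<lambda>t. (1/2) * t + 1/2) ` N' \<union> {1/2})" (is "negligible ?N")
    using N(1) N'(1) by (intro negligible_Un negligible_affine_real) auto
  moreover have "(G has_vector_derivative hv (G t) (H t)) (at t)" if t: "t \<in> {0<..<1} - ?N" for t
  proof (cases "t < 1/2")
    case True
    have "2 * t \<notin> N" using t imageI[of "2 * t" N "\<lambda>t. (1/2) * t + 0"] by auto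
    then have "2 * t \<in> {0<..<1} - N" using t True by auto
    from N(2)[OF this] have d: "(\<gamma> \<circ> (\<lambda>t. 2 * t) has_vector_derivative 2 *\<^sub>R hv (\<gamma> (2 * t)) (h (2 * t))) (at t)"
      by (intro vector_diff_chain_at) (auto intro!: derivative_eq_intros)
    have "(G has_vector_derivative 2 *\<^sub>R hv (\<gamma> (2 * t)) (h (2 * t))) (at t)"
      by (rule has_vector_derivative_transform_within_open[OF d, of "{..<1/2}"]) (use True in \<open>auto simp: G_def\<close>)
    then show ?thesis using True by (simp add: G_def H_def linear_scale[OF linear_hv])
  next
    case False
    then have t2: "t > 1/2" using t by auto
    have "2 * t - 1 \<notin> N'" using t imageI[of "2 * t - 1" N' "\<lambda>t. (1/2) * t + 1/2"] by (auto simp: field_simps)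
    then have "2 * t - 1 \<in> {0<..<1} - N'" using t t2 by auto
    from N'(2)[OF this] have d: "(\<gamma>' \<circ> (\<lambda>t. 2 * t - 1) has_vector_derivative 2 *\<^sub>R hv (\<gamma>' (2 * t - 1)) (h' (2 * t - 1))) (at t)"
      by (intro vector_diff_chain_at) (auto intro!: derivative_eq_intros)
    have "(G has_vector_derivative 2 *\<^sub>R hv (\<gamma>' (2 * t - 1)) (h' (2 * t - 1))) (at t)"
      by (rule has_vector_derivative_transform_within_open[OF d, of "{1/2<..}"]) (use t2 in \<open>auto simp: G_def\<close>)
    then show ?thesis using t2 by (simp add: G_def H_def linear_scale[OF linear_hv])
  qed
  moreover have int: "((\<lambda>t. norm (H t)) has_integral (l + m)) {0..1}"
  proof (rule has_integral_combine[of 0 "1/2" 1])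
    have im: "(\<lambda>x. x / 2) ` {0..1} = {0..1/2::real}" "(\<lambda>x. x / 2 + 1/2) ` {0..1} = {1/2..1::real}"
      using image_affinity_atLeastAtMost[of "1/2" 0 0 "1::real"] image_affinity_atLeastAtMost[of "1/2" "1/2" 0 "1::real"] by simp_all
    have "((\<lambda>t. 2 * norm (h t)) has_integral 2 * l) {0..1}"
      using hi g(4) by (intro has_integral_mult_right) (metis integrable_integral)
    from has_integral_affinity01[OF this, of 2 0]
    have "((\<lambda>t. 2 * norm (h (2 * t))) has_integral l) {0..1/2}" using im by simp
    then show "((\<lambda>t. norm (H t)) has_integral l) {0..1/2}"
      by (rule has_integral_eq[rotated]) (auto simp: H_def)
    have "((\<lambda>t. 2 * norm (h' t)) has_integral 2 * m) {0..1}"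
      using hi' g'(4) by (intro has_integral_mult_right) (metis integrable_integral)
    from has_integral_affinity01[OF this, of 2 "-1"]
    have "((\<lambda>t. 2 * norm (h' (2 * t - 1))) has_integral m) {1/2..1}" using im by simp
    then show "((\<lambda>t. norm (H t)) has_integral m) {1/2..1}"
      by (rule has_integral_spike_finite[of "{1/2}", rotated 2]) (auto simp: H_def)
  qed auto
  moreover have "\<forall>t i. \<sigma> i \<noteq> 1 \<longrightarrow> H t $ i = 0" using h0 h0' by (auto simp: H_def)
  ultimately have "horizontal gm \<sigma> G H" unfolding horizontal_iff integrable_on_def by blast
  moreover have "integral {0..1} (\<lambda>t. norm (H t)) = l + m" using int by (rule integral_unique)
  moreover have "G 0 = x" "G 1 = z" using g g' by (auto simp: G_def)
  ultimately show ?thesis unfolding hpath_def by blast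
qed

lemma hpath_line: assumes "\<And>i. \<sigma> i \<noteq> 1 \<Longrightarrow> v $ i = 0" shows "hpath 0 v (norm v)"
proof -
  have "horizontal gm \<sigma> (\<lambda>t. t *\<^sub>R v) (\<lambda>t. v)" unfolding horizontal_iff
  proof (intro conjI exI[of _ "{}"] ballI)
    show "\<exists>C. C-lipschitz_on {0..1} (\<lambda>t. t *\<^sub>R v)"
      by (intro exI[of _ "norm v"] lipschitz_onI) (auto simp: dist_norm scaleR_diff_left[symmetric] mult.commute)
    show "((\<lambda>t. t *\<^sub>R v) has_vector_derivative hv (t *\<^sub>R v) v) (at t)" for t
      unfolding hv_line by (auto intro!: derivative_eq_intros simp: has_vector_derivative_def)
  qed (use assms in auto)
  then show ?thesis unfolding hpath_def by (intro exI[of _ "\<lambda>t. t *\<^sub>R v"] exI[of _ "\<lambda>t. v"]) auto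
qed

text \<open>In the Euclidean unit ball the horizontal fields are bounded by M, so a curve of length
  below 1/M starting at 0 cannot reach the unit sphere. The estimate is made up to the first exit
  time \<tau>.\<close>

lemma hpath_box: obtains c where "c > 0" "\<And>x l. hpath 0 x l \<Longrightarrow> l < c \<Longrightarrow> norm x < 1"
proof -
  obtain M where M: "M > 0" "\<And>x v. norm x \<le> 1 \<Longrightarrow> norm (hv x v) \<le> M * norm v" using hv_bounded by blast
  have "norm x < 1" if p: "hpath 0 x l" and l: "l < 1 / M" for x l
  proof (rule ccontr)
    assume nx: "\<not> norm x < 1"
    obtain \<gamma> h where g: "horizontal gm \<sigma> \<gamma> h" "\<gamma> 0 = 0" "\<gamma> 1 = x" "integral {0..1} (\<lambda>t. norm (h t)) = l"
      using p unfolding hpath_def by blast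
    obtain C N where C: "C-lipschitz_on {0..1} \<gamma>" and N: "negligible N"
      "\<And>t. t \<in> {0<..<1} - N \<Longrightarrow> (\<gamma> has_vector_derivative hv (\<gamma> t) (h t)) (at t)"
      and hi: "(\<lambda>t. norm (h t)) integrable_on {0..1}"
      using g(1) unfolding horizontal_iff by blast
    have cont: "continuous_on {0..1} (\<lambda>t. norm (\<gamma> t))" using C by (intro continuous_intros lipschitz_on_continuous_on)
    let ?T = "{t \<in> {0..1}. 1 \<le> norm (\<gamma> t)}"
    have cl: "closed ?T" using continuous_closed_preimage[OF cont, of "{1..}"] by (simp add: vimage_def Int_def)
    have ne: "1 \<in> ?T" using nx g(3) by simp
    have bd: "bdd_below ?T" by (rule bdd_belowI[of _ 0]) auto
    define \<tau> where "\<tau> = Inf ?T"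
    have \<tau>T: "\<tau> \<in> ?T" unfolding \<tau>_def by (rule closed_contains_Inf[OF _ bd cl]) (use ne in auto)
    have lt: "norm (\<gamma> t) < 1" if "t \<in> {0..<\<tau>}" for t
      using that \<tau>T cInf_lower[OF _ bd, of t] unfolding \<tau>_def[symmetric] by (auto simp: not_le[symmetric])
    have sub: "{0..\<tau>} \<subseteq> {0..1}" using \<tau>T by auto
    have hi': "(\<lambda>t. M * norm (h t)) integrable_on {0..\<tau>}"
      using integrable_on_subinterval[OF hi sub] by (rule integrable_on_mult_right)
    have "norm (\<gamma> \<tau> - \<gamma> 0) \<le> integral {0..\<tau>} (\<lambda>t. M * norm (h t))"
    proof (rule norm_diff_le_integral_lipschitz[where N = "N \<union> {0,\<tau>}" and f' = "\<lambda>t. hv (\<gamma> t) (h t)" and C = C])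
      show "C-lipschitz_on {0..\<tau>} \<gamma>" using C sub by (rule lipschitz_on_subset)
      fix t assume t: "t \<in> {0..\<tau>} - (N \<union> {0,\<tau>})"
      then have "t \<in> {0<..<1} - N" using \<tau>T by auto
      then show "(\<gamma> has_vector_derivative hv (\<gamma> t) (h t)) (at t within {0..\<tau>})"
        using N(2) has_vector_derivative_at_within by blast
      show "norm (hv (\<gamma> t) (h t)) \<le> M * norm (h t)" using lt[of t] t by (intro M(2)) auto
    qed (use N(1) M(1) \<tau>T hi' in auto)
    also have "\<dots> = M * integral {0..\<tau>} (\<lambda>t. norm (h t))" by simp
    also have "\<dots> \<le> M * l"
      using M(1) g(4) integral_subset_le[OF sub integrable_on_subinterval[OF hi sub] hi] by (simp add: mult_left_mono)
    also have "\<dots> < 1" using l M(1) by (simp add: field_simps)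
    finally show False using \<tau>T g(2) by simp
  qed
  then show ?thesis using that[of "1/M"] M(1) by simp
qed

end

section \<open>Connectivity by horizontal curves and the topology of the distance\<close>

context carnot begin

text \<open>Words in the horizontal one-parameter subgroups. That they exhaust the group gives
  connectivity by horizontal curves, and the induction rule is reused wherever a map is determined
  by its behaviour along horizontal lines.\<close>

inductive_set W :: "(real^'n) set" where
  W_0: "0 \<in> W"
| W_step: "x \<in> W \<Longrightarrow> \<sigma> i = 1 \<Longrightarrow> x \<odot> (t *\<^sub>R axis i 1) \<in> W"

lemma W_gm: "y \<in> W \<Longrightarrow> x \<in> W \<Longrightarrow> x \<odot> y \<in> W"
  by (induction rule: W.induct) (auto simp: gm_assoc[symmetric] intro: W.intros)

lemma W_axis: "\<sigma> i = 1 \<Longrightarrow> t *\<^sub>R axis i 1 \<in> W"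
  using W_step[OF W_0, of i t] by simp

lemma W_uminus: "x \<in> W \<Longrightarrow> - x \<in> W"
proof (induction rule: W.induct)
  case (W_step x i t)
  then show ?case using W_gm[OF W_step(3) W_axis[OF W_step(2), of "- t"]] by (simp add: gm_uminus)
qed (simp add: W_0)

lemma W_dl: "x \<in> W \<Longrightarrow> r > 0 \<Longrightarrow> dl r x \<in> W"
proof (induction rule: W.induct)
  case (W_step x i t)
  have "dl r (t *\<^sub>R axis i 1) = (r * t) *\<^sub>R axis i 1"
    using W_step(2) by (simp add: linear_scale[OF linear_dl] dl_axis)
  then show ?case using W.W_step[of "dl r x" i "r * t"] W_step by (simp add: dl_gm[symmetric])
qed (simp add: W_0)

text \<open>For the conjugate z one has z \<odot> x = x \<odot> y. Comparing coordinates degree by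
  degree, each degree being additive once the lower coordinates of z vanish, identifies the
  coordinates of z with those of y up to degree k.\<close>

lemma conj_filt:
  assumes y: "y \<in> filt k"
  shows "x \<odot> y \<odot> (- x) \<in> filt k" and "\<sigma> i = k \<Longrightarrow> (x \<odot> y \<odot> (- x)) $ i = y $ i"
proof -
  let ?z = "x \<odot> y \<odot> (- x)"
  have zx: "?z \<odot> x = x \<odot> y" by simp
  have xy: "(x \<odot> y) $ i = x $ i + y $ i" if "\<sigma> i \<le> k" for i using gm_nth_right[OF y that] .
  have "m \<le> k \<Longrightarrow> ?z \<in> filt m" for m
  proof (induction m)
    case (Suc m)
    then have z: "?z \<in> filt m" by simp
    have "?z $ i = 0" if "\<sigma> i = m" for i
    proof -
      have "(?z \<odot> x) $ i = ?z $ i + x $ i" by (rule gm_nth_left[OF z]) (use that in simp)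
      moreover have "y $ i = 0" using y that Suc by (auto simp: filt_def)
      ultimately show ?thesis using xy[of i] that Suc(2) unfolding zx by simp
    qed
    then show ?case using z by (simp add: mem_filt_Suc)
  qed (simp add: filt_def)
  then show z: "?z \<in> filt k" by simp
  show "?z $ i = y $ i" if "\<sigma> i = k"
    using gm_nth_left[OF z, of i x] xy[of i] that unfolding zx by simp
qed

lemma gcomm_filt: assumes y: "y \<in> filt k" shows "gcomm gm x y \<in> filt (Suc k)"
proof -
  have z: "x \<odot> y \<odot> (- x) \<in> filt k" by (rule conj_filt[OF y])
  have "gcomm gm x y $ i = 0" if "\<sigma> i \<le> k" for i
  proof -
    have "gcomm gm x y $ i = (x \<odot> y \<odot> (- x)) $ i + (- y) $ i"
      unfolding gcomm_def by (rule gm_nth_left[OF z that])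
    then show ?thesis using conj_filt(2)[OF y, of i x] z y that by (cases "\<sigma> i = k") (auto simp: filt_def)
  qed
  then show ?thesis by (auto simp: filt_def less_Suc_eq_le)
qed

text \<open>The group identity [x, y y'] = [x, y] (y [x, y'] y^-1) is exact, and conjugation leaves
  leading coordinates alone. With the analogous identity on the left, commutators are biadditive in
  degree k + 1.\<close>

lemma gcomm_gm_right:
  assumes "y \<in> filt k" "y' \<in> filt k" "\<sigma> i = Suc k"
  shows "gcomm gm x (y \<odot> y') $ i = gcomm gm x y $ i + gcomm gm x y' $ i"
proof -
  have "gcomm gm x (y \<odot> y') = gcomm gm x y \<odot> (y \<odot> gcomm gm x y' \<odot> (- y))"
    by (simp add: gcomm_def gm_uminus gm_assoc)
  then show ?thesis
    using gm_nth_left[OF gcomm_filt[OF assms(1)], of i] conj_filt(2)[OF gcomm_filt[OF assms(2)], of i] assms(3) by simp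
qed

lemma gcomm_gm_left:
  assumes "y \<in> filt k" "\<sigma> i = Suc k"
  shows "gcomm gm (x \<odot> x') y $ i = gcomm gm x y $ i + gcomm gm x' y $ i"
proof -
  have "gcomm gm (x \<odot> x') y = (x \<odot> gcomm gm x' y \<odot> (- x)) \<odot> gcomm gm x y"
    by (simp add: gcomm_def gm_uminus gm_assoc)
  then show ?thesis
    using gm_nth_left[OF conj_filt(1)[OF gcomm_filt[OF assms(1)]], of i] conj_filt(2)[OF gcomm_filt[OF assms(1)], of i] assms(2) by simp
qed

lemma filt_scaleR: "y \<in> filt k \<Longrightarrow> c *\<^sub>R y \<in> filt k"
  by (auto simp: filt_def)

lemma gcomm_0 [simp]: "gcomm gm x 0 = 0" "gcomm gm 0 x = 0"
  by (simp_all add: gcomm_def)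

lemma gcomm_nat_right:
  assumes "y \<in> filt k" "\<sigma> i = Suc k"
  shows "gcomm gm x (real n *\<^sub>R y) $ i = real n * gcomm gm x y $ i"
proof (induction n)
  case (Suc n)
  have "real (Suc n) *\<^sub>R y = (real n *\<^sub>R y) \<odot> y" using gm_scaleR[of "real n" y 1] by (simp add: add.commute)
  then show ?case using gcomm_gm_right[OF filt_scaleR[OF assms(1)] assms, of x "real n"] Suc by (simp add: algebra_simps)
qed simp

lemma gcomm_nat_left:
  assumes "y \<in> filt k" "\<sigma> i = Suc k"
  shows "gcomm gm (real n *\<^sub>R x) y $ i = real n * gcomm gm x y $ i"
proof (induction n)
  case (Suc n)
  have "real (Suc n) *\<^sub>R x = (real n *\<^sub>R x) \<odot> x" using gm_scaleR[of "real n" x 1] by (simp add: add.commute)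
  then show ?case using gcomm_gm_left[OF assms, of "real n *\<^sub>R x" x] Suc by (simp add: algebra_simps)
qed simp

lemma gcomm_dl: "r > 0 \<Longrightarrow> gcomm gm (dl r x) (dl r y) = dl r (gcomm gm x y)"
  by (simp add: gcomm_def dl_gm dl_uminus[symmetric])

lemma layer_filt: "w \<in> layer \<sigma> k \<Longrightarrow> w \<in> filt k"
  by (auto simp: layer_iff filt_def)

lemma dl_layer: assumes "w \<in> layer \<sigma> k" shows "dl r w = r ^ k *\<^sub>R w"
proof (rule vec_eq_iff[THEN iffD2], rule allI)
  fix i show "dl r w $ i = (r ^ k *\<^sub>R w) $ i" using assms by (cases "\<sigma> i = k") (auto simp: layer_iff)
qed

definition layer_part :: "nat \<Rightarrow> real^'n \<Rightarrow> real^'n" where "layer_part k x = (\<chi> i. if \<sigma> i = k then x $ i else 0)"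

lemma layer_part_layer: "layer_part k x \<in> layer \<sigma> k" by (auto simp: layer_iff layer_part_def)

lemma split_filt:
  assumes "x \<in> filt k" "y \<in> filt k" "\<And>i. \<sigma> i = k \<Longrightarrow> y $ i = x $ i"
  shows "(- y) \<odot> x \<in> filt (Suc k)"
  using filt_gm[OF filt_uminus[OF assms(2)] assms(1)] gm_nth_left[OF filt_uminus[OF assms(2)], of _ x] assms(3)
  by (auto simp: mem_filt_Suc)

definition topdeg :: nat where "topdeg = Suc (Max (range \<sigma>))"

lemma sigma_topdeg: "\<sigma> i < topdeg"
  by (simp add: topdeg_def less_Suc_eq_le)

text \<open>A component of x of degree n \<ge> 2 cannot contribute to degree k + 1: the dilation by
  2 scales that coordinate by 2^(k + 1), biadditivity by 2^(n + k). Downward induction removes one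
  layer of x at a time.\<close>

lemma gcomm_filt2_left:
  assumes m: "2 \<le> m" and k: "k \<ge> 1" and y: "y \<in> layer \<sigma> k" and i: "\<sigma> i = Suc k"
  shows "m \<le> topdeg \<Longrightarrow> x \<in> filt m \<Longrightarrow> gcomm gm x y $ i = 0"
proof (induction m arbitrary: x rule: inc_induct)
  case base
  then have "x = 0" by (rule filt_top[OF sigma_topdeg])
  then show ?case by simp
next
  case (step n)
  have yk: "y \<in> filt k" by (rule layer_filt[OF y])
  let ?w = "layer_part n x"
  have "2 ^ Suc k * gcomm gm ?w y $ i = dl 2 (gcomm gm ?w y) $ i" using i by simp
  also have "\<dots> = gcomm gm (dl 2 ?w) (dl 2 y) $ i" by (simp add: gcomm_dl)
  also have "\<dots> = gcomm gm (real (2 ^ n) *\<^sub>R ?w) (real (2 ^ k) *\<^sub>R y) $ i"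
    by (simp add: dl_layer[OF layer_part_layer] dl_layer[OF y])
  also have "\<dots> = 2 ^ n * (2 ^ k * gcomm gm ?w y $ i)"
    unfolding gcomm_nat_right[OF yk i] gcomm_nat_left[OF yk i] by simp
  finally have eq: "(2 ^ n - 2) * (2 ^ k * gcomm gm ?w y $ i) = 0" by (simp add: algebra_simps)
  have "(2::real) ^ 2 \<le> 2 ^ n" using step(1) m by (intro power_increasing) auto
  then have 0: "gcomm gm ?w y $ i = 0" using eq by auto
  have "(- ?w) \<odot> x \<in> filt (Suc n)"
    by (rule split_filt[OF step(4) layer_filt[OF layer_part_layer]]) (simp add: layer_part_def)
  then have "gcomm gm ((- ?w) \<odot> x) y $ i = 0" by (rule step(3))
  then show ?case using 0 gcomm_gm_left[OF yk i, of ?w "(- ?w) \<odot> x"] by simp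
qed

text \<open>In these coordinates the commutator is biadditive, so the quotients defining the bracket
  along t = 1/(n + 1) are all equal to the commutator itself.\<close>

lemma gcomm_bracket:
  assumes w: "w \<in> filt k" and i: "\<sigma> i = Suc k"
  shows "gcomm gm v w $ i = lie_bracket gm v w $ i"
proof -
  have lim0: "filterlim (\<lambda>n. 1 / real (Suc n)) (at 0) sequentially"
    unfolding filterlim_at using LIMSEQ_inverse_real_of_nat by (auto simp: inverse_eq_divide)
  have "((\<lambda>n. ((1 / (1 / real (Suc n))^2) *\<^sub>R gcomm gm ((1 / real (Suc n)) *\<^sub>R v) ((1 / real (Suc n)) *\<^sub>R w)) $ i)
      \<longlongrightarrow> lie_bracket gm v w $ i) sequentially"
    by (intro tendsto_vec_nth filterlim_compose[OF bracket_lim lim0])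
  moreover have "((1 / (1 / real (Suc n))^2) *\<^sub>R gcomm gm ((1 / real (Suc n)) *\<^sub>R v) ((1 / real (Suc n)) *\<^sub>R w)) $ i = gcomm gm v w $ i" for n
  proof -
    let ?N = "real (Suc n)"
    have "gcomm gm (?N *\<^sub>R ((1/?N) *\<^sub>R v)) (?N *\<^sub>R ((1/?N) *\<^sub>R w)) $ i = ?N * (?N * gcomm gm ((1/?N) *\<^sub>R v) ((1/?N) *\<^sub>R w) $ i)"
      unfolding gcomm_nat_right[OF filt_scaleR[OF w] i] gcomm_nat_left[OF filt_scaleR[OF w] i] by simp
    then show ?thesis by (simp add: power2_eq_square)
  qed
  ultimately show ?thesis using LIMSEQ_unique[OF tendsto_const] by fastforce
qed

text \<open>The leading terms, in degree k, of the elements of \<open>W \<inter> filt k\<close>; commutators realise brackets on leading terms, so all of \<open>V\<^sub>k\<close> is reached.\<close>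

definition lead_W :: "nat \<Rightarrow> (real^'n) set" where
  "lead_W k = {w \<in> layer \<sigma> k. \<exists>y\<in>W \<inter> filt k. \<forall>i. \<sigma> i = k \<longrightarrow> y $ i = w $ i}"

lemma subspace_layer: "subspace (layer \<sigma> k)" by (simp add: layer_def)

lemma subspace_lead_W: assumes k: "k \<ge> 1" shows "subspace (lead_W k)"
proof (rule subspaceI)
  show "0 \<in> lead_W k" using W_0 subspace_0[OF subspace_layer] by (auto simp: lead_W_def filt_def intro!: bexI[of _ 0])
next
  fix w w' assume "w \<in> lead_W k" "w' \<in> lead_W k"
  then obtain y y' where y: "y \<in> W" "y \<in> filt k" "\<And>i. \<sigma> i = k \<Longrightarrow> y $ i = w $ i" "w \<in> layer \<sigma> k"
    and y': "y' \<in> W" "y' \<in> filt k" "\<And>i. \<sigma> i = k \<Longrightarrow> y' $ i = w' $ i" "w' \<in> layer \<sigma> k" unfolding lead_W_def by blast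
  have "y \<odot> y' \<in> W \<inter> filt k" using y y' W_gm filt_gm by blast
  moreover have "(y \<odot> y') $ i = (w + w') $ i" if "\<sigma> i = k" for i using gm_nth_left[OF y(2), of i y'] y y' that by simp
  ultimately show "w + w' \<in> lead_W k" using y y' subspace_add[OF subspace_layer] unfolding lead_W_def by blast
next
  fix c :: real and w assume "w \<in> lead_W k"
  then obtain y where y: "y \<in> W" "y \<in> filt k" "\<And>i. \<sigma> i = k \<Longrightarrow> y $ i = w $ i" "w \<in> layer \<sigma> k" unfolding lead_W_def by blast
  \<comment> \<open>Dilation by the k-th root of |c| multiplies the coordinates of degree k by |c|;
    the sign comes from inverting y.\<close>
  define z where "z = dl (root k \<bar>c\<bar>) (if c \<ge> 0 then y else - y)"
  have "z \<in> W"
  proof (cases "c = 0")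
    case True
    then show ?thesis using W_0 by (simp add: z_def)
  next
    case False
    then have "root k \<bar>c\<bar> > 0" using k by simp
    then show ?thesis unfolding z_def using y W_dl W_uminus by simp
  qed
  moreover have "z \<in> filt k" unfolding z_def using y filt_dl filt_uminus by simp
  moreover have "z $ i = (c *\<^sub>R w) $ i" if "\<sigma> i = k" for i
    using y(3)[OF that] that k by (simp add: z_def real_root_pow_pos2)
  ultimately show "c *\<^sub>R w \<in> lead_W k" using y subspace_scale[OF subspace_layer] unfolding lead_W_def by blast
qed

lemma lead_W_1: "lead_W 1 = layer \<sigma> 1"
proof -
  have "span {axis i 1 |i. \<sigma> i = Suc 0} \<subseteq> lead_W (Suc 0)"
  proof (rule span_minimal[OF _ subspace_lead_W])
    show "{axis i 1 |i. \<sigma> i = Suc 0} \<subseteq> lead_W (Suc 0)"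
    proof
      fix w :: "real^'n" assume "w \<in> {axis i 1 |i. \<sigma> i = Suc 0}"
      then obtain i where i: "w = axis i 1" "\<sigma> i = 1" by auto
      have "w \<in> W" using W_axis[OF i(2), of 1] i by simp
      moreover have "w \<in> layer \<sigma> 1" using i by (auto simp: layer_iff axis_def)
      ultimately show "w \<in> lead_W (Suc 0)" using layer_filt[of w 1] unfolding lead_W_def by auto
    qed
  qed simp
  then show ?thesis by (auto simp: lead_W_def layer_def)
qed

text \<open>Induction along the stratification: a bracket [v, w] with v in the first layer is the
  leading term of the commutator of words realising v and w, and such brackets span the next
  layer.\<close>

lemma lead_W_eq: "lead_W (Suc k) = layer \<sigma> (Suc k)"
proof (induction k)
  case 0
  show ?case using lead_W_1 by simp
next
  case (Suc k)
  let ?k = "Suc k"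
  have sk: "span {lie_bracket gm v w |v w. v \<in> layer \<sigma> 1 \<and> w \<in> layer \<sigma> ?k} = layer \<sigma> (Suc ?k)"
    by (rule strat) simp
  have "{lie_bracket gm v w |v w. v \<in> layer \<sigma> 1 \<and> w \<in> layer \<sigma> ?k} \<subseteq> lead_W (Suc ?k)"
  proof
    fix b assume "b \<in> {lie_bracket gm v w |v w. v \<in> layer \<sigma> 1 \<and> w \<in> layer \<sigma> ?k}"
    then obtain v w where b: "b = lie_bracket gm v w" and v: "v \<in> layer \<sigma> 1" and w: "w \<in> layer \<sigma> ?k" by blast
    have bl: "b \<in> layer \<sigma> (Suc ?k)" 
      unfolding sk[symmetric] by (rule span_base) (use b v w in blast)
    have "v \<in> lead_W 1" "w \<in> lead_W ?k" using v w lead_W_1 Suc by simp_all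
    then obtain x y where x: "x \<in> W" "\<And>i. \<sigma> i = 1 \<Longrightarrow> x $ i = v $ i"
      and y: "y \<in> W" "y \<in> filt ?k" "\<And>i. \<sigma> i = ?k \<Longrightarrow> y $ i = w $ i" unfolding lead_W_def by blast
    have wk: "w \<in> filt ?k" by (rule layer_filt[OF w])
    have x': "(- v) \<odot> x \<in> filt 2"
      using split_filt[of x 1 v] x(2) filt_1 by (simp add: numeral_2_eq_2)
    have y': "(- w) \<odot> y \<in> filt (Suc ?k)" by (rule split_filt[OF y(2) wk]) (simp add: y(3))
    have y'k: "(- w) \<odot> y \<in> filt ?k" using y' by (simp add: mem_filt_Suc)
    \<comment> \<open>Replacing x by v and y by w drops factors in \<open>filt 2\<close> and
      \<open>filt (Suc ?k)\<close>; both kinds of correction vanish in degree ?k + 1.\<close>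
    have "gcomm gm x y $ i = b $ i" if i: "\<sigma> i = Suc ?k" for i
    proof -
      have z: "gcomm gm u ((- w) \<odot> y) $ i = 0" for u
        using gcomm_filt[OF y', of u] i by (simp add: filt_def)
      have s: "gcomm gm u y $ i = gcomm gm u w $ i" for u
        using gcomm_gm_right[OF wk y'k i, of u] z by simp
      have "gcomm gm x y $ i = gcomm gm v y $ i + gcomm gm ((- v) \<odot> x) y $ i"
        using gcomm_gm_left[OF y(2) i, of v "(- v) \<odot> x"] by simp
      also have "gcomm gm ((- v) \<odot> x) y $ i = 0"
        unfolding s using gcomm_filt2_left[OF _ _ w i _ x'] sigma_topdeg[of i] i by simp
      finally show ?thesis using s[of v] gcomm_bracket[OF wk i, of v] b by simp
    qed
    moreover have "gcomm gm x y \<in> W" unfolding gcomm_def using x y by (intro W_gm W_uminus)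
    ultimately show "b \<in> lead_W (Suc ?k)" using bl gcomm_filt[OF y(2), of x] unfolding lead_W_def by blast
  qed
  then have "span {lie_bracket gm v w |v w. v \<in> layer \<sigma> 1 \<and> w \<in> layer \<sigma> ?k} \<subseteq> lead_W (Suc ?k)"
    by (rule span_minimal[OF _ subspace_lead_W]) simp
  then show ?case unfolding sk by (auto simp: lead_W_def)
qed

text \<open>Leading terms are divided out by words, one layer at a time, until the degrees are
  exhausted.\<close>

lemma filt_in_W: "m \<le> topdeg \<Longrightarrow> 1 \<le> m \<Longrightarrow> x \<in> filt m \<Longrightarrow> x \<in> W"
proof (induction m arbitrary: x rule: inc_induct)
  case base
  then show ?case using filt_top[OF sigma_topdeg] W_0 by metis
next
  case (step n)
  obtain n' where n': "n = Suc n'" using step by (cases n) auto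
  have "layer_part n x \<in> lead_W n" using lead_W_eq[of n'] layer_part_layer n' by simp
  then obtain y where y: "y \<in> W" "y \<in> filt n" "\<And>i. \<sigma> i = n \<Longrightarrow> y $ i = layer_part n x $ i" unfolding lead_W_def by blast
  have "(- y) \<odot> x \<in> filt (Suc n)" by (rule split_filt[OF step(5) y(2)]) (simp add: y(3) layer_part_def)
  then have "(- y) \<odot> x \<in> W" using step by simp
  then show ?case using W_gm[OF _ y(1)] by (metis gm_cancel_left(2))
qed

lemma W_UNIV: "x \<in> W"
  by (rule filt_in_W[of 1]) (auto simp: filt_1 topdeg_def)

lemma hpath_0: "hpath 0 0 0" using hpath_line[of 0] by simp

lemma hpath_ex: "\<exists>l. hpath x y l"
proof -
  have 0: "\<exists>l. hpath 0 z l" for z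
    using W_UNIV[of z]
  proof (induction rule: W.induct)
    case (W_step x i t)
    then obtain l where "hpath 0 x l" by blast
    moreover have "hpath 0 (t *\<^sub>R axis i 1) (norm (t *\<^sub>R axis i 1 :: real^'n))"
      by (rule hpath_line) (use W_step(2) in \<open>auto simp: axis_def\<close>)
    then have "hpath x (x \<odot> (t *\<^sub>R axis i 1)) (norm (t *\<^sub>R axis i 1 :: real^'n))"
      using hpath_left[of 0 _ _ x] by simp
    ultimately show ?case using hpath_trans by blast
  qed (use hpath_0 in blast)
  from 0[of "(- x) \<odot> y"] obtain l where "hpath 0 ((- x) \<odot> y) l" by blast
  from hpath_left[OF this, of x] show ?thesis by auto
qed

section \<open>The Carnot-Caratheodory distance, its norm \<open>Nm\<close> and their
  invariances\<close>

abbreviation rho :: "real^'n \<Rightarrow> real^'n \<Rightarrow> real" where "rho \<equiv> cc_dist gm \<sigma>"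
definition Nm :: "real^'n \<Rightarrow> real" where "Nm x = rho 0 x"

lemma rho_le: "hpath x y l \<Longrightarrow> rho x y \<le> l"
  unfolding cc_dist_hpath by (rule cInf_lower) (auto intro!: bdd_belowI[of _ 0] hpath_nonneg)

lemma rho_nonneg: "0 \<le> rho x y"
  unfolding cc_dist_hpath using hpath_ex by (intro cInf_greatest) (auto intro: hpath_nonneg)

lemma rho_approx: assumes "e > 0" obtains l where "hpath x y l" "l < rho x y + e"
proof -
  have "Inf {l. hpath x y l} < rho x y + e" using assms by (simp add: cc_dist_hpath)
  then show ?thesis using cInf_lessD[of "{l. hpath x y l}"] hpath_ex that by blast
qed

lemma rho_leI: assumes "\<And>l. hpath x y l \<Longrightarrow> c \<le> l" shows "c \<le> rho x y"
  unfolding cc_dist_hpath using hpath_ex assms by (intro cInf_greatest) auto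

lemma rho_left: "rho (a \<odot> x) (a \<odot> y) = rho x y"
proof (rule antisym)
  show "rho (a \<odot> x) (a \<odot> y) \<le> rho x y" by (rule rho_leI) (intro rho_le hpath_left)
  show "rho x y \<le> rho (a \<odot> x) (a \<odot> y)" by (rule rho_leI, rule rho_le) (metis hpath_left gm_cancel_left(1))
qed

lemma rho_sym: "rho x y = rho y x"
  by (rule antisym; rule rho_leI; rule rho_le; erule hpath_sym)

lemma rho_triangle: "rho x z \<le> rho x y + rho y z"
proof (rule field_le_epsilon)
  fix e :: real assume "e > 0"
  then obtain l m where "hpath x y l" "l < rho x y + e/2" "hpath y z m" "m < rho y z + e/2"
    using rho_approx[of "e/2" x y] rho_approx[of "e/2" y z] by (metis half_gt_zero)
  then show "rho x z \<le> rho x y + rho y z + e" using rho_le[OF hpath_trans[of x y l z m]] by linarith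
qed

lemma rho_self [simp]: "rho x x = 0"
proof -
  have "rho 0 0 = 0" using rho_le[OF hpath_0] rho_nonneg[of 0 0] by simp
  then show ?thesis using rho_left[of x 0 0] by simp
qed

lemma rho_dl: assumes "r > 0" shows "rho (dl r x) (dl r y) = r * rho x y"
proof (rule antisym)
  have "rho (dl r x) (dl r y) / r \<le> rho x y"
    by (rule rho_leI) (use rho_le[OF hpath_dl[OF _ assms]] assms in \<open>simp add: pos_divide_le_eq mult.commute\<close>)
  then show "rho (dl r x) (dl r y) \<le> r * rho x y" using assms by (simp add: pos_divide_le_eq mult.commute)
  show "r * rho x y \<le> rho (dl r x) (dl r y)"
  proof (rule rho_leI)
    fix l assume "hpath (dl r x) (dl r y) l"
    from hpath_dl[OF this, of "1/r"] have "hpath x y ((1/r) * l)" using assms by (simp add: dl_inverse)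
    from rho_le[OF this] show "r * rho x y \<le> l" using assms by (simp add: field_simps)
  qed
qed

lemma rho_Nm: "rho x y = Nm ((- x) \<odot> y)"
  unfolding Nm_def using rho_left[of "- x" x y] by simp

lemma Nm_nonneg [simp]: "0 \<le> Nm x" by (simp add: Nm_def rho_nonneg)
lemma Nm_0 [simp]: "Nm 0 = 0" by (simp add: Nm_def)
lemma Nm_uminus [simp]: "Nm (- x) = Nm x" using rho_left[of x 0 "- x"] by (simp add: Nm_def rho_sym)
lemma Nm_gm: "Nm (x \<odot> y) \<le> Nm x + Nm y"
  using rho_triangle[of 0 "x \<odot> y" x] rho_left[of x 0 y] by (simp add: Nm_def)
lemma Nm_dl: "r \<ge> 0 \<Longrightarrow> Nm (dl r x) = r * Nm x"
  using rho_dl[of r 0 x] by (cases "r = 0") (auto simp: Nm_def)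
lemma rho_gm_right: "rho x (x \<odot> y) = Nm y" by (simp add: rho_Nm)

lemma Nm_horiz: "(\<And>i. \<sigma> i \<noteq> 1 \<Longrightarrow> v $ i = 0) \<Longrightarrow> Nm v \<le> norm v"
  unfolding Nm_def by (intro rho_le hpath_line)

section \<open>Ball-box comparison with the Euclidean norm\<close>

lemma Nm_box: obtains c where "c > 0" "\<And>x r. r > 0 \<Longrightarrow> Nm x < c * r \<Longrightarrow> norm (dl (1/r) x) < 1"
proof -
  obtain c where c: "c > 0" "\<And>x l. hpath 0 x l \<Longrightarrow> l < c \<Longrightarrow> norm x < 1" using hpath_box by blast
  have 1: "norm x < 1" if "Nm x < c" for x
    using rho_approx[of "c - Nm x" 0 x] that c(2) unfolding Nm_def by fastforce
  have "norm (dl (1/r) x) < 1" if "r > 0" "Nm x < c * r" for x r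
    by (rule 1) (use that in \<open>simp add: Nm_dl field_simps\<close>)
  then show ?thesis using that c(1) by blast
qed

lemma Nm_imp_coord: obtains K where "K > 0" "\<And>x r i. 0 \<le> r \<Longrightarrow> Nm x \<le> r \<Longrightarrow> \<bar>x $ i\<bar> \<le> (K * r) ^ \<sigma> i"
proof -
  obtain c where c: "c > 0" "\<And>x r. r > 0 \<Longrightarrow> Nm x < c * r \<Longrightarrow> norm (dl (1/r) x) < 1" using Nm_box by blast
  have pos: "\<bar>x $ i\<bar> \<le> r ^ \<sigma> i" if "r > 0" "Nm x < c * r" for x r i
  proof -
    have "\<bar>dl (1/r) x $ i\<bar> < 1" using c(2)[OF that] component_le_norm_cart[of "dl (1/r) x" i] by linarith
    then show ?thesis using that(1) by (simp add: abs_mult power_one_over field_simps)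
  qed
  have "\<bar>x $ i\<bar> \<le> (2/c * r) ^ \<sigma> i" if "0 \<le> r" "Nm x \<le> r" for x r i
  proof (cases "r = 0")
    case False
    then show ?thesis using that c(1) by (intro pos) auto
  next
    case True
    then have N0: "Nm x = 0" using that by (simp add: antisym)
    have "\<bar>x $ i\<bar> \<le> e" if "e > 0" for e
    proof -
      have "\<bar>x $ i\<bar> \<le> (min 1 e) ^ \<sigma> i" using that N0 c(1) by (intro pos) auto
      also have "\<dots> \<le> (min 1 e) ^ 1" using that sigma_ge1[of i] by (intro power_decreasing) auto
      finally show ?thesis by simp
    qed
    then have "x $ i = 0" using field_le_epsilon[of "\<bar>x $ i\<bar>" 0] by simp
    then show ?thesis using True by simp
  qed
  then show ?thesis using that[of "2/c"] c(1) by simp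
qed

lemma Nm_bounded_imp_bounded: obtains R where "R > 0" "\<And>x. Nm x \<le> r \<Longrightarrow> norm x \<le> R"
proof -
  obtain K where K: "K > 0" "\<And>x r i. 0 \<le> r \<Longrightarrow> Nm x \<le> r \<Longrightarrow> \<bar>x $ i\<bar> \<le> (K * r) ^ \<sigma> i" using Nm_imp_coord by blast
  have "norm x \<le> \<bar>\<Sum>i\<in>UNIV. (K * r) ^ \<sigma> i\<bar> + 1" if "Nm x \<le> r" for x
  proof -
    have r: "0 \<le> r" using that Nm_nonneg[of x] by linarith
    have "norm x \<le> (\<Sum>i\<in>UNIV. \<bar>x $ i\<bar>)" by (rule norm_le_l1_cart)
    also have "\<dots> \<le> (\<Sum>i\<in>UNIV. (K * r) ^ \<sigma> i)" by (intro sum_mono K(2)[OF r that])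
    finally show ?thesis by linarith
  qed
  then show ?thesis using that[of "\<bar>\<Sum>i\<in>UNIV. (K * r) ^ \<sigma> i\<bar> + 1"] by simp
qed

lemma Nm_small_imp_small: assumes "e > 0" obtains d where "d > 0" "\<And>x. Nm x < d \<Longrightarrow> norm x < e"
proof -
  obtain c where c: "c > 0" "\<And>x r. r > 0 \<Longrightarrow> Nm x < c * r \<Longrightarrow> norm (dl (1/r) x) < 1" using Nm_box by blast
  define r where "r = min 1 e"
  have r: "r > 0" "r \<le> 1" "r \<le> e" using assms by (auto simp: r_def)
  have "norm x < e" if "Nm x < c * r" for x
  proof -
    have "norm x = norm (dl r (dl (1/r) x))" using r by (simp add: dl_inverse)
    also have "\<dots> \<le> r * norm (dl (1/r) x)" using r by (intro norm_dl_le) auto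
    also have "\<dots> < r * 1" using r c(2)[OF r(1) that] by (intro mult_strict_left_mono) auto
    finally show ?thesis using r by simp
  qed
  then show ?thesis using that[of "c * r"] c(1) r(1) by simp
qed

text \<open>The coordinates of degree k are prescribed one by one, each by a dilate of a fixed p in
  \<open>filt k\<close> whose leading term is the basis vector. As |x_j| \<le> 1, the dilation
  factor is at most 1 and the distance bound is uniform.\<close>

lemma filt_Nm_layer:
  assumes k: "k \<ge> 1" and "finite I" "I \<subseteq> {i. \<sigma> i = k}"
  shows "\<exists>C. \<forall>x. norm x \<le> 1 \<longrightarrow> (\<exists>y\<in>filt k. Nm y \<le> C \<and> (\<forall>i. \<sigma> i = k \<longrightarrow> y $ i = (if i \<in> I then x $ i else 0)))"
  using assms(2,3)
proof (induction I rule: finite_induct)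
  case empty
  show ?case by (intro exI[of _ 0] allI impI bexI[of _ 0]) (auto simp: filt_def)
next
  case (insert j I)
  then obtain C where C: "\<And>x. norm x \<le> 1 \<Longrightarrow> \<exists>y\<in>filt k. Nm y \<le> C \<and> (\<forall>i. \<sigma> i = k \<longrightarrow> y $ i = (if i \<in> I then x $ i else 0))" by auto
  have j: "\<sigma> j = k" using insert by auto
  obtain k' where k': "k = Suc k'" using k by (cases k) auto
  have "axis j 1 \<in> lead_W k" using j lead_W_eq[of k'] k' by (auto simp: layer_iff axis_def)
  then obtain p where p: "p \<in> filt k" "\<And>i. \<sigma> i = k \<Longrightarrow> p $ i = axis j 1 $ i" unfolding lead_W_def by blast
  show ?case
  proof (intro exI[of _ "C + Nm p"] allI impI)
    fix x :: "real^'n" assume x: "norm x \<le> 1"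
    obtain y where y: "y \<in> filt k" "Nm y \<le> C" "\<And>i. \<sigma> i = k \<Longrightarrow> y $ i = (if i \<in> I then x $ i else 0)" using C[OF x] by blast
    define q where "q = dl (root k \<bar>x $ j\<bar>) (if x $ j \<ge> 0 then p else - p)"
    have xj: "\<bar>x $ j\<bar> \<le> 1" using x component_le_norm_cart[of x j] by linarith
    have q: "q \<in> filt k" unfolding q_def using p filt_dl filt_uminus by simp
    have "root k \<bar>x $ j\<bar> \<le> 1" using k xj by simp
    then have "Nm q \<le> Nm p" unfolding q_def using k by (simp add: Nm_dl mult_left_le_one_le)
    moreover have "q $ i = (if i = j then x $ j else 0)" if "\<sigma> i = k" for i
      using p(2)[OF that] k that by (auto simp: q_def real_root_pow_pos2 axis_def)
    ultimately show "\<exists>y\<in>filt k. Nm y \<le> C + Nm p \<and> (\<forall>i. \<sigma> i = k \<longrightarrow> y $ i = (if i \<in> insert j I then x $ i else 0))"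
      using y q filt_gm[OF y(1) q] gm_nth_left[OF y(1), of _ q] Nm_gm[of y q] insert(2)
      by (intro bexI[of _ "y \<odot> q"]) auto
  qed
qed

text \<open>Downward induction. Dividing x by an element y with the same leading coordinates leaves
  a remainder in the next step of the filtration; compactness bounds its norm by R, and the dilation
  by 1/R' brings it into the unit ball at the price of a factor R' in the distance.\<close>

lemma Nm_filt_bounded: "m \<le> topdeg \<Longrightarrow> 1 \<le> m \<Longrightarrow> \<exists>C. \<forall>x\<in>filt m. norm x \<le> 1 \<longrightarrow> Nm x \<le> C"
proof (induction m rule: inc_induct)
  case base
  then show ?case using filt_top[OF sigma_topdeg] by (metis Nm_0 order_refl)
next
  case (step n)
  then obtain C2 where C2: "\<And>x. x \<in> filt (Suc n) \<Longrightarrow> norm x \<le> 1 \<Longrightarrow> Nm x \<le> C2" by auto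
  obtain C1 where C1: "\<And>x. norm x \<le> 1 \<Longrightarrow> \<exists>y\<in>filt n. Nm y \<le> C1 \<and> (\<forall>i. \<sigma> i = n \<longrightarrow> y $ i = x $ i)"
    using filt_Nm_layer[of n "{i. \<sigma> i = n}"] step by auto
  obtain R1 where R1: "R1 > 0" "\<And>x. Nm x \<le> C1 \<Longrightarrow> norm x \<le> R1" using Nm_bounded_imp_bounded[of C1] by blast
  have "bounded ((\<lambda>z. fst z \<odot> snd z) ` (cball 0 R1 \<times> cball 0 1))"
    by (intro compact_imp_bounded compact_continuous_image compact_Times) (auto intro!: continuous_intros)
  then obtain R where R: "R > 0" "\<And>y x. norm y \<le> R1 \<Longrightarrow> norm x \<le> 1 \<Longrightarrow> norm (y \<odot> x) \<le> R" by (force simp: bounded_pos)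
  define R' where "R' = max 1 R"
  have R': "R' \<ge> 1" "R' \<ge> R" "R' > 0" by (auto simp: R'_def)
  have "Nm x \<le> C1 + R' * C2" if x: "x \<in> filt n" "norm x \<le> 1" for x
  proof -
    obtain y where y: "y \<in> filt n" "Nm y \<le> C1" "\<And>i. \<sigma> i = n \<Longrightarrow> y $ i = x $ i" using C1[OF x(2)] by blast
    let ?z = "(- y) \<odot> x"
    have z: "?z \<in> filt (Suc n)" by (rule split_filt[OF x(1) y(1) y(3)])
    have nz: "norm ?z \<le> R" using R1(2)[OF y(2)] x(2) by (intro R) auto
    have "norm (dl (1/R') ?z) \<le> (1/R') * norm ?z" using R' by (intro norm_dl_le) auto
    also have "\<dots> \<le> 1" using nz R' by (simp add: field_simps)
    finally have "Nm (dl (1/R') ?z) \<le> C2" using C2 filt_dl[OF z] by blast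
    then have "Nm ?z \<le> R' * C2" using R' by (simp add: Nm_dl field_simps)
    moreover have "Nm x \<le> Nm y + Nm ?z" using Nm_gm[of y ?z] by simp
    ultimately show ?thesis using y(2) by linarith
  qed
  then show ?case by blast
qed

lemma Nm_bounded_unit: obtains C where "C > 0" "\<And>x. norm x \<le> 1 \<Longrightarrow> Nm x \<le> C"
proof -
  obtain C where "\<forall>x\<in>filt 1. norm x \<le> 1 \<longrightarrow> Nm x \<le> C" using Nm_filt_bounded[of 1] by (auto simp: topdeg_def)
  then have "\<And>x. norm x \<le> 1 \<Longrightarrow> Nm x \<le> max C 1" using filt_1 by (meson max.coboundedI1)
  then show ?thesis using that[of "max C 1"] by simp
qed

lemma small_imp_Nm_small: assumes "e > 0" obtains d where "d > 0" "\<And>x. norm x < d \<Longrightarrow> Nm x < e"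
proof -
  obtain C where C: "C > 0" "\<And>x. norm x \<le> 1 \<Longrightarrow> Nm x \<le> C" using Nm_bounded_unit by blast
  \<comment> \<open>The dilation by 1/s enlarges coordinates at most by the factor 1/s^topdeg, so a
    point of norm below s^topdeg is carried into the unit ball, where \<open>Nm\<close> is at most
    C; scaling back gives s C < e.\<close>
  define s where "s = min 1 (e / (2 * C))"
  have s: "s > 0" "s \<le> 1" "s * C < e" using assms C(1) by (auto simp: s_def min_def field_simps)
  have "Nm x < e" if x: "norm x < s ^ topdeg" for x
  proof -
    have "norm (dl (1/s) x) \<le> norm ((1 / s ^ topdeg) *\<^sub>R x)"
    proof (rule norm_le_componentwise_cart)
      fix i
      have "s ^ topdeg \<le> s ^ \<sigma> i" using s sigma_topdeg[of i] by (intro power_decreasing) auto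
      then have "(1/s) ^ \<sigma> i \<le> 1 / s ^ topdeg" using s by (simp add: power_one_over frac_le)
      then show "norm (dl (1/s) x $ i) \<le> norm (((1 / s ^ topdeg) *\<^sub>R x) $ i)"
        using s by (simp add: abs_mult mult_right_mono del: power_one_over times_divide_eq_left)
    qed
    also have "\<dots> \<le> 1" using x s by (simp add: field_simps)
    finally have "Nm (dl (1/s) x) \<le> C" by (rule C(2))
    then have "Nm x \<le> s * C" using s by (simp add: Nm_dl field_simps)
    then show ?thesis using s by linarith
  qed
  then show ?thesis using that[of "s ^ topdeg"] s by simp
qed

section \<open>The distance induces the Euclidean topology\<close>

lemma Nm_diff: "\<bar>Nm x - Nm y\<bar> \<le> Nm ((- x) \<odot> y)"
  using Nm_gm[of x "(- x) \<odot> y"] Nm_gm[of y "- ((- x) \<odot> y)"] Nm_uminus[of "(- x) \<odot> y"] by (simp add: gm_uminus)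

lemma Nm_tendsto: assumes "(f \<longlongrightarrow> a) F" shows "((\<lambda>x. Nm (f x)) \<longlongrightarrow> Nm a) F"
proof (rule tendstoI)
  fix e :: real assume e: "e > 0"
  obtain d where d: "d > 0" "\<And>x. norm x < d \<Longrightarrow> Nm x < e" using small_imp_Nm_small[OF e] by blast
  have "((\<lambda>x. (- f x) \<odot> a) \<longlongrightarrow> (- a) \<odot> a) F" by (intro tendsto_intros assms)
  then have "eventually (\<lambda>x. dist ((- f x) \<odot> a) 0 < d) F" using d(1) by (auto dest: tendstoD)
  then show "eventually (\<lambda>x. dist (Nm (f x)) (Nm a) < e) F"
  proof (rule eventually_mono)
    fix x assume "dist ((- f x) \<odot> a) 0 < d"
    then show "dist (Nm (f x)) (Nm a) < e" using d(2)[of "(- f x) \<odot> a"] Nm_diff[of "f x" a] by (simp add: dist_real_def)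
  qed
qed

lemma rho_tendsto [tendsto_intros]:
  "(f \<longlongrightarrow> a) F \<Longrightarrow> (g \<longlongrightarrow> b) F \<Longrightarrow> ((\<lambda>x. rho (f x) (g x)) \<longlongrightarrow> rho a b) F"
  unfolding rho_Nm by (intro Nm_tendsto tendsto_intros)

lemma continuous_rho [continuous_intros]:
  "continuous_on S f \<Longrightarrow> continuous_on S g \<Longrightarrow> continuous_on S (\<lambda>x. rho (f x) (g x))"
  unfolding continuous_on_def by (auto intro: rho_tendsto)

lemma rho_tendsto_0_imp: assumes "((\<lambda>i. rho (f i) a) \<longlongrightarrow> 0) F" shows "(f \<longlongrightarrow> a) F"
proof -
  have "((\<lambda>i. (- a) \<odot> f i) \<longlongrightarrow> 0) F"
  proof (rule tendstoI)
    fix e :: real assume e: "e > 0"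
    obtain d where d: "d > 0" "\<And>x. Nm x < d \<Longrightarrow> norm x < e" using Nm_small_imp_small[OF e] by blast
    show "eventually (\<lambda>i. dist ((- a) \<odot> f i) 0 < e) F"
      using tendstoD[OF assms d(1)] by (rule eventually_mono) (use d(2) in \<open>auto simp: rho_Nm[symmetric] rho_sym[of a] rho_nonneg\<close>)
  qed
  then have "((\<lambda>i. a \<odot> ((- a) \<odot> f i)) \<longlongrightarrow> a \<odot> 0) F" by (intro tendsto_intros)
  then show ?thesis by simp
qed

lemma rho_eq_0: "rho x y = 0 \<longleftrightarrow> x = y"
proof
  assume "rho x y = 0"
  then have "((\<lambda>i::nat. x) \<longlongrightarrow> y) sequentially" by (intro rho_tendsto_0_imp) simp
  then show "x = y" using LIMSEQ_unique tendsto_const by blast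
qed simp

lemma open_rho_ball: "open {y. rho x y < r}"
  by (intro open_Collect_less continuous_intros)

lemma closed_rho_cball: "closed {y. rho x y \<le> r}"
  by (intro closed_Collect_le continuous_intros)

lemma compact_rho_cball: "compact {y. rho x y \<le> r}"
proof -
  obtain R where "R > 0" "\<And>x. Nm x \<le> r \<Longrightarrow> norm x \<le> R" using Nm_bounded_imp_bounded[of r] by blast
  then have b: "{y. rho 0 y \<le> r} \<subseteq> cball 0 R" by (auto simp: Nm_def)
  have "compact {y. rho 0 y \<le> r}"
    using closed_rho_cball bounded_subset[OF bounded_cball b] by (simp add: compact_eq_bounded_closed)
  then have "compact ((\<lambda>y. x \<odot> y) ` {y. rho 0 y \<le> r})" by (intro compact_continuous_image continuous_intros)
  moreover have "(\<lambda>y. x \<odot> y) ` {y. rho 0 y \<le> r} = {y. rho x y \<le> r}"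
  proof (intro set_eqI iffI)
    fix y assume "y \<in> {y. rho x y \<le> r}"
    then show "y \<in> (\<lambda>y. x \<odot> y) ` {y. rho 0 y \<le> r}"
      by (intro image_eqI[of _ _ "(- x) \<odot> y"]) (auto simp: rho_Nm)
  qed (auto simp: rho_Nm)
  ultimately show ?thesis by simp
qed

end

section \<open>Vitali coverings by metric balls\<close>

context carnot begin

definition cB :: "real^'n \<Rightarrow> real \<Rightarrow> (real^'n) set" where "cB x r = {y. rho x y \<le> r}"

lemma compact_cB: "compact (cB x r)" unfolding cB_def by (rule compact_rho_cball)
lemma borel_cB [measurable]: "cB x r \<in> sets borel" using compact_cB borel_compact by blast

lemma open_contains_cB: assumes "open U" "x \<in> U" obtains s where "s > 0" "cB x s \<subseteq> U"
proof -
  have "open ((\<lambda>y. x \<odot> y) -` U)" by (rule open_vimage[OF assms(1)]) (intro continuous_intros)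
  moreover have "0 \<in> (\<lambda>y. x \<odot> y) -` U" using assms by simp
  ultimately obtain e where e: "e > 0" "ball 0 e \<subseteq> (\<lambda>y. x \<odot> y) -` U" by (meson open_contains_ball)
  obtain d where d: "d > 0" "\<And>x. Nm x < d \<Longrightarrow> norm x < e" using Nm_small_imp_small[OF e(1)] by blast
  have "cB x (d/2) \<subseteq> U"
  proof
    fix y assume "y \<in> cB x (d/2)"
    then have "Nm ((- x) \<odot> y) < d" using d(1) by (simp add: cB_def rho_Nm)
    then have "(- x) \<odot> y \<in> ball 0 e" using d(2) by simp
    then have "x \<odot> ((- x) \<odot> y) \<in> U" using e(2) by blast
    then show "y \<in> U" by simp
  qed
  then show ?thesis using that[of "d/2"] d(1) by simp
qed

definition om :: real where "om = measure lborel (cB 0 1)"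

lemma emeasure_cB: assumes "r > 0" shows "emeasure lborel (cB x r) = ennreal (r ^ nu * om)"
proof -
  have "emeasure lborel (cB x r) = (\<integral>\<^sup>+z. indicator (cB x r) (x \<odot> z) \<partial>lborel)"
    by (subst nn_integral_left_translate) auto
  also have "\<dots> = (\<integral>\<^sup>+z. indicator (cB 0 r) z \<partial>lborel)"
    by (rule nn_integral_cong) (auto simp: cB_def rho_Nm indicator_def)
  also have "\<dots> = ennreal (r ^ nu) * (\<integral>\<^sup>+z. indicator (cB 0 r) (dl r z) \<partial>lborel)"
    by (subst nn_integral_dl) (use assms in auto)
  also have "(\<integral>\<^sup>+z. indicator (cB 0 r) (dl r z) \<partial>lborel) = (\<integral>\<^sup>+z. indicator (cB 0 1) z \<partial>lborel)"
    by (rule nn_integral_cong) (use assms in \<open>auto simp: cB_def rho_Nm Nm_dl indicator_def mult_le_cancel_left1\<close>)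
  also have "\<dots> = ennreal om"
    unfolding om_def using emeasure_compact_finite[OF compact_cB] by (simp add: emeasure_eq_ennreal_measure less_top[symmetric])
  finally show ?thesis using assms by (simp add: ennreal_mult')
qed

lemma om_pos: "om > 0"
proof -
  have "open {y. rho 0 y < 1}" "0 \<in> {y. rho 0 y < 1}" using open_rho_ball by auto
  then have "\<not> negligible {y. rho 0 y < 1}" using open_not_negligible by blast
  moreover have "{y. rho 0 y < 1} \<subseteq> cB 0 1" by (auto simp: cB_def)
  ultimately have "\<not> negligible (cB 0 1)" using negligible_subset by blast
  then have "emeasure lborel (cB 0 1) \<noteq> 0" by (auto simp: negligible_iff_null_sets null_sets_def)
  then show ?thesis using emeasure_cB[of 1 0] by (auto simp: ennreal_eq_0_iff)
qed

lemma measure_cB: "r > 0 \<Longrightarrow> measure lborel (cB x r) = r ^ nu * om"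
  using emeasure_cB[of r x] om_pos by (simp add: measure_def)

lemma cB_lmeasurable: "cB x r \<in> lmeasurable" using compact_cB by (rule lmeasurable_compact)

text \<open>Zorn's lemma is applied to the disjoint subfamilies C such that every ball of K meeting
  C meets a member of at least half its radius. A maximal one meets every ball: otherwise a ball of
  radius above half the supremum of the remaining radii could be added.\<close>

lemma vitali_5r:
  fixes K :: "((real^'n) \<times> real) set"
  assumes K: "\<And>x r. (x,r) \<in> K \<Longrightarrow> 0 < r \<and> r \<le> R"
  shows "\<exists>C\<subseteq>K. (\<forall>c\<in>C. \<forall>c'\<in>C. c \<noteq> c' \<longrightarrow> case_prod cB c \<inter> case_prod cB c' = {}) \<and>
    (\<forall>k\<in>K. \<exists>c\<in>C. case_prod cB k \<inter> case_prod cB c \<noteq> {} \<and> snd k \<le> 2 * snd c)"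
proof -
  define meets where "meets k c \<longleftrightarrow> case_prod cB k \<inter> case_prod cB c \<noteq> {}" for k c
  have meets_sym: "meets a b \<longleftrightarrow> meets b a" for a b unfolding meets_def by (simp add: Int_commute)
  define \<A> where "\<A> = {C. C \<subseteq> K \<and> (\<forall>c\<in>C. \<forall>c'\<in>C. c \<noteq> c' \<longrightarrow> \<not> meets c c') \<and>
     (\<forall>k\<in>K. (\<exists>c\<in>C. meets k c) \<longrightarrow> (\<exists>c\<in>C. meets k c \<and> snd k \<le> 2 * snd c))}"
  have "\<exists>M\<in>\<A>. \<forall>X\<in>\<A>. M \<subseteq> X \<longrightarrow> X = M"
  proof (rule subset_Zorn_nonempty)
    show "\<A> \<noteq> {}" unfolding \<A>_def by (intro notI) (drule equals0D[of _ "{}"], simp)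
    fix \<C> assume ne: "\<C> \<noteq> {}" and ch: "subset.chain \<A> \<C>"
    have sub: "\<C> \<subseteq> \<A>" and lin: "\<And>X Y. X \<in> \<C> \<Longrightarrow> Y \<in> \<C> \<Longrightarrow> X \<subseteq> Y \<or> Y \<subseteq> X"
      using ch unfolding subset.chain_def by blast+
    have 1: "\<Union>\<C> \<subseteq> K" using sub unfolding \<A>_def by blast
    have 2: "\<not> meets c c'" if c: "c \<in> \<Union>\<C>" "c' \<in> \<Union>\<C>" "c \<noteq> c'" for c c'
    proof -
      obtain X Y where XY: "X \<in> \<C>" "Y \<in> \<C>" "c \<in> X" "c' \<in> Y" using c by blast
      then obtain Z where "Z \<in> \<C>" "c \<in> Z" "c' \<in> Z" using lin[of X Y] by blast
      then show ?thesis using sub c(3) unfolding \<A>_def by blast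
    qed
    have 3: "\<exists>c\<in>\<Union>\<C>. meets k c \<and> snd k \<le> 2 * snd c" if k: "k \<in> K" "c \<in> \<Union>\<C>" "meets k c" for k c
    proof -
      obtain X where X: "X \<in> \<C>" "c \<in> X" using k by blast
      then have "X \<in> \<A>" using sub by blast
      then have "\<exists>c\<in>X. meets k c \<and> snd k \<le> 2 * snd c" using k X(2) unfolding \<A>_def by blast
      then show ?thesis using X(1) by blast
    qed
    show "\<Union>\<C> \<in> \<A>" unfolding \<A>_def using 1 2 3 by blast
  qed
  then obtain M where M: "M \<in> \<A>" "\<And>X. X \<in> \<A> \<Longrightarrow> M \<subseteq> X \<Longrightarrow> X = M" by blast
  have MK: "M \<subseteq> K" and Md: "\<And>c c'. c \<in> M \<Longrightarrow> c' \<in> M \<Longrightarrow> c \<noteq> c' \<Longrightarrow> \<not> meets c c'"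
    and Mm: "\<And>k c. k \<in> K \<Longrightarrow> c \<in> M \<Longrightarrow> meets k c \<Longrightarrow> \<exists>c\<in>M. meets k c \<and> snd k \<le> 2 * snd c"
    using M(1) unfolding \<A>_def by blast+
  have self: "meets k k" if "k \<in> K" for k
    using that K[of "fst k" "snd k"] unfolding meets_def by (cases k) (auto simp: cB_def intro!: exI[of _ "fst k"])
  have all: "\<exists>c\<in>M. meets k c" if k: "k \<in> K" for k
  proof (rule ccontr)
    assume no: "\<not> (\<exists>c\<in>M. meets k c)"
    define K' where "K' = {k \<in> K. \<forall>c\<in>M. \<not> meets k c}"
    have kK': "k \<in> K'" using k no unfolding K'_def by blast
    have bdd: "bdd_above (snd ` K')" using K unfolding K'_def by (intro bdd_aboveI[of _ R]) auto
    have "snd k > 0" using K[of "fst k" "snd k"] k by simp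
    moreover have "snd k \<le> Sup (snd ` K')" by (rule cSup_upper[OF _ bdd]) (use kK' in blast)
    ultimately have "Sup (snd ` K') / 2 < Sup (snd ` K')" by simp
    then obtain k0 where k0: "k0 \<in> K'" "Sup (snd ` K') / 2 < snd k0"
      using less_cSup_iff[of "snd ` K'"] bdd kK' by blast
    have big: "snd k' \<le> 2 * snd k0" if "k' \<in> K'" for k'
      using cSup_upper[OF imageI[OF that, of snd] bdd] k0(2) by simp
    have "insert k0 M \<in> \<A>" unfolding \<A>_def
    proof (intro CollectI conjI ballI impI)
      show "insert k0 M \<subseteq> K" using MK k0 unfolding K'_def by blast
      show "\<not> meets c c'" if "c \<in> insert k0 M" "c' \<in> insert k0 M" "c \<noteq> c'" for c c'
        using that k0(1) Md meets_sym unfolding K'_def by blast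
      fix k' assume k': "k' \<in> K" "\<exists>c\<in>insert k0 M. meets k' c"
      show "\<exists>c\<in>insert k0 M. meets k' c \<and> snd k' \<le> 2 * snd c"
      proof (cases "\<exists>c\<in>M. meets k' c")
        case True
        then show ?thesis using Mm[OF k'(1)] by blast
      next
        case False
        then have "k' \<in> K'" "meets k' k0" using k' unfolding K'_def by blast+
        then show ?thesis using big by blast
      qed
    qed
    then have "insert k0 M = M" using M(2)[of "insert k0 M"] by blast
    then have "k0 \<in> M" by blast
    then show False using k0(1) self[of k0] unfolding K'_def by blast
  qed
  have "case_prod cB c \<inter> case_prod cB c' = {}" if "c \<in> M" "c' \<in> M" "c \<noteq> c'" for c c'
    using Md[OF that] unfolding meets_def by blast
  moreover have "\<exists>c\<in>M. case_prod cB k \<inter> case_prod cB c \<noteq> {} \<and> snd k \<le> 2 * snd c" if k: "k \<in> K" for k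
    using all[OF k] Mm[OF k] unfolding meets_def by (metis (lifting))
  ultimately show ?thesis using MK by (intro exI[of _ M]) blast
qed

text \<open>Only centres have to be caught, so the factor is 3 instead of the usual 5.\<close>

lemma vitali_enlarge:
  assumes "case_prod cB k \<inter> case_prod cB c \<noteq> {}" "snd k \<le> 2 * snd c"
  shows "fst k \<in> cB (fst c) (3 * snd c)"
proof -
  obtain y where "rho (fst k) y \<le> snd k" "rho (fst c) y \<le> snd c"
    using assms(1) by (cases k; cases c) (auto simp: cB_def)
  then show ?thesis using rho_triangle[of "fst c" "fst k" y] assms(2) by (simp add: cB_def rho_sym)
qed

lemma disjoint_cB_sum_le:
  assumes "U \<in> lmeasurable" "finite F" "\<And>c. c \<in> F \<Longrightarrow> snd c > 0 \<and> case_prod cB c \<subseteq> U"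
    "\<And>c c'. c \<in> F \<Longrightarrow> c' \<in> F \<Longrightarrow> c \<noteq> c' \<Longrightarrow> case_prod cB c \<inter> case_prod cB c' = {}"
  shows "(\<Sum>c\<in>F. snd c ^ nu * om) \<le> measure lebesgue U"
proof -
  have "(\<Sum>c\<in>F. snd c ^ nu * om) = (\<Sum>c\<in>F. measure lebesgue (case_prod cB c))"
    using assms(3) by (intro sum.cong) (auto simp: measure_cB case_prod_beta)
  also have "\<dots> = measure lebesgue (\<Union>c\<in>F. case_prod cB c)"
    by (rule measure_finite_Union[symmetric])
      (use assms cB_lmeasurable in \<open>auto simp: disjoint_family_on_def case_prod_beta fmeasurable_def less_top[symmetric]\<close>)
  also have "\<dots> \<le> measure lebesgue U"
    by (rule measure_mono_fmeasurable) (use assms cB_lmeasurable in \<open>auto simp: case_prod_beta intro!: sets.finite_UN\<close>)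
  finally show ?thesis .
qed

lemma disjoint_cB_summable:
  assumes "U \<in> lmeasurable" "\<And>c. c \<in> C \<Longrightarrow> snd c > 0 \<and> case_prod cB c \<subseteq> U"
    "\<And>c c'. c \<in> C \<Longrightarrow> c' \<in> C \<Longrightarrow> c \<noteq> c' \<Longrightarrow> case_prod cB c \<inter> case_prod cB c' = {}"
  shows "(\<lambda>c. snd c ^ nu * om) summable_on C" "countable C"
proof -
  show s: "(\<lambda>c. snd c ^ nu * om) summable_on C"
  proof (rule nonneg_bdd_above_summable_on)
    show "0 \<le> snd c ^ nu * om" if "c \<in> C" for c using assms(2)[OF that] om_pos by simp
    show "bdd_above (sum (\<lambda>c. snd c ^ nu * om) ` {F. F \<subseteq> C \<and> finite F})"
    proof (rule bdd_aboveI2)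
      fix F assume "F \<in> {F. F \<subseteq> C \<and> finite F}"
      then show "(\<Sum>c\<in>F. snd c ^ nu * om) \<le> measure lebesgue U"
        by (intro disjoint_cB_sum_le assms) (use assms in auto)
    qed
  qed
  have "countable {c \<in> C. snd c ^ nu * om \<noteq> 0}" by (rule summable_countable_real[OF s])
  moreover have "{c \<in> C. snd c ^ nu * om \<noteq> 0} = C" using assms(2) om_pos by force
  ultimately show "countable C" by simp
qed

text \<open>All but a finite part F of the disjoint family has small total volume. A point outside
  the family has positive distance from F, so a small ball around it meets a member beyond F, and
  the point lies in the threefold enlargement of that member. The enlargements have total measure at
  most e.\<close>

lemma vitali_cover:
  assumes U: "U \<in> lmeasurable" and K: "\<And>x r. (x,r) \<in> K \<Longrightarrow> 0 < r \<and> cB x r \<subseteq> U"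
    and fine: "\<And>x d. x \<in> Z \<Longrightarrow> d > 0 \<Longrightarrow> \<exists>r. (x,r) \<in> K \<and> r < d"
  shows "\<exists>C\<subseteq>K. countable C \<and> (\<forall>c\<in>C. \<forall>c'\<in>C. c \<noteq> c' \<longrightarrow> case_prod cB c \<inter> case_prod cB c' = {}) \<and>
    negligible (Z - (\<Union>c\<in>C. case_prod cB c))"
proof -
  let ?K = "{k \<in> K. snd k \<le> 1}"
  have K1: "0 < r \<and> r \<le> 1" if "(x,r) \<in> ?K" for x r using K that by auto
  have "\<exists>C\<subseteq>?K. (\<forall>c\<in>C. \<forall>c'\<in>C. c \<noteq> c' \<longrightarrow> case_prod cB c \<inter> case_prod cB c' = {}) \<and>
    (\<forall>k\<in>?K. \<exists>c\<in>C. case_prod cB k \<inter> case_prod cB c \<noteq> {} \<and> snd k \<le> 2 * snd c)"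
    by (rule vitali_5r[of ?K 1], rule K1)
  then obtain C where C0: "C \<subseteq> ?K" "\<forall>c\<in>C. \<forall>c'\<in>C. c \<noteq> c' \<longrightarrow> case_prod cB c \<inter> case_prod cB c' = {}"
    "\<forall>k\<in>?K. \<exists>c\<in>C. case_prod cB k \<inter> case_prod cB c \<noteq> {} \<and> snd k \<le> 2 * snd c"
    by blast
  note C = C0(1) C0(2)[rule_format] C0(3)[rule_format]
  have CU: "snd c > 0 \<and> case_prod cB c \<subseteq> U" if "c \<in> C" for c
    using C(1) K[of "fst c" "snd c"] that by (auto simp: case_prod_beta)
  note sm = disjoint_cB_summable[OF U CU C(2)]
  let ?f = "\<lambda>c::(real^'n) \<times> real. snd c ^ nu * om"
  have f0: "?f c \<ge> 0" if "c \<in> C" for c using CU[OF that] om_pos by simp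
  have "negligible (Z - (\<Union>c\<in>C. case_prod cB c))"
    unfolding negligible_outer_le
  proof (intro allI impI)
    fix e :: real assume e: "e > 0"
    \<comment> \<open>Tripling a radius multiplies the volume by 3^nu.\<close>
    define e' where "e' = e / 3 ^ nu"
    have e': "e' > 0" using e by (simp add: e'_def)
    have "(sum ?f \<longlongrightarrow> infsum ?f C) (finite_subsets_at_top C)"
      using has_sum_infsum[OF sm(1)] by (simp add: has_sum_def)
    from tendstoD[OF this e'] obtain F where F: "finite F" "F \<subseteq> C" "dist (sum ?f F) (infsum ?f C) < e'"
      unfolding eventually_finite_subsets_at_top by blast
    have tail: "sum ?f F' \<le> e'" if F': "finite F'" "F' \<subseteq> C - F" for F'
    proof -
      have "sum ?f (F \<union> F') \<le> infsum ?f C"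
        by (rule finite_sum_le_infsum[OF sm(1)]) (use F F' f0 in auto)
      moreover have "sum ?f (F \<union> F') = sum ?f F + sum ?f F'" using F F' by (intro sum.union_disjoint) auto
      ultimately show ?thesis using F(3) by (simp add: dist_real_def)
    qed
    let ?T = "\<Union>c\<in>C - F. cB (fst c) (3 * snd c)"
    have cov: "Z - (\<Union>c\<in>C. case_prod cB c) \<subseteq> ?T"
    proof
      fix x assume x: "x \<in> Z - (\<Union>c\<in>C. case_prod cB c)"
      \<comment> \<open>Smaller than each gap between x and a ball of F. The entry 1 keeps the
        minimum meaningful for empty F and the radius within the bound of \<open>?K\<close>.\<close>
      define d where "d = Min (insert 1 ((\<lambda>c. rho (fst c) x - snd c) ` F)) / 2"
      have pos: "rho (fst c) x - snd c > 0" if "c \<in> F" for c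
        using x F(2) that by (auto simp: cB_def case_prod_beta not_le)
      have "Min (insert 1 ((\<lambda>c. rho (fst c) x - snd c) ` F)) > 0"
        using F(1) pos by (subst Min_gr_iff) auto
      then have d: "d > 0" and dM: "2 * d = Min (insert 1 ((\<lambda>c. rho (fst c) x - snd c) ` F))" by (auto simp: d_def)
      have le: "2 * d \<le> y" if "y \<in> insert 1 ((\<lambda>c. rho (fst c) x - snd c) ` F)" for y
        unfolding dM using F(1) that by (intro Min_le) auto
      have d1: "d \<le> 1" using le[of 1] d by simp
      have dF: "d < rho (fst c) x - snd c" if "c \<in> F" for c
        using le[of "rho (fst c) x - snd c"] that d by force
      obtain r where r: "(x,r) \<in> K" "r < d" using fine[of x d] x d by blast
      obtain c where c: "c \<in> C" "case_prod cB (x,r) \<inter> case_prod cB c \<noteq> {}" "snd (x,r) \<le> 2 * snd c"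
        using C(3)[of "(x,r)"] r d1 by auto
      have "c \<notin> F"
      proof
        assume cF: "c \<in> F"
        obtain y where "rho x y \<le> r" "rho (fst c) y \<le> snd c" using c(2) by (auto simp: cB_def case_prod_beta)
        then show False using rho_triangle[of "fst c" x y] dF[OF cF] r(2) by (simp add: rho_sym)
      qed
      moreover have "x \<in> cB (fst c) (3 * snd c)" using vitali_enlarge[OF c(2,3)] by simp
      ultimately show "x \<in> ?T" using c(1) by blast
    qed
    have bnd: "measure lebesgue (\<Union>c\<in>F'. cB (fst c) (3 * snd c)) \<le> e" if F': "F' \<subseteq> C - F" "finite F'" for F'
    proof -
      have "measure lebesgue (\<Union>c\<in>F'. cB (fst c) (3 * snd c)) \<le> (\<Sum>c\<in>F'. measure lebesgue (cB (fst c) (3 * snd c)))"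
        using F'(2) by (intro measure_UNION_le) auto
      also have "\<dots> = (\<Sum>c\<in>F'. 3 ^ nu * ?f c)"
      proof (rule sum.cong[OF refl])
        fix c assume "c \<in> F'"
        then have "snd c > 0" using F' CU by blast
        then show "measure lebesgue (cB (fst c) (3 * snd c)) = 3 ^ nu * ?f c"
          by (simp add: measure_cB power_mult_distrib)
      qed
      also have "\<dots> = 3 ^ nu * sum ?f F'" by (simp add: sum_distrib_left)
      also have "\<dots> \<le> 3 ^ nu * e'" using tail[OF F'(2,1)] by (intro mult_left_mono) auto
      finally show ?thesis by (simp add: e'_def)
    qed
    have "?T \<in> lmeasurable" "measure lebesgue ?T \<le> e"
      using fmeasurable_UN_bound[of "C - F" "\<lambda>c. cB (fst c) (3 * snd c)" lebesgue e]
        measure_UN_bound[of "C - F" "\<lambda>c. cB (fst c) (3 * snd c)" lebesgue e]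
        bnd cB_lmeasurable sm(2) countable_Diff by auto
    then show "\<exists>T. Z - (\<Union>c\<in>C. case_prod cB c) \<subseteq> T \<and> T \<in> lmeasurable \<and> measure lebesgue T \<le> e"
      using cov by blast
  qed
  moreover have "C \<subseteq> K" using C(1) by blast
  ultimately show ?thesis using sm(2) C0(2) by (intro exI[of _ C]) simp
qed

text \<open>In place of a density theorem: almost every point of S is not porous, which is all that the blow-up of a map defined on S needs.\<close>

definition nonporous :: "(real^'n) set \<Rightarrow> real^'n \<Rightarrow> bool" where
  "nonporous S x \<longleftrightarrow> (\<forall>\<theta>>0. \<exists>r0>0. \<forall>z. rho x z < r0 \<longrightarrow> (\<exists>z'\<in>S. rho z z' \<le> \<theta> * rho x z))"

text \<open>At a porous point there are arbitrarily small balls of radius 2 p containing a hole of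
  radius \<theta> p free of S, a fixed proportion of the volume. Disjoint balls of this kind inside
  an open U that barely exceeds S have small total volume, because their holes lie in U - S; and
  they cover the porous points up to a null set.\<close>

lemma negligible_porous:
  assumes S: "S \<in> sets lebesgue"
  shows "negligible {x \<in> S. \<not> nonporous S x}"
proof -
  define Z where "Z n m = {x \<in> S. Nm x \<le> real m \<and>
     (\<forall>r0>0. \<exists>z. rho x z < r0 \<and> (\<forall>z'\<in>S. rho z z' > (1 / real (Suc n)) * rho x z))}" for n m
  have "negligible (Z n m)" for n m
    unfolding negligible_outer_le
  proof (intro allI impI)
    fix e :: real assume e: "e > 0"
    define \<theta> where "\<theta> = 1 / real (Suc n)"
    have \<theta>: "\<theta> > 0" "\<theta> \<le> 1" by (auto simp: \<theta>_def)
    \<comment> \<open>The ratio of the volume of a ball of radius 2 p to that of its hole of radius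
      \<theta> p.\<close>
    let ?q = "(2 / \<theta>) ^ nu"
    have q: "?q > 0" using \<theta> by simp
    let ?V = "{y. rho 0 y < real m + 1}"
    have V: "open ?V" by (rule open_rho_ball)
    have "S \<inter> ?V \<in> sets lebesgue" using S V by (intro sets.Int) auto
    from sets_lebesgue_outer_open[OF this, of "e / ?q"] e q
    obtain U0 where U0: "open U0" "S \<inter> ?V \<subseteq> U0" "U0 - (S \<inter> ?V) \<in> lmeasurable" "emeasure lebesgue (U0 - (S \<inter> ?V)) < ennreal (e / ?q)" by auto
    define U where "U = U0 \<inter> ?V"
    have Uo: "open U" using U0 V by (auto simp: U_def)
    have "?V \<subseteq> cB 0 (real m + 1)" by (auto simp: cB_def)
    then have Ul: "U \<in> lmeasurable"
      using Uo compact_cB[of 0 "real m + 1"] bounded_subset[OF compact_imp_bounded, of _ U]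
      by (intro lmeasurable_open) (auto simp: U_def)
    have US: "U - S \<in> lmeasurable" "measure lebesgue (U - S) \<le> e / ?q"
    proof -
      show l: "U - S \<in> lmeasurable" using fmeasurable.Diff[OF Ul, of "S \<inter> ?V"] S by (intro fmeasurable_Diff[OF Ul]) auto
      have "measure lebesgue (U - S) \<le> measure lebesgue (U0 - (S \<inter> ?V))"
        by (rule measure_mono_fmeasurable) (use l U0 in \<open>auto simp: U_def fmeasurable_def\<close>)
      also have "\<dots> \<le> e / ?q"
        using U0(4) e q unfolding emeasure_eq_measure2[OF U0(3)] by (simp add: ennreal_less_iff)
      finally show "measure lebesgue (U - S) \<le> e / ?q" .
    qed
    define K where "K = {(x,r). x \<in> Z n m \<and> 0 < r \<and> cB x r \<subseteq> U \<and> r ^ nu * om \<le> ?q * measure lebesgue (cB x r - S)}"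
    have fine: "\<exists>r. (x,r) \<in> K \<and> r < d" if x: "x \<in> Z n m" and d: "d > 0" for x d
    proof -
      have "x \<in> U" using x U0(2) by (auto simp: Z_def U_def Nm_def)
      then obtain s where s: "s > 0" "cB x s \<subseteq> U" using open_contains_cB[OF Uo] by blast
      obtain z where z: "rho x z < min (d/2) (s/2)" "\<And>z'. z' \<in> S \<Longrightarrow> rho z z' > \<theta> * rho x z"
      proof -
        have "\<forall>r0>0. \<exists>z. rho x z < r0 \<and> (\<forall>z'\<in>S. rho z z' > \<theta> * rho x z)" using x unfolding Z_def \<theta>_def by blast
        moreover have "min (d/2) (s/2) > 0" using d s by simp
        ultimately obtain z where "rho x z < min (d/2) (s/2)" "\<forall>z'\<in>S. rho z z' > \<theta> * rho x z" by blast
        then show ?thesis using that by blast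
      qed
      let ?p = "rho x z"
      have p: "?p > 0"
      proof -
        have "z \<noteq> x" using z(2)[of x] x by (auto simp: Z_def)
        then show ?thesis using rho_eq_0[of x z] rho_nonneg[of x z] by simp
      qed
      have sub: "cB z (\<theta> * ?p) \<subseteq> cB x (2 * ?p) - S"
      proof
        fix y assume y: "y \<in> cB z (\<theta> * ?p)"
        have "y \<notin> S" using z(2)[of y] y by (auto simp: cB_def)
        moreover have "rho x y \<le> ?p + \<theta> * ?p" using rho_triangle[of x y z] y by (simp add: cB_def)
        moreover have "\<theta> * ?p \<le> 1 * ?p" using \<theta> p by (intro mult_right_mono) auto
        ultimately show "y \<in> cB x (2 * ?p) - S" by (simp add: cB_def)
      qed
      have "(\<theta> * ?p) ^ nu * om = measure lebesgue (cB z (\<theta> * ?p))" using \<theta> p by (simp add: measure_cB)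
      also have "\<dots> \<le> measure lebesgue (cB x (2 * ?p) - S)"
        using sub S fmeasurable_Diff[OF cB_lmeasurable S] by (intro measure_mono_fmeasurable) auto
      finally have "?q * ((\<theta> * ?p) ^ nu * om) \<le> ?q * measure lebesgue (cB x (2 * ?p) - S)" using q by simp
      moreover have "?q * ((\<theta> * ?p) ^ nu * om) = (2 * ?p) ^ nu * om"
      proof -
        have "?q * (\<theta> * ?p) ^ nu = ((2 / \<theta>) * (\<theta> * ?p)) ^ nu" by (rule power_mult_distrib[symmetric])
        also have "(2 / \<theta>) * (\<theta> * ?p) = 2 * ?p" using \<theta> by simp
        finally show ?thesis by (simp only: mult.assoc[symmetric])
      qed
      moreover have "cB x (2 * ?p) \<subseteq> U" using s(2) z(1) by (auto simp: cB_def)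
      ultimately have "(x, 2 * ?p) \<in> K" using x p unfolding K_def by auto
      then show ?thesis using z(1) by (intro exI[of _ "2 * ?p"]) auto
    qed
    have KU: "0 < r \<and> cB x r \<subseteq> U" if "(x,r) \<in> K" for x r using that by (auto simp: K_def)
    have "\<exists>C\<subseteq>K. countable C \<and> (\<forall>c\<in>C. \<forall>c'\<in>C. c \<noteq> c' \<longrightarrow> case_prod cB c \<inter> case_prod cB c' = {}) \<and>
        negligible (Z n m - (\<Union>c\<in>C. case_prod cB c))"
      by (rule vitali_cover[OF Ul]) (rule KU, assumption, rule fine)
    then obtain C where C: "C \<subseteq> K" "countable C" "\<forall>c\<in>C. \<forall>c'\<in>C. c \<noteq> c' \<longrightarrow> case_prod cB c \<inter> case_prod cB c' = {}"
      "negligible (Z n m - (\<Union>c\<in>C. case_prod cB c))"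
      by blast
    have bnd: "measure lebesgue (\<Union>c\<in>F. case_prod cB c) \<le> e" if F: "F \<subseteq> C" "finite F" for F
    proof -
      have cm: "case_prod cB c \<in> lmeasurable" "case_prod cB c - S \<in> lmeasurable" for c
        using cB_lmeasurable fmeasurable_Diff[OF cB_lmeasurable S] by (auto simp: case_prod_beta)
      have "measure lebesgue (\<Union>c\<in>F. case_prod cB c) \<le> (\<Sum>c\<in>F. measure lebesgue (case_prod cB c))"
        using F(2) cm(1) by (intro measure_UNION_le) auto
      also have "\<dots> \<le> (\<Sum>c\<in>F. ?q * measure lebesgue (case_prod cB c - S))"
      proof (rule sum_mono)
        fix c assume "c \<in> F"
        then have "c \<in> K" using F C by blast
        then show "measure lebesgue (case_prod cB c) \<le> ?q * measure lebesgue (case_prod cB c - S)"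
          by (cases c) (auto simp: K_def measure_cB)
      qed
      also have "\<dots> = ?q * (\<Sum>c\<in>F. measure lebesgue (case_prod cB c - S))" by (simp add: sum_distrib_left)
      also have "(\<Sum>c\<in>F. measure lebesgue (case_prod cB c - S)) = measure lebesgue (\<Union>c\<in>F. case_prod cB c - S)"
      proof (rule measure_finite_Union[symmetric])
        show "disjoint_family_on (\<lambda>c. case_prod cB c - S) F"
          unfolding disjoint_family_on_def using C(3) F by blast
        show "(\<lambda>c. case_prod cB c - S) ` F \<subseteq> sets lebesgue" using fmeasurableD[OF cm(2)] by blast
        show "emeasure lebesgue (case_prod cB c - S) \<noteq> \<infinity>" for c
          using fmeasurableD2[OF cm(2)[of c]] by (simp only: infinity_ennreal_def not_False_eq_True)
      qed (rule F)
      also have "\<dots> \<le> measure lebesgue (U - S)"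
      proof (rule measure_mono_fmeasurable[OF _ _ US(1)])
        show "(\<Union>c\<in>F. case_prod cB c - S) \<subseteq> U - S" using KU F C(1) by fastforce
        show "(\<Union>c\<in>F. case_prod cB c - S) \<in> sets lebesgue" using F cm(2) by (intro sets.finite_UN) auto
      qed
      also have "?q * measure lebesgue (U - S) \<le> ?q * (e / ?q)" using US(2) q by (intro mult_left_mono) auto
      finally show ?thesis using \<theta> by simp
    qed
    let ?T = "\<Union>c\<in>C. case_prod cB c"
    have T: "?T \<in> lmeasurable" "measure lebesgue ?T \<le> e"
      using fmeasurable_UN_bound[OF C(2), of "case_prod cB" lebesgue e] measure_UN_bound[OF C(2), of "case_prod cB" lebesgue e]
        bnd cB_lmeasurable by (auto simp: case_prod_beta)
    have nl: "Z n m - ?T \<in> null_sets lebesgue" using C(4) by (simp add: negligible_iff_null_sets)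
    have "?T \<union> (Z n m - ?T) \<in> lmeasurable" using T(1) nl by (intro fmeasurable.Un) (auto simp: fmeasurable_def null_sets_def)
    moreover have "measure lebesgue (?T \<union> (Z n m - ?T)) = measure lebesgue ?T"
      using T nl by (intro measure_Un_null_set) auto
    ultimately show "\<exists>T. Z n m \<subseteq> T \<and> T \<in> lmeasurable \<and> measure lebesgue T \<le> e"
      using T(2) by (intro exI[of _ "?T \<union> (Z n m - ?T)"]) auto
  qed
  then have "negligible (\<Union>((\<lambda>(n,m). Z n m) ` UNIV))" by (intro negligible_countable_Union) auto
  moreover have "(\<Union>n m. Z n m) = \<Union>((\<lambda>(n,m). Z n m) ` UNIV)" by auto
  ultimately have neg: "negligible (\<Union>n m. Z n m)" by simp
  have "{x \<in> S. \<not> nonporous S x} \<subseteq> (\<Union>n m. Z n m)"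
  proof
    fix x assume "x \<in> {x \<in> S. \<not> nonporous S x}"
    then have x: "x \<in> S" and nd: "\<not> nonporous S x" by simp_all
    from nd[unfolded nonporous_def, unfolded not_all]
    obtain \<theta> where nd': "\<not> (\<theta> > 0 \<longrightarrow> (\<exists>r0>0. \<forall>z. rho x z < r0 \<longrightarrow> (\<exists>z'\<in>S. rho z z' \<le> \<theta> * rho x z)))" ..
    then have \<theta>0: "\<theta> > 0" by (rule contrapos_np) simp
    have \<theta>: "\<theta> > 0" "\<exists>z. rho x z < r0 \<and> (\<forall>z'\<in>S. \<not> rho z z' \<le> \<theta> * rho x z)" if "r0 > 0" for r0
    proof -
      have "\<not> (\<forall>z. rho x z < r0 \<longrightarrow> (\<exists>z'\<in>S. rho z z' \<le> \<theta> * rho x z))"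
        using nd' that \<theta>0 by simp
      then show "\<exists>z. rho x z < r0 \<and> (\<forall>z'\<in>S. \<not> rho z z' \<le> \<theta> * rho x z)" by simp
    qed (rule \<theta>0)
    obtain n where n: "1 / real (Suc n) < \<theta>" using \<theta>0 nat_approx_posE by blast
    obtain m where m: "Nm x \<le> real m" using real_arch_simple by blast
    have "\<exists>z. rho x z < r0 \<and> (\<forall>z'\<in>S. rho z z' > (1 / real (Suc n)) * rho x z)" if r0: "r0 > 0" for r0
    proof -
      obtain z where z: "rho x z < r0" "\<And>z'. z' \<in> S \<Longrightarrow> \<not> rho z z' \<le> \<theta> * rho x z" using \<theta>(2)[OF r0] by blast
      have "1 / real (Suc n) * rho x z \<le> \<theta> * rho x z" using n rho_nonneg[of x z] by (intro mult_right_mono) auto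
      then have "\<forall>z'\<in>S. rho z z' > (1 / real (Suc n)) * rho x z" using z(2) by (simp add: not_le order.strict_trans1)
      then show ?thesis using z(1) by blast
    qed
    then have "x \<in> Z n m" using x m unfolding Z_def by blast
    then show "x \<in> (\<Union>n m. Z n m)" by blast
  qed
  then show ?thesis using neg negligible_subset by blast
qed

end

section \<open>Directional derivatives of real Lipschitz functions\<close>

lemma cauchy_at_0_imp_convergent:
  fixes q :: "real \<Rightarrow> real"
  assumes "\<And>e. e > 0 \<Longrightarrow> \<exists>d>0. \<forall>h h'. h \<noteq> 0 \<and> \<bar>h\<bar> < d \<and> h' \<noteq> 0 \<and> \<bar>h'\<bar> < d \<longrightarrow> \<bar>q h - q h'\<bar> \<le> e"
  shows "\<exists>l. (q \<longlongrightarrow> l) (at 0)"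
proof -
  define X where "X n = q (1 / real (Suc n))" for n
  have small: "\<exists>N. \<forall>n\<ge>N. 1 / real (Suc n) < d" if d: "d > 0" for d :: real
  proof -
    obtain N where N: "1 / real (Suc N) < d" using nat_approx_posE[OF d] by blast
    have "1 / real (Suc n) < d" if "n \<ge> N" for n
      using N frac_le[of 1 1 "real (Suc N)" "real (Suc n)"] that by simp
    then show ?thesis by blast
  qed
  have "Cauchy X"
  proof (rule metric_CauchyI)
    fix e :: real assume e: "e > 0"
    then obtain d where d: "d > 0" "\<And>h h'. h \<noteq> 0 \<and> \<bar>h\<bar> < d \<and> h' \<noteq> 0 \<and> \<bar>h'\<bar> < d \<Longrightarrow> \<bar>q h - q h'\<bar> \<le> e/2"
      using assms[of "e/2"] by auto
    obtain N where N: "\<And>n. n \<ge> N \<Longrightarrow> 1 / real (Suc n) < d" using small[OF d(1)] by blast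
    have "dist (X m) (X n) < e" if "m \<ge> N" "n \<ge> N" for m n
      using d(2)[of "1 / real (Suc m)" "1 / real (Suc n)"] N[OF that(1)] N[OF that(2)] e by (simp add: X_def dist_real_def)
    then show "\<exists>M. \<forall>m\<ge>M. \<forall>n\<ge>M. dist (X m) (X n) < e" by blast
  qed
  then obtain l where l: "X \<longlonglongrightarrow> l" using Cauchy_convergent convergentD by blast
  have "(q \<longlongrightarrow> l) (at 0)"
    unfolding tendsto_iff
  proof (intro allI impI)
    fix e :: real assume e: "e > 0"
    then obtain d where d: "d > 0" "\<And>h h'. h \<noteq> 0 \<and> \<bar>h\<bar> < d \<and> h' \<noteq> 0 \<and> \<bar>h'\<bar> < d \<Longrightarrow> \<bar>q h - q h'\<bar> \<le> e/2"
      using assms[of "e/2"] by auto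
    obtain N where N: "\<And>n. n \<ge> N \<Longrightarrow> 1 / real (Suc n) < d" using small[OF d(1)] by blast
    have "\<bar>q h - l\<bar> \<le> e/2" if h: "h \<noteq> 0" "\<bar>h\<bar> < d" for h
    proof (rule LIMSEQ_le_const2)
      show "(\<lambda>n. \<bar>q h - X n\<bar>) \<longlonglongrightarrow> \<bar>q h - l\<bar>" by (intro tendsto_intros l)
      show "\<exists>N. \<forall>n\<ge>N. \<bar>q h - X n\<bar> \<le> e/2"
        using d(2)[of h] h N by (intro exI[of _ N]) (auto simp: X_def)
    qed
    then show "eventually (\<lambda>h. dist (q h) l < e) (at 0)"
      unfolding eventually_at using d(1) e by (intro exI[of _ d]) (fastforce simp: dist_real_def)
  qed
  then show ?thesis by blast
qed

context carnot begin

text \<open>Right translations preserve Lebesgue measure, so the measure of N equals its average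
  over the translates by t v with t in the unit interval. Exchanging the integrals leaves the line
  sections of N, which are null.\<close>

lemma nn_integral_translate_average:
  assumes N: "N \<in> sets borel" and line: "\<And>x. {t. x \<odot> (t *\<^sub>R v) \<in> N} \<in> null_sets lborel"
  shows "emeasure lborel N = 0"
proof -
  have psf: "pair_sigma_finite (lborel :: (real^'n) measure) (lborel :: real measure)" by unfold_locales
  have c: "(\<lambda>z::(real^'n) \<times> real. fst z \<odot> (snd z *\<^sub>R v)) \<in> borel_measurable borel"
    by (intro borel_measurable_continuous_onI continuous_intros)
  have "(\<lambda>z. indicator N (fst z \<odot> (snd z *\<^sub>R v)) * indicator {0..1} (snd z) :: ennreal) \<in> borel_measurable borel"
    using measurable_compose[OF c borel_measurable_indicator[OF N]]
    by (intro borel_measurable_times_ennreal measurable_compose[OF borel_measurable_continuous_onI[OF continuous_on_snd[OF continuous_on_id]]]) auto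
  then have m: "(\<lambda>z. indicator N (fst z \<odot> (snd z *\<^sub>R v)) * indicator {0..1} (snd z) :: ennreal) \<in> borel_measurable (lborel \<Otimes>\<^sub>M lborel)"
    by (simp add: lborel_prod)
  have tr: "(\<integral>\<^sup>+x. indicator N (x \<odot> (t *\<^sub>R v)) \<partial>lborel) = emeasure lborel N" for t
    using nn_integral_right_translate[of "indicator N" "t *\<^sub>R v"] N by simp
  have "emeasure lborel N = (\<integral>\<^sup>+t. emeasure lborel N * indicator {0..1::real} t \<partial>lborel)"
    by (simp add: nn_integral_cmult_indicator)
  also have "\<dots> = (\<integral>\<^sup>+t. (\<integral>\<^sup>+x. indicator N (x \<odot> (t *\<^sub>R v)) * indicator {0..1::real} t \<partial>lborel) \<partial>lborel)"
  proof (rule nn_integral_cong)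
    fix t :: real
    have "(\<lambda>x. indicator N (x \<odot> (t *\<^sub>R v)) :: ennreal) \<in> borel_measurable lborel"
      by (rule measurable_compose[of "\<lambda>x. x \<odot> (t *\<^sub>R v)" _ borel]) (use N in \<open>auto intro!: borel_measurable_continuous_onI continuous_intros\<close>)
    then show "emeasure lborel N * indicator {0..1} t = (\<integral>\<^sup>+x. indicator N (x \<odot> (t *\<^sub>R v)) * indicator {0..1::real} t \<partial>lborel)"
      by (simp add: nn_integral_multc tr)
  qed
  also have "\<dots> = (\<integral>\<^sup>+x. (\<integral>\<^sup>+t. indicator N (x \<odot> (t *\<^sub>R v)) * indicator {0..1::real} t \<partial>lborel) \<partial>lborel)"
    using pair_sigma_finite.Fubini[OF psf m] by simp
  also have "\<dots> = (\<integral>\<^sup>+x. 0 \<partial>(lborel :: (real^'n) measure))"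
  proof (rule nn_integral_cong)
    fix x :: "real^'n"
    have "AE t in lborel. t \<notin> {t. x \<odot> (t *\<^sub>R v) \<in> N}" by (rule AE_not_in[OF line])
    then have "AE t in lborel. indicator N (x \<odot> (t *\<^sub>R v)) * indicator {0..1::real} t = (0::ennreal)" by (rule AE_mp) simp
    then show "(\<integral>\<^sup>+t. indicator N (x \<odot> (t *\<^sub>R v)) * indicator {0..1::real} t \<partial>lborel) = (0::ennreal)"
      by (subst nn_integral_cong_AE) auto
  qed
  finally show ?thesis by simp
qed

definition horiz_quot :: "(real^'n \<Rightarrow> real) \<Rightarrow> 'n \<Rightarrow> real \<Rightarrow> real^'n \<Rightarrow> real" where
  "horiz_quot f i h x = (f (x \<odot> (h *\<^sub>R axis i 1)) - f x) / h"

lemma rho_axis: "\<sigma> i = 1 \<Longrightarrow> rho (x \<odot> (s *\<^sub>R axis i 1)) (x \<odot> (t *\<^sub>R axis i 1)) \<le> \<bar>s - t\<bar>"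
proof -
  assume i: "\<sigma> i = 1"
  have "rho (x \<odot> (s *\<^sub>R axis i 1)) (x \<odot> (t *\<^sub>R axis i 1)) = Nm ((- s) *\<^sub>R axis i 1 \<odot> t *\<^sub>R axis i 1)"
    by (simp add: rho_left) (simp add: rho_Nm)
  also have "\<dots> = Nm ((t - s) *\<^sub>R axis i 1)" by (subst gm_scaleR) simp
  also have "\<dots> \<le> norm ((t - s) *\<^sub>R axis i 1 :: real^'n)" by (rule Nm_horiz) (use i in \<open>auto simp: axis_def\<close>)
  finally show ?thesis by (simp add: abs_minus_commute norm_axis_1)
qed

lemma lipschitz_rho_continuous:
  assumes "\<And>x y. \<bar>f x - f y\<bar> \<le> C * rho x y" shows "continuous_on UNIV (f :: real^'n \<Rightarrow> real)"
  unfolding continuous_on_def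
proof
  fix x
  have "((\<lambda>y. f y - f x) \<longlongrightarrow> 0) (at x)"
  proof (rule tendsto_0_le[where K = 1])
    have "((\<lambda>y. C * rho y x) \<longlongrightarrow> C * rho x x) (at x)" by (intro tendsto_intros)
    then show "((\<lambda>y. C * rho y x) \<longlongrightarrow> 0) (at x)" by simp
    show "\<forall>\<^sub>F y in at x. norm (f y - f x) \<le> norm (C * rho y x) * 1"
      using assms by (intro always_eventually allI) (simp add: order.trans[OF assms abs_ge_self])
  qed
  then show "(f \<longlongrightarrow> f x) (at x within UNIV)" by (simp add: LIM_zero_cancel)
qed

lemma horiz_quot_converges_ae:
  assumes lip: "\<And>x y. \<bar>f x - f y\<bar> \<le> C * rho x y" and C: "C \<ge> 0" and i: "\<sigma> i = 1"
  shows "negligible {x. \<not> (\<exists>l. ((\<lambda>h. horiz_quot f i h x) \<longlongrightarrow> l) (at 0))}"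
proof -
  \<comment> \<open>Cauchy's criterion with tolerances 1/(m + 1) and 1/(n + 1). Each
    \<open>P m n\<close> is closed by continuity in x, so the set of convergence is Borel and the
    argument along lines applies to its complement.\<close>
  define P where "P m n = {x. \<forall>h h'. h \<noteq> 0 \<and> \<bar>h\<bar> < 1 / real (Suc n) \<and> h' \<noteq> 0 \<and> \<bar>h'\<bar> < 1 / real (Suc n) \<longrightarrow>
      \<bar>horiz_quot f i h x - horiz_quot f i h' x\<bar> \<le> 1 / real (Suc m)}" for m n
  have cf: "continuous_on S f" for S using lipschitz_rho_continuous[OF lip] continuous_on_subset by blast
  have cu: "continuous_on UNIV (horiz_quot f i h)" for h
    unfolding horiz_quot_def by (cases "h = 0") (auto intro!: continuous_intros continuous_on_compose2[OF cf[of UNIV]])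
  have clP: "closed (P m n)" for m n unfolding P_def
    by (intro closed_Collect_all closed_Collect_imp open_Collect_const closed_Collect_le continuous_intros cu)
  have eq: "{x. \<exists>l. ((\<lambda>h. horiz_quot f i h x) \<longlongrightarrow> l) (at 0)} = (\<Inter>m. \<Union>n. P m n)"
  proof (intro set_eqI iffI)
    fix x assume "x \<in> {x. \<exists>l. ((\<lambda>h. horiz_quot f i h x) \<longlongrightarrow> l) (at 0)}"
    then obtain l where l: "((\<lambda>h. horiz_quot f i h x) \<longlongrightarrow> l) (at 0)" by blast
    have "\<exists>n. x \<in> P m n" for m
    proof -
      define M where "M = 1 / real (Suc m)"
      have "eventually (\<lambda>h. dist (horiz_quot f i h x) l < M / 2) (at 0)" by (rule tendstoD[OF l]) (simp add: M_def)
      then obtain d where d: "d > 0" "\<And>h. h \<noteq> 0 \<Longrightarrow> \<bar>h\<bar> < d \<Longrightarrow> \<bar>horiz_quot f i h x - l\<bar> < M / 2"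
        by (auto simp: eventually_at dist_real_def)
      obtain n where n: "1 / real (Suc n) < d" using nat_approx_posE[OF d(1)] by blast
      have "\<bar>horiz_quot f i h x - horiz_quot f i h' x\<bar> \<le> 1 / real (Suc m)"
        if "h \<noteq> 0 \<and> \<bar>h\<bar> < 1 / real (Suc n) \<and> h' \<noteq> 0 \<and> \<bar>h'\<bar> < 1 / real (Suc n)" for h h'
        unfolding M_def[symmetric] using d(2)[of h] d(2)[of h'] that n by linarith
      then show ?thesis unfolding P_def by blast
    qed
    then show "x \<in> (\<Inter>m. \<Union>n. P m n)" by blast
  next
    fix x assume x: "x \<in> (\<Inter>m. \<Union>n. P m n)"
    have "\<exists>l. ((\<lambda>h. horiz_quot f i h x) \<longlongrightarrow> l) (at 0)"
    proof (rule cauchy_at_0_imp_convergent)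
      fix e :: real assume "e > 0"
      then obtain m where m: "1 / real (Suc m) < e" using nat_approx_posE by blast
      obtain n where n: "x \<in> P m n" using x by blast
      show "\<exists>d>0. \<forall>h h'. h \<noteq> 0 \<and> \<bar>h\<bar> < d \<and> h' \<noteq> 0 \<and> \<bar>h'\<bar> < d \<longrightarrow> \<bar>horiz_quot f i h x - horiz_quot f i h' x\<bar> \<le> e"
      proof (intro exI[of _ "1 / real (Suc n)"] conjI allI impI)
        fix h h' assume "h \<noteq> 0 \<and> \<bar>h\<bar> < 1 / real (Suc n) \<and> h' \<noteq> 0 \<and> \<bar>h'\<bar> < 1 / real (Suc n)"
        then have "\<bar>horiz_quot f i h x - horiz_quot f i h' x\<bar> \<le> 1 / real (Suc m)" using n unfolding P_def by blast
        then show "\<bar>horiz_quot f i h x - horiz_quot f i h' x\<bar> \<le> e" using m by linarith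
      qed simp
    qed
    then show "x \<in> {x. \<exists>l. ((\<lambda>h. horiz_quot f i h x) \<longlongrightarrow> l) (at 0)}" by simp
  qed
  let ?N = "{x. \<not> (\<exists>l. ((\<lambda>h. horiz_quot f i h x) \<longlongrightarrow> l) (at 0))}"
  have Neq: "?N = - (\<Inter>m. \<Union>n. P m n)" using eq by blast
  have Nb: "?N \<in> sets borel" unfolding Neq using clP by (intro borel_comp sets.countable_INT'' sets.countable_UN) auto
  have "{t. x \<odot> (t *\<^sub>R axis i 1) \<in> ?N} \<in> null_sets lborel" for x
  proof -
    let ?g = "\<lambda>t. f (x \<odot> (t *\<^sub>R axis i 1))"
    have "\<bar>?g s - ?g t\<bar> \<le> C * \<bar>s - t\<bar>" for s t
      by (rule order.trans[OF lip]) (intro mult_left_mono rho_axis i C)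
    from lipschitz_real_ae_differentiable[OF this]
    have "negligible {t. \<not> (\<exists>l. (quot ?g t \<longlongrightarrow> l) (at 0))}" .
    moreover have q: "quot ?g t h = horiz_quot f i h (x \<odot> (t *\<^sub>R axis i 1))" for t h
      unfolding quot_def horiz_quot_def gm_assoc gm_scaleR ..
    ultimately have neg: "negligible {t. x \<odot> (t *\<^sub>R axis i 1) \<in> ?N}" by (simp add: q[abs_def])
    have "(\<lambda>t. x \<odot> (t *\<^sub>R axis i 1)) \<in> borel_measurable borel"
      by (intro borel_measurable_continuous_onI continuous_intros)
    from measurable_sets_borel[OF this Nb] have "{t. x \<odot> (t *\<^sub>R axis i 1) \<in> ?N} \<in> sets borel" by (simp add: vimage_def)
    then show ?thesis using neg by (auto simp: negligible_iff_null_sets null_sets_def)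
  qed
  from nn_integral_translate_average[OF Nb this] Nb
  show ?thesis by (auto simp: negligible_iff_null_sets null_sets_def)
qed

lemma gm_nth_axis: "\<sigma> k = 1 \<Longrightarrow> (y \<odot> (t *\<^sub>R axis i 1)) $ k = y $ k + (if k = i then t else 0)"
  by (simp add: gm_nth_horiz axis_def)

text \<open>Convergence of the quotients at x0 alone is not enough, since the increment starts at x0
  \<odot> dl r y. The closed set S of points with quotients uniformly near a rational q contains x0;
  non-porosity gives a point z of S close to the starting point relative to r, and the Lipschitz
  bound allows start and end to be moved to z and its translate.\<close>

lemma pansu_rademacher_step:
  assumes lip: "\<And>x y. \<bar>f x - f y\<bar> \<le> C * rho x y" and C: "C \<ge> 0" and i: "\<sigma> i = 1"
    and lim: "((\<lambda>h. horiz_quot f i h x0) \<longlongrightarrow> a) (at 0)"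
    and dens: "\<And>m q n. q \<in> \<rat> \<Longrightarrow> x0 \<in> {x. \<forall>h. h \<noteq> 0 \<and> \<bar>h\<bar> < 1 / real (Suc n) \<longrightarrow> \<bar>horiz_quot f i h x - q\<bar> \<le> 1 / real (Suc m)} \<Longrightarrow>
       nonporous {x. \<forall>h. h \<noteq> 0 \<and> \<bar>h\<bar> < 1 / real (Suc n) \<longrightarrow> \<bar>horiz_quot f i h x - q\<bar> \<le> 1 / real (Suc m)} x0"
  shows "((\<lambda>r. (f (x0 \<odot> dl r (y \<odot> (t *\<^sub>R axis i 1))) - f (x0 \<odot> dl r y)) / r) \<longlongrightarrow> t * a) (at_right 0)"
proof (cases "t = 0")
  case False
  show ?thesis unfolding tendsto_iff
  proof (intro allI impI)
    fix e :: real assume e: "e > 0"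
    \<comment> \<open>Moving the two endpoints costs C e1 each, and passing from the quotient at z
      to a costs 2 M |t| < e/4. The margin e/100 makes the first bound strict even when C e1
      vanishes.\<close>
    define e1 where "e1 = e / (4 * (C + 1))"
    have e1: "e1 > 0" "2 * (C * e1) < e / 2 + e/100"
    proof -
      show "e1 > 0" using e C by (simp add: e1_def)
      have "2 * (C * e1) = (e/2) * (C / (C + 1))" using C by (simp add: e1_def field_simps)
      also have "\<dots> \<le> (e/2) * 1" using C e by (intro mult_left_mono) auto
      finally show "2 * (C * e1) < e / 2 + e/100" using e by simp
    qed
    obtain m where m: "1 / real (Suc m) < e / (8 * \<bar>t\<bar>)" using nat_approx_posE[of "e / (8 * \<bar>t\<bar>)"] e False by auto
    define M where "M = 1 / real (Suc m)"
    have M0: "M > 0" by (simp add: M_def)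
    note m = m[folded M_def]
    obtain q where q: "q \<in> \<rat>" "a < q" "q < a + M / 2" using Rats_dense_in_real[of a "a + M / 2"] M0 by auto
    have "eventually (\<lambda>h. dist (horiz_quot f i h x0) a < M / 2) (at 0)" by (rule tendstoD[OF lim]) (simp add: M0)
    then obtain d where d: "d > 0" "\<And>h. h \<noteq> 0 \<Longrightarrow> \<bar>h\<bar> < d \<Longrightarrow> \<bar>horiz_quot f i h x0 - a\<bar> < M / 2"
      by (auto simp: eventually_at dist_real_def)
    obtain n where n: "1 / real (Suc n) < d" using nat_approx_posE[OF d(1)] by blast
    define S where "S = {x. \<forall>h. h \<noteq> 0 \<and> \<bar>h\<bar> < 1 / real (Suc n) \<longrightarrow> \<bar>horiz_quot f i h x - q\<bar> \<le> M}"
    have "\<bar>horiz_quot f i h x0 - q\<bar> \<le> M" if "h \<noteq> 0 \<and> \<bar>h\<bar> < 1 / real (Suc n)" for h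
    proof -
      have "\<bar>horiz_quot f i h x0 - a\<bar> < M / 2" using d(2)[of h] that n by linarith
      moreover have "\<bar>a - q\<bar> < M / 2" using q by simp
      ultimately show ?thesis by linarith
    qed
    then have "x0 \<in> S" unfolding S_def by blast
    then have dS: "nonporous S x0" using dens[OF q(1)] unfolding S_def M_def by blast
    let ?e = "t *\<^sub>R axis i 1 :: real^'n"
    have "open {y'. rho (y \<odot> ?e) (y' \<odot> ?e) < e1 \<and> rho y y' < e1}"
      by (intro open_Collect_conj open_Collect_less continuous_intros)
    moreover have "y \<in> {y'. rho (y \<odot> ?e) (y' \<odot> ?e) < e1 \<and> rho y y' < e1}" using e1 by simp
    ultimately obtain s where s: "s > 0" "cB y s \<subseteq> {y'. rho (y \<odot> ?e) (y' \<odot> ?e) < e1 \<and> rho y y' < e1}"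
      using open_contains_cB by blast
    \<comment> \<open>An error \<theta> r Nm y at the point x0 \<odot> dl r y becomes, after
      rescaling by 1/r, a distance of at most s from y. The summand 1 avoids division by
      zero.\<close>
    define \<theta> where "\<theta> = s / (Nm y + 1)"
    have \<theta>: "\<theta> > 0" "\<theta> * Nm y \<le> s" using s(1) Nm_nonneg[of y] by (auto simp: \<theta>_def field_simps add_pos_nonneg intro!: divide_pos_pos)
    obtain r0 where r0: "r0 > 0" "\<And>z. rho x0 z < r0 \<Longrightarrow> \<exists>z'\<in>S. rho z z' \<le> \<theta> * rho x0 z"
      using dS \<theta>(1) unfolding nonporous_def by blast
    define r1 where "r1 = min (r0 / (Nm y + 1)) (1 / real (Suc n) / \<bar>t\<bar>)"
    have r1: "r1 > 0" using r0(1) Nm_nonneg[of y] False by (auto simp: r1_def intro!: divide_pos_pos add_nonneg_pos)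
    have main: "\<bar>(f (x0 \<odot> dl r (y \<odot> ?e)) - f (x0 \<odot> dl r y)) / r - t * a\<bar> < e" if r: "0 < r" "r < r1" for r
    proof -
      have rn: "r * Nm y < r0"
      proof -
        have "r * Nm y \<le> r * (Nm y + 1)" using r(1) by simp
        also have "\<dots> < r0" using r Nm_nonneg[of y] by (simp add: r1_def pos_less_divide_eq add_nonneg_pos)
        finally show ?thesis .
      qed
      have rx: "rho x0 (x0 \<odot> dl r y) = r * Nm y" using r(1) by (simp add: rho_gm_right Nm_dl)
      obtain z where z: "z \<in> S" "rho (x0 \<odot> dl r y) z \<le> \<theta> * (r * Nm y)" using r0(2)[of "x0 \<odot> dl r y"] rn rx by auto
      define y' where "y' = dl (1/r) ((- x0) \<odot> z)"
      have zy: "z = x0 \<odot> dl r y'" using r(1) by (simp add: y'_def dl_inverse)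
      have "r * rho y y' \<le> r * (\<theta> * Nm y)"
        using z(2) r(1) unfolding zy by (simp add: rho_left rho_dl mult.left_commute)
      then have "rho y y' \<le> s" using r(1) \<theta>(2) by simp
      then have ry: "rho (y \<odot> ?e) (y' \<odot> ?e) < e1" "rho y y' < e1" using s(2) by (auto simp: cB_def)
      have de: "dl r ?e = (r * t) *\<^sub>R axis i 1" using i by (simp add: linear_scale[OF linear_dl] dl_axis)
      have ze: "x0 \<odot> dl r (y' \<odot> ?e) = z \<odot> ((r * t) *\<^sub>R axis i 1)"
        unfolding zy dl_gm[OF r(1), symmetric] de gm_assoc ..
      have rt: "r * t \<noteq> 0" "\<bar>r * t\<bar> < 1 / real (Suc n)"
      proof -
        show "r * t \<noteq> 0" using r False by simp
        have "r < 1 / real (Suc n) / \<bar>t\<bar>" using r by (simp add: r1_def)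
        moreover have "\<bar>t\<bar> > 0" using False by simp
        ultimately have "r * \<bar>t\<bar> < 1 / real (Suc n)" by (subst (asm) pos_less_divide_eq)
        then show "\<bar>r * t\<bar> < 1 / real (Suc n)" using r(1) by (simp add: abs_mult)
      qed
      have u: "\<bar>horiz_quot f i (r * t) z - q\<bar> \<le> M" using z(1) rt unfolding S_def by blast
      have fz: "f (x0 \<odot> dl r (y' \<odot> ?e)) - f z = (r * t) * horiz_quot f i (r * t) z"
        unfolding ze horiz_quot_def using rt(1) by simp
      have A: "\<bar>f (x0 \<odot> dl r (y \<odot> ?e)) - f (x0 \<odot> dl r (y' \<odot> ?e))\<bar> \<le> r * (C * e1)"
      proof -
        have "\<bar>f (x0 \<odot> dl r (y \<odot> ?e)) - f (x0 \<odot> dl r (y' \<odot> ?e))\<bar> \<le> C * (r * rho (y \<odot> ?e) (y' \<odot> ?e))"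
          using lip[of "x0 \<odot> dl r (y \<odot> ?e)" "x0 \<odot> dl r (y' \<odot> ?e)"] r(1) by (simp add: rho_left rho_dl)
        also have "\<dots> \<le> C * (r * e1)" using ry r C by (intro mult_left_mono) auto
        finally show ?thesis by (simp add: mult.left_commute)
      qed
      have B: "\<bar>f (x0 \<odot> dl r y) - f z\<bar> \<le> r * (C * e1)"
      proof -
        have "\<bar>f (x0 \<odot> dl r y) - f z\<bar> \<le> C * (r * rho y y')"
          using lip[of "x0 \<odot> dl r y" z] r(1) unfolding zy by (simp add: rho_left rho_dl)
        also have "\<dots> \<le> C * (r * e1)" using ry r C by (intro mult_left_mono) auto
        finally show ?thesis by (simp add: mult.left_commute)
      qed
      have ua: "\<bar>horiz_quot f i (r * t) z - a\<bar> \<le> 2 * M" using u q by linarith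
      have D: "\<bar>(r * t) * horiz_quot f i (r * t) z - (r * t) * a\<bar> \<le> r * (\<bar>t\<bar> * (2 * M))"
      proof -
        have "\<bar>(r * t) * horiz_quot f i (r * t) z - (r * t) * a\<bar> = (r * \<bar>t\<bar>) * \<bar>horiz_quot f i (r * t) z - a\<bar>"
          using r(1) by (simp add: right_diff_distrib[symmetric] abs_mult del: right_diff_distrib)
        also have "\<dots> \<le> (r * \<bar>t\<bar>) * (2 * M)" using ua r(1) by (intro mult_left_mono) auto
        finally show ?thesis by (simp add: mult.assoc)
      qed
      have tm: "\<bar>t\<bar> * (2 * M) < e / 4"
      proof -
        have "\<bar>t\<bar> * M < \<bar>t\<bar> * (e / (8 * \<bar>t\<bar>))" using m False by (intro mult_strict_left_mono) auto
        also have "\<dots> = e / 8" using False by simp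
        finally show ?thesis by linarith
      qed
      let ?X = "f (x0 \<odot> dl r (y \<odot> ?e)) - f (x0 \<odot> dl r y)"
      have "\<bar>?X - r * (t * a)\<bar> \<le> r * (C * e1) + r * (C * e1) + r * (\<bar>t\<bar> * (2 * M))"
        using A B D[folded fz] unfolding mult.assoc[of r t a] by linarith
      also have "\<dots> = r * (2 * (C * e1) + \<bar>t\<bar> * (2 * M))" by (simp add: algebra_simps)
      also have "\<dots> < r * e" using e1(2) tm e r(1) by (intro mult_strict_left_mono) linarith+
      finally have X: "\<bar>?X - r * (t * a)\<bar> < r * e" .
      have "?X / r - t * a = (?X - r * (t * a)) / r" using r(1) by (simp add: diff_divide_distrib)
      then have "\<bar>?X / r - t * a\<bar> = \<bar>?X - r * (t * a)\<bar> / r" using r(1) by (simp only: abs_divide abs_of_pos)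
      also have "\<dots> < e" using X r(1) by (subst pos_divide_less_eq) (simp_all only: mult.commute[of e r])
      finally show ?thesis .
    qed
    show "\<forall>\<^sub>F r in at_right 0. dist ((f (x0 \<odot> dl r (y \<odot> ?e)) - f (x0 \<odot> dl r y)) / r) (t * a) < e"
      unfolding eventually_at_right_field using r1 main by (intro exI[of _ r1]) (auto simp: dist_real_def)
  qed
qed simp

text \<open>Each letter of a word for y contributes one limit of the preceding lemma, and the
  increments telescope to a linear function because horizontal coordinates add. Rational q keeps the
  exceptional sets countable in number.\<close>

lemma pansu_rademacher_real:
  assumes lip: "\<And>x y. \<bar>f x - f y\<bar> \<le> C * rho x y" and C: "C \<ge> 0"
  shows "negligible {x0. \<not> (\<exists>a. \<forall>y. ((\<lambda>r. (f (x0 \<odot> dl r y) - f x0) / r) \<longlongrightarrow> (\<Sum>i\<in>{i. \<sigma> i = 1}. a i * y $ i)) (at_right 0))}"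
proof -
  define S where "S i m q n = {x. \<forall>h. h \<noteq> 0 \<and> \<bar>h\<bar> < 1 / real (Suc n) \<longrightarrow> \<bar>horiz_quot f i h x - q\<bar> \<le> 1 / real (Suc m)}" for i m q n
  have cf: "continuous_on S f" for S using lipschitz_rho_continuous[OF lip] continuous_on_subset by blast
  have cu: "continuous_on UNIV (horiz_quot f i h)" for h i
    unfolding horiz_quot_def by (cases "h = 0") (auto intro!: continuous_intros continuous_on_compose2[OF cf[of UNIV]])
  have clS: "closed (S i m q n)" for i m q n unfolding S_def
    by (intro closed_Collect_all closed_Collect_imp open_Collect_const closed_Collect_le continuous_intros cu)
  have neg1: "negligible {x \<in> S i m q n. \<not> nonporous (S i m q n) x}" for i m q n
    by (rule negligible_porous) (use clS in auto)
  let ?B1 = "\<Union>((\<lambda>(i,m,q,n). {x \<in> S i m q n. \<not> nonporous (S i m q n) x}) ` (UNIV \<times> UNIV \<times> \<rat> \<times> UNIV))"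
  have B1: "negligible ?B1"
  proof (rule negligible_countable_Union)
    have "countable ((UNIV :: 'n set) \<times> (UNIV :: nat set) \<times> (\<rat> :: real set) \<times> (UNIV :: nat set))"
      by (intro countable_SIGMA) (auto simp: countable_rat countable_finite)
    then show "countable ((\<lambda>(i,m,q,n). {x \<in> S i m q n. \<not> nonporous (S i m q n) x}) ` (UNIV \<times> UNIV \<times> \<rat> \<times> UNIV))" by (rule countable_image)
  qed (use neg1 in auto)
  let ?B2 = "\<Union>i\<in>{i. \<sigma> i = 1}. {x. \<not> (\<exists>l. ((\<lambda>h. horiz_quot f i h x) \<longlongrightarrow> l) (at 0))}"
  have B2: "negligible ?B2"
  proof (rule negligible_Union)
    fix T assume "T \<in> (\<lambda>i. {x. \<not> (\<exists>l. ((\<lambda>h. horiz_quot f i h x) \<longlongrightarrow> l) (at 0))}) ` {i. \<sigma> i = 1}"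
    then obtain i where i: "\<sigma> i = 1" and T: "T = {x. \<not> (\<exists>l. ((\<lambda>h. horiz_quot f i h x) \<longlongrightarrow> l) (at 0))}" by blast
    show "negligible T" unfolding T by (rule horiz_quot_converges_ae[OF lip C i])
  qed simp
  show ?thesis
  proof (rule negligible_subset[OF negligible_Un[OF B1 B2]], rule subsetI, rule ccontr)
    fix x0 assume x0: "x0 \<in> {x0. \<not> (\<exists>a. \<forall>y. ((\<lambda>r. (f (x0 \<odot> dl r y) - f x0) / r) \<longlongrightarrow> (\<Sum>i\<in>{i. \<sigma> i = 1}. a i * y $ i)) (at_right 0))}"
      and nB: "x0 \<notin> ?B1 \<union> ?B2"
    have "\<forall>i. \<exists>l. \<sigma> i = 1 \<longrightarrow> ((\<lambda>h. horiz_quot f i h x0) \<longlongrightarrow> l) (at 0)" using nB by blast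
    then obtain a where a: "\<And>i. \<sigma> i = 1 \<Longrightarrow> ((\<lambda>h. horiz_quot f i h x0) \<longlongrightarrow> a i) (at 0)" by metis
    have dens: "nonporous (S i m q n) x0" if q: "q \<in> \<rat>" and xS: "x0 \<in> S i m q n" for i m q n
    proof (rule ccontr)
      assume "\<not> nonporous (S i m q n) x0"
      then have "x0 \<in> ?B1" using xS q by (intro UnionI[OF imageI[of "(i,m,q,n)"]]) auto
      then show False using nB by blast
    qed
    have step: "((\<lambda>r. (f (x0 \<odot> dl r (y \<odot> (t *\<^sub>R axis i 1))) - f (x0 \<odot> dl r y)) / r) \<longlongrightarrow> t * a i) (at_right 0)"
      if i: "\<sigma> i = 1" for i t y
      by (rule pansu_rademacher_step[OF lip C i a[OF i]]) (rule dens[unfolded S_def])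
    have "((\<lambda>r. (f (x0 \<odot> dl r y) - f x0) / r) \<longlongrightarrow> (\<Sum>i\<in>{i. \<sigma> i = 1}. a i * y $ i)) (at_right 0)" for y
      using W_UNIV[of y]
    proof (induction rule: W.induct)
      case (W_step x i t)
      have "((\<lambda>r. (f (x0 \<odot> dl r (x \<odot> (t *\<^sub>R axis i 1))) - f (x0 \<odot> dl r x)) / r + (f (x0 \<odot> dl r x) - f x0) / r)
          \<longlongrightarrow> t * a i + (\<Sum>i\<in>{i. \<sigma> i = 1}. a i * x $ i)) (at_right 0)"
        by (rule tendsto_add[OF step[OF W_step(2)] W_step(3)])
      moreover have "(\<Sum>k\<in>{k. \<sigma> k = 1}. a k * (x \<odot> (t *\<^sub>R axis i 1)) $ k) = t * a i + (\<Sum>i\<in>{i. \<sigma> i = 1}. a i * x $ i)"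
      proof -
        have "(\<Sum>k\<in>{k. \<sigma> k = 1}. a k * (x \<odot> (t *\<^sub>R axis i 1)) $ k) = (\<Sum>k\<in>{k. \<sigma> k = 1}. a k * x $ k + (if k = i then t * a i else 0))"
          by (rule sum.cong) (auto simp: gm_nth_axis algebra_simps)
        then show ?thesis using W_step(2) by (simp add: sum.distrib)
      qed
      ultimately show ?case by (simp add: add_divide_distrib[symmetric])
    qed simp
    then show False using x0 by blast
  qed
qed

end

section \<open>Homomorphisms from horizontal data\<close>

text \<open>One limit is wanted for all y simultaneously. A product of uncountably many compact sets
  need not be sequentially compact, so a finer filter takes the place of a subsequence.\<close>

lemma tychonoff_cluster_filter:
  fixes \<Psi> :: "'i \<Rightarrow> 'a \<Rightarrow> 'b::topological_space"
  assumes F: "F \<noteq> bot" and mem: "\<And>i y. \<Psi> i y \<in> K y" and K: "\<And>y. compact (K y)"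
  shows "\<exists>G \<psi>. G \<le> F \<and> G \<noteq> bot \<and> (\<forall>y. ((\<lambda>i. \<Psi> i y) \<longlongrightarrow> \<psi> y) G)"
proof -
  have "compactin (product_topology (\<lambda>_. euclidean) UNIV) (PiE UNIV K)"
    using K by (subst compactin_PiE) simp
  then have "compact (PiE UNIV K)" by (simp add: euclidean_product_topology)
  moreover have "filtermap \<Psi> F \<noteq> bot" using F by (simp add: filtermap_bot_iff)
  moreover have "eventually (\<lambda>f. f \<in> PiE UNIV K) (filtermap \<Psi> F)"
    using mem by (auto simp: eventually_filtermap intro!: always_eventually)
  ultimately obtain \<psi> where \<psi>: "inf (nhds \<psi>) (filtermap \<Psi> F) \<noteq> bot" unfolding compact_filter by blast
  \<comment> \<open>The coarsest filter below F along which \<Psi> converges to \<psi>; it is proper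
    because \<psi> is a cluster point.\<close>
  define G where "G = inf (filtercomap \<Psi> (nhds \<psi>)) F"
  have "G \<noteq> bot"
  proof
    assume "G = bot"
    then have "eventually (\<lambda>_. False) (inf (filtercomap \<Psi> (nhds \<psi>)) F)" by (simp add: G_def)
    then obtain P Q where PQ: "eventually P (filtercomap \<Psi> (nhds \<psi>))" "eventually Q F" "\<And>i. P i \<Longrightarrow> Q i \<Longrightarrow> False"
      unfolding eventually_inf by blast
    obtain P' where P': "eventually P' (nhds \<psi>)" "\<And>i. P' (\<Psi> i) \<Longrightarrow> P i"
      using PQ(1) unfolding eventually_filtercomap by blast
    have "eventually (\<lambda>f. \<not> P' f) (filtermap \<Psi> F)"
      unfolding eventually_filtermap using PQ(2) by (rule eventually_mono) (use PQ(3) P'(2) in blast)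
    then have "eventually (\<lambda>_. False) (inf (nhds \<psi>) (filtermap \<Psi> F))"
      unfolding eventually_inf using P'(1) by blast
    then show False using \<psi> by (simp add: trivial_limit_def)
  qed
  moreover have "G \<le> F" unfolding G_def by simp
  moreover have "((\<lambda>i. \<Psi> i y) \<longlongrightarrow> \<psi> y) G" for y
  proof -
    have "filterlim \<Psi> (nhds \<psi>) G"
      unfolding G_def by (rule filterlim_mono[OF filterlim_filtercomap order_refl]) simp
    from continuous_on_tendsto_compose[OF continuous_on_product_coordinates this] show ?thesis by simp
  qed
  ultimately show ?thesis by blast
qed

context carnot begin

text \<open>Divide out the candidate: d t = c t \<odot> (- t w). Its increment over s is governed by
  an element whose horizontal coordinates vanish and whose distance from 0 is O(|s|). The other
  coordinates have degree at least 2, hence are O(s^2), so d has derivative 0.\<close>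

lemma curve_affine:
  assumes lip: "\<And>s t. rho (c s) (c t) \<le> C * \<bar>s - t\<bar>" and C: "C \<ge> 0"
    and hor: "\<And>k t. \<sigma> k = 1 \<Longrightarrow> c t $ k = c 0 $ k + t * w $ k" and w: "\<And>k. \<sigma> k \<noteq> 1 \<Longrightarrow> w $ k = 0"
  shows "c t = c 0 \<odot> (t *\<^sub>R w)"
proof -
  obtain K0 where K0: "K0 > 0" "\<And>x r i. 0 \<le> r \<Longrightarrow> Nm x \<le> r \<Longrightarrow> \<bar>x $ i\<bar> \<le> (K0 * r) ^ \<sigma> i" using Nm_imp_coord by blast
  define d where "d t = c t \<odot> ((- t) *\<^sub>R w)" for t
  define C' where "C' = C + norm w"
  have C': "C' \<ge> 0" using C by (simp add: C'_def)
  define K1 where "K1 = (\<Sum>i\<in>(UNIV::'n set). (K0 * C') ^ \<sigma> i)"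
  have K1: "K1 \<ge> 0" unfolding K1_def using K0(1) C' by (intro sum_nonneg) auto
  have est: "norm (((- c t) \<odot> c (t + s)) \<odot> ((- s) *\<^sub>R w)) \<le> K1 * s\<^sup>2" (is "norm ?e \<le> _") if s: "\<bar>s\<bar> \<le> 1" for t s
  proof -
    have "Nm ?e \<le> Nm ((- c t) \<odot> c (t + s)) + Nm ((- s) *\<^sub>R w)" by (rule Nm_gm)
    also have "Nm ((- c t) \<odot> c (t + s)) \<le> C * \<bar>s\<bar>" using lip[of t "t + s"] by (simp add: rho_Nm)
    also have "Nm ((- s) *\<^sub>R w) \<le> norm ((- s) *\<^sub>R w)" by (rule Nm_horiz) (simp add: w)
    finally have N: "Nm ?e \<le> C' * \<bar>s\<bar>" by (simp add: C'_def algebra_simps)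
    have co: "\<bar>?e $ i\<bar> \<le> (K0 * C') ^ \<sigma> i * s\<^sup>2" for i
    proof (cases "\<sigma> i = 1")
      case True
      have "?e $ i = 0" using hor[OF True, of t] hor[OF True, of "t + s"] True by (simp add: gm_nth_horiz algebra_simps)
      then show ?thesis using K0(1) C' by simp
    next
      case False
      then have i2: "2 \<le> \<sigma> i" using sigma_ge1[of i] by linarith
      have "\<bar>?e $ i\<bar> \<le> (K0 * (C' * \<bar>s\<bar>)) ^ \<sigma> i" using C' N by (intro K0(2)) auto
      also have "\<dots> = (K0 * C') ^ \<sigma> i * \<bar>s\<bar> ^ \<sigma> i" by (simp add: power_mult_distrib mult.assoc)
      also have "\<dots> \<le> (K0 * C') ^ \<sigma> i * \<bar>s\<bar> ^ 2"
        using s i2 K0(1) C' by (intro mult_left_mono power_decreasing) auto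
      finally show ?thesis by simp
    qed
    have "norm ?e \<le> (\<Sum>i\<in>UNIV. \<bar>?e $ i\<bar>)" by (rule norm_le_l1_cart)
    also have "\<dots> \<le> (\<Sum>i\<in>UNIV. (K0 * C') ^ \<sigma> i * s\<^sup>2)" by (intro sum_mono co)
    finally show ?thesis by (simp add: K1_def sum_distrib_right)
  qed
  have der: "(d has_derivative (\<lambda>h. 0)) (at t within UNIV)" for t
    unfolding has_derivative_within_alt
  proof (intro conjI allI impI)
    fix e :: real assume e: "e > 0"
    \<comment> \<open>\<open>Q\<close> takes the small element ?e to d y and 0 to d t;
      differentiability at 0 bounds its increments from 0 by B + 1 times the norm.\<close>
    define Q where "Q u = c t \<odot> (u \<odot> ((- t) *\<^sub>R w))" for u
    have "\<exists>Q'. (Q has_derivative Q') (at 0)"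
      unfolding Q_def by (rule exI, rule gm_has_derivative[OF has_derivative_const gm_left_has_derivative])
    then obtain Q' where Q': "bounded_linear Q'" and Q1: "\<exists>d>0. \<forall>y. norm (y - 0) < d \<longrightarrow> norm (Q y - Q 0 - Q' (y - 0)) \<le> 1 * norm (y - 0)"
      unfolding has_derivative_at_alt using zero_less_one by blast
    obtain d1 where d1: "d1 > 0" "\<And>u. norm u < d1 \<Longrightarrow> norm (Q u - Q 0 - Q' u) \<le> norm u" using Q1 by auto
    obtain B where B: "B > 0" "\<And>u. norm (Q' u) \<le> norm u * B" using bounded_linear.pos_bounded[OF Q'] by blast
    have Qb: "norm (Q u - Q 0) \<le> (B + 1) * norm u" if "norm u < d1" for u
      using d1(2)[OF that] B(2)[of u] norm_triangle_ineq[of "Q u - Q 0 - Q' u" "Q' u"] by (simp add: algebra_simps)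
    define \<delta> where "\<delta> = min 1 (min (d1 / (K1 + 1)) (e / ((B + 1) * (K1 + 1))))"
    have \<delta>: "\<delta> > 0" using d1(1) e B(1) K1 by (auto simp: \<delta>_def intro!: divide_pos_pos mult_pos_pos)
    show "\<exists>\<delta>>0. \<forall>y\<in>UNIV. norm (y - t) < \<delta> \<longrightarrow> norm (d y - d t - 0) \<le> e * norm (y - t)"
    proof (intro exI[of _ \<delta>] conjI ballI impI \<delta>)
      fix y :: real assume y: "norm (y - t) < \<delta>"
      define s where "s = y - t"
      have s: "\<bar>s\<bar> < 1" "\<bar>s\<bar> < d1 / (K1 + 1)" "\<bar>s\<bar> < e / ((B + 1) * (K1 + 1))" using y by (auto simp: s_def \<delta>_def)
      have yt: "y = t + s" by (simp add: s_def)
      let ?e = "((- c t) \<odot> c (t + s)) \<odot> ((- s) *\<^sub>R w)"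
      have ss: "s\<^sup>2 \<le> \<bar>s\<bar>" 
      proof -
        have "\<bar>s\<bar> * \<bar>s\<bar> \<le> \<bar>s\<bar> * 1" using s(1) by (intro mult_left_mono) auto
        then show ?thesis by (simp add: power2_eq_square)
      qed
      have "norm ?e \<le> K1 * s\<^sup>2" using s(1) by (intro est) auto
      also have "\<dots> \<le> K1 * \<bar>s\<bar>" using ss K1 by (rule mult_left_mono)
      also have "\<dots> \<le> (K1 + 1) * \<bar>s\<bar>" by (simp add: distrib_right)
      also have "\<dots> < d1" using s(2) K1 by (simp add: pos_less_divide_eq mult.commute)
      finally have ne: "norm ?e < d1" .
      have dy: "d y = Q ?e"
      proof -
        have "(- (t + s)) *\<^sub>R w = ((- s) *\<^sub>R w) \<odot> ((- t) *\<^sub>R w)" by (subst gm_scaleR) (simp add: algebra_simps)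
        then show ?thesis unfolding d_def Q_def yt by (simp add: gm_assoc)
      qed
      have dt: "d t = Q 0" by (simp add: d_def Q_def)
      have "norm (d y - d t) \<le> (B + 1) * norm ?e" unfolding dy dt by (rule Qb[OF ne])
      also have "\<dots> \<le> (B + 1) * (K1 * s\<^sup>2)" using s(1) B(1) by (intro mult_left_mono est) auto
      also have "\<dots> \<le> ((B + 1) * (K1 + 1) * \<bar>s\<bar>) * \<bar>s\<bar>"
      proof -
        have "K1 * s\<^sup>2 \<le> (K1 + 1) * (\<bar>s\<bar> * \<bar>s\<bar>)" by (simp add: power2_eq_square distrib_right)
        then have "(B + 1) * (K1 * s\<^sup>2) \<le> (B + 1) * ((K1 + 1) * (\<bar>s\<bar> * \<bar>s\<bar>))" using B(1) by (intro mult_left_mono) auto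
        then show ?thesis by (simp only: mult.assoc)
      qed
      also have "\<dots> \<le> e * \<bar>s\<bar>"
      proof (rule mult_right_mono)
        have "(B + 1) * (K1 + 1) > 0" using B(1) K1 by (intro mult_pos_pos) auto
        then show "(B + 1) * (K1 + 1) * \<bar>s\<bar> \<le> e" using s(3) by (simp add: pos_less_divide_eq mult.commute)
      qed simp
      finally show "norm (d y - d t - 0) \<le> e * norm (y - t)" by (simp add: s_def)
    qed
  qed simp
  have "\<exists>k. \<forall>t\<in>UNIV. d t = k" by (rule has_derivative_zero_constant) (auto intro: der)
  then have "d t = d 0" by auto
  then have "c t \<odot> (- (t *\<^sub>R w)) = c 0" by (simp add: d_def)
  then show ?thesis by (metis gm_cancel_right(2))
qed

text \<open>Along a horizontal line \<psi> is a Lipschitz curve with affine horizontal coordinates,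
  so \<open>curve_affine\<close> determines all other coordinates. The resulting right factor does
  not depend on the starting point z.\<close>

lemma horizontal_linear_imp_step:
  assumes lip: "\<And>y z. rho (\<psi> y) (\<psi> z) \<le> C * rho y z" and C: "C \<ge> 0"
    and hor: "\<And>k y. \<sigma> k = 1 \<Longrightarrow> \<psi> y $ k = (\<Sum>i\<in>{i. \<sigma> i = 1}. a k i * y $ i)" and i: "\<sigma> i = 1"
  shows "\<psi> (z \<odot> (t *\<^sub>R axis i 1)) = \<psi> z \<odot> (t *\<^sub>R (\<chi> k. if \<sigma> k = 1 then a k i else 0))"
proof -
  let ?c = "\<lambda>t. \<psi> (z \<odot> (t *\<^sub>R axis i 1))"
  have "?c t = ?c 0 \<odot> (t *\<^sub>R (\<chi> k. if \<sigma> k = 1 then a k i else 0))"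
  proof (rule curve_affine[where C = C])
    show "rho (?c s) (?c t) \<le> C * \<bar>s - t\<bar>" for s t
      by (rule order.trans[OF lip]) (intro mult_left_mono rho_axis i C)
    show "?c t $ k = ?c 0 $ k + t * (\<chi> k. if \<sigma> k = 1 then a k i else 0) $ k" if k: "\<sigma> k = 1" for k t
    proof -
      have "(\<Sum>l\<in>{l. \<sigma> l = 1}. a k l * (z \<odot> (t *\<^sub>R axis i 1)) $ l) = (\<Sum>l\<in>{l. \<sigma> l = 1}. a k l * z $ l + (if l = i then t * a k i else 0))"
        by (rule sum.cong) (auto simp: gm_nth_axis algebra_simps)
      also have "\<dots> = (\<Sum>l\<in>{l. \<sigma> l = 1}. a k l * z $ l) + t * a k i" using i by (simp add: sum.distrib)
      finally show ?thesis using k by (simp add: hor)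
    qed
  qed (use C in auto)
  then show ?thesis by simp
qed

text \<open>Since each letter of a word for y contributes a right factor independent of what
  precedes it, the image of x \<odot> y is the image of x followed by the image of the word.\<close>

lemma horizontal_linear_imp_hom:
  assumes lip: "\<And>y z. rho (\<psi> y) (\<psi> z) \<le> C * rho y z" and C: "C \<ge> 0" and z0: "\<psi> 0 = 0"
    and hor: "\<And>k y. \<sigma> k = 1 \<Longrightarrow> \<psi> y $ k = (\<Sum>i\<in>{i. \<sigma> i = 1}. a k i * y $ i)"
  shows "\<psi> (x \<odot> y) = \<psi> x \<odot> \<psi> y"
  using W_UNIV[of y]
proof (induction rule: W.induct)
  case (W_step y i t)
  have "\<psi> (z \<odot> (t *\<^sub>R axis i 1)) = \<psi> z \<odot> (t *\<^sub>R (\<chi> k. if \<sigma> k = 1 then a k i else 0))" for z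
    by (rule horizontal_linear_imp_step[OF lip C _ W_step(2)]) (rule hor)
  then show ?case using W_step(3) by (simp add: gm_assoc[symmetric])
qed (simp add: z0)

text \<open>Both maps take the same step for each letter of a word. This is what makes all cluster
  points of the blow-ups coincide.\<close>

lemma horizontal_linear_unique:
  assumes lip: "\<And>y z. rho (\<psi> y) (\<psi> z) \<le> C * rho y z" and C: "C \<ge> 0" and z0: "\<psi> 0 = 0"
    and hor: "\<And>k y. \<sigma> k = 1 \<Longrightarrow> \<psi> y $ k = (\<Sum>i\<in>{i. \<sigma> i = 1}. a k i * y $ i)"
    and lip': "\<And>y z. rho (\<psi>' y) (\<psi>' z) \<le> C * rho y z" and z0': "\<psi>' 0 = 0"
    and hor': "\<And>k y. \<sigma> k = 1 \<Longrightarrow> \<psi>' y $ k = (\<Sum>i\<in>{i. \<sigma> i = 1}. a k i * y $ i)"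
  shows "\<psi> y = \<psi>' y"
  using W_UNIV[of y]
proof (induction rule: W.induct)
  case (W_step y i t)
  have "\<psi> (y \<odot> (t *\<^sub>R axis i 1)) = \<psi> y \<odot> (t *\<^sub>R (\<chi> k. if \<sigma> k = 1 then a k i else 0))"
    by (rule horizontal_linear_imp_step[OF lip C _ W_step(2)]) (rule hor)
  moreover have "\<psi>' (y \<odot> (t *\<^sub>R axis i 1)) = \<psi>' y \<odot> (t *\<^sub>R (\<chi> k. if \<sigma> k = 1 then a k i else 0))"
    by (rule horizontal_linear_imp_step[OF lip' C _ W_step(2)]) (rule hor')
  ultimately show ?case using W_step(3) by simp
qed (simp add: z0 z0')

text \<open>Addition is the first-order part of the product at the identity, hence a limit of
  rescaled products. For this reason a continuous homomorphism compatible with such multiples is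
  additive.\<close>

lemma gm_scaled_limit: "(\<lambda>n. real (Suc n) *\<^sub>R (((1 / real (Suc n)) *\<^sub>R x) \<odot> ((1 / real (Suc n)) *\<^sub>R y))) \<longlonglongrightarrow> x + y"
proof -
  have "((\<lambda>t. (t *\<^sub>R x) \<odot> (t *\<^sub>R y)) has_derivative (\<lambda>s. Dg (0 *\<^sub>R x, 0 *\<^sub>R y) (s *\<^sub>R x, s *\<^sub>R y))) (at 0)"
    by (rule gm_has_derivative) (auto intro!: derivative_eq_intros)
  then have l0: "((\<lambda>t::real. norm ((t *\<^sub>R x) \<odot> (t *\<^sub>R y) - t *\<^sub>R (x + y)) / norm t) \<longlongrightarrow> 0) (at 0)"
    unfolding has_derivative_at by (simp add: Dg_0 scaleR_add_right)
  have "((\<lambda>t. norm ((1/t) *\<^sub>R ((t *\<^sub>R x) \<odot> (t *\<^sub>R y)) - (x + y))) \<longlongrightarrow> 0) (at 0)"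
  proof (rule Lim_transform_eventually[OF l0])
    have "norm ((t *\<^sub>R x) \<odot> (t *\<^sub>R y) - t *\<^sub>R (x + y)) / norm t = norm ((1/t) *\<^sub>R ((t *\<^sub>R x) \<odot> (t *\<^sub>R y)) - (x + y))"
      if t: "t \<noteq> 0" for t :: real
    proof -
      have "(1/t) *\<^sub>R ((t *\<^sub>R x) \<odot> (t *\<^sub>R y)) - (x + y) = (1/t) *\<^sub>R ((t *\<^sub>R x) \<odot> (t *\<^sub>R y) - t *\<^sub>R (x + y))"
        using t by (simp add: scaleR_diff_right)
      then show ?thesis by simp
    qed
    then show "\<forall>\<^sub>F t in at 0. norm ((t *\<^sub>R x) \<odot> (t *\<^sub>R y) - t *\<^sub>R (x + y)) / norm t = norm ((1/t) *\<^sub>R ((t *\<^sub>R x) \<odot> (t *\<^sub>R y)) - (x + y))"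
      by (auto simp: eventually_at_filter)
  qed
  then have lim: "((\<lambda>t. (1/t) *\<^sub>R ((t *\<^sub>R x) \<odot> (t *\<^sub>R y))) \<longlongrightarrow> x + y) (at 0)"
    by (rule LIM_zero_cancel[OF tendsto_norm_zero_cancel])
  have "filterlim (\<lambda>n. 1 / real (Suc n)) (at 0) sequentially"
    unfolding filterlim_at using LIMSEQ_inverse_real_of_nat by (auto simp: inverse_eq_divide)
  from filterlim_compose[OF lim this] show ?thesis by simp
qed

lemma lipschitz_hom_linear:
  assumes lip: "\<And>y z. rho (\<psi> y) (\<psi> z) \<le> C * rho y z" and hom: "\<And>x y. \<psi> (x \<odot> y) = \<psi> x \<odot> \<psi> y"
  shows "linear \<psi>"
proof -
  have \<psi>0: "\<psi> 0 = 0" using hom[of 0 0] by (metis gm_0_right gm_left_inj)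
  have cont: "((\<lambda>i. \<psi> (f i)) \<longlongrightarrow> \<psi> a) F" if f: "(f \<longlongrightarrow> a) F" for f a and F :: "'z filter"
  proof (rule rho_tendsto_0_imp)
    have "((\<lambda>i. C * rho (f i) a) \<longlongrightarrow> C * rho a a) F" by (intro tendsto_intros f)
    then have "((\<lambda>i. C * rho (f i) a) \<longlongrightarrow> 0) F" by simp
    then show "((\<lambda>i. rho (\<psi> (f i)) (\<psi> a)) \<longlongrightarrow> 0) F"
      by (rule tendsto_sandwich[OF always_eventually always_eventually tendsto_const, rotated 2]) (auto simp: rho_nonneg lip)
  qed
  have nat: "\<psi> (real n *\<^sub>R x) = real n *\<^sub>R \<psi> x" for n x
  proof (induction n)
    case (Suc n)
    have "real (Suc n) *\<^sub>R z = (real n *\<^sub>R z) \<odot> z" for z using gm_scaleR[of "real n" z 1] by (simp add: add.commute)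
    then show ?case using Suc hom by metis
  qed (simp add: \<psi>0)
  have inv: "\<psi> ((1 / real (Suc n)) *\<^sub>R x) = (1 / real (Suc n)) *\<^sub>R \<psi> x" for n x
    using nat[of "Suc n" "(1 / real (Suc n)) *\<^sub>R x"] by (simp add: eq_vector_fraction_iff del: of_nat_Suc)
  have add: "\<psi> (x + y) = \<psi> x + \<psi> y" for x y
  proof (rule LIMSEQ_unique)
    show "(\<lambda>n. \<psi> (real (Suc n) *\<^sub>R (((1 / real (Suc n)) *\<^sub>R x) \<odot> ((1 / real (Suc n)) *\<^sub>R y)))) \<longlonglongrightarrow> \<psi> (x + y)"
      by (rule cont[OF gm_scaled_limit])
    show "(\<lambda>n. \<psi> (real (Suc n) *\<^sub>R (((1 / real (Suc n)) *\<^sub>R x) \<odot> ((1 / real (Suc n)) *\<^sub>R y)))) \<longlonglongrightarrow> \<psi> x + \<psi> y"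
      unfolding nat hom inv by (rule gm_scaled_limit)
  qed
  have neg: "\<psi> (- x) = - \<psi> x" for x using add[of x "- x"] \<psi>0 by (simp add: eq_neg_iff_add_eq_0 add.commute)
  have int: "\<psi> (real_of_int m *\<^sub>R x) = real_of_int m *\<^sub>R \<psi> x" for m x
  proof (cases "m \<ge> 0")
    case True
    then show ?thesis using nat[of "nat m" x] by simp
  next
    case False
    then show ?thesis using nat[of "nat (- m)" x] neg[of "real_of_int (- m) *\<^sub>R x"] by simp
  qed
  have sc: "\<psi> (t *\<^sub>R x) = t *\<^sub>R \<psi> x" for t x
  proof (rule LIMSEQ_unique)
    \<comment> \<open>Rational approximations of t with denominator n + 1, for which homogeneity is
      already known; continuity then gives it for t.\<close>
    let ?q = "\<lambda>n. (1 / real (Suc n)) * real_of_int \<lfloor>real (Suc n) * t\<rfloor>"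
    have q: "?q \<longlonglongrightarrow> t"
    proof (rule LIMSEQ_I)
      fix e :: real assume "e > 0"
      then obtain N where N: "1 / real (Suc N) < e" using nat_approx_posE by blast
      have "norm (?q n - t) < e" if n: "n \<ge> N" for n
      proof -
        have "\<bar>real_of_int \<lfloor>real (Suc n) * t\<rfloor> - real (Suc n) * t\<bar> \<le> 1" by linarith
        then have "(1 / real (Suc n)) * \<bar>real_of_int \<lfloor>real (Suc n) * t\<rfloor> - real (Suc n) * t\<bar> \<le> (1 / real (Suc n)) * 1"
          by (intro mult_left_mono) auto
        moreover have "norm (?q n - t) = (1 / real (Suc n)) * \<bar>real_of_int \<lfloor>real (Suc n) * t\<rfloor> - real (Suc n) * t\<bar>"
        proof -
          have "?q n - t = (1 / real (Suc n)) * (real_of_int \<lfloor>real (Suc n) * t\<rfloor> - real (Suc n) * t)"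
            by (simp add: right_diff_distrib del: of_nat_Suc)
          then show ?thesis by (simp add: abs_mult del: of_nat_Suc)
        qed
        moreover have "1 / real (Suc n) \<le> 1 / real (Suc N)" using n by (intro divide_left_mono) auto
        ultimately show ?thesis using N by linarith
      qed
      then show "\<exists>no. \<forall>n\<ge>no. norm (?q n - t) < e" by blast
    qed
    show "(\<lambda>n. \<psi> (?q n *\<^sub>R x)) \<longlonglongrightarrow> \<psi> (t *\<^sub>R x)" by (intro cont tendsto_intros q)
    have "\<psi> (?q n *\<^sub>R x) = ?q n *\<^sub>R \<psi> x" for n
      using inv[of n "real_of_int \<lfloor>real (Suc n) * t\<rfloor> *\<^sub>R x"] int by simp
    then show "(\<lambda>n. \<psi> (?q n *\<^sub>R x)) \<longlonglongrightarrow> t *\<^sub>R \<psi> x" using tendsto_scaleR[OF q tendsto_const] by simp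
  qed
  show ?thesis by (rule linearI) (simp_all add: add sc)
qed

text \<open>On horizontal letters a dilation is a scalar multiplication and L stays horizontal; both
  sides are multiplicative along words.\<close>

lemma contact_dl:
  assumes L: "contactomorphism gm \<sigma> L" and r: "r > 0"
  shows "L (dl r x) = dl r (L x)"
  using W_UNIV[of x]
proof (induction rule: W.induct)
  case W_0
  then show ?case using L by (simp add: contactomorphism_def linear_0)
next
  case (W_step x i t)
  have lin: "linear L" and hom: "\<And>x y. L (x \<odot> y) = L x \<odot> L y" and lay: "L ` layer \<sigma> 1 \<subseteq> layer \<sigma> 1"
    using L unfolding contactomorphism_def by blast+
  have "axis i 1 \<in> layer \<sigma> 1" using W_step(2) by (auto simp: layer_iff axis_def)
  then have "L (axis i 1) \<in> layer \<sigma> 1" using lay by blast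
  then have "dl r (L (axis i 1)) = r *\<^sub>R L (axis i 1)" using dl_layer[of "L (axis i 1)" 1 r] by simp
  then have "L (dl r (t *\<^sub>R axis i 1)) = dl r (L (t *\<^sub>R axis i 1))"
    using W_step(2) by (simp add: linear_scale[OF linear_dl] linear_scale[OF lin] dl_axis)
  then show ?case using W_step(3) by (simp add: dl_gm[OF r, symmetric] hom)
qed

text \<open>Lipschitz maps into the group do not extend in general, but real functions do. This is
  applied to the horizontal coordinates of \<phi>, to which the differentiability theorem on the
  whole group then applies.\<close>

lemma mcshane_extension:
  assumes lip: "\<And>x y. x \<in> E \<Longrightarrow> y \<in> E \<Longrightarrow> \<bar>f x - f y\<bar> \<le> C * rho x y" and C: "C \<ge> 0"
  shows "\<exists>g :: real^'n \<Rightarrow> real. (\<forall>x\<in>E. g x = f x) \<and> (\<forall>x y. \<bar>g x - g y\<bar> \<le> C * rho x y)"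
proof (cases "E = {}")
  case True
  then show ?thesis using C rho_nonneg by (intro exI[of _ "\<lambda>x. 0"]) auto
next
  case False
  then obtain e0 where e0: "e0 \<in> E" by blast
  define g where "g x = (INF y\<in>E. f y + C * rho x y)" for x
  have bd: "bdd_below ((\<lambda>y. f y + C * rho x y) ` E)" for x
  proof (rule bdd_belowI2)
    fix y assume y: "y \<in> E"
    have "f e0 - f y \<le> C * rho e0 y" using lip[OF e0 y] by linarith
    also have "\<dots> \<le> C * (rho x e0 + rho x y)" using rho_triangle[of e0 y x] C by (intro mult_left_mono) (auto simp: rho_sym)
    finally show "f e0 - C * rho x e0 \<le> f y + C * rho x y" by (simp add: algebra_simps)
  qed
  have "g x = f x" if x: "x \<in> E" for x
  proof (rule antisym)
    show "g x \<le> f x" unfolding g_def using cINF_lower[OF bd x, of x] by simp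
    show "f x \<le> g x" unfolding g_def
    proof (rule cINF_greatest[OF False])
      fix y assume "y \<in> E"
      then show "f x \<le> f y + C * rho x y" using lip[OF x, of y] by linarith
    qed
  qed
  moreover have half: "g x - g z \<le> C * rho x z" for x z
  proof -
    have "g x - C * rho x z \<le> g z"
      unfolding g_def[of z]
    proof (rule cINF_greatest[OF False])
      fix y assume y: "y \<in> E"
      have "g x \<le> f y + C * rho x y" unfolding g_def by (rule cINF_lower[OF bd y])
      also have "\<dots> \<le> f y + C * (rho x z + rho z y)" using rho_triangle[of x y z] C by (intro add_left_mono mult_left_mono)
      finally show "g x - C * rho x z \<le> f y + C * rho z y" by (simp add: algebra_simps)
    qed
    then show ?thesis by simp
  qed
  moreover have "\<bar>g x - g z\<bar> \<le> C * rho x z" for x z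
    using half[of x z] half[of z x] by (simp add: rho_sym[of z x] abs_le_iff)
  ultimately show ?thesis by blast
qed

end

section \<open>Pansu differentiability almost everywhere\<close>

context carnot begin

lemma near_point_ex:
  assumes "x0 \<in> E"
  shows "\<exists>z'\<in>E. rho z z' \<le> rho x0 z \<and> (\<forall>w\<in>E. rho z z' \<le> rho z w + (rho x0 z)\<^sup>2)"
proof (cases "rho x0 z = 0")
  case True
  then show ?thesis using assms rho_nonneg by (intro bexI[of _ x0]) (auto simp: rho_sym[of z x0])
next
  case False
  let ?e = "INF w\<in>E. rho z w"
  have bd: "bdd_below ((\<lambda>w. rho z w) ` E)" by (rule bdd_belowI2[of _ 0]) (rule rho_nonneg)
  have ne: "(\<lambda>w. rho z w) ` E \<noteq> {}" using assms by blast
  have "?e < ?e + (rho x0 z)\<^sup>2" using False by simp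
  from cInf_lessD[OF ne this] obtain w where w: "w \<in> E" "rho z w < ?e + (rho x0 z)\<^sup>2" by blast
  have le: "?e \<le> rho z w'" if "w' \<in> E" for w' by (rule cINF_lower[OF bd that])
  show ?thesis
  proof (cases "rho z w \<le> rho x0 z")
    case True
    have "rho z w \<le> rho z w' + (rho x0 z)\<^sup>2" if "w' \<in> E" for w' using le[OF that] w(2) by linarith
    then show ?thesis using True w(1) by blast
  next
    \<comment> \<open>The approximate minimiser w is farther from z than x0 is, so x0 itself does
      the job.\<close>
    case False
    have "rho z x0 \<le> rho z w' + (rho x0 z)\<^sup>2" if "w' \<in> E" for w' using le[OF that] w(2) False rho_sym[of z x0] by linarith
    then show ?thesis using assms rho_sym[of z x0] by (intro bexI[of _ x0]) auto
  qed
qed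

text \<open>The quadratic error replaces a nearest point, which need not exist as E is not assumed closed.\<close>

definition near :: "(real^'n) set \<Rightarrow> real^'n \<Rightarrow> real^'n \<Rightarrow> real^'n" where
  "near E x0 z = (SOME z'. z' \<in> E \<and> rho z z' \<le> rho x0 z \<and> (\<forall>w\<in>E. rho z z' \<le> rho z w + (rho x0 z)\<^sup>2))"

lemma near: assumes "x0 \<in> E"
  shows "near E x0 z \<in> E" "rho z (near E x0 z) \<le> rho x0 z" "w \<in> E \<Longrightarrow> rho z (near E x0 z) \<le> rho z w + (rho x0 z)\<^sup>2"
proof -
  have "\<exists>z'. z' \<in> E \<and> rho z z' \<le> rho x0 z \<and> (\<forall>w\<in>E. rho z z' \<le> rho z w + (rho x0 z)\<^sup>2)"
    using near_point_ex[OF assms, of z] by blast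
  from someI_ex[OF this] show "near E x0 z \<in> E" "rho z (near E x0 z) \<le> rho x0 z"
    "w \<in> E \<Longrightarrow> rho z (near E x0 z) \<le> rho z w + (rho x0 z)\<^sup>2"
    unfolding near_def by blast+
qed

lemma near_small:
  assumes x0: "x0 \<in> E" and d: "nonporous E x0" and \<theta>: "\<theta> > 0"
  shows "\<exists>r0>0. \<forall>z. rho x0 z < r0 \<longrightarrow> rho z (near E x0 z) \<le> \<theta> * rho x0 z"
proof -
  have "\<theta>/2 > 0" using \<theta> by simp
  then obtain r0 where r0: "r0 > 0" "\<forall>z. rho x0 z < r0 \<longrightarrow> (\<exists>z'\<in>E. rho z z' \<le> (\<theta>/2) * rho x0 z)"
    using d unfolding nonporous_def by blast
  show ?thesis
  proof (intro exI[of _ "min r0 (\<theta>/2)"] conjI allI impI)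
    fix z assume z: "rho x0 z < min r0 (\<theta>/2)"
    then obtain z' where z': "z' \<in> E" "rho z z' \<le> (\<theta>/2) * rho x0 z" using r0(2) by auto
    have "(rho x0 z)\<^sup>2 \<le> (\<theta>/2) * rho x0 z"
      unfolding power2_eq_square using z rho_nonneg[of x0 z] by (intro mult_right_mono) auto
    then show "rho z (near E x0 z) \<le> \<theta> * rho x0 z"
      using near(3)[OF x0 z'(1), of z] z'(2) by (simp add: field_simps)
  qed (use r0(1) \<theta> in simp)
qed

text \<open>\<phi> is known on E only, so the rescaled map at y is sampled at an approximate nearest
  point of E. The rescaled displacement of the sample is \<open>gap\<close>, which tends to 0 at a
  non-porous point.\<close>

definition blow :: "(real^'n) set \<Rightarrow> (real^'n \<Rightarrow> real^'n) \<Rightarrow> real^'n \<Rightarrow> real \<Rightarrow> real^'n \<Rightarrow> real^'n" where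
  "blow E \<phi> x0 r y = dl (1/r) ((- \<phi> x0) \<odot> \<phi> (near E x0 (x0 \<odot> dl r y)))"

definition gap :: "(real^'n) set \<Rightarrow> real^'n \<Rightarrow> real \<Rightarrow> real^'n \<Rightarrow> real" where
  "gap E x0 r y = rho (x0 \<odot> dl r y) (near E x0 (x0 \<odot> dl r y)) / r"

lemma gap_tendsto:
  assumes x0: "x0 \<in> E" and d: "nonporous E x0" and r: "(r \<longlongrightarrow> 0) F" "\<And>i. r i > 0"
  shows "((\<lambda>i. gap E x0 (r i) y) \<longlongrightarrow> 0) F"
  unfolding tendsto_iff
proof (intro allI impI)
  fix e :: real assume e: "e > 0"
  define \<theta> where "\<theta> = e / (Nm y + 1)"
  have N1: "Nm y + 1 > 0" using Nm_nonneg[of y] by linarith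
  have \<theta>: "\<theta> > 0" using e N1 by (simp add: \<theta>_def)
  have \<theta>e: "\<theta> * Nm y < e"
  proof -
    have "\<theta> * Nm y < \<theta> * (Nm y + 1)" using \<theta> by simp
    also have "\<dots> = e" using N1 by (simp add: \<theta>_def)
    finally show ?thesis .
  qed
  obtain r0 where r0: "r0 > 0" "\<forall>z. rho x0 z < r0 \<longrightarrow> rho z (near E x0 z) \<le> \<theta> * rho x0 z"
    using near_small[OF x0 d \<theta>] by blast
  have "((\<lambda>i. r i * Nm y) \<longlongrightarrow> 0 * Nm y) F" by (intro tendsto_intros r)
  then have "eventually (\<lambda>i. dist (r i * Nm y) 0 < r0) F" using r0(1) by (auto dest: tendstoD)
  then show "eventually (\<lambda>i. dist (gap E x0 (r i) y) 0 < e) F"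
  proof (rule eventually_mono)
    fix i assume i: "dist (r i * Nm y) 0 < r0"
    let ?z = "x0 \<odot> dl (r i) y"
    have z: "rho x0 ?z = r i * Nm y" using r(2)[of i] by (simp add: rho_gm_right Nm_dl)
    have "rho x0 ?z < r0" using i z by (simp add: dist_real_def)
    then have "rho ?z (near E x0 ?z) \<le> \<theta> * (r i * Nm y)" using r0(2) z by metis
    then have "gap E x0 (r i) y \<le> \<theta> * Nm y" unfolding gap_def using r(2)[of i] by (simp add: pos_divide_le_eq mult.assoc mult.commute mult.left_commute)
    moreover have "gap E x0 (r i) y \<ge> 0" unfolding gap_def using r(2)[of i] rho_nonneg by (simp add: less_imp_le)
    ultimately show "dist (gap E x0 (r i) y) 0 < e" using \<theta>e by (simp add: dist_real_def)
  qed
qed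

lemma near_rho_le:
  assumes "r > 0"
  shows "rho (near E x0 (x0 \<odot> dl r y)) (near E x0 (x0 \<odot> dl r y')) / r \<le> gap E x0 r y + rho y y' + gap E x0 r y'"
proof -
  let ?z = "x0 \<odot> dl r y" and ?z' = "x0 \<odot> dl r y'"
  have "rho (near E x0 ?z) (near E x0 ?z') \<le> rho (near E x0 ?z) ?z + (rho ?z ?z' + rho ?z' (near E x0 ?z'))"
    using rho_triangle[of "near E x0 ?z" "near E x0 ?z'" ?z] rho_triangle[of ?z "near E x0 ?z'" ?z'] by linarith
  also have "rho ?z ?z' = r * rho y y'" using assms by (simp add: rho_left rho_dl)
  finally have "rho (near E x0 ?z) (near E x0 ?z') / r \<le> (rho (near E x0 ?z) ?z + (r * rho y y' + rho ?z' (near E x0 ?z'))) / r"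
    using assms by (simp add: divide_right_mono)
  also have "\<dots> = gap E x0 r y + rho y y' + gap E x0 r y'"
    using assms by (simp add: gap_def add_divide_distrib rho_sym[of _ ?z])
  finally show ?thesis .
qed

lemma rho_blow:
  assumes "r > 0"
  shows "rho (dl (1/r) ((- a) \<odot> u)) (dl (1/r) ((- a) \<odot> v)) = rho u v / r"
  using assms by (simp add: rho_dl rho_left)

text \<open>The displacement of the samples vanishes in the limit, so the Lipschitz bound survives
  with the same constant C. The horizontal coordinates of the limit are read off the extensions f,
  whose difference quotients converge.\<close>

lemma blow_cluster:
  fixes r :: "nat \<Rightarrow> real"
  assumes x0: "x0 \<in> E" and d: "nonporous E x0" and r: "r \<longlonglongrightarrow> 0" "\<And>i. r i > 0"
    and lip: "\<And>x y. x \<in> E \<Longrightarrow> y \<in> E \<Longrightarrow> rho (\<phi> x) (\<phi> y) \<le> C * rho x y" and C: "C \<ge> 0"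
    and f: "\<And>k x. \<sigma> k = 1 \<Longrightarrow> x \<in> E \<Longrightarrow> f k x = \<phi> x $ k"
    and flip: "\<And>k x y. \<sigma> k = 1 \<Longrightarrow> \<bar>f k x - f k y\<bar> \<le> C' * rho x y"
    and a: "\<And>k y. \<sigma> k = 1 \<Longrightarrow> ((\<lambda>r. (f k (x0 \<odot> dl r y) - f k x0) / r) \<longlongrightarrow> (\<Sum>i\<in>{i. \<sigma> i = 1}. a k i * y $ i)) (at_right 0)"
  shows "\<exists>G \<psi>. G \<le> sequentially \<and> G \<noteq> bot \<and> (\<forall>y. ((\<lambda>n. blow E \<phi> x0 (r n) y) \<longlongrightarrow> \<psi> y) G) \<and>
     (\<forall>y z. rho (\<psi> y) (\<psi> z) \<le> C * rho y z) \<and> \<psi> 0 = 0 \<and>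
     (\<forall>k y. \<sigma> k = 1 \<longrightarrow> \<psi> y $ k = (\<Sum>i\<in>{i. \<sigma> i = 1}. a k i * y $ i))"
proof -
  \<comment> \<open>The sample is at most twice as far from x0 as the point it replaces; this
    provides the compact sets for Tychonoff's theorem.\<close>
  have mem: "blow E \<phi> x0 (r n) y \<in> cB 0 (2 * C * Nm y)" for n y
  proof -
    let ?z = "x0 \<odot> dl (r n) y"
    have z: "rho x0 ?z = r n * Nm y" using r(2)[of n] by (simp add: rho_gm_right Nm_dl)
    have "rho x0 (near E x0 ?z) \<le> 2 * (r n * Nm y)"
      using rho_triangle[of x0 "near E x0 ?z" ?z] near(2)[OF x0, of ?z] z by linarith
    then have "C * rho x0 (near E x0 ?z) \<le> C * (2 * (r n * Nm y))" using C by (rule mult_left_mono)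
    then have le: "rho (\<phi> x0) (\<phi> (near E x0 ?z)) \<le> C * (2 * (r n * Nm y))"
      using lip[OF x0 near(1)[OF x0, of ?z]] by linarith
    have "rho 0 (blow E \<phi> x0 (r n) y) = rho (\<phi> x0) (\<phi> (near E x0 ?z)) / r n"
      using rho_blow[OF r(2)[of n], of "\<phi> x0" "\<phi> x0" "\<phi> (near E x0 ?z)"] by (simp add: blow_def)
    also have "\<dots> \<le> (C * (2 * (r n * Nm y))) / r n" using le r(2)[of n] by (intro divide_right_mono) auto
    also have "\<dots> = 2 * C * Nm y" using r(2)[of n] by simp
    finally show ?thesis by (simp add: cB_def)
  qed
  obtain G \<psi> where G: "G \<le> sequentially" "G \<noteq> bot" and lim: "\<And>y. ((\<lambda>n. blow E \<phi> x0 (r n) y) \<longlongrightarrow> \<psi> y) G"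
    using tychonoff_cluster_filter[of sequentially "\<lambda>n. blow E \<phi> x0 (r n)" "\<lambda>y. cB 0 (2 * C * Nm y)"] mem compact_cB
    by (metis sequentially_bot)
  have rG: "(r \<longlongrightarrow> 0) G" by (rule tendsto_mono[OF G(1) r(1)])
  have gG: "((\<lambda>n. gap E x0 (r n) y) \<longlongrightarrow> 0) G" for y by (rule gap_tendsto[OF x0 d rG r(2)])
  have L: "rho (\<psi> y) (\<psi> z) \<le> C * rho y z" for y z
  proof (rule tendsto_le[OF G(2)])
    show "((\<lambda>n. rho (blow E \<phi> x0 (r n) y) (blow E \<phi> x0 (r n) z)) \<longlongrightarrow> rho (\<psi> y) (\<psi> z)) G" by (intro tendsto_intros lim)
    have "((\<lambda>n. C * (gap E x0 (r n) y + rho y z + gap E x0 (r n) z)) \<longlongrightarrow> C * (0 + rho y z + 0)) G" by (intro tendsto_intros gG)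
    then show "((\<lambda>n. C * (gap E x0 (r n) y + rho y z + gap E x0 (r n) z)) \<longlongrightarrow> C * rho y z) G" by simp
    show "\<forall>\<^sub>F n in G. rho (blow E \<phi> x0 (r n) y) (blow E \<phi> x0 (r n) z) \<le> C * (gap E x0 (r n) y + rho y z + gap E x0 (r n) z)"
    proof (intro always_eventually allI)
      fix n
      let ?u = "near E x0 (x0 \<odot> dl (r n) y)" and ?v = "near E x0 (x0 \<odot> dl (r n) z)"
      have "rho (blow E \<phi> x0 (r n) y) (blow E \<phi> x0 (r n) z) = rho (\<phi> ?u) (\<phi> ?v) / r n"
        unfolding blow_def by (rule rho_blow[OF r(2)])
      also have "\<dots> \<le> (C * rho ?u ?v) / r n"
        using lip[OF near(1)[OF x0] near(1)[OF x0]] r(2)[of n] by (simp add: divide_right_mono)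
      also have "\<dots> = C * (rho ?u ?v / r n)" by simp
      also have "\<dots> \<le> C * (gap E x0 (r n) y + rho y z + gap E x0 (r n) z)"
        using near_rho_le[OF r(2)] C by (intro mult_left_mono)
      finally show "rho (blow E \<phi> x0 (r n) y) (blow E \<phi> x0 (r n) z) \<le> C * (gap E x0 (r n) y + rho y z + gap E x0 (r n) z)" .
    qed
  qed
  have Z: "\<psi> 0 = 0"
  proof -
    have "rho x0 (near E x0 x0) \<le> 0" using near(2)[OF x0, of x0] by simp
    then have "near E x0 x0 = x0" using rho_eq_0[of x0 "near E x0 x0"] rho_nonneg[of x0 "near E x0 x0"] by simp
    then have "blow E \<phi> x0 (r n) 0 = 0" for n by (simp add: blow_def)
    then have "((\<lambda>n. 0) \<longlongrightarrow> \<psi> 0) G" using lim[of 0] by simp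
    then show ?thesis using tendsto_unique[OF G(2) _ tendsto_const] by metis
  qed
  have H: "\<psi> y $ k = (\<Sum>i\<in>{i. \<sigma> i = 1}. a k i * y $ i)" if k: "\<sigma> k = 1" for k y
  proof (rule tendsto_unique[OF G(2)])
    show "((\<lambda>n. blow E \<phi> x0 (r n) y $ k) \<longlongrightarrow> \<psi> y $ k) G" by (rule tendsto_vec_nth[OF lim])
    have rr: "filterlim r (at_right 0) G"
      unfolding filterlim_at using rG r(2) by (auto intro!: always_eventually simp: less_imp_le less_imp_neq[THEN not_sym])
    have A: "((\<lambda>n. (f k (x0 \<odot> dl (r n) y) - f k x0) / r n) \<longlongrightarrow> (\<Sum>i\<in>{i. \<sigma> i = 1}. a k i * y $ i)) G"
      by (rule filterlim_compose[OF a[OF k] rr])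
    have B: "((\<lambda>n. (f k (near E x0 (x0 \<odot> dl (r n) y)) - f k (x0 \<odot> dl (r n) y)) / r n) \<longlongrightarrow> 0) G"
    proof (rule tendsto_0_le[where K = "\<bar>C'\<bar>"])
      show "((\<lambda>n. gap E x0 (r n) y) \<longlongrightarrow> 0) G" by (rule gG)
      show "\<forall>\<^sub>F n in G. norm ((f k (near E x0 (x0 \<odot> dl (r n) y)) - f k (x0 \<odot> dl (r n) y)) / r n) \<le> norm (gap E x0 (r n) y) * \<bar>C'\<bar>"
      proof (intro always_eventually allI)
        fix n
        let ?z = "x0 \<odot> dl (r n) y"
        have "\<bar>f k (near E x0 ?z) - f k ?z\<bar> \<le> C' * rho ?z (near E x0 ?z)" using flip[OF k, of "near E x0 ?z" ?z] by (simp add: rho_sym)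
        also have "\<dots> \<le> \<bar>C'\<bar> * rho ?z (near E x0 ?z)" by (intro mult_right_mono rho_nonneg) auto
        finally have "\<bar>f k (near E x0 ?z) - f k ?z\<bar> / r n \<le> (\<bar>C'\<bar> * rho ?z (near E x0 ?z)) / r n"
          using r(2)[of n] by (simp add: divide_right_mono)
        then show "norm ((f k (near E x0 ?z) - f k ?z) / r n) \<le> norm (gap E x0 (r n) y) * \<bar>C'\<bar>"
          using r(2)[of n] rho_nonneg[of ?z "near E x0 ?z"] by (simp add: gap_def abs_divide mult.commute)
      qed
    qed
    have "blow E \<phi> x0 (r n) y $ k = (f k (near E x0 (x0 \<odot> dl (r n) y)) - f k (x0 \<odot> dl (r n) y)) / r n + (f k (x0 \<odot> dl (r n) y) - f k x0) / r n" for n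
    proof -
      have "blow E \<phi> x0 (r n) y $ k = (f k (near E x0 (x0 \<odot> dl (r n) y)) - f k x0) / r n"
        using k by (simp add: blow_def gm_nth_horiz f near(1)[OF x0] x0)
      then show ?thesis by (simp add: diff_divide_distrib)
    qed
    then show "((\<lambda>n. blow E \<phi> x0 (r n) y $ k) \<longlongrightarrow> (\<Sum>i\<in>{i. \<sigma> i = 1}. a k i * y $ i)) G"
      using tendsto_add[OF B A] by simp
  qed
  show ?thesis using G lim L Z H by blast
qed

text \<open>L is a cluster point along one sequence of scales. A sequence of points violating
  differentiability is rescaled by its distances from x0; its blow-ups also have a cluster point,
  which has the same horizontal coordinates and so equals L. As the directions converge along a
  subsequence, the error must fall below \<epsilon>.\<close>

lemma pansu_differentiable_at:
  assumes x0: "x0 \<in> E" and d: "nonporous E x0"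
    and lip: "\<And>x y. x \<in> E \<Longrightarrow> y \<in> E \<Longrightarrow> rho (\<phi> x) (\<phi> y) \<le> C * rho x y" and C: "C \<ge> 0"
    and f: "\<And>k x. \<sigma> k = 1 \<Longrightarrow> x \<in> E \<Longrightarrow> f k x = \<phi> x $ k"
    and flip: "\<And>k x y. \<sigma> k = 1 \<Longrightarrow> \<bar>f k x - f k y\<bar> \<le> C' * rho x y"
    and a: "\<And>k y. \<sigma> k = 1 \<Longrightarrow> ((\<lambda>r. (f k (x0 \<odot> dl r y) - f k x0) / r) \<longlongrightarrow> (\<Sum>i\<in>{i. \<sigma> i = 1}. a k i * y $ i)) (at_right 0)"
  shows "\<exists>L. pansu_diff_with gm \<sigma> E \<phi> x0 L"
proof -
  have cl: "\<exists>G \<psi>. G \<le> sequentially \<and> G \<noteq> bot \<and> (\<forall>y. ((\<lambda>n. blow E \<phi> x0 (r n) y) \<longlongrightarrow> \<psi> y) G) \<and>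
     (\<forall>y z. rho (\<psi> y) (\<psi> z) \<le> C * rho y z) \<and> \<psi> 0 = 0 \<and>
     (\<forall>k y. \<sigma> k = 1 \<longrightarrow> \<psi> y $ k = (\<Sum>i\<in>{i. \<sigma> i = 1}. a k i * y $ i))"
    if r: "r \<longlonglongrightarrow> 0" "\<And>i. r i > 0" for r :: "nat \<Rightarrow> real"
    by (rule blow_cluster[OF x0 d r lip C]) (assumption | rule f flip a)+
  have n0: "(\<lambda>n. 1 / real (Suc n)) \<longlonglongrightarrow> 0" using LIMSEQ_inverse_real_of_nat by (simp add: inverse_eq_divide)
  from cl[OF n0] obtain L where lipL: "\<And>y z. rho (L y) (L z) \<le> C * rho y z" and L0: "L 0 = 0"
    and horL: "\<And>k y. \<sigma> k = 1 \<Longrightarrow> L y $ k = (\<Sum>i\<in>{i. \<sigma> i = 1}. a k i * y $ i)" by fastforce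
  have hom: "L (x \<odot> y) = L x \<odot> L y" for x y
    by (rule horizontal_linear_imp_hom[OF lipL C L0]) (rule horL)
  have lin: "linear L" by (rule lipschitz_hom_linear[OF lipL hom])
  have Lax: "L (axis i 1) \<in> layer \<sigma> 1" if "\<sigma> i = 1" for i
  proof -
    have "L (0 \<odot> (1 *\<^sub>R axis i 1)) = L 0 \<odot> (1 *\<^sub>R (\<chi> k. if \<sigma> k = 1 then a k i else 0))"
      by (rule horizontal_linear_imp_step[OF lipL C _ that]) (rule horL)
    then show ?thesis by (simp add: L0 layer_iff)
  qed
  have "L ` layer \<sigma> 1 \<subseteq> layer \<sigma> 1"
  proof -
    have "L ` layer \<sigma> 1 = span (L ` {axis i 1 |i. \<sigma> i = 1})" unfolding layer_def by (rule linear_span_image[OF lin, symmetric])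
    also have "\<dots> \<subseteq> layer \<sigma> 1" by (rule span_minimal[OF _ subspace_layer]) (use Lax in blast)
    finally show ?thesis .
  qed
  then have contact: "contactomorphism gm \<sigma> L" using lin hom unfolding contactomorphism_def by blast
  have "\<exists>\<delta>>0. \<forall>x\<in>E. rho x0 x < \<delta> \<longrightarrow> rho ((- \<phi> x0) \<odot> \<phi> x) (L ((- x0) \<odot> x)) \<le> \<epsilon> * rho x0 x" if \<epsilon>: "\<epsilon> > 0" for \<epsilon>
  proof (rule ccontr)
    assume no: "\<not> (\<exists>\<delta>>0. \<forall>x\<in>E. rho x0 x < \<delta> \<longrightarrow> rho ((- \<phi> x0) \<odot> \<phi> x) (L ((- x0) \<odot> x)) \<le> \<epsilon> * rho x0 x)"
    have "\<exists>x\<in>E. rho x0 x < 1 / real (Suc n) \<and> rho ((- \<phi> x0) \<odot> \<phi> x) (L ((- x0) \<odot> x)) > \<epsilon> * rho x0 x" for n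
    proof (rule ccontr)
      assume "\<not> (\<exists>x\<in>E. rho x0 x < 1 / real (Suc n) \<and> rho ((- \<phi> x0) \<odot> \<phi> x) (L ((- x0) \<odot> x)) > \<epsilon> * rho x0 x)"
      then have "\<forall>x\<in>E. rho x0 x < 1 / real (Suc n) \<longrightarrow> rho ((- \<phi> x0) \<odot> \<phi> x) (L ((- x0) \<odot> x)) \<le> \<epsilon> * rho x0 x" by (auto simp: not_less)
      then show False using no by (auto dest!: spec[of _ "1 / real (Suc n)"])
    qed
    then obtain X where X: "\<And>n. X n \<in> E" "\<And>n. rho x0 (X n) < 1 / real (Suc n)"
      "\<And>n. rho ((- \<phi> x0) \<odot> \<phi> (X n)) (L ((- x0) \<odot> X n)) > \<epsilon> * rho x0 (X n)" by metis
    define r where "r n = rho x0 (X n)" for n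
    have r0: "r n > 0" for n
    proof (rule ccontr)
      assume "\<not> r n > 0"
      then have "rho x0 (X n) = 0" using rho_nonneg[of x0 "X n"] by (simp add: r_def)
      then show False using X(3)[of n] rho_eq_0[of x0 "X n"] by (simp add: L0)
    qed
    have rlim: "r \<longlonglongrightarrow> 0"
      by (rule tendsto_sandwich[OF _ _ tendsto_const n0]) (use X(2) in \<open>auto intro!: always_eventually simp: r_def rho_nonneg less_imp_le\<close>)
    define y where "y n = dl (1 / r n) ((- x0) \<odot> X n)" for n
    have Xy: "X n = x0 \<odot> dl (r n) (y n)" for n using r0[of n] by (simp add: y_def dl_inverse)
    have ym: "y n \<in> cB 0 1" for n
    proof -
      have "Nm (y n) = (1 / r n) * Nm ((- x0) \<odot> X n)" unfolding y_def using r0[of n] by (intro Nm_dl) simp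
      also have "Nm ((- x0) \<odot> X n) = r n" by (simp add: r_def rho_Nm)
      finally have "Nm (y n) = 1" using r0[of n] by simp
      then show ?thesis by (simp add: cB_def Nm_def)
    qed
    \<comment> \<open>The rescaled points lie on the unit sphere, so the directions can be made to
      converge before the cluster filter is taken along the same subsequence.\<close>
    obtain yy s where s: "strict_mono s" "(y \<circ> s) \<longlonglongrightarrow> yy"
      using compact_cB[of 0 1, unfolded compact_def] ym by blast
    let ?r = "r \<circ> s"
    have r': "?r \<longlonglongrightarrow> 0" "\<And>i. ?r i > 0" using LIMSEQ_subseq_LIMSEQ[OF rlim s(1)] r0 by auto
    from cl[OF r'] obtain G \<psi> where G: "G \<le> sequentially" "G \<noteq> bot" and lim: "\<And>y. ((\<lambda>n. blow E \<phi> x0 (?r n) y) \<longlongrightarrow> \<psi> y) G"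
      and lip\<psi>: "\<And>y z. rho (\<psi> y) (\<psi> z) \<le> C * rho y z" and \<psi>0: "\<psi> 0 = 0"
      and hor\<psi>: "\<And>k y. \<sigma> k = 1 \<Longrightarrow> \<psi> y $ k = (\<Sum>i\<in>{i. \<sigma> i = 1}. a k i * y $ i)" by fastforce
    have eq: "\<psi> y = L y" for y
      by (rule horizontal_linear_unique[OF lip\<psi> C \<psi>0 _ lipL L0]) (assumption | rule hor\<psi> horL)+
    have ylim: "((\<lambda>n. y (s n)) \<longlongrightarrow> yy) G" using tendsto_mono[OF G(1) s(2)] by (simp add: o_def)
    have gapG: "((\<lambda>n. gap E x0 (?r n) yy) \<longlongrightarrow> 0) G" by (rule gap_tendsto[OF x0 d tendsto_mono[OF G(1) r'(1)] r'(2)])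
    define V where "V n = dl (1 / ?r n) ((- \<phi> x0) \<odot> \<phi> (X (s n)))" for n
    have VL: "rho (V n) (L (y (s n))) > \<epsilon>" for n
    proof -
      let ?q = "?r n"
      have q: "?q > 0" by (rule r'(2))
      have "rho (V n) (L (y (s n))) = (1 / ?q) * rho ((- \<phi> x0) \<odot> \<phi> (X (s n))) (L ((- x0) \<odot> X (s n)))"
      proof -
        have "L (y (s n)) = dl (1 / ?q) (L ((- x0) \<odot> X (s n)))" unfolding y_def using contact_dl[OF contact, of "1 / ?q"] q by simp
        then show ?thesis unfolding V_def using rho_dl[of "1 / ?q"] q by simp
      qed
      moreover have "rho ((- \<phi> x0) \<odot> \<phi> (X (s n))) (L ((- x0) \<odot> X (s n))) > \<epsilon> * ?q" using X(3)[of "s n"] by (simp add: r_def)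
      then have "(1 / ?q) * rho ((- \<phi> x0) \<odot> \<phi> (X (s n))) (L ((- x0) \<odot> X (s n))) > (1 / ?q) * (\<epsilon> * ?q)"
        using q by (intro mult_strict_left_mono) auto
      moreover have "(1 / ?q) * (\<epsilon> * ?q) = \<epsilon>" using q by simp
      ultimately show ?thesis by simp
    qed
    have bV: "rho (V n) (blow E \<phi> x0 (?r n) yy) \<le> C * (rho (y (s n)) yy + gap E x0 (?r n) yy)" for n
    proof -
      let ?q = "?r n" and ?u = "near E x0 (x0 \<odot> dl (?r n) yy)" and ?w = "x0 \<odot> dl (?r n) yy"
      have q: "?q > 0" by (rule r'(2))
      have "rho (V n) (blow E \<phi> x0 ?q yy) = rho (\<phi> (X (s n))) (\<phi> ?u) / ?q"
        unfolding V_def blow_def by (rule rho_blow[OF q])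
      also have "\<dots> \<le> (C * rho (X (s n)) ?u) / ?q"
        using lip[OF X(1) near(1)[OF x0]] q by (simp add: divide_right_mono)
      also have "\<dots> \<le> (C * (rho (X (s n)) ?w + rho ?w ?u)) / ?q"
        using rho_triangle[of "X (s n)" ?u ?w] C q by (intro divide_right_mono mult_left_mono) auto
      also have "rho (X (s n)) ?w = ?q * rho (y (s n)) yy" using Xy[of "s n"] q by (simp add: rho_left rho_dl)
      also have "(C * (?q * rho (y (s n)) yy + rho ?w ?u)) / ?q = C * (rho (y (s n)) yy + gap E x0 ?q yy)"
        using q by (simp add: gap_def field_simps)
      finally show ?thesis .
    qed
    have "((\<lambda>n. C * (rho (y (s n)) yy + gap E x0 (?r n) yy) + rho (blow E \<phi> x0 (?r n) yy) (L (y (s n)))) \<longlongrightarrow> C * (rho yy yy + 0) + rho (\<psi> yy) (L yy)) G"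
    proof (intro tendsto_intros ylim gapG lim)
      show "((\<lambda>n. L (y (s n))) \<longlongrightarrow> L yy) G"
        using isCont_tendsto_compose[OF linear_continuous_at[OF lin[unfolded linear_conv_bounded_linear]] ylim] .
    qed
    then have lim0: "((\<lambda>n. C * (rho (y (s n)) yy + gap E x0 (?r n) yy) + rho (blow E \<phi> x0 (?r n) yy) (L (y (s n)))) \<longlongrightarrow> 0) G"
      by (simp add: eq)
    have "\<epsilon> \<le> 0"
    proof (rule tendsto_le[OF G(2) lim0 tendsto_const])
      show "\<forall>\<^sub>F n in G. \<epsilon> \<le> C * (rho (y (s n)) yy + gap E x0 (?r n) yy) + rho (blow E \<phi> x0 (?r n) yy) (L (y (s n)))"
      proof (intro always_eventually allI)
        fix n show "\<epsilon> \<le> C * (rho (y (s n)) yy + gap E x0 (?r n) yy) + rho (blow E \<phi> x0 (?r n) yy) (L (y (s n)))"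
          using VL[of n] bV[of n] rho_triangle[of "V n" "L (y (s n))" "blow E \<phi> x0 (?r n) yy"] by linarith
      qed
    qed
    then show False using \<epsilon> by simp
  qed
  then show ?thesis using contact unfolding pansu_diff_with_def by blast
qed

lemma pansu_ae:
  assumes A: "A \<in> sets lebesgue" "A \<subseteq> E" and lipE: "cc_lipschitz_on gm \<sigma> E \<phi>"
  shows "negligible {x \<in> A. \<not> (\<exists>L. pansu_diff_with gm \<sigma> E \<phi> x L)}"
proof -
  obtain C0 where C0: "\<And>x y. x \<in> E \<Longrightarrow> y \<in> E \<Longrightarrow> rho (\<phi> x) (\<phi> y) \<le> C0 * rho x y"
    using lipE unfolding cc_lipschitz_on_def by blast
  define C where "C = \<bar>C0\<bar>"
  have C: "C \<ge> 0" by (simp add: C_def)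
  have lip: "rho (\<phi> x) (\<phi> y) \<le> C * rho x y" if "x \<in> E" "y \<in> E" for x y
    using C0[OF that] mult_right_mono[OF abs_ge_self[of C0] rho_nonneg[of x y]] by (simp add: C_def)
  obtain K where K: "K > 0" "\<And>x r i. 0 \<le> r \<Longrightarrow> Nm x \<le> r \<Longrightarrow> \<bar>x $ i\<bar> \<le> (K * r) ^ \<sigma> i" using Nm_imp_coord by blast
  have KC: "K * C \<ge> 0" using K(1) C by simp
  have "\<exists>g. (\<forall>x\<in>E. g x = \<phi> x $ k) \<and> (\<forall>x y. \<bar>g x - g y\<bar> \<le> (K * C) * rho x y)" if k: "\<sigma> k = 1" for k
  proof (rule mcshane_extension[OF _ KC])
    fix x y assume xy: "x \<in> E" "y \<in> E"
    have "\<bar>((- \<phi> x) \<odot> \<phi> y) $ k\<bar> \<le> (K * (C * rho x y)) ^ \<sigma> k"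
      using lip[OF xy] C rho_nonneg[of x y] by (intro K(2)) (auto simp: rho_Nm[symmetric])
    then show "\<bar>\<phi> x $ k - \<phi> y $ k\<bar> \<le> (K * C) * rho x y" using k by (simp add: gm_nth_horiz abs_minus_commute mult.assoc)
  qed
  then obtain f where f: "\<And>k x. \<sigma> k = 1 \<Longrightarrow> x \<in> E \<Longrightarrow> f k x = \<phi> x $ k"
    and flip: "\<And>k x y. \<sigma> k = 1 \<Longrightarrow> \<bar>f k x - f k y\<bar> \<le> (K * C) * rho x y" by metis
  define B where "B k = {x0. \<not> (\<exists>a. \<forall>y. ((\<lambda>r. (f k (x0 \<odot> dl r y) - f k x0) / r) \<longlongrightarrow> (\<Sum>i\<in>{i. \<sigma> i = 1}. a i * y $ i)) (at_right 0))}" for k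
  have Bn: "negligible (B k)" if k: "\<sigma> k = 1" for k
    unfolding B_def by (rule pansu_rademacher_real[OF flip[OF k] KC])
  have nB: "negligible (\<Union>k\<in>{k. \<sigma> k = 1}. B k)" by (rule negligible_Union) (use Bn in auto)
  have nD: "negligible {x \<in> A. \<not> nonporous A x}" by (rule negligible_porous[OF A(1)])
  show ?thesis
  proof (rule negligible_subset[OF negligible_Un[OF nB nD]], rule subsetI, rule ccontr)
    fix x0 assume x0: "x0 \<in> {x \<in> A. \<not> (\<exists>L. pansu_diff_with gm \<sigma> E \<phi> x L)}" and no: "x0 \<notin> (\<Union>k\<in>{k. \<sigma> k = 1}. B k) \<union> {x \<in> A. \<not> nonporous A x}"
    have xE: "x0 \<in> E" using x0 A(2) by blast
    have dA: "nonporous A x0" using x0 no by blast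
    \<comment> \<open>Porosity is controlled on the measurable set A while differentiability is
      relative to E; being non-porous passes to supersets.\<close>
    have dE: "nonporous E x0" unfolding nonporous_def
    proof (intro allI impI)
      fix \<theta> :: real assume "\<theta> > 0"
      then obtain r0 where r0: "r0 > 0" "\<forall>z. rho x0 z < r0 \<longrightarrow> (\<exists>z'\<in>A. rho z z' \<le> \<theta> * rho x0 z)" using dA unfolding nonporous_def by blast
      show "\<exists>r0>0. \<forall>z. rho x0 z < r0 \<longrightarrow> (\<exists>z'\<in>E. rho z z' \<le> \<theta> * rho x0 z)"
        by (rule exI[of _ r0]) (use r0 A(2) in blast)
    qed
    have "\<forall>k. \<exists>a. \<sigma> k = 1 \<longrightarrow> (\<forall>y. ((\<lambda>r. (f k (x0 \<odot> dl r y) - f k x0) / r) \<longlongrightarrow> (\<Sum>i\<in>{i. \<sigma> i = 1}. a i * y $ i)) (at_right 0))"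
      using no unfolding B_def by blast
    from choice[OF this] obtain a where "\<forall>k. \<sigma> k = 1 \<longrightarrow> (\<forall>y. ((\<lambda>r. (f k (x0 \<odot> dl r y) - f k x0) / r) \<longlongrightarrow> (\<Sum>i\<in>{i. \<sigma> i = 1}. a k i * y $ i)) (at_right 0))" ..
    then have a: "((\<lambda>r. (f k (x0 \<odot> dl r y) - f k x0) / r) \<longlongrightarrow> (\<Sum>i\<in>{i. \<sigma> i = 1}. a k i * y $ i)) (at_right 0)" if "\<sigma> k = 1" for k y
      using that by simp
    have "\<exists>L. pansu_diff_with gm \<sigma> E \<phi> x0 L"
      by (rule pansu_differentiable_at[OF xE dE lip C]) (assumption | rule f flip a)+
    then show False using x0 by blast
  qed
qed

end

section \<open>Spherical Hausdorff premeasures and fibres\<close>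

context carnot begin

text \<open>The premeasure of dimension 1 and mesh \<kappa> without its normalising factor, which
  reappears as 2 * \<open>Hpre\<close>.\<close>

definition Hpre :: "real \<Rightarrow> (real^'n) set \<Rightarrow> ennreal" where
  "Hpre \<kappa> F = Inf {(\<Sum>k. ennreal (r k powr 1)) | r c. (\<forall>k. 0 \<le> r k \<and> r k \<le> \<kappa>) \<and>
                F \<subseteq> (\<Union>k::nat. cc_ball gm \<sigma> (c k) (r k))}"

lemma H1_Hpre: "H1 gm \<sigma> F = (SUP \<kappa>\<in>{0<..}. 2 * Hpre \<kappa> F)"
  unfolding H1_def sph_hausdorff_def Hpre_def by simp

lemma Hpre_le:
  assumes "\<And>k. 0 \<le> r k \<and> r k \<le> \<kappa>" "F \<subseteq> (\<Union>k::nat. cc_ball gm \<sigma> (c k) (r k))"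
  shows "Hpre \<kappa> F \<le> (\<Sum>k. ennreal (r k))"
proof -
  have "(\<Sum>k. ennreal (r k)) = (\<Sum>k. ennreal (r k powr 1))" using assms(1) by simp
  then show ?thesis unfolding Hpre_def using assms by (intro Inf_lower) blast
qed

lemma Hpre_greatest:
  assumes "\<And>r c. (\<And>k. 0 \<le> r k \<and> r k \<le> \<kappa>) \<Longrightarrow> F \<subseteq> (\<Union>k::nat. cc_ball gm \<sigma> (c k) (r k)) \<Longrightarrow> a \<le> (\<Sum>k. ennreal (r k))"
  shows "a \<le> Hpre \<kappa> F"
  unfolding Hpre_def
proof (rule Inf_greatest)
  fix s assume "s \<in> {(\<Sum>k. ennreal (r k powr 1)) | r c. (\<forall>k. 0 \<le> r k \<and> r k \<le> \<kappa>) \<and> F \<subseteq> (\<Union>k::nat. cc_ball gm \<sigma> (c k) (r k))}"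
  then obtain r c where s: "s = (\<Sum>k. ennreal (r k powr 1))" and r: "\<forall>k. 0 \<le> r k \<and> r k \<le> \<kappa>" and c: "F \<subseteq> (\<Union>k::nat. cc_ball gm \<sigma> (c k) (r k))" by blast
  have "s = (\<Sum>k. ennreal (r k))" unfolding s using r by simp
  moreover have "a \<le> (\<Sum>k. ennreal (r k))" by (rule assms[OF spec[OF r] c])
  ultimately show "a \<le> s" by simp
qed

lemma Hpre_lessD:
  assumes "Hpre \<kappa> F < a"
  shows "\<exists>r c. (\<forall>k. 0 \<le> r k \<and> r k \<le> \<kappa>) \<and> F \<subseteq> (\<Union>k::nat. cc_ball gm \<sigma> (c k) (r k)) \<and> (\<Sum>k. ennreal (r k)) < a"
proof -
  from assms obtain s where s: "s \<in> {(\<Sum>k. ennreal (r k powr 1)) | r c. (\<forall>k. 0 \<le> r k \<and> r k \<le> \<kappa>) \<and> F \<subseteq> (\<Union>k::nat. cc_ball gm \<sigma> (c k) (r k))}" "s < a"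
    unfolding Hpre_def Inf_less_iff by blast
  then obtain r c where s': "s = (\<Sum>k. ennreal (r k powr 1))" and r: "\<forall>k. 0 \<le> r k \<and> r k \<le> \<kappa>" and c: "F \<subseteq> (\<Union>k::nat. cc_ball gm \<sigma> (c k) (r k))" by blast
  have "s = (\<Sum>k. ennreal (r k))" unfolding s' using r by simp
  then show ?thesis using r c s(2) by (intro exI[of _ r] exI[of _ c]) simp
qed

lemma Hpre_mono: "F \<subseteq> F' \<Longrightarrow> Hpre \<kappa> F \<le> Hpre \<kappa> F'"
  by (rule Hpre_greatest) (rule Hpre_le, auto)

lemma Hpre_antimono: "\<kappa> \<le> \<kappa>' \<Longrightarrow> Hpre \<kappa>' F \<le> Hpre \<kappa> F"
  by (rule Hpre_greatest, rule Hpre_le) (meson order.trans)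

lemma Hpre_empty: "\<kappa> \<ge> 0 \<Longrightarrow> Hpre \<kappa> {} = 0"
  using Hpre_le[of "\<lambda>_. 0" \<kappa> "{}" "\<lambda>_. 0"] by simp

lemma Hpre_subset_ball:
  assumes "F \<subseteq> cc_ball gm \<sigma> x r" "0 \<le> r" "r \<le> \<kappa>"
  shows "Hpre \<kappa> F \<le> ennreal r"
proof -
  let ?r = "\<lambda>k::nat. if k = 0 then r else 0"
  have "Hpre \<kappa> F \<le> (\<Sum>k. ennreal (?r k))"
    by (rule Hpre_le[where c = "\<lambda>_. x"]) (use assms in \<open>auto intro!: exI[of _ 0]\<close>)
  also have "\<dots> = (\<Sum>k\<in>{0}. ennreal (?r k))" by (rule suminf_finite) auto
  finally show ?thesis by simp
qed

lemma Hpre_UN: "Hpre \<kappa> (\<Union>n::nat. F n) \<le> (\<Sum>n. Hpre \<kappa> (F n))"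
proof (rule ennreal_le_epsilon)
  fix e :: real assume fin: "(\<Sum>n. Hpre \<kappa> (F n)) < top" and e: "e > 0"
  have hf: "Hpre \<kappa> (F n) < top" for n using fin ennreal_suminf_lessD by blast
  have "\<forall>n. \<exists>rc. (\<forall>k. 0 \<le> fst rc k \<and> fst rc k \<le> \<kappa>) \<and> F n \<subseteq> (\<Union>k::nat. cc_ball gm \<sigma> (snd rc k) (fst rc k)) \<and>
     (\<Sum>k. ennreal (fst rc k)) \<le> Hpre \<kappa> (F n) + ennreal (e * (1/2) ^ Suc n)"
  proof
    fix n
    have "Hpre \<kappa> (F n) < Hpre \<kappa> (F n) + ennreal (e * (1/2) ^ Suc n)"
    proof -
      have "0 < e * (1/2) ^ Suc n" using e by simp
      moreover obtain h where "Hpre \<kappa> (F n) = ennreal h" "h \<ge> 0" using hf[of n] by (cases "Hpre \<kappa> (F n)") auto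
      ultimately show ?thesis by (simp only: ennreal_plus[symmetric] less_imp_le) (simp add: ennreal_less_iff)
    qed
    from Hpre_lessD[OF this] obtain r c where "\<forall>k. 0 \<le> r k \<and> r k \<le> \<kappa>" "F n \<subseteq> (\<Union>k::nat. cc_ball gm \<sigma> (c k) (r k))"
      "(\<Sum>k. ennreal (r k)) < Hpre \<kappa> (F n) + ennreal (e * (1/2) ^ Suc n)" by blast
    then show "\<exists>rc. (\<forall>k. 0 \<le> fst rc k \<and> fst rc k \<le> \<kappa>) \<and> F n \<subseteq> (\<Union>k::nat. cc_ball gm \<sigma> (snd rc k) (fst rc k)) \<and>
     (\<Sum>k. ennreal (fst rc k)) \<le> Hpre \<kappa> (F n) + ennreal (e * (1/2) ^ Suc n)"
      by (intro exI[of _ "(r,c)"]) (simp add: less_imp_le)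
  qed
  from choice[OF this] obtain RC where RC: "\<forall>n. (\<forall>k. 0 \<le> fst (RC n) k \<and> fst (RC n) k \<le> \<kappa>) \<and> F n \<subseteq> (\<Union>k::nat. cc_ball gm \<sigma> (snd (RC n) k) (fst (RC n) k)) \<and>
     (\<Sum>k. ennreal (fst (RC n) k)) \<le> Hpre \<kappa> (F n) + ennreal (e * (1/2) ^ Suc n)" ..
  let ?R = "\<lambda>m. fst (RC (fst (prod_decode m))) (snd (prod_decode m))"
  let ?C = "\<lambda>m. snd (RC (fst (prod_decode m))) (snd (prod_decode m))"
  have "Hpre \<kappa> (\<Union>n. F n) \<le> (\<Sum>m. ennreal (?R m))"
  proof (rule Hpre_le[where c = ?C])
    show "0 \<le> ?R k \<and> ?R k \<le> \<kappa>" for k using RC by simp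
    show "(\<Union>n. F n) \<subseteq> (\<Union>k. cc_ball gm \<sigma> (?C k) (?R k))"
    proof
      fix x assume "x \<in> (\<Union>n. F n)"
      then obtain n where "x \<in> F n" by blast
      then obtain k where k: "x \<in> cc_ball gm \<sigma> (snd (RC n) k) (fst (RC n) k)" using RC by blast
      show "x \<in> (\<Union>k. cc_ball gm \<sigma> (?C k) (?R k))"
        by (rule UN_I[of "prod_encode (n,k)"]) (use k in simp_all)
    qed
  qed
  also have "\<dots> = (\<Sum>n. \<Sum>k. ennreal (fst (RC n) k))"
    using suminf_ennreal_2dimen[of "\<lambda>n. \<Sum>k. ennreal (fst (RC n) k)" "\<lambda>(n,k). ennreal (fst (RC n) k)"] by (simp add: case_prod_beta)
  also have "\<dots> \<le> (\<Sum>n. Hpre \<kappa> (F n) + ennreal (e * (1/2) ^ Suc n))"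
    using RC by (intro suminf_le) auto
  also have "\<dots> = (\<Sum>n. Hpre \<kappa> (F n)) + (\<Sum>n. ennreal (e * (1/2) ^ Suc n))"
    by (rule suminf_add[symmetric]) auto
  also have "(\<Sum>n. ennreal (e * (1/2) ^ Suc n)) = ennreal e"
  proof -
    have "(\<lambda>n. e * (1/2) ^ Suc n) sums (e * 1)" by (rule sums_mult[OF power_half_series])
    then have "summable (\<lambda>n. e * (1/2) ^ Suc n)" "(\<Sum>n. e * (1/2) ^ Suc n) = e" by (auto simp: sums_iff)
    then show ?thesis using e by (subst suminf_ennreal2) auto
  qed
  finally show "Hpre \<kappa> (\<Union>n. F n) \<le> (\<Sum>n. Hpre \<kappa> (F n)) + ennreal e" .
qed

lemma Hpre_Un: assumes "\<kappa> \<ge> 0" shows "Hpre \<kappa> (A \<union> B) \<le> Hpre \<kappa> A + Hpre \<kappa> B"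
proof -
  let ?F = "\<lambda>n::nat. if n = 0 then A else if n = 1 then B else {}"
  have "A \<union> B = (\<Union>n. ?F n)" by (auto split: if_splits)
  then have "Hpre \<kappa> (A \<union> B) \<le> (\<Sum>n. Hpre \<kappa> (?F n))" using Hpre_UN[of \<kappa> ?F] by simp
  also have "\<dots> = (\<Sum>n\<in>{0,1}. Hpre \<kappa> (?F n))" by (rule suminf_finite) (auto simp: Hpre_empty assms)
  finally show ?thesis by simp
qed

lemma Hpre_scale:
  assumes s: "s > 0"
  shows "Hpre (s * \<kappa>) ((\<lambda>y. x0 \<odot> dl s y) ` S) \<le> ennreal s * Hpre \<kappa> S"
proof -
  let ?h = "Hpre (s * \<kappa>) ((\<lambda>y. x0 \<odot> dl s y) ` S)"
  have c1: "ennreal (1/s) * (ennreal s * z) = z" "ennreal s * (ennreal (1/s) * z) = z" for z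
    using s by (simp_all add: mult.assoc[symmetric] ennreal_mult'[symmetric])
  have "ennreal (1/s) * ?h \<le> Hpre \<kappa> S"
  proof (rule Hpre_greatest)
    fix r :: "nat \<Rightarrow> real" and c assume r: "\<And>k. 0 \<le> r k \<and> r k \<le> \<kappa>" and c: "S \<subseteq> (\<Union>k. cc_ball gm \<sigma> (c k) (r k))"
    have "?h \<le> (\<Sum>k. ennreal (s * r k))"
    proof (rule Hpre_le[where c = "\<lambda>k. x0 \<odot> dl s (c k)"])
      show "0 \<le> s * r k \<and> s * r k \<le> s * \<kappa>" for k using r[of k] s by simp
      show "(\<lambda>y. x0 \<odot> dl s y) ` S \<subseteq> (\<Union>k. cc_ball gm \<sigma> (x0 \<odot> dl s (c k)) (s * r k))"
        using c s by (fastforce simp: cc_ball_def rho_left rho_dl)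
    qed
    also have "\<dots> = ennreal s * (\<Sum>k. ennreal (r k))" using s r by (simp add: ennreal_mult')
    finally have "ennreal (1/s) * ?h \<le> ennreal (1/s) * (ennreal s * (\<Sum>k. ennreal (r k)))" by (rule mult_left_mono) simp
    then show "ennreal (1/s) * ?h \<le> (\<Sum>k. ennreal (r k))" unfolding c1 .
  qed
  then have "ennreal s * (ennreal (1/s) * ?h) \<le> ennreal s * Hpre \<kappa> S" by (rule mult_left_mono) simp
  then show ?thesis unfolding c1 .
qed

text \<open>Two points of a ball of radius at most \<kappa> are less than 2 \<kappa> \<le> \<delta>
  apart, so no ball of a cover meets both sets and the cover splits.\<close>

lemma Hpre_separated:
  assumes sep: "\<And>x y. x \<in> A \<Longrightarrow> y \<in> B \<Longrightarrow> \<delta> \<le> rho x y" and \<kappa>: "2 * \<kappa> \<le> \<delta>"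
  shows "Hpre \<kappa> A + Hpre \<kappa> B \<le> Hpre \<kappa> (A \<union> B)"
proof (rule Hpre_greatest)
  fix r :: "nat \<Rightarrow> real" and c assume r: "\<And>k. 0 \<le> r k \<and> r k \<le> \<kappa>" and c: "A \<union> B \<subseteq> (\<Union>k. cc_ball gm \<sigma> (c k) (r k))"
  define r1 where "r1 k = (if cc_ball gm \<sigma> (c k) (r k) \<inter> A \<noteq> {} then r k else 0)" for k
  define r2 where "r2 k = (if cc_ball gm \<sigma> (c k) (r k) \<inter> B \<noteq> {} then r k else 0)" for k
  have h1: "Hpre \<kappa> A \<le> (\<Sum>k. ennreal (r1 k))"
  proof (rule Hpre_le[where c = c])
    show "0 \<le> r1 k \<and> r1 k \<le> \<kappa>" for k using r[of k] by (auto simp: r1_def)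
    show "A \<subseteq> (\<Union>k. cc_ball gm \<sigma> (c k) (r1 k))"
    proof
      fix x assume x: "x \<in> A"
      then obtain k where k: "x \<in> cc_ball gm \<sigma> (c k) (r k)" using c by blast
      then have "r1 k = r k" using x by (auto simp: r1_def)
      then show "x \<in> (\<Union>k. cc_ball gm \<sigma> (c k) (r1 k))" using k by (intro UN_I[of k]) auto
    qed
  qed
  have h2: "Hpre \<kappa> B \<le> (\<Sum>k. ennreal (r2 k))"
  proof (rule Hpre_le[where c = c])
    show "0 \<le> r2 k \<and> r2 k \<le> \<kappa>" for k using r[of k] by (auto simp: r2_def)
    show "B \<subseteq> (\<Union>k. cc_ball gm \<sigma> (c k) (r2 k))"
    proof
      fix x assume x: "x \<in> B"
      then obtain k where k: "x \<in> cc_ball gm \<sigma> (c k) (r k)" using c by blast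
      then have "r2 k = r k" using x by (auto simp: r2_def)
      then show "x \<in> (\<Union>k. cc_ball gm \<sigma> (c k) (r2 k))" using k by (intro UN_I[of k]) auto
    qed
  qed
  have le: "ennreal (r1 k) + ennreal (r2 k) \<le> ennreal (r k)" for k
  proof (cases "cc_ball gm \<sigma> (c k) (r k) \<inter> A \<noteq> {} \<and> cc_ball gm \<sigma> (c k) (r k) \<inter> B \<noteq> {}")
    case True
    then obtain x y where "x \<in> A" "y \<in> B" "rho (c k) x < r k" "rho (c k) y < r k" by (auto simp: cc_ball_def)
    then have False using sep[of x y] rho_triangle[of x y "c k"] rho_sym[of x "c k"] r[of k] \<kappa> by linarith
    then show ?thesis ..
  qed (auto simp: r1_def r2_def)
  have "Hpre \<kappa> A + Hpre \<kappa> B \<le> (\<Sum>k. ennreal (r1 k)) + (\<Sum>k. ennreal (r2 k))" using h1 h2 by (rule add_mono)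
  also have "\<dots> = (\<Sum>k. ennreal (r1 k) + ennreal (r2 k))" by (rule suminf_add) auto
  also have "\<dots> \<le> (\<Sum>k. ennreal (r k))" using le by (intro suminf_le) auto
  finally show "Hpre \<kappa> A + Hpre \<kappa> B \<le> (\<Sum>k. ennreal (r k))" .
qed

lemma Hpre_le_H1: "\<kappa> > 0 \<Longrightarrow> 2 * Hpre \<kappa> F \<le> H1 gm \<sigma> F"
  unfolding H1_Hpre by (rule SUP_upper) simp

lemma H1_seq: "H1 gm \<sigma> F = (SUP n. 2 * Hpre (1 / real (Suc n)) F)"
proof (rule antisym)
  show "H1 gm \<sigma> F \<le> (SUP n. 2 * Hpre (1 / real (Suc n)) F)" unfolding H1_Hpre
  proof (rule SUP_least)
    fix \<kappa> :: real assume "\<kappa> \<in> {0<..}"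
    then obtain n where n: "1 / real (Suc n) < \<kappa>" using nat_approx_posE[of \<kappa>] by auto
    have "2 * Hpre \<kappa> F \<le> 2 * Hpre (1 / real (Suc n)) F" using n by (intro mult_left_mono Hpre_antimono) auto
    also have "\<dots> \<le> (SUP n. 2 * Hpre (1 / real (Suc n)) F)" by (rule SUP_upper) simp
    finally show "2 * Hpre \<kappa> F \<le> (SUP n. 2 * Hpre (1 / real (Suc n)) F)" .
  qed
  show "(SUP n. 2 * Hpre (1 / real (Suc n)) F) \<le> H1 gm \<sigma> F" by (rule SUP_least) (rule Hpre_le_H1, simp)
qed

lemma Hpre_seq_mono: "m \<le> n \<Longrightarrow> Hpre (1 / real (Suc m)) F \<le> Hpre (1 / real (Suc n)) F"
  by (rule Hpre_antimono) (simp add: frac_le)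

lemma H1_mono: "F \<subseteq> F' \<Longrightarrow> H1 gm \<sigma> F \<le> H1 gm \<sigma> F'"
  unfolding H1_seq by (intro SUP_mono' mult_left_mono Hpre_mono) auto

lemma H1_empty: "H1 gm \<sigma> {} = 0"
  unfolding H1_seq by (simp add: Hpre_empty)

lemma H1_UN: "H1 gm \<sigma> (\<Union>n::nat. F n) \<le> (\<Sum>n. H1 gm \<sigma> (F n))"
  unfolding H1_seq[of "\<Union>n. F n"]
proof (rule SUP_least)
  fix m :: nat
  have "2 * Hpre (1 / real (Suc m)) (\<Union>n. F n) \<le> 2 * (\<Sum>n. Hpre (1 / real (Suc m)) (F n))" by (intro mult_left_mono Hpre_UN) simp
  also have "\<dots> = (\<Sum>n. 2 * Hpre (1 / real (Suc m)) (F n))" by simp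
  also have "\<dots> \<le> (\<Sum>n. H1 gm \<sigma> (F n))" by (intro suminf_le Hpre_le_H1) auto
  finally show "2 * Hpre (1 / real (Suc m)) (\<Union>n. F n) \<le> (\<Sum>n. H1 gm \<sigma> (F n))" .
qed

lemma H1_Un: "H1 gm \<sigma> (A \<union> B) \<le> H1 gm \<sigma> A + H1 gm \<sigma> B"
proof -
  let ?F = "\<lambda>n::nat. if n = 0 then A else if n = 1 then B else {}"
  have "A \<union> B = (\<Union>n. ?F n)" by (auto split: if_splits)
  then have "H1 gm \<sigma> (A \<union> B) \<le> (\<Sum>n. H1 gm \<sigma> (?F n))" using H1_UN[of ?F] by simp
  also have "\<dots> = (\<Sum>n\<in>{0,1}. H1 gm \<sigma> (?F n))" by (rule suminf_finite) (auto simp: H1_empty)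
  finally show ?thesis by simp
qed

lemma compact_separated:
  assumes "compact K" "compact K'" "K \<inter> K' = {}"
  shows "\<exists>\<delta>>0. \<forall>x\<in>K. \<forall>y\<in>K'. \<delta> \<le> rho x y"
proof (cases "K \<times> K' = {}")
  case True
  then show ?thesis by (intro exI[of _ 1]) auto
next
  case False
  have "compact (K \<times> K')" using assms by (intro compact_Times)
  moreover have "continuous_on (K \<times> K') (\<lambda>z. rho (fst z) (snd z))" by (intro continuous_intros)
  ultimately obtain z where z: "z \<in> K \<times> K'" "\<And>w. w \<in> K \<times> K' \<Longrightarrow> rho (fst z) (snd z) \<le> rho (fst w) (snd w)"
    using continuous_attains_inf[OF _ False] by blast
  have "rho (fst z) (snd z) \<noteq> 0" using z(1) assms(3) rho_eq_0 by fastforce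
  then have "rho (fst z) (snd z) > 0" using rho_nonneg[of "fst z" "snd z"] by simp
  moreover have "rho (fst z) (snd z) \<le> rho x y" if "x \<in> K" "y \<in> K'" for x y using z(2)[of "(x,y)"] that by simp
  ultimately show ?thesis by blast
qed

text \<open>Disjoint compact sets have positive distance, and for fine meshes the premeasure of the
  union splits.\<close>

lemma H1_disjoint_compact:
  assumes "compact K" "compact K'" "K \<inter> K' = {}" "A \<subseteq> K" "B \<subseteq> K'"
  shows "H1 gm \<sigma> A + H1 gm \<sigma> B \<le> H1 gm \<sigma> (A \<union> B)"
proof -
  obtain \<delta> where \<delta>: "\<delta> > 0" "\<forall>x\<in>K. \<forall>y\<in>K'. \<delta> \<le> rho x y" using compact_separated[OF assms(1-3)] by blast
  obtain m where m: "1 / real (Suc m) < \<delta> / 2" using nat_approx_posE[of "\<delta>/2"] \<delta>(1) by auto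
  let ?f = "\<lambda>F n. 2 * Hpre (1 / real (Suc n)) F"
  have inc: "incseq (?f F)" for F by (rule incseq_SucI) (intro mult_left_mono Hpre_seq_mono, auto)
  have "H1 gm \<sigma> A + H1 gm \<sigma> B = (SUP n. ?f A n + ?f B n)"
    unfolding H1_seq by (rule ennreal_SUP_add[symmetric, OF inc inc])
  also have "\<dots> \<le> H1 gm \<sigma> (A \<union> B)"
  proof (rule SUP_least)
    fix n
    let ?l = "max m n"
    have "1 / real (Suc ?l) \<le> 1 / real (Suc m)" by (simp add: frac_le)
    then have l: "2 * (1 / real (Suc ?l)) \<le> \<delta>" using m by linarith
    have "?f A n + ?f B n \<le> ?f A ?l + ?f B ?l" by (intro add_mono mult_left_mono Hpre_seq_mono) auto
    also have "\<dots> = 2 * (Hpre (1 / real (Suc ?l)) A + Hpre (1 / real (Suc ?l)) B)" by (simp only: distrib_left)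
    also have "\<dots> \<le> 2 * Hpre (1 / real (Suc ?l)) (A \<union> B)"
      by (intro mult_left_mono Hpre_separated[OF _ l]) (use \<delta>(2) assms(4,5) in auto)
    also have "\<dots> \<le> H1 gm \<sigma> (A \<union> B)" by (rule Hpre_le_H1) simp
    finally show "?f A n + ?f B n \<le> H1 gm \<sigma> (A \<union> B)" .
  qed
  finally show ?thesis .
qed

text \<open>Together with countable subadditivity this turns the measure of a fibre into a countable
  sum over compact pieces of the domain.\<close>

lemma H1_sum_disjoint_compact:
  assumes K: "\<And>i::nat. compact (K i)" and dis: "\<And>i j. i \<noteq> j \<Longrightarrow> K i \<inter> K j = {}" and A: "\<And>i. A i \<subseteq> K i"
  shows "(\<Sum>i. H1 gm \<sigma> (A i)) \<le> H1 gm \<sigma> (\<Union>i. A i)"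
proof -
  have fin: "(\<Sum>i<n. H1 gm \<sigma> (A i)) \<le> H1 gm \<sigma> (\<Union>i<n. A i)" for n
  proof (induction n)
    case (Suc n)
    have "(\<Sum>i<Suc n. H1 gm \<sigma> (A i)) \<le> H1 gm \<sigma> (\<Union>i<n. A i) + H1 gm \<sigma> (A n)" using Suc by (simp add: add_right_mono)
    also have "\<dots> \<le> H1 gm \<sigma> ((\<Union>i<n. A i) \<union> A n)"
    proof (rule H1_disjoint_compact)
      show "compact (\<Union>i<n. K i)" using K by (intro compact_UN) auto
      show "(\<Union>i<n. K i) \<inter> K n = {}" 
      proof (rule equals0I)
        fix x assume "x \<in> (\<Union>i<n. K i) \<inter> K n"
        then obtain i where i: "i < n" "x \<in> K i" "x \<in> K n" by blast
        then show False using dis[of i n] by auto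
      qed
      show "(\<Union>i<n. A i) \<subseteq> (\<Union>i<n. K i)" by (rule UN_mono) (use A in auto)
    qed (use K A in auto)
    also have "(\<Union>i<n. A i) \<union> A n = (\<Union>i<Suc n. A i)" by (auto simp: less_Suc_eq)
    finally show ?case .
  qed (simp add: H1_empty)
  show ?thesis unfolding suminf_eq_SUP
  proof (rule SUP_least)
    fix n
    have "H1 gm \<sigma> (\<Union>i<n. A i) \<le> H1 gm \<sigma> (\<Union>i. A i)" by (rule H1_mono) auto
    then show "(\<Sum>i<n. H1 gm \<sigma> (A i)) \<le> H1 gm \<sigma> (\<Union>i. A i)" using fin[of n] by (rule order.trans[rotated])
  qed
qed

section \<open>Semicontinuity and measurability of fibre measures\<close>

lemma open_cc_ball: "open (cc_ball gm \<sigma> x r)"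
  unfolding cc_ball_def by (rule open_rho_ball)

text \<open>An open cover of one fibre also covers all nearby fibres: the part of \<Gamma> outside
  the cover has a closed projection by compactness of K, and p is not in it. The parameter space is
  general because it is used for base points alone and for base points paired with a
  tolerance.\<close>

lemma Hpre_fiber_usc:
  fixes \<Gamma> :: "((real^'n) \<times> 'p::metric_space) set"
  assumes K: "compact K" and \<Gamma>: "closed \<Gamma>" "fst ` \<Gamma> \<subseteq> K"
  shows "open {p. Hpre \<kappa> {y. (y,p) \<in> \<Gamma>} < a}"
proof (rule openI)
  fix p assume "p \<in> {p. Hpre \<kappa> {y. (y,p) \<in> \<Gamma>} < a}"
  then have "Hpre \<kappa> {y. (y,p) \<in> \<Gamma>} < a" by simp
  from Hpre_lessD[OF this] obtain r c where r: "\<forall>k. 0 \<le> r k \<and> r k \<le> \<kappa>"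
    and c: "{y. (y,p) \<in> \<Gamma>} \<subseteq> (\<Union>k::nat. cc_ball gm \<sigma> (c k) (r k))" and s: "(\<Sum>k. ennreal (r k)) < a" by blast
  let ?U = "\<Union>k. cc_ball gm \<sigma> (c k) (r k)"
  have U: "open ?U" by (intro open_UN ballI open_cc_ball)
  let ?P = "snd ` (\<Gamma> \<inter> ((K - ?U) \<times> UNIV))"
  have KU: "compact (K - ?U)" using K U by (rule compact_diff)
  have "closed ?P"
    unfolding closed_sequential_limits
  proof (intro allI impI)
    fix x l assume "(\<forall>n. x n \<in> ?P) \<and> x \<longlonglongrightarrow> l"
    then have x: "\<And>n. x n \<in> ?P" "x \<longlonglongrightarrow> l" by blast+
    have "\<forall>n. \<exists>y. (y, x n) \<in> \<Gamma> \<and> y \<in> K - ?U" 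
    proof
      fix n
      obtain z where "z \<in> \<Gamma> \<inter> ((K - ?U) \<times> UNIV)" "x n = snd z" using x(1)[of n] by blast
      then show "\<exists>y. (y, x n) \<in> \<Gamma> \<and> y \<in> K - ?U" by (intro exI[of _ "fst z"]) auto
    qed
    from choice[OF this] obtain y where y: "\<forall>n. (y n, x n) \<in> \<Gamma> \<and> y n \<in> K - ?U" ..
    then have yK: "\<forall>n. y n \<in> K - ?U" by simp
    obtain yy q where q: "yy \<in> K - ?U" "strict_mono q" "(y \<circ> q) \<longlonglongrightarrow> yy"
      using KU[unfolded compact_def, THEN spec, THEN mp, OF yK] by (elim bexE exE conjE)
    have lm: "(\<lambda>n. ((y \<circ> q) n, (x \<circ> q) n)) \<longlonglongrightarrow> (yy, l)"
      by (intro tendsto_Pair q(3) LIMSEQ_subseq_LIMSEQ[OF x(2) q(2)])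
    have "(yy, l) \<in> \<Gamma>" by (rule closed_sequentially[OF \<Gamma>(1) _ lm]) (use y in simp)
    then show "l \<in> ?P" using q(1) by (intro image_eqI[of _ _ "(yy,l)"]) simp_all
  qed
  moreover have "p \<notin> ?P" using c by auto
  ultimately obtain e where e: "e > 0" "ball p e \<subseteq> - ?P" by (meson ComplI open_Compl open_contains_ball)
  have "ball p e \<subseteq> {p. Hpre \<kappa> {y. (y,p) \<in> \<Gamma>} < a}"
  proof
    fix p' assume "p' \<in> ball p e"
    then have "p' \<notin> ?P" using e(2) by blast
    have "{y. (y,p') \<in> \<Gamma>} \<subseteq> ?U"
    proof (rule subsetI, rule ccontr)
      fix y assume y: "y \<in> {y. (y,p') \<in> \<Gamma>}" "y \<notin> ?U"
      then have "y \<in> K" using \<Gamma>(2) imageI[of "(y,p')" \<Gamma> fst] by auto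
      then have "p' \<in> ?P" using y by (intro image_eqI[of _ _ "(y,p')"]) simp_all
      then show False using \<open>p' \<notin> ?P\<close> by contradiction
    qed
    then have "Hpre \<kappa> {y. (y,p') \<in> \<Gamma>} \<le> (\<Sum>k. ennreal (r k))" using r by (intro Hpre_le[where c = c]) auto
    then show "p' \<in> {p. Hpre \<kappa> {y. (y,p) \<in> \<Gamma>} < a}" using s by simp
  qed
  then show "\<exists>e>0. ball p e \<subseteq> {p. Hpre \<kappa> {y. (y,p) \<in> \<Gamma>} < a}" using e(1) by blast
qed

lemma Hpre_fiber_measurable:
  fixes \<Gamma> :: "((real^'n) \<times> 'p::metric_space) set"
  assumes K: "compact K" and \<Gamma>: "closed \<Gamma>" "fst ` \<Gamma> \<subseteq> K"
  shows "(\<lambda>p. Hpre \<kappa> {y. (y,p) \<in> \<Gamma>}) \<in> borel_measurable borel"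
proof (rule borel_measurableI_less)
  fix a :: ennreal
  have eq: "{x \<in> space borel. Hpre \<kappa> {y. (y, x) \<in> \<Gamma>} < a} = {p. Hpre \<kappa> {y. (y,p) \<in> \<Gamma>} < a}" by simp
  show "{x \<in> space borel. Hpre \<kappa> {y. (y, x) \<in> \<Gamma>} < a} \<in> sets borel"
    unfolding eq by (rule borel_open[OF Hpre_fiber_usc[OF assms]])
qed

lemma H1_fiber_measurable:
  fixes \<Gamma> :: "((real^'n) \<times> 'p::metric_space) set"
  assumes K: "compact K" and \<Gamma>: "closed \<Gamma>" "fst ` \<Gamma> \<subseteq> K"
  shows "(\<lambda>p. H1 gm \<sigma> {y. (y,p) \<in> \<Gamma>}) \<in> borel_measurable borel"
  unfolding H1_seq by (intro borel_measurable_SUP borel_measurable_times_ennreal Hpre_fiber_measurable[OF assms]) auto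

end

section \<open>The projection and Lebesgue measure on the hyperplane\<close>

lemma vec_lambda_measurable: "vec_lambda \<in> measurable (PiM UNIV (\<lambda>_::'n::finite. lborel :: real measure)) borel"
proof (rule borel_measurable_euclidean_space[THEN iffD2], rule ballI)
  fix b :: "real^'n" assume "b \<in> Basis"
  then obtain i where b: "b = axis i 1" by (auto simp: Basis_vec_def)
  have "(\<lambda>f. f i) \<in> measurable (PiM UNIV (\<lambda>_::'n. lborel :: real measure)) lborel"
    by (rule measurable_component_singleton) simp
  then show "(\<lambda>f. vec_lambda f \<bullet> b) \<in> borel_measurable (PiM UNIV (\<lambda>_::'n. lborel :: real measure))"
    unfolding b by (simp add: inner_axis)
qed

lemma lborel_vec_PiM: "(lborel :: (real^'n::finite) measure) = distr (PiM UNIV (\<lambda>_. lborel)) borel vec_lambda"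
proof (rule lborel_eqI)
  interpret product_sigma_finite "\<lambda>_::'n. lborel :: real measure" by unfold_locales
  have m: "vec_lambda \<in> measurable (PiM UNIV (\<lambda>_::'n. lborel :: real measure)) borel" by (rule vec_lambda_measurable)
  fix l u :: "real^'n" assume lu: "\<And>b. b \<in> Basis \<Longrightarrow> l \<bullet> b \<le> u \<bullet> b"
  have lu': "l $ i \<le> u $ i" for i using lu[of "axis i 1"] by (auto simp: Basis_vec_def inner_axis)
  have ev: "vec_lambda -` box l u \<inter> space (PiM UNIV (\<lambda>_::'n. lborel :: real measure)) = (\<Pi>\<^sub>E i\<in>UNIV. {l $ i <..< u $ i})"
    by (auto simp: mem_box_cart space_PiM PiE_def Pi_def)
  have "emeasure (distr (PiM UNIV (\<lambda>_. lborel)) borel vec_lambda) (box l u) = (\<Prod>i\<in>UNIV. emeasure lborel {l $ i <..< u $ i})"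
    using m by (simp add: emeasure_distr ev emeasure_PiM)
  also have "\<dots> = ennreal (\<Prod>i\<in>UNIV. u $ i - l $ i)" using lu' by (simp add: prod_ennreal)
  also have "\<dots> = emeasure lborel (box l u)" by (rule emeasure_lborel_cbox_cart[OF lu', symmetric])
  also have "\<dots> = ennreal (\<Prod>b\<in>Basis. (u - l) \<bullet> b)" by (rule emeasure_lborel_box[OF lu])
  finally show "emeasure (distr (PiM UNIV (\<lambda>_. lborel)) borel vec_lambda) (box l u) = ennreal (\<Prod>b\<in>Basis. (u - l) \<bullet> b)" .
qed simp

lemma hyp_emb_measurable: "hyp_emb j \<in> measurable (PiM (UNIV - {j}) (\<lambda>_::'n::finite. lborel :: real measure)) borel"
proof (rule borel_measurable_euclidean_space[THEN iffD2], rule ballI)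
  fix b :: "real^'n" assume "b \<in> Basis"
  then obtain i where b: "b = axis i 1" by (auto simp: Basis_vec_def)
  show "(\<lambda>f. hyp_emb j f \<bullet> b) \<in> borel_measurable (PiM (UNIV - {j}) (\<lambda>_::'n. lborel :: real measure))"
  proof (cases "i = j")
    case False
    have "(\<lambda>f. f i) \<in> measurable (PiM (UNIV - {j}) (\<lambda>_::'n. lborel :: real measure)) lborel"
      by (rule measurable_component_singleton) (use False in simp)
    then show ?thesis unfolding b using False by (simp add: inner_axis hyp_emb_def)
  qed (simp add: b inner_axis hyp_emb_def)
qed

lemma nn_integral_hyp_emb:
  fixes k :: "real^'n::finite \<Rightarrow> ennreal"
  assumes k: "k \<in> borel_measurable borel"
  shows "(\<integral>\<^sup>+x. k x \<partial>lborel) = (\<integral>\<^sup>+q. (\<integral>\<^sup>+t. k (hyp_emb j q + t *\<^sub>R axis j 1) \<partial>lborel) \<partial>PiM (UNIV - {j}) (\<lambda>_. lborel))"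
proof -
  interpret product_sigma_finite "\<lambda>_::'n. lborel :: real measure" by unfold_locales
  have ins: "insert j (UNIV - {j}) = (UNIV :: 'n set)" by blast
  have m: "(\<lambda>f. k (vec_lambda f)) \<in> borel_measurable (PiM (insert j (UNIV - {j})) (\<lambda>_. lborel))"
    unfolding ins by (rule measurable_compose[OF vec_lambda_measurable k])
  have "(\<integral>\<^sup>+x. k x \<partial>lborel) = (\<integral>\<^sup>+f. k (vec_lambda f) \<partial>PiM UNIV (\<lambda>_. lborel))"
    using k by (subst lborel_vec_PiM) (simp add: nn_integral_distr[OF vec_lambda_measurable])
  also have "\<dots> = (\<integral>\<^sup>+f. k (vec_lambda f) \<partial>PiM (insert j (UNIV - {j})) (\<lambda>_. lborel))" unfolding ins ..
  also have "\<dots> = (\<integral>\<^sup>+q. (\<integral>\<^sup>+t. k (vec_lambda (q(j := t))) \<partial>lborel) \<partial>PiM (UNIV - {j}) (\<lambda>_. lborel))"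
    by (rule product_nn_integral_insert[OF _ _ m]) auto
  also have "\<dots> = (\<integral>\<^sup>+q. (\<integral>\<^sup>+t. k (hyp_emb j q + t *\<^sub>R axis j 1) \<partial>lborel) \<partial>PiM (UNIV - {j}) (\<lambda>_. lborel))"
  proof -
    have "vec_lambda (q(j := t)) = hyp_emb j q + t *\<^sub>R axis j 1" for q :: "'n \<Rightarrow> real" and t
      by (auto simp: vec_eq_iff hyp_emb_def axis_def)
    then show ?thesis by simp
  qed
  finally show ?thesis .
qed

context carnot begin

lemma Dg_tendsto_0:
  assumes "(u \<longlongrightarrow> 0) F" "(v \<longlongrightarrow> 0) F" shows "((\<lambda>a. Dg (u a, v a) z) \<longlongrightarrow> Dg (0,0) z) F"
proof -
  have "((\<lambda>a. (u a, v a)) \<longlongrightarrow> (0,0)) F" by (intro tendsto_intros assms)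
  then have "((\<lambda>a. Dg (u a, v a)) \<longlongrightarrow> Dg (0,0)) F" using continuous_on_tendsto_compose[OF Dg_cont, of _ "(0,0)"] by simp
  then show ?thesis by (intro tendsto_intros)
qed

lemma dl_tendsto_0: "((\<lambda>a. dl a y) \<longlongrightarrow> 0) (at_right 0)"
proof -
  have "((\<lambda>a. dl a y) \<longlongrightarrow> dl 0 y) (at_right 0)" by (intro tendsto_intros)
  then show ?thesis by simp
qed

text \<open>The Jacobian matrices of a map commuting with dilations at y and at \<open>dl a y\<close> are conjugate; let a tend to 0.\<close>

lemma homogeneous_det_const:
  assumes d: "\<And>y. (f has_derivative f' y) (at y)" and h: "\<And>a y. a > 0 \<Longrightarrow> f (dl a y) = dl a (f y)"
    and lim: "\<And>k. ((\<lambda>a. f' (dl a y) k) \<longlongrightarrow> f' 0 k) (at_right 0)"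
  shows "det (matrix (f' y)) = det (matrix (f' 0))"
proof (rule det_homogeneous_const[where M = "\<lambda>a. matrix (f' (dl a y))"])
  fix a :: real assume a: "a > 0"
  have lin: "linear (f' y)" for y using d has_derivative_linear by blast
  have "((\<lambda>y. f (dl a y)) has_derivative (\<lambda>k. f' (dl a y) (dl a k))) (at y)"
    by (rule has_derivative_compose[OF dl_has_derivative d])
  moreover have "((\<lambda>y. dl a (f y)) has_derivative (\<lambda>k. dl a (f' y k))) (at y)"
    by (rule has_derivative_compose[OF d dl_has_derivative])
  ultimately have "(\<lambda>k. f' (dl a y) (dl a k)) = (\<lambda>k. dl a (f' y k))"
    unfolding h[OF a] by (rule has_derivative_unique)
  then show "matrix (f' (dl a y)) ** matrix (dl a) = matrix (dl a) ** matrix (f' y)"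
    by (simp add: matrix_compose[symmetric] lin linear_dl o_def)
qed (rule matrix_tendsto[OF lim])

end

section \<open>Integral lines of X_j and the projection onto the hyperplane\<close>

locale carnot_proj = carnot gm \<sigma> for gm :: "real^'n::finite \<Rightarrow> real^'n \<Rightarrow> real^'n" (infixl "\<odot>" 70) and \<sigma> +
  fixes j :: 'n
  assumes sj: "\<sigma> j = 1"
begin

abbreviation ej :: "real^'n" where "ej \<equiv> axis j 1"
abbreviation pr :: "real^'n \<Rightarrow> real^'n" where "pr \<equiv> proj gm j"

lemma gm_ej_nth: "(x \<odot> (t *\<^sub>R ej)) $ j = x $ j + t"
  using gm_nth_axis[OF sj, of x t j] by simp

lemma pr_eq: "pr x = x \<odot> ((- x $ j) *\<^sub>R ej)"
  unfolding proj_def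
proof (rule the_equality)
  show "(x \<odot> ((- x $ j) *\<^sub>R ej)) $ j = 0 \<and> (\<exists>t. x \<odot> ((- x $ j) *\<^sub>R ej) \<odot> (t *\<^sub>R ej) = x)"
  proof
    show "(x \<odot> ((- x $ j) *\<^sub>R ej)) $ j = 0" by (simp only: gm_ej_nth)
    show "\<exists>t. x \<odot> ((- x $ j) *\<^sub>R ej) \<odot> (t *\<^sub>R ej) = x"
      by (rule exI[of _ "x $ j"]) (simp add: gm_assoc gm_scaleR)
  qed
next
  fix p assume p: "p $ j = 0 \<and> (\<exists>t. p \<odot> (t *\<^sub>R ej) = x)"
  then obtain t where t: "p \<odot> (t *\<^sub>R ej) = x" by blast
  have "x $ j = t" using p unfolding t[symmetric] gm_ej_nth by simp
  then show "p = x \<odot> ((- x $ j) *\<^sub>R ej)" unfolding t[symmetric] by (simp add: gm_assoc gm_scaleR)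
qed

lemma pr_nth [simp]: "pr x $ j = 0"
  unfolding pr_eq gm_ej_nth by simp

lemma pr_split: "pr x \<odot> (x $ j *\<^sub>R ej) = x"
  by (simp add: pr_eq gm_assoc gm_scaleR)

lemma pr_gm_ej [simp]: "pr (x \<odot> (t *\<^sub>R ej)) = pr x"
  unfolding pr_eq gm_ej_nth by (simp add: gm_assoc gm_scaleR)

lemma pr_fix: "p $ j = 0 \<Longrightarrow> pr p = p"
  by (simp add: pr_eq)

lemma pr_eq_iff: "pr x = pr y \<longleftrightarrow> (\<exists>t. x = y \<odot> (t *\<^sub>R ej))"
proof
  assume "pr x = pr y"
  then have "x = pr y \<odot> (x $ j *\<^sub>R ej)" using pr_split[of x] by simp
  then have "x = y \<odot> ((- y $ j) *\<^sub>R ej) \<odot> (x $ j *\<^sub>R ej)" by (simp add: pr_eq)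
  then have "x = y \<odot> ((- y $ j + x $ j) *\<^sub>R ej)" by (simp only: gm_assoc gm_scaleR)
  then show "\<exists>t. x = y \<odot> (t *\<^sub>R ej)" by blast
qed auto

lemma continuous_pr [continuous_intros]: "continuous_on S f \<Longrightarrow> continuous_on S (\<lambda>x. pr (f x))"
  unfolding pr_eq by (intro continuous_intros)

lemma dl_ej: "dl r (t *\<^sub>R ej) = (r * t) *\<^sub>R ej"
  using sj by (simp add: linear_scale[OF linear_dl] dl_axis)

text \<open>Left translations and dilations permute the integral lines of X_j, so they descend to
  the hyperplane, where they act by p \<mapsto> pr (g \<odot> dl r p).\<close>

lemma pr_translate_pr: "r > 0 \<Longrightarrow> pr (g \<odot> dl r (pr z)) = pr (g \<odot> dl r z)"
proof -
  assume r: "r > 0"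
  have "g \<odot> dl r z = g \<odot> dl r (pr z \<odot> (z $ j *\<^sub>R ej))" by (simp add: pr_split)
  also have "\<dots> = g \<odot> dl r (pr z) \<odot> ((r * z $ j) *\<^sub>R ej)" using r by (simp add: dl_gm[symmetric] dl_ej gm_assoc)
  finally show ?thesis by simp
qed

lemma pr_translate_inj: assumes "r > 0" "pr (g \<odot> dl r x) = pr (g \<odot> dl r y)" shows "pr x = pr y"
proof -
  obtain t where "g \<odot> dl r x = g \<odot> dl r y \<odot> (t *\<^sub>R ej)" using assms(2) pr_eq_iff by blast
  then have "dl r x = dl r y \<odot> (t *\<^sub>R ej)" by (simp add: gm_assoc)
  also have "t *\<^sub>R ej = dl r ((t/r) *\<^sub>R ej)" using assms(1) by (simp add: dl_ej)
  also have "dl r y \<odot> dl r ((t/r) *\<^sub>R ej) = dl r (y \<odot> ((t/r) *\<^sub>R ej))" by (rule dl_gm[OF assms(1)])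
  finally have "dl (1/r) (dl r x) = dl (1/r) (dl r (y \<odot> ((t/r) *\<^sub>R ej)))" by simp
  then have "x = y \<odot> ((t/r) *\<^sub>R ej)" using assms(1) by (simp add: dl_inverse)
  then show ?thesis by simp
qed

text \<open>\<open>Tm\<close> bends the straight line in direction j through a point of the
  hyperplane into the integral line of X_j through that point; \<open>Ti\<close> is its inverse.
  Both have unit Jacobian, which turns Fubini in coordinates into Fubini along integral
  lines.\<close>

definition Tm :: "real^'n \<Rightarrow> real^'n" where "Tm y = (y - y $ j *\<^sub>R ej) \<odot> (y $ j *\<^sub>R ej)"
definition Ti :: "real^'n \<Rightarrow> real^'n" where "Ti x = x \<odot> (- (x $ j *\<^sub>R ej)) + x $ j *\<^sub>R ej"

lemma ej_nth [simp]: "ej $ j = 1" by (simp add: axis_def)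

lemma Tm_Ti: "Tm (Ti x) = x"
proof -
  have 1: "Ti x $ j = x $ j" unfolding Ti_def using gm_ej_nth[of x "- x $ j"] by simp
  have "Tm (Ti x) = x \<odot> (- (x $ j *\<^sub>R ej)) \<odot> (x $ j *\<^sub>R ej)" unfolding Tm_def 1 by (simp add: Ti_def)
  then show ?thesis by simp
qed

lemma Ti_Tm: "Ti (Tm y) = y"
proof -
  have 1: "Tm y $ j = y $ j" unfolding Tm_def gm_ej_nth by simp
  show ?thesis unfolding Ti_def 1 by (simp add: Tm_def)
qed

lemma nth_has_derivative: "((\<lambda>x. x $ j *\<^sub>R ej) has_derivative (\<lambda>k. k $ j *\<^sub>R ej)) (at x within S)"
  by (intro bounded_linear_imp_has_derivative bounded_linear_compose[OF bounded_linear_scaleR_left bounded_linear_vec_nth])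

lemma nn_integral_Tm:
  assumes h: "h \<in> borel_measurable borel" shows "(\<integral>\<^sup>+x. h (Tm x) \<partial>lborel) = (\<integral>\<^sup>+x. h x \<partial>lborel)"
proof -
  let ?T' = "\<lambda>y k. Dg (y - y $ j *\<^sub>R ej, y $ j *\<^sub>R ej) (k - k $ j *\<^sub>R ej, k $ j *\<^sub>R ej)"
  let ?I' = "\<lambda>y k. Dg (y, - (y $ j *\<^sub>R ej)) (k, - (k $ j *\<^sub>R ej)) + k $ j *\<^sub>R ej"
  have dT: "(Tm has_derivative ?T' y) (at y)" for y
    unfolding Tm_def by (intro gm_has_derivative has_derivative_diff has_derivative_ident nth_has_derivative)
  have dI: "(Ti has_derivative ?I' y) (at y)" for y
    unfolding Ti_def by (intro has_derivative_add gm_has_derivative has_derivative_minus has_derivative_ident nth_has_derivative)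
  have l1: "((\<lambda>a. dl a y $ j *\<^sub>R ej) \<longlongrightarrow> 0) (at_right 0)" for y
  proof -
    have "((\<lambda>a. dl a y $ j *\<^sub>R ej) \<longlongrightarrow> (0::real^'n) $ j *\<^sub>R ej) (at_right 0)"
      by (intro tendsto_scaleR tendsto_vec_nth dl_tendsto_0 tendsto_const)
    then show ?thesis by simp
  qed
  have l2: "((\<lambda>a. dl a y - dl a y $ j *\<^sub>R ej) \<longlongrightarrow> 0) (at_right 0)" for y
    using tendsto_diff[OF dl_tendsto_0 l1] by simp
  have l3: "((\<lambda>a. - (dl a y $ j *\<^sub>R ej)) \<longlongrightarrow> 0) (at_right 0)" for y
    using tendsto_minus[OF l1] by simp
  have id: "det (matrix (\<lambda>k::real^'n. k)) = 1" by (simp add: matrix_id_mat_1[unfolded id_def])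
  have "det (matrix (?T' y)) = det (matrix (?T' 0))" for y
  proof (rule homogeneous_det_const[OF dT])
    show "Tm (dl a y) = dl a (Tm y)" if "a > 0" for a y
      using that sj by (simp add: Tm_def dl_gm[symmetric] linear_diff[OF linear_dl] linear_scale[OF linear_dl] dl_axis mult.commute)
    show "((\<lambda>a. ?T' (dl a y) k) \<longlongrightarrow> ?T' 0 k) (at_right 0)" for k
      using Dg_tendsto_0[OF l2 l1] by simp
  qed
  then have detT: "\<bar>det (matrix (?T' y))\<bar> = 1" for y by (simp add: Dg_0 id)
  have "det (matrix (?I' y)) = det (matrix (?I' 0))" for y
  proof (rule homogeneous_det_const[OF dI])
    show "Ti (dl a y) = dl a (Ti y)" if "a > 0" for a y
      using that sj by (simp add: Ti_def dl_gm[symmetric] dl_uminus linear_add[OF linear_dl] linear_scale[OF linear_dl] dl_axis mult.commute)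
    show "((\<lambda>a. ?I' (dl a y) k) \<longlongrightarrow> ?I' 0 k) (at_right 0)" for k
      using tendsto_add[OF Dg_tendsto_0[OF dl_tendsto_0 l3] tendsto_const] by simp
  qed
  then have detI: "\<bar>det (matrix (?I' y))\<bar> = 1" for y by (simp add: Dg_0 id)
  show ?thesis
    using nn_integral_lborel_diffeo[of Ti ?I' 1 Tm ?T' h, OF dI detI _ dT _ Tm_Ti Ti_Tm h] detT by simp
qed

text \<open>Lebesgue measure of the hyperplane, placed on the ambient space so that base points are
  elements of the group.\<close>

definition Pm :: "(real^'n) measure" where "Pm = distr (PiM (UNIV - {j}) (\<lambda>_. lborel)) borel (hyp_emb j)"

lemma sets_Pm [simp, measurable_cong]: "sets Pm = sets borel" and space_Pm [simp]: "space Pm = UNIV"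
  by (simp_all add: Pm_def)

lemma nn_integral_Pm: "h \<in> borel_measurable borel \<Longrightarrow> (\<integral>\<^sup>+p. h p \<partial>Pm) = (\<integral>\<^sup>+q. h (hyp_emb j q) \<partial>PiM (UNIV - {j}) (\<lambda>_. lborel))"
  unfolding Pm_def by (rule nn_integral_distr[OF hyp_emb_measurable]) simp

lemma hyp_emb_nth [simp]: "hyp_emb j q $ j = 0" by (simp add: hyp_emb_def)

lemma nn_integral_Pm_mono:
  assumes "h \<in> borel_measurable borel" "h' \<in> borel_measurable borel" "\<And>p. p $ j = 0 \<Longrightarrow> h p \<le> h' p"
  shows "(\<integral>\<^sup>+p. h p \<partial>Pm) \<le> (\<integral>\<^sup>+p. h' p \<partial>Pm)"
  unfolding nn_integral_Pm[OF assms(1)] nn_integral_Pm[OF assms(2)] by (rule nn_integral_mono) (simp add: assms(3))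

lemma borel_line_integral:
  assumes k: "k \<in> borel_measurable borel"
  shows "(\<lambda>p. \<integral>\<^sup>+t. k (p \<odot> (t *\<^sub>R ej)) \<partial>lborel) \<in> borel_measurable (borel :: (real^'n) measure)"
proof -
  have c: "(\<lambda>z::(real^'n) \<times> real. fst z \<odot> (snd z *\<^sub>R ej)) \<in> borel_measurable borel"
    by (intro borel_measurable_continuous_onI continuous_intros)
  have "(\<lambda>z. k (fst z \<odot> (snd z *\<^sub>R ej))) \<in> borel_measurable (borel :: ((real^'n) \<times> real) measure)" by (rule measurable_compose[OF c k])
  then have "(\<lambda>z. k (fst z \<odot> (snd z *\<^sub>R ej))) \<in> borel_measurable ((borel :: (real^'n) measure) \<Otimes>\<^sub>M (lborel :: real measure))"
    by (simp add: borel_prod[symmetric] measurable_cong_sets[OF sets_pair_measure_cong[OF refl sets_lborel] refl])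
  then have "(\<lambda>(p,t). k (p \<odot> (t *\<^sub>R ej))) \<in> borel_measurable ((borel :: (real^'n) measure) \<Otimes>\<^sub>M (lborel :: real measure))"
    by (simp add: case_prod_beta)
  then show ?thesis by (rule lborel.borel_measurable_nn_integral)
qed

lemma fubini_Pm:
  assumes k: "k \<in> borel_measurable borel"
  shows "(\<integral>\<^sup>+x. k x \<partial>lborel) = (\<integral>\<^sup>+p. (\<integral>\<^sup>+t. k (p \<odot> (t *\<^sub>R ej)) \<partial>lborel) \<partial>Pm)"
proof -
  have cT: "Tm \<in> borel_measurable borel"
    unfolding Tm_def by (intro borel_measurable_continuous_onI continuous_intros)
  have T: "Tm (hyp_emb j q + t *\<^sub>R ej) = hyp_emb j q \<odot> (t *\<^sub>R ej)" for q t by (simp add: Tm_def)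
  have "(\<integral>\<^sup>+x. k x \<partial>lborel) = (\<integral>\<^sup>+x. k (Tm x) \<partial>lborel)" by (rule nn_integral_Tm[OF k, symmetric])
  also have "\<dots> = (\<integral>\<^sup>+q. (\<integral>\<^sup>+t. k (Tm (hyp_emb j q + t *\<^sub>R ej)) \<partial>lborel) \<partial>PiM (UNIV - {j}) (\<lambda>_. lborel))"
    by (rule nn_integral_hyp_emb[OF measurable_compose[OF cT k]])
  also have "\<dots> = (\<integral>\<^sup>+p. (\<integral>\<^sup>+t. k (p \<odot> (t *\<^sub>R ej)) \<partial>lborel) \<partial>Pm)"
    unfolding T by (rule nn_integral_Pm[OF borel_line_integral[OF k], symmetric])
  finally show ?thesis .
qed

lemma pr_measurable: "pr \<in> borel_measurable borel"
  by (intro borel_measurable_continuous_onI continuous_pr continuous_on_id)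

text \<open>An integral over the hyperplane becomes one over a slab of the group, so that the
  invariances of Lebesgue measure can be transferred to \<open>Pm\<close>.\<close>

lemma nn_integral_window:
  assumes h: "h \<in> borel_measurable borel" and ab: "a \<le> b"
  shows "(\<integral>\<^sup>+x. h (pr x) * indicator {a..b} (x $ j) \<partial>lborel) = ennreal (b - a) * (\<integral>\<^sup>+p. h p \<partial>Pm)"
proof -
  have m: "(\<lambda>x. h (pr x) * indicator {a..b} (x $ j)) \<in> borel_measurable borel"
  proof (rule borel_measurable_times_ennreal[OF measurable_compose[OF pr_measurable h]])
    have "(\<lambda>x::real^'n. x $ j) \<in> borel_measurable borel" by (intro borel_measurable_continuous_onI continuous_intros)
    then show "(\<lambda>x::real^'n. indicator {a..b} (x $ j) :: ennreal) \<in> borel_measurable borel"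
      by (rule measurable_compose) simp
  qed
  have m2: "(\<lambda>p. ennreal (b - a) * h p) \<in> borel_measurable borel" using h by simp
  have inner: "(\<integral>\<^sup>+t. h (pr (p \<odot> (t *\<^sub>R ej))) * indicator {a..b} ((p \<odot> (t *\<^sub>R ej)) $ j) \<partial>lborel) = ennreal (b - a) * h p" if "p $ j = 0" for p
  proof -
    have "(\<integral>\<^sup>+t. h (pr (p \<odot> (t *\<^sub>R ej))) * indicator {a..b} ((p \<odot> (t *\<^sub>R ej)) $ j) \<partial>lborel) = (\<integral>\<^sup>+t. h p * indicator {a..b} t \<partial>lborel)"
      unfolding gm_ej_nth pr_gm_ej using that by (simp add: pr_fix)
    also have "\<dots> = h p * ennreal (b - a)" using ab by (simp add: nn_integral_cmult_indicator)
    finally show ?thesis by (simp add: mult.commute)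
  qed
  have "(\<integral>\<^sup>+x. h (pr x) * indicator {a..b} (x $ j) \<partial>lborel)
      = (\<integral>\<^sup>+p. (\<integral>\<^sup>+t. h (pr (p \<odot> (t *\<^sub>R ej))) * indicator {a..b} ((p \<odot> (t *\<^sub>R ej)) $ j) \<partial>lborel) \<partial>Pm)"
    by (rule fubini_Pm[OF m])
  also have "\<dots> = (\<integral>\<^sup>+p. ennreal (b - a) * h p \<partial>Pm)"
    unfolding nn_integral_Pm[OF borel_line_integral[OF m]] nn_integral_Pm[OF m2]
    by (rule nn_integral_cong) (rule inner, simp)
  also have "\<dots> = ennreal (b - a) * (\<integral>\<^sup>+p. h p \<partial>Pm)" using h by (intro nn_integral_cmult) (simp add: Pm_def)
  finally show ?thesis .
qed

lemma nu_pos: "nu \<ge> 1"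
  using member_le_sum[of j UNIV \<sigma>] sj by (simp add: nu_def)

text \<open>A slab of thickness r is the image of one of thickness 1 under a translated dilation. Of
  the Jacobian r^nu one factor r is the thickness, which leaves r^(nu - 1).\<close>

lemma nn_integral_Pm_scale:
  assumes h: "h \<in> borel_measurable borel" and r: "r > 0"
  shows "(\<integral>\<^sup>+p. h p \<partial>Pm) = ennreal (r ^ (nu - 1)) * (\<integral>\<^sup>+p. h (pr (g \<odot> dl r p)) \<partial>Pm)"
proof -
  have cg: "(\<lambda>z. pr (g \<odot> dl r z)) \<in> borel_measurable borel" by (intro borel_measurable_continuous_onI continuous_intros)
  have m0: "(\<lambda>x::real^'n. x $ j) \<in> borel_measurable borel" by (intro borel_measurable_continuous_onI continuous_intros)
  have mI: "(\<lambda>x. h (pr x) * indicator {g $ j..g $ j + r} (x $ j)) \<in> borel_measurable borel"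
    by (rule borel_measurable_times_ennreal[OF measurable_compose[OF pr_measurable h] measurable_compose[OF m0]]) simp
  let ?k = "\<lambda>x. h (pr x) * indicator {g $ j..g $ j + r} (x $ j)"
  have mg: "(\<lambda>z. ?k (g \<odot> z)) \<in> borel_measurable borel"
    by (rule measurable_compose[OF _ mI]) (intro borel_measurable_continuous_onI continuous_intros)
  have "ennreal r * (\<integral>\<^sup>+p. h p \<partial>Pm) = (\<integral>\<^sup>+x. ?k x \<partial>lborel)"
    using nn_integral_window[OF h, of "g $ j" "g $ j + r"] r by simp
  also have "\<dots> = (\<integral>\<^sup>+z. ?k (g \<odot> z) \<partial>lborel)" by (rule nn_integral_left_translate[OF mI, symmetric])
  also have "\<dots> = ennreal (r ^ nu) * (\<integral>\<^sup>+z. ?k (g \<odot> dl r z) \<partial>lborel)" by (rule nn_integral_dl[OF mg r, symmetric])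
  also have "(\<integral>\<^sup>+z. ?k (g \<odot> dl r z) \<partial>lborel) = (\<integral>\<^sup>+z. h (pr (g \<odot> dl r (pr z))) * indicator {0..1} (z $ j) \<partial>lborel)"
  proof (rule nn_integral_cong)
    fix z
    have "(g \<odot> dl r z) $ j = g $ j + r * z $ j" using sj by (simp add: gm_nth_horiz)
    then have "indicator {g $ j..g $ j + r} ((g \<odot> dl r z) $ j) = (indicator {0..1} (z $ j) :: ennreal)"
      using r by (simp add: indicator_def zero_le_mult_iff)
    then show "?k (g \<odot> dl r z) = h (pr (g \<odot> dl r (pr z))) * indicator {0..1} (z $ j)"
      by (simp add: pr_translate_pr[OF r])
  qed
  also have "\<dots> = (\<integral>\<^sup>+p. h (pr (g \<odot> dl r p)) \<partial>Pm)"
    using nn_integral_window[OF measurable_compose[OF cg h], of 0 1] by simp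
  finally have "ennreal r * (\<integral>\<^sup>+p. h p \<partial>Pm) = ennreal (r ^ nu) * (\<integral>\<^sup>+p. h (pr (g \<odot> dl r p)) \<partial>Pm)" .
  moreover have "r ^ nu = r * r ^ (nu - 1)" using nu_pos by (metis le_add_diff_inverse power_Suc plus_1_eq_Suc)
  ultimately have "ennreal r * (\<integral>\<^sup>+p. h p \<partial>Pm) = ennreal r * (ennreal (r ^ (nu - 1)) * (\<integral>\<^sup>+p. h (pr (g \<odot> dl r p)) \<partial>Pm))"
    using r by (simp add: ennreal_mult' mult.assoc)
  then show ?thesis using r by (simp add: ennreal_mult_cancel_left)
qed

lemma Pm_compact_finite: assumes "compact S" shows "emeasure Pm S < top"
proof -
  have Sb: "S \<in> sets borel" using assms by (rule borel_compact)
  have "emeasure Pm S = (\<integral>\<^sup>+p. indicator S p \<partial>Pm)" using Sb by simp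
  also have "\<dots> = (\<integral>\<^sup>+x. indicator S (pr x) * indicator {0..1} (x $ j) \<partial>lborel)"
    using nn_integral_window[of "indicator S" 0 1] Sb by simp
  also have "\<dots> \<le> (\<integral>\<^sup>+x. indicator ((\<lambda>z. fst z \<odot> (snd z *\<^sub>R ej)) ` (S \<times> {0..1})) x \<partial>lborel)"
  proof (rule nn_integral_mono)
    fix x
    show "indicator S (pr x) * indicator {0..1} (x $ j) \<le> (indicator ((\<lambda>z. fst z \<odot> (snd z *\<^sub>R ej)) ` (S \<times> {0..1})) x :: ennreal)"
    proof (cases "pr x \<in> S \<and> x $ j \<in> {0..1}")
      case True
      then have "x \<in> (\<lambda>z. fst z \<odot> (snd z *\<^sub>R ej)) ` (S \<times> {0..1})"
        using pr_split[of x] by (intro image_eqI[of _ _ "(pr x, x $ j)"]) auto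
      then show ?thesis by (simp add: indicator_def)
    qed (auto simp: indicator_def)
  qed
  also have "\<dots> = emeasure lborel ((\<lambda>z. fst z \<odot> (snd z *\<^sub>R ej)) ` (S \<times> {0..1}))"
    by (intro nn_integral_indicator) (auto intro!: borel_compact compact_continuous_image compact_Times assms continuous_intros)
  also have "\<dots> < top"
  proof -
    have "compact ((\<lambda>z. fst z \<odot> (snd z *\<^sub>R ej)) ` (S \<times> {0..1::real}))"
      by (intro compact_continuous_image compact_Times assms continuous_intros compact_Icc)
    from emeasure_compact_finite[OF this] show ?thesis by simp
  qed
  finally show ?thesis .
qed

definition cP :: real where "cP = measure Pm (pr ` cB 0 1)"

lemma compact_pr_cB: "compact (pr ` cB x r)"
  by (intro compact_continuous_image continuous_intros compact_cB)

text \<open>The map induced on the hyperplane by the translated dilation takes the projected unit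
  ball onto the projected ball of radius r about y.\<close>

lemma Pm_pr_cB: assumes r: "r > 0" shows "emeasure Pm (pr ` cB y r) \<le> ennreal (r ^ (nu - 1) * cP)"
proof -
  have b: "pr ` cB y r \<in> sets borel" "pr ` cB 0 1 \<in> sets borel" using compact_pr_cB borel_compact by blast+
  have cg: "(\<lambda>z. pr (y \<odot> dl r z)) \<in> borel_measurable borel" by (intro borel_measurable_continuous_onI continuous_intros)
  have "emeasure Pm (pr ` cB y r) = (\<integral>\<^sup>+p. indicator (pr ` cB y r) p \<partial>Pm)" using b by simp
  also have "\<dots> = ennreal (r ^ (nu - 1)) * (\<integral>\<^sup>+p. indicator (pr ` cB y r) (pr (y \<odot> dl r p)) \<partial>Pm)"
    using b by (intro nn_integral_Pm_scale r) auto
  also have "(\<integral>\<^sup>+p. indicator (pr ` cB y r) (pr (y \<odot> dl r p)) \<partial>Pm) \<le> (\<integral>\<^sup>+p. indicator (pr ` cB 0 1) p \<partial>Pm)"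
  proof (rule nn_integral_Pm_mono)
    show "(\<lambda>p. indicator (pr ` cB y r) (pr (y \<odot> dl r p)) :: ennreal) \<in> borel_measurable borel"
      by (rule measurable_compose[OF cg]) (use b in simp)
    fix p :: "real^'n" assume p: "p $ j = 0"
    have "p \<in> pr ` cB 0 1" if mem: "pr (y \<odot> dl r p) \<in> pr ` cB y r"
    proof -
      obtain u where u: "u \<in> cB y r" "pr (y \<odot> dl r p) = pr u" using mem by blast
      define z where "z = dl (1/r) ((- y) \<odot> u)"
      have uz: "u = y \<odot> dl r z" using r by (simp add: z_def dl_inverse)
      have "r * Nm z \<le> r * 1" using u(1) r unfolding uz cB_def by (simp add: rho_gm_right Nm_dl)
      then have "z \<in> cB 0 1" using r by (simp add: cB_def Nm_def[symmetric])
      moreover have "pr p = pr z" using pr_translate_inj[OF r] u(2) unfolding uz by blast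
      ultimately show ?thesis using pr_fix[OF p] by (metis imageI)
    qed
    then show "indicator (pr ` cB y r) (pr (y \<odot> dl r p)) \<le> (indicator (pr ` cB 0 1) p :: ennreal)"
      by (auto simp: indicator_def)
  qed (use b in simp)
  also have "\<dots> = emeasure Pm (pr ` cB 0 1)" using b by simp
  also have "\<dots> = ennreal cP" unfolding cP_def using Pm_compact_finite[OF compact_pr_cB] by (simp add: emeasure_eq_ennreal_measure less_top[symmetric])
  finally show ?thesis using r by (simp add: ennreal_mult' mult_left_mono)
qed

end

section \<open>Fibres over negligible sets and measurability\<close>

text \<open>Inner regularity is applied in turn to the part of A in the ball of radius n that is not
  yet exhausted, with error 1/(n + 1). Disjointness is wanted because fibre measures add over
  disjoint compact sets.\<close>

lemma lebesgue_disjoint_compacts: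
  fixes A :: "'a::euclidean_space set"
  assumes A: "A \<in> sets lebesgue"
  shows "\<exists>K::nat \<Rightarrow> 'a set. (\<forall>i. compact (K i) \<and> K i \<subseteq> A) \<and> (\<forall>i l. i \<noteq> l \<longrightarrow> K i \<inter> K l = {}) \<and> negligible (A - (\<Union>i. K i))"
proof -
  define Q where "Q n H H' \<longleftrightarrow> (\<exists>K. compact K \<and> K \<subseteq> A \<and> K \<inter> H = {} \<and> H' = H \<union> K \<and> A \<inter> cball 0 (real n) - H' \<in> lmeasurable \<and>
      measure lebesgue (A \<inter> cball 0 (real n) - H') < 1 / real (Suc n))" for n :: nat and H H' :: "'a set"
  have "\<exists>H. \<forall>n. (compact (H n) \<and> H n \<subseteq> A) \<and> Q n (H n) (H (Suc n))"
  proof (rule dependent_nat_choice)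
    show "\<exists>x. compact x \<and> x \<subseteq> A" by (rule exI[of _ "{}"]) simp
    fix H :: "'a set" and n :: nat assume H: "compact H \<and> H \<subseteq> A"
    have Hb: "H \<in> sets lebesgue" using H by (simp add: borel_compact)
    have B: "A \<inter> cball 0 (real n) - H \<in> sets lebesgue" using A Hb by (intro sets.Diff sets.Int) auto
    obtain T where T: "closed T" "T \<subseteq> A \<inter> cball 0 (real n) - H" "A \<inter> cball 0 (real n) - H - T \<in> lmeasurable"
      "emeasure lebesgue (A \<inter> cball 0 (real n) - H - T) < ennreal (1 / real (Suc n))"
      using sets_lebesgue_inner_closed[OF B, of "1 / real (Suc n)"] by auto
    have Tc: "compact T" using T(1,2) by (meson Diff_subset Int_lower2 bounded_cball bounded_subset compact_eq_bounded_closed order_trans)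
    have eq: "A \<inter> cball 0 (real n) - H - T = A \<inter> cball 0 (real n) - (H \<union> T)" by blast
    have lt: "measure lebesgue (A \<inter> cball 0 (real n) - (H \<union> T)) < 1 / real (Suc n)"
      using T(4) T(3) unfolding eq by (simp add: emeasure_eq_measure2 ennreal_less_iff)
    show "\<exists>y. (compact y \<and> y \<subseteq> A) \<and> Q n H y"
      unfolding Q_def using H Tc T(2,3) lt
      by (intro exI[of _ "H \<union> T"] conjI exI[of _ T] compact_Un) (auto simp: eq)
  qed
  then obtain H where H: "\<And>n. compact (H n)" "\<And>n. H n \<subseteq> A" and Q: "\<And>n. Q n (H n) (H (Suc n))" by blast
  from Q have "\<forall>n. \<exists>K. compact K \<and> K \<subseteq> A \<and> K \<inter> H n = {} \<and> H (Suc n) = H n \<union> K \<and> A \<inter> cball 0 (real n) - H (Suc n) \<in> lmeasurable \<and>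
      measure lebesgue (A \<inter> cball 0 (real n) - H (Suc n)) < 1 / real (Suc n)" unfolding Q_def by simp
  from choice[OF this] obtain K where K: "\<And>n. compact (K n)" "\<And>n. K n \<subseteq> A" "\<And>n. K n \<inter> H n = {}" "\<And>n. H (Suc n) = H n \<union> K n"
      "\<And>n. A \<inter> cball 0 (real n) - H (Suc n) \<in> lmeasurable" "\<And>n. measure lebesgue (A \<inter> cball 0 (real n) - H (Suc n)) < 1 / real (Suc n)" by blast
  have Hmono: "H m \<subseteq> H n" if "m \<le> n" for m n using lift_Suc_mono_le[of H m n] K(4) that by blast
  have dis: "K i \<inter> K l = {}" if "i < l" for i l
  proof -
    have "K i \<subseteq> H (Suc i)" unfolding K(4) by blast
    also have "H (Suc i) \<subseteq> H l" using that by (intro Hmono) simp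
    finally show ?thesis using K(3)[of l] by blast
  qed
  \<comment> \<open>the sets H n start from an arbitrary compact H 0, which is therefore added to the sequence\<close>
  define K' where "K' i = (case i of 0 \<Rightarrow> H 0 | Suc n \<Rightarrow> K n)" for i
  have HU: "H n \<subseteq> (\<Union>i. K' i)" for n
  proof (induction n)
    case 0 show ?case using UN_upper[of 0 UNIV K'] by (simp add: K'_def)
  next
    case (Suc n) show ?case unfolding K(4) using Suc UN_upper[of "Suc n" UNIV K'] by (simp add: K'_def)
  qed
  have dis': "K' i \<inter> K' l = {}" if "i < l" for i l
  proof -
    obtain l' where l: "l = Suc l'" using \<open>i < l\<close> by (cases l) auto
    show ?thesis
    proof (cases i)
      case 0 then show ?thesis using K(3)[of l'] Hmono[of 0 l'] by (auto simp: K'_def l)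
    next
      case (Suc i') then show ?thesis using dis[of i' l'] \<open>i < l\<close> by (simp add: K'_def l)
    qed
  qed
  have neg: "negligible ((A - (\<Union>i. K' i)) \<inter> cball 0 (real m))" for m
  proof (rule negligible_outer_le[THEN iffD2], intro allI impI)
    fix e :: real assume e: "e > 0"
    obtain n0 where n0: "1 / real (Suc n0) < e" using nat_approx_posE[OF e] by (metis of_nat_Suc)
    define n where "n = max n0 m"
    have n: "m \<le> n" "1 / real (Suc n) < e"
    proof -
      have "1 / real (Suc n) \<le> 1 / real (Suc n0)" unfolding n_def by (intro divide_left_mono) auto
      then show "m \<le> n" "1 / real (Suc n) < e" using n0 by (simp_all add: n_def)
    qed
    have "(A - (\<Union>i. K' i)) \<inter> cball 0 (real m) \<subseteq> A \<inter> cball 0 (real n) - H (Suc n)" using HU[of "Suc n"] n(1) by auto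
    then show "\<exists>T. (A - (\<Union>i. K' i)) \<inter> cball 0 (real m) \<subseteq> T \<and> T \<in> lmeasurable \<and> measure lebesgue T \<le> e"
      using K(5)[of n] K(6)[of n] n(2) by (intro exI[of _ "A \<inter> cball 0 (real n) - H (Suc n)"]) auto
  qed
  have "negligible (\<Union>m. (A - (\<Union>i. K' i)) \<inter> cball 0 (real m))" by (rule negligible_countable_Union) (use neg in auto)
  moreover have "(\<Union>m. (A - (\<Union>i. K' i)) \<inter> cball 0 (real m)) = A - (\<Union>i. K' i)"
  proof -
    have "\<exists>m. x \<in> cball 0 (real m)" for x :: 'a using real_arch_simple[of "norm x"] by simp
    then show ?thesis by blast
  qed
  moreover have "compact (K' i) \<and> K' i \<subseteq> A" for i using H K(1,2) by (auto simp: K'_def split: nat.split)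
  moreover have "K' i \<inter> K' l = {}" if "i \<noteq> l" for i l
    using dis'[of i l] dis'[of l i] that by (cases "i < l") auto
  ultimately show ?thesis by (intro exI[of _ K'] conjI allI impI) simp_all
qed

context carnot_proj begin

lemma disjoint_cB_sequence:
  assumes U: "U \<in> lmeasurable" and C: "\<And>c. c \<in> C \<Longrightarrow> snd c > 0 \<and> case_prod cB c \<subseteq> U"
    and dis: "\<And>c c'. c \<in> C \<Longrightarrow> c' \<in> C \<Longrightarrow> c \<noteq> c' \<Longrightarrow> case_prod cB c \<inter> case_prod cB c' = {}"
  shows "\<exists>x r. (\<forall>n::nat. r n = 0 \<or> (x n, r n) \<in> C) \<and> (\<forall>c\<in>C. \<exists>n. c = (x n, r n)) \<and>
     (\<Sum>n. ennreal (r n ^ nu * om)) \<le> ennreal (measure lebesgue U)"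
proof -
  have cC: "countable C" by (rule disjoint_cB_summable(2)[of U C]) (use U C dis in auto)
  let ?S = "to_nat_on C ` C"
  have inj: "inj_on (to_nat_on C) C" using cC by (rule inj_on_to_nat_on)
  define q where "q n = inv_into C (to_nat_on C) n" for n
  define x where "x n = fst (q n)" for n
  define r where "r n = (if n \<in> ?S then snd (q n) else 0)" for n
  have qC: "q n \<in> C" if "n \<in> ?S" for n using that unfolding q_def by (rule inv_into_into)
  have qi: "q (to_nat_on C c) = c" if "c \<in> C" for c unfolding q_def by (rule inv_into_f_f[OF inj that])
  have 1: "r n = 0 \<or> (x n, r n) \<in> C" for n using qC[of n] by (simp add: x_def r_def)
  have 2: "c = (x (to_nat_on C c), r (to_nat_on C c))" if "c \<in> C" for c using that by (simp add: x_def r_def qi)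
  have "(\<Sum>n. ennreal (r n ^ nu * om)) \<le> ennreal (measure lebesgue U)"
    unfolding suminf_eq_SUP
  proof (rule SUP_least)
    fix N
    have rn: "r n \<ge> 0" for n using C[OF qC[of n]] by (auto simp: r_def less_imp_le)
    have "(\<Sum>n<N. r n ^ nu * om) = (\<Sum>n\<in>{..<N} \<inter> ?S. r n ^ nu * om)"
      by (rule sum.mono_neutral_right) (use nu_pos in \<open>auto simp: r_def\<close>)
    also have "\<dots> = (\<Sum>n\<in>{..<N} \<inter> ?S. snd (q n) ^ nu * om)" by (rule sum.cong) (auto simp: r_def)
    also have "\<dots> = (\<Sum>c\<in>q ` ({..<N} \<inter> ?S). snd c ^ nu * om)"
      by (rule sum.reindex[symmetric, unfolded o_def]) (auto simp: inj_on_def qi)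
    also have "\<dots> \<le> measure lebesgue U"
    proof (rule disjoint_cB_sum_le[OF U])
      have sub: "q ` ({..<N} \<inter> ?S) \<subseteq> C" using qC by blast
      show "finite (q ` ({..<N} \<inter> ?S))" by simp
      show "0 < snd c \<and> case_prod cB c \<subseteq> U" if "c \<in> q ` ({..<N} \<inter> ?S)" for c by (rule C[OF subsetD[OF sub that]])
      show "case_prod cB c \<inter> case_prod cB c' = {}" if "c \<in> q ` ({..<N} \<inter> ?S)" "c' \<in> q ` ({..<N} \<inter> ?S)" "c \<noteq> c'" for c c'
        by (rule dis[OF subsetD[OF sub that(1)] subsetD[OF sub that(2)] that(3)])
    qed
    finally show "(\<Sum>n<N. ennreal (r n ^ nu * om)) \<le> ennreal (measure lebesgue U)"
      using rn om_pos by (subst sum_ennreal) (auto intro!: ennreal_leI)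
  qed
  then show ?thesis using 1 2 by (intro exI[of _ x] exI[of _ r]) blast
qed

end

locale carnot_lip = carnot_proj gm \<sigma> j for gm :: "real^'n::finite \<Rightarrow> real^'n \<Rightarrow> real^'n" (infixl "\<odot>" 70) and \<sigma> j +
  fixes E :: "(real^'n) set" and \<phi> :: "real^'n \<Rightarrow> real^'n" and Lc :: real
  assumes Lc: "Lc \<ge> 0" and lip: "x \<in> E \<Longrightarrow> y \<in> E \<Longrightarrow> rho (\<phi> x) (\<phi> y) \<le> Lc * rho x y"
begin

definition fib :: "(real^'n) set \<Rightarrow> real^'n \<Rightarrow> (real^'n) set" where "fib A p = {x \<in> A. pr (\<phi> x) = p}"

lemma continuous_on_lip: "continuous_on E \<phi>"
  unfolding continuous_on_def
proof
  fix x assume x: "x \<in> E"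
  show "(\<phi> \<longlongrightarrow> \<phi> x) (at x within E)"
  proof (rule rho_tendsto_0_imp)
    have "((\<lambda>y. rho y x) \<longlongrightarrow> rho x x) (at x within E)" by (intro tendsto_intros)
    then have t: "((\<lambda>y. Lc * rho y x) \<longlongrightarrow> Lc * rho x x) (at x within E)" by (intro tendsto_intros)
    show "((\<lambda>y. rho (\<phi> y) (\<phi> x)) \<longlongrightarrow> 0) (at x within E)"
    proof (rule tendsto_sandwich[of "\<lambda>_. 0" _ _ "\<lambda>y. Lc * rho y x"])
      show "\<forall>\<^sub>F y in at x within E. rho (\<phi> y) (\<phi> x) \<le> Lc * rho y x"
        unfolding eventually_at_filter using lip x by (intro always_eventually) auto
    qed (use t in \<open>auto simp: rho_nonneg rho_self\<close>)
  qed
qed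

lemma fib_closed:
  assumes K: "compact K" "K \<subseteq> E" shows "closed {z. fst z \<in> K \<and> pr (\<phi> (fst z)) = snd z}"
proof -
  have "continuous_on (K \<times> UNIV) (\<lambda>z. \<phi> (fst z))"
    by (rule continuous_on_compose2[OF continuous_on_lip]) (use K in \<open>auto intro!: continuous_intros\<close>)
  then have "continuous_on (K \<times> UNIV) (\<lambda>z. pr (\<phi> (fst z)) - snd z)" by (intro continuous_intros)
  moreover have "closed (K \<times> (UNIV :: (real^'n) set))" by (rule closed_Times[OF compact_imp_closed[OF K(1)] closed_UNIV])
  ultimately have "closed ((K \<times> UNIV) \<inter> (\<lambda>z. pr (\<phi> (fst z)) - snd z) -` {0})"
    by (rule continuous_closed_preimage) simp
  also have "(K \<times> UNIV) \<inter> (\<lambda>z. pr (\<phi> (fst z)) - snd z) -` {0} = {z. fst z \<in> K \<and> pr (\<phi> (fst z)) = snd z}" by auto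
  finally show ?thesis .
qed

lemma H1_fib_borel: assumes K: "compact K" "K \<subseteq> E" shows "(\<lambda>p. H1 gm \<sigma> (fib K p)) \<in> borel_measurable borel"
  using H1_fiber_measurable[OF K(1) fib_closed[OF K]] by (auto simp: fib_def)

text \<open>A crude coarea inequality. A ball of radius r contributes a length of order r to a
  fibre, and only for base points in the projection of a ball of radius M r, whose measure is of
  order r^(nu - 1). The product is of the order of the volume, and the disjoint balls lie in an open
  set of small measure.\<close>

lemma null_fibre_step:
  assumes Z: "negligible Z" "Z \<subseteq> E" and \<kappa>: "\<kappa> > 0" and e: "e > 0"
  shows "\<exists>G\<in>borel_measurable borel. (\<integral>\<^sup>+p. G p \<partial>Pm) \<le> ennreal e \<and> (\<forall>p. Hpre \<kappa> (fib Z p) \<le> G p)"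
proof -
  \<comment> \<open>A point of the threefold ball about x n is mapped to within 3 Lc r of \<phi> (x
    n); the summand 1 keeps M positive.\<close>
  define M where "M = 3 * Lc + 1"
  have M: "M > 0" "3 * Lc \<le> M" using Lc by (simp_all add: M_def)
  have cP0: "cP \<ge> 0" by (simp add: cP_def)
  \<comment> \<open>Collects the constants: 4 r from the covering balls and (M r)^(nu - 1) cP from
    the projection, divided by the volume r^nu om.\<close>
  define D where "D = 4 * M ^ (nu - 1) * cP / om"
  have D: "D \<ge> 0" using M om_pos cP0 by (simp add: D_def)
  obtain U where U: "open U" "Z \<subseteq> U" "U \<in> lmeasurable" "measure lebesgue U < e / (D + 1)"
    using negligible_outer_open[OF Z(1), of "e / (D + 1)"] e D by auto
  define K where "K = {(x,r). x \<in> Z \<and> 0 < r \<and> r \<le> \<kappa>/4 \<and> cB x r \<subseteq> U}"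
  have "\<exists>C\<subseteq>K. (\<forall>c\<in>C. \<forall>c'\<in>C. c \<noteq> c' \<longrightarrow> case_prod cB c \<inter> case_prod cB c' = {}) \<and>
    (\<forall>k\<in>K. \<exists>c\<in>C. case_prod cB k \<inter> case_prod cB c \<noteq> {} \<and> snd k \<le> 2 * snd c)"
    by (rule vitali_5r[of K "\<kappa>/4"]) (simp add: K_def)
  then obtain C where C: "C \<subseteq> K" "\<forall>c\<in>C. \<forall>c'\<in>C. c \<noteq> c' \<longrightarrow> case_prod cB c \<inter> case_prod cB c' = {}"
    "\<forall>k\<in>K. \<exists>c\<in>C. case_prod cB k \<inter> case_prod cB c \<noteq> {} \<and> snd k \<le> 2 * snd c" by blast
  have CK: "fst c \<in> Z" "0 < snd c" "snd c \<le> \<kappa>/4" "case_prod cB c \<subseteq> U" if "c \<in> C" for c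
    using that C(1) by (auto simp: K_def)
  have "\<exists>x r. (\<forall>n::nat. r n = 0 \<or> (x n, r n) \<in> C) \<and> (\<forall>c\<in>C. \<exists>n. c = (x n, r n)) \<and>
     (\<Sum>n. ennreal (r n ^ nu * om)) \<le> ennreal (measure lebesgue U)"
    by (rule disjoint_cB_sequence[OF U(3)]) (use C(2) CK in auto)
  then obtain x r where r: "\<And>n::nat. r n = 0 \<or> (x n, r n) \<in> C" and xr: "\<And>c. c \<in> C \<Longrightarrow> \<exists>n. c = (x n, r n)"
    and s: "(\<Sum>n. ennreal (r n ^ nu * om)) \<le> ennreal (measure lebesgue U)" by blast
  have r0: "r n \<ge> 0" "4 * r n \<le> \<kappa>" for n
    using r[of n] CK(2)[of "(x n, r n)"] CK(3)[of "(x n, r n)"] \<kappa> by auto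
  define B where "B n = pr ` cB (\<phi> (x n)) (M * r n)" for n
  have B: "B n \<in> sets borel" for n unfolding B_def by (rule borel_compact[OF compact_pr_cB])
  define G where "G p = (\<Sum>n. ennreal (4 * r n) * indicator (B n) p)" for p
  have Gm: "G \<in> borel_measurable borel" unfolding G_def using B by measurable
  have "(\<integral>\<^sup>+p. G p \<partial>Pm) = (\<Sum>n. \<integral>\<^sup>+p. ennreal (4 * r n) * indicator (B n) p \<partial>Pm)"
    unfolding G_def by (rule nn_integral_suminf) (use B in measurable)
  also have "\<dots> = (\<Sum>n. ennreal (4 * r n) * emeasure Pm (B n))"
    using B by (simp add: nn_integral_cmult_indicator)
  also have "\<dots> \<le> (\<Sum>n. ennreal D * ennreal (r n ^ nu * om))"
  proof (rule suminf_le)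
    fix n
    show "ennreal (4 * r n) * emeasure Pm (B n) \<le> ennreal D * ennreal (r n ^ nu * om)"
    proof (cases "r n = 0")
      case False
      then have rp: "r n > 0" using r0[of n] by simp
      have nu': "r n ^ nu = r n * r n ^ (nu - 1)" using nu_pos by (cases nu) auto
      have "emeasure Pm (B n) \<le> ennreal ((M * r n) ^ (nu - 1) * cP)" unfolding B_def using rp M by (intro Pm_pr_cB) simp
      then have "ennreal (4 * r n) * emeasure Pm (B n) \<le> ennreal (4 * r n) * ennreal ((M * r n) ^ (nu - 1) * cP)"
        by (rule mult_left_mono) simp
      also have "\<dots> = ennreal (D * (r n ^ nu * om))"
        using rp M cP0 om_pos by (simp add: ennreal_mult'[symmetric] D_def nu' power_mult_distrib field_simps)
      finally show ?thesis using D by (simp add: ennreal_mult')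
    qed simp
  qed auto
  also have "\<dots> = ennreal D * (\<Sum>n. ennreal (r n ^ nu * om))" by simp
  also have "\<dots> \<le> ennreal D * ennreal (measure lebesgue U)" by (rule mult_left_mono[OF s]) simp
  also have "\<dots> \<le> ennreal e"
  proof -
    have "D * measure lebesgue U \<le> D * (e / (D + 1))" using U(4) D by (intro mult_left_mono) auto
    also have "\<dots> \<le> e" using D e by (simp add: field_simps)
    finally show ?thesis using D by (simp add: ennreal_mult'[symmetric] ennreal_leI)
  qed
  finally have int: "(\<integral>\<^sup>+p. G p \<partial>Pm) \<le> ennreal e" .
  have "Hpre \<kappa> (fib Z p) \<le> G p" for p
  proof -
    \<comment> \<open>The covering balls are open, so radius 4 r is used for points at distance at
      most 3 r. An index whose projected ball misses p gets radius 0, that is, an empty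
      ball.\<close>
    let ?R = "\<lambda>n. if p \<in> B n then 4 * r n else 0"
    have "Hpre \<kappa> (fib Z p) \<le> (\<Sum>n. ennreal (?R n))"
    proof (rule Hpre_le[where c = x])
      show "0 \<le> ?R k \<and> ?R k \<le> \<kappa>" for k using r0[of k] \<kappa> by simp
      show "fib Z p \<subseteq> (\<Union>k. cc_ball gm \<sigma> (x k) (?R k))"
      proof
        fix z assume z: "z \<in> fib Z p"
        then have zZ: "z \<in> Z" "pr (\<phi> z) = p" by (auto simp: fib_def)
        obtain s where s: "s > 0" "cB z s \<subseteq> U" using open_contains_cB[OF U(1), of z] zZ U(2) by blast
        have "cB z (min s (\<kappa>/4)) \<subseteq> cB z s" by (auto simp: cB_def)
        then have "(z, min s (\<kappa>/4)) \<in> K" using zZ s \<kappa> by (auto simp: K_def)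
        then obtain c where c: "c \<in> C" "case_prod cB (z, min s (\<kappa>/4)) \<inter> case_prod cB c \<noteq> {}" "snd (z, min s (\<kappa>/4)) \<le> 2 * snd c"
          using C(3) by blast
        have zc: "z \<in> cB (fst c) (3 * snd c)" using vitali_enlarge[OF c(2,3)] by simp
        obtain n where n: "c = (x n, r n)" using xr[OF c(1)] by blast
        have rp: "r n > 0" "x n \<in> Z" using CK(1,2)[OF c(1)] n by auto
        have d: "rho (x n) z \<le> 3 * r n" using zc n by (simp add: cB_def)
        have "rho (\<phi> (x n)) (\<phi> z) \<le> Lc * rho (x n) z" using rp(2) zZ(1) Z(2) by (intro lip) auto
        also have "\<dots> \<le> Lc * (3 * r n)" by (rule mult_left_mono[OF d Lc])
        also have "\<dots> \<le> M * r n" using mult_right_mono[OF M(2), of "r n"] rp by simp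
        finally have "p \<in> B n" unfolding B_def using zZ(2) by (auto simp: cB_def)
        then have "z \<in> cc_ball gm \<sigma> (x n) (?R n)" using d rp by (simp add: cc_ball_def)
        then show "z \<in> (\<Union>k. cc_ball gm \<sigma> (x k) (?R k))" by blast
      qed
    qed
    also have "\<dots> = G p" unfolding G_def by (intro suminf_cong) auto
    finally show ?thesis .
  qed
  then show ?thesis using Gm int by blast
qed

text \<open>For a fixed mesh, the infimum of majorants with integrals at most 1/(m + 1) is a
  measurable majorant with integral 0.\<close>

lemma null_fibre:
  assumes Z: "negligible Z" "Z \<subseteq> E"
  shows "AE p in Pm. H1 gm \<sigma> (fib Z p) = 0"
proof -
  have "AE p in Pm. Hpre (1 / real (Suc n)) (fib Z p) = 0" for n
  proof -
    have "\<forall>m. \<exists>G. G \<in> borel_measurable borel \<and> (\<integral>\<^sup>+p. G p \<partial>Pm) \<le> ennreal (1 / real (Suc m)) \<and> (\<forall>p. Hpre (1 / real (Suc n)) (fib Z p) \<le> G p)"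
    proof
      fix m
      show "\<exists>G. G \<in> borel_measurable borel \<and> (\<integral>\<^sup>+p. G p \<partial>Pm) \<le> ennreal (1 / real (Suc m)) \<and> (\<forall>p. Hpre (1 / real (Suc n)) (fib Z p) \<le> G p)"
        using null_fibre_step[OF Z, of "1 / real (Suc n)" "1 / real (Suc m)"] by auto
    qed
    from choice[OF this] obtain G where G: "\<And>m. G m \<in> borel_measurable borel" "\<And>m. (\<integral>\<^sup>+p. G m p \<partial>Pm) \<le> ennreal (1 / real (Suc m))"
      "\<And>m p. Hpre (1 / real (Suc n)) (fib Z p) \<le> G m p" by blast
    have m: "(\<lambda>p. INF m. G m p) \<in> borel_measurable Pm" using G(1) by measurable
    have "(\<integral>\<^sup>+p. (INF m. G m p) \<partial>Pm) \<le> ennreal (1 / real (Suc m))" for m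
      by (rule order.trans[OF nn_integral_mono G(2)]) (rule INF_lower, simp)
    moreover have "(\<lambda>m. ennreal (1 / real (Suc m))) \<longlonglongrightarrow> ennreal 0"
      by (intro tendsto_ennrealI LIMSEQ_Suc lim_1_over_n)
    ultimately have "(\<integral>\<^sup>+p. (INF m. G m p) \<partial>Pm) \<le> 0" by (intro LIMSEQ_le_const[of _ 0]) auto
    then have "AE p in Pm. (INF m. G m p) = 0" using nn_integral_0_iff_AE[OF m] by simp
    then show ?thesis
    proof (rule AE_mp, intro AE_I2 impI)
      fix p assume "(INF m. G m p) = 0"
      moreover have "Hpre (1 / real (Suc n)) (fib Z p) \<le> (INF m. G m p)" using G(3) by (intro INF_greatest)
      ultimately show "Hpre (1 / real (Suc n)) (fib Z p) = 0" by simp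
    qed
  qed
  then have "AE p in Pm. \<forall>n. Hpre (1 / real (Suc n)) (fib Z p) = 0" by (simp add: AE_all_countable)
  then show ?thesis by (rule AE_mp) (intro AE_I2 impI, simp add: H1_seq)
qed

text \<open>Over a compact set the fibre measure is a supremum of upper semicontinuous functions,
  hence Borel. A splits into disjoint compact sets and a null set, and over almost every base point
  the fibre measure is the sum over the compact pieces.\<close>

lemma H1_fib_ae_borel:
  assumes A: "A \<in> sets lebesgue" "A \<subseteq> E"
  shows "\<exists>f\<in>borel_measurable borel. AE p in Pm. H1 gm \<sigma> (fib A p) = f p"
proof -
  obtain K :: "nat \<Rightarrow> (real^'n) set" where K: "\<And>i. compact (K i)" "\<And>i. K i \<subseteq> A" "\<And>i l. i \<noteq> l \<Longrightarrow> K i \<inter> K l = {}"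
    "negligible (A - (\<Union>i. K i))" using lebesgue_disjoint_compacts[OF A(1)] by blast
  let ?f = "\<lambda>p. \<Sum>i. H1 gm \<sigma> (fib (K i) p)"
  have KE: "K i \<subseteq> E" for i using K(2) A(2) by blast
  have m: "?f \<in> borel_measurable borel" using H1_fib_borel[OF K(1) KE] by measurable
  have "AE p in Pm. H1 gm \<sigma> (fib (A - (\<Union>i. K i)) p) = 0" by (rule null_fibre[OF K(4)]) (use A in blast)
  then have "AE p in Pm. H1 gm \<sigma> (fib A p) = ?f p"
  proof (rule AE_mp, intro AE_I2 impI)
    fix p assume z: "H1 gm \<sigma> (fib (A - (\<Union>i. K i)) p) = 0"
    have "fib A p \<subseteq> (\<Union>i. fib (K i) p) \<union> fib (A - (\<Union>i. K i)) p" by (auto simp: fib_def)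
    then have "H1 gm \<sigma> (fib A p) \<le> H1 gm \<sigma> (\<Union>i. fib (K i) p) + H1 gm \<sigma> (fib (A - (\<Union>i. K i)) p)"
      using H1_mono H1_Un order.trans by blast
    also have "\<dots> \<le> ?f p" using H1_UN[of "\<lambda>i. fib (K i) p"] z by simp
    finally have 1: "H1 gm \<sigma> (fib A p) \<le> ?f p" .
    have "?f p \<le> H1 gm \<sigma> (\<Union>i. fib (K i) p)" by (rule H1_sum_disjoint_compact[OF K(1) K(3)]) (auto simp: fib_def)
    also have "\<dots> \<le> H1 gm \<sigma> (fib A p)" using K(2) by (intro H1_mono) (auto simp: fib_def)
    finally show "H1 gm \<sigma> (fib A p) = ?f p" using 1 by simp
  qed
  then show ?thesis using m by (intro bexI[of _ ?f])
qed

end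

section \<open>The blow-up estimate\<close>

text \<open>Both sides are the (j,i) cofactor: a permutation with p j \<noteq> i contributes 0 to
  either determinant, and for the others the factors agree.\<close>

lemma det_row_axis_eq_col_axis:
  fixes M :: "real^'n::finite^'n"
  shows "det (\<chi> r. if r = j then axis i 1 else M $ r) = det (\<chi> r c. if c = i then (if r = j then 1 else 0) else M $ r $ c)"
  (is "det ?A = det ?B")
  unfolding det_def
proof (rule sum.cong[OF refl])
  fix p :: "'n \<Rightarrow> 'n" assume "p \<in> {p. p permutes UNIV}"
  then have p: "p permutes UNIV" by simp
  have "(\<Prod>r\<in>UNIV. ?A $ r $ p r) = (\<Prod>r\<in>UNIV. ?B $ r $ p r)"
  proof (cases "p j = i")
    case True
    have "?A $ r $ p r = ?B $ r $ p r" for r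
    proof (cases "r = j")
      case False
      then have "p r \<noteq> i" using True permutes_inj[OF p] by (auto dest: injD)
      then show ?thesis using False by simp
    qed (use True in \<open>simp add: axis_def\<close>)
    then show ?thesis by simp
  next
    case False
    obtain r where r: "p r = i" using permutes_surj[OF p] by (metis surjD)
    then have "r \<noteq> j" using False by blast
    then have "?B $ r $ p r = 0" using r by simp
    then have B: "(\<Prod>r\<in>UNIV. ?B $ r $ p r) = 0" by (intro prod_zero bexI[of _ r]) simp_all
    have "?A $ j $ p j = 0" using False by (simp add: axis_def)
    then have "(\<Prod>r\<in>UNIV. ?A $ r $ p r) = 0" by (intro prod_zero bexI[of _ j]) simp_all
    then show ?thesis using B by (rule trans[OF _ sym])
  qed
  then show "of_int (sign p) * (\<Prod>r\<in>UNIV. ?A $ r $ p r) = of_int (sign p) * (\<Prod>r\<in>UNIV. ?B $ r $ p r)" by simp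
qed

text \<open>Laplace expansion along row j: the cofactors of that row form column j of the
  adjugate.\<close>

lemma det_replace_row:
  fixes M :: "real^'n::finite^'n"
  shows "det (\<chi> r. if r = j then v else M $ r) = v \<bullet> (adjugate M *v axis j 1)"
proof -
  have v: "v = (\<Sum>i\<in>UNIV. v $ i *s axis i 1)" by (rule basis_expansion[symmetric])
  have "det (\<chi> r. if r = j then v else M $ r) = det (\<chi> r. if r = j then (\<Sum>i\<in>UNIV. v $ i *s axis i 1) else M $ r)"
    by (subst v) (rule refl)
  also have "\<dots> = (\<Sum>i\<in>UNIV. det (\<chi> r. if r = j then v $ i *s axis i 1 else M $ r))"
    using det_linear_row_sum[of "UNIV :: 'n set" j "\<lambda>r i. v $ i *s axis i 1" "\<lambda>r. M $ r"] by simp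
  also have "\<dots> = (\<Sum>i\<in>UNIV. v $ i * det (\<chi> r. if r = j then axis i 1 else M $ r))"
    by (intro sum.cong refl det_row_mul)
  also have "\<dots> = (\<Sum>i\<in>UNIV. v $ i * adjugate M $ i $ j)" by (simp add: det_row_axis_eq_col_axis adjugate_def)
  also have "\<dots> = v \<bullet> (adjugate M *v axis j 1)"
    by (simp add: inner_vec_def matrix_vector_mult_basis column_def)
  finally show ?thesis .
qed

context carnot begin

text \<open>A 1-Lipschitz curve maps an interval of length h to within h/2 of the image of its
  midpoint, so a ball of radius h/2, enlarged by 1 + e to be open, covers it; the normalising factor
  2 restores the length h. Grid intervals meeting T stay in an open U of nearly the same
  measure.\<close>

lemma Hpre_line:
  assumes f: "\<And>a b. rho (f a) (f b) \<le> \<bar>a - b\<bar>" and T: "compact T" and \<kappa>: "\<kappa> > 0"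
  shows "2 * Hpre \<kappa> (f ` T) \<le> emeasure lborel T"
proof -
  obtain l where l: "emeasure lborel T = ennreal l" "l \<ge> 0" using emeasure_compact_finite[OF T] by (cases "emeasure lborel T") auto
  have step: "2 * Hpre \<kappa> (f ` T) \<le> ennreal ((1 + e) * (l + e))" if e: "e > 0" for e
  proof -
    have Tl: "T \<in> sets lebesgue" using T by (simp add: borel_compact)
    obtain U where U: "open U" "T \<subseteq> U" "U - T \<in> lmeasurable" "emeasure lebesgue (U - T) < ennreal e"
      using sets_lebesgue_outer_open[OF Tl e] .
    have Ub: "T \<in> sets borel" "U - T \<in> sets borel" using borel_compact[OF T] borel_open[OF U(1)] by simp_all
    have "emeasure lborel U = emeasure lborel T + emeasure lborel (U - T)"
      using plus_emeasure[of T lborel "U - T"] Ub U(2) by (simp add: Un_absorb1 Diff_partition)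
    also have "emeasure lborel (U - T) \<le> ennreal e" using U(4) Ub(2) by (simp add: emeasure_completion less_imp_le)
    finally have Um: "emeasure lborel U \<le> ennreal (l + e)" using l e by simp
    obtain d where d: "d > 0" "(\<Union>x\<in>T. ball x d) \<subseteq> U" using compact_subset_open_imp_ball_epsilon_subset[OF T U(1,2)] by blast
    \<comment> \<open>The first bound keeps the grid intervals that meet T inside U, the second
      keeps the radii within the mesh \<kappa>.\<close>
    define h where "h = min (d/2) (\<kappa> / (1 + e))"
    have h: "h > 0" "h < d" "h * (1 + e) \<le> \<kappa>"
    proof -
      have "h \<le> \<kappa> / (1 + e)" by (simp add: h_def)
      then show "h * (1 + e) \<le> \<kappa>" using e by (simp add: pos_le_divide_eq)
    qed (use d \<kappa> e in \<open>auto simp: h_def\<close>)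
    define I where "I m = {of_int m * h..<(of_int m + 1) * h}" for m :: int
    define F where "F = {m. I m \<inter> T \<noteq> {}}"
    define m where "m k = int_decode k" for k
    define r where "r k = (if m k \<in> F then h/2 * (1 + e) else 0)" for k
    have "Hpre \<kappa> (f ` T) \<le> (\<Sum>k. ennreal (r k))"
    proof (rule Hpre_le[where c = "\<lambda>k. f ((of_int (m k) + 1/2) * h)"])
      show "0 \<le> r k \<and> r k \<le> \<kappa>" for k using h e \<kappa> by (auto simp: r_def)
      show "f ` T \<subseteq> (\<Union>k. cc_ball gm \<sigma> (f ((of_int (m k) + 1/2) * h)) (r k))"
      proof
        fix y assume "y \<in> f ` T"
        then obtain t where t: "t \<in> T" "y = f t" by blast
        define k where "k = int_encode \<lfloor>t / h\<rfloor>"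
        have mk: "m k = \<lfloor>t / h\<rfloor>" by (simp add: m_def k_def)
        have "of_int (m k) \<le> t / h" "t / h < of_int (m k) + 1" unfolding mk by linarith+
        then have b: "of_int (m k) * h \<le> t" "t < (of_int (m k) + 1) * h" using h by (simp_all add: field_simps)
        then have "m k \<in> F" using t by (auto simp: F_def I_def)
        then have rk: "r k = h/2 * (1 + e)" by (simp add: r_def)
        have "rho (f ((of_int (m k) + 1/2) * h)) (f t) \<le> \<bar>(of_int (m k) + 1/2) * h - t\<bar>" by (rule f)
        also have "\<dots> \<le> h/2" using b unfolding abs_le_iff by (simp add: algebra_simps)
        also have "\<dots> < r k" unfolding rk using h e by simp
        finally show "y \<in> (\<Union>k. cc_ball gm \<sigma> (f ((of_int (m k) + 1/2) * h)) (r k))" using t(2) by (auto simp: cc_ball_def)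
      qed
    qed
    then have "2 * Hpre \<kappa> (f ` T) \<le> 2 * (\<Sum>k. ennreal (r k))" by (rule mult_left_mono) simp
    also have "\<dots> = (\<Sum>k. 2 * ennreal (r k))" by simp
    also have "\<dots> = (\<Sum>k. ennreal (1 + e) * emeasure lborel (if m k \<in> F then I (m k) else {}))"
    proof (rule suminf_cong)
      fix k
      have "2 * ennreal (h/2 * (1 + e)) = ennreal ((1 + e) * h)" using h e by (simp add: ennreal_numeral[symmetric] ennreal_mult[symmetric] mult.commute del: ennreal_numeral)
      moreover have "emeasure lborel (I (m k)) = ennreal h" using h by (simp add: I_def algebra_simps)
      ultimately show "2 * ennreal (r k) = ennreal (1 + e) * emeasure lborel (if m k \<in> F then I (m k) else {})"
        using e h by (simp add: r_def ennreal_mult)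
    qed
    also have "\<dots> = ennreal (1 + e) * (\<Sum>k. emeasure lborel (if m k \<in> F then I (m k) else {}))" by simp
    also have "(\<Sum>k. emeasure lborel (if m k \<in> F then I (m k) else {})) = emeasure lborel (\<Union>k. if m k \<in> F then I (m k) else {})"
    proof (rule suminf_emeasure)
      show "range (\<lambda>k. if m k \<in> F then I (m k) else {}) \<subseteq> sets lborel" by (auto simp: I_def)
      have I: "n = n'" if "t \<in> I n" "t \<in> I n'" for n n' t
      proof -
        have "\<lfloor>t / h\<rfloor> = n" "\<lfloor>t / h\<rfloor> = n'" using that h by (auto simp: I_def floor_eq_iff field_simps)
        then show ?thesis by simp
      qed
      show "disjoint_family (\<lambda>k. if m k \<in> F then I (m k) else {})"
        unfolding disjoint_family_on_def
      proof (intro ballI impI equals0I)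
        fix k k' t assume "k \<noteq> k'" "t \<in> (if m k \<in> F then I (m k) else {}) \<inter> (if m k' \<in> F then I (m k') else {})"
        then have "m k = m k'" using I[of t "m k" "m k'"] by (auto split: if_splits)
        then show False using \<open>k \<noteq> k'\<close> inj_int_decode[of UNIV] by (simp add: m_def inj_eq)
      qed
    qed
    also have "\<dots> \<le> emeasure lborel U"
    proof (rule emeasure_mono)
      show "(\<Union>k. if m k \<in> F then I (m k) else {}) \<subseteq> U"
      proof
        fix t assume "t \<in> (\<Union>k. if m k \<in> F then I (m k) else {})"
        then obtain k where k: "m k \<in> F" "t \<in> I (m k)" by (auto split: if_splits)
        then obtain t' where t': "t' \<in> T" "t' \<in> I (m k)" by (auto simp: F_def)
        have "dist t' t < d" using k(2) t'(2) h(2) by (auto simp: I_def dist_real_def algebra_simps)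
        then have "t \<in> (\<Union>x\<in>T. ball x d)" using t'(1) by auto
        then show "t \<in> U" using d(2) by blast
      qed
    qed (use U(1) in simp)
    also have "\<dots> \<le> ennreal (l + e)" by (rule Um)
    finally have "2 * Hpre \<kappa> (f ` T) \<le> ennreal (1 + e) * ennreal (l + e)" by (simp add: mult_left_mono)
    then show ?thesis using e l by (simp add: ennreal_mult)
  qed
  have "(\<lambda>n. ennreal ((1 + 1 / real (Suc n)) * (l + 1 / real (Suc n)))) \<longlonglongrightarrow> ennreal ((1 + 0) * (l + 0))"
    by (intro tendsto_ennrealI tendsto_intros LIMSEQ_Suc lim_1_over_n)
  then have "2 * Hpre \<kappa> (f ` T) \<le> ennreal ((1 + 0) * (l + 0))"
    by (rule LIMSEQ_le_const) (use step in auto)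
  then show ?thesis using l by simp
qed

lemma inner_horiz_gm: assumes "v \<in> layer \<sigma> 1" shows "v \<bullet> (x \<odot> y) = v \<bullet> x + v \<bullet> y"
proof -
  have "v $ i * (x \<odot> y) $ i = v $ i * x $ i + v $ i * y $ i" for i
    using assms gm_nth_horiz[of i x y] by (cases "\<sigma> i = 1") (auto simp: layer_iff algebra_simps)
  then show ?thesis by (simp add: inner_vec_def sum.distrib)
qed

lemma inner_horiz_dl: assumes "v \<in> layer \<sigma> 1" shows "v \<bullet> dl a x = a * (v \<bullet> x)"
proof -
  have "v $ i * dl a x $ i = a * (v $ i * x $ i)" for i
    using assms by (cases "\<sigma> i = 1") (auto simp: layer_iff)
  then show ?thesis unfolding inner_vec_def sum_distrib_left inner_real_def by (intro sum.cong refl)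
qed

end

section \<open>Fibres of a contactomorphism\<close>

context carnot_proj begin

text \<open>Either L annihilates a nonzero horizontal vector, and then s = 0, or L is injective on
  the first layer, hence onto it by dimension, and X_j is hit.\<close>

lemma contact_direction:
  assumes L: "contactomorphism gm \<sigma> L"
  shows "\<exists>v s. v \<in> layer \<sigma> 1 \<and> norm v = 1 \<and> L v = s *\<^sub>R ej"
proof -
  let ?V = "layer \<sigma> 1"
  have lin: "linear L" and LV: "L ` ?V \<subseteq> ?V" using L by (auto simp: contactomorphism_def)
  have "\<exists>v s. v \<in> ?V \<and> v \<noteq> 0 \<and> L v = s *\<^sub>R ej"
  proof (cases "inj_on L ?V")
    case False
    then obtain v where "v \<in> ?V" "L v = 0" "v \<noteq> 0" using linear_injective_on_subspace_0[OF lin subspace_layer] by blast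
    then show ?thesis by (intro exI[of _ v] exI[of _ 0]) simp
  next
    case True
    then have "dim (L ` ?V) = dim ?V" using lin subspace_layer[of 1] by (intro dim_image_eq) (simp_all add: span_eq_iff[THEN iffD2])
    then have "L ` ?V = ?V" using subspace_dim_equal[OF linear_subspace_image[OF lin subspace_layer] subspace_layer LV] by simp
    moreover have "ej \<in> ?V" using sj by (auto simp: layer_iff axis_def)
    ultimately obtain v where v: "v \<in> ?V" "L v = ej" by (metis imageE)
    have "v \<noteq> 0" using v(2) linear_0[OF lin] by (auto simp: axis_eq_0_iff)
    then show ?thesis using v by (intro exI[of _ v] exI[of _ 1]) simp
  qed
  then obtain v s where v: "v \<in> ?V" "v \<noteq> 0" "L v = s *\<^sub>R ej" by blast
  have "(1 / norm v) *\<^sub>R v \<in> ?V" using v(1) subspace_layer by (simp add: subspace_scale)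
  moreover have "L ((1 / norm v) *\<^sub>R v) = (s / norm v) *\<^sub>R ej" by (simp add: linear_scale[OF lin] v(3))
  ultimately show ?thesis using v(2) by (intro exI[of _ "(1 / norm v) *\<^sub>R v"] exI[of _ "s / norm v"]) simp
qed

abbreviation Jc :: "(real^'n \<Rightarrow> real^'n) \<Rightarrow> real" where "Jc L \<equiv> norm (adjugate (matrix L) *v ej)"

text \<open>With a horizontal unit vector v that L maps into the line of X_j, the map \<open>\<Psi>\<close> straightens the
  fibres of the projection of L: it sends the line y exp(t v) to an integral line of X_j at unit speed,
  so that its (constant) Jacobian controls the integral of the lengths of the fibres.\<close>

lemma straightening_jacobian:
  assumes L: "contactomorphism gm \<sigma> L" and v: "v \<in> layer \<sigma> 1" "norm v = 1"
  defines "\<Psi> \<equiv> \<lambda>x. L x \<odot> ((v \<bullet> x - L x $ j) *\<^sub>R ej)"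
  shows "\<exists>c. \<bar>c\<bar> \<le> Jc L \<and> (\<forall>S. compact S \<longrightarrow> emeasure lborel (\<Psi> ` S) \<le> ennreal \<bar>c\<bar> * emeasure lborel S) \<and>
     (c \<noteq> 0 \<longrightarrow> (\<forall>w. L w = (L w $ j) *\<^sub>R ej \<and> v \<bullet> w = 0 \<longrightarrow> w = 0))"
proof -
  have lin: "linear L" using L by (simp add: contactomorphism_def)
  have bl: "bounded_linear L" using lin by (simp add: linear_conv_bounded_linear)
  define \<Psi>' where "\<Psi>' y k = Dg (L y, (v \<bullet> y - L y $ j) *\<^sub>R ej) (L k, (v \<bullet> k - L k $ j) *\<^sub>R ej)" for y k
  have b2: "bounded_linear (\<lambda>x. (v \<bullet> x - L x $ j) *\<^sub>R ej)"
    by (intro bounded_linear_compose[OF bounded_linear_scaleR_left] bounded_linear_sub bounded_linear_inner_right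
        bounded_linear_compose[OF bounded_linear_vec_nth bl])
  have d: "(\<Psi> has_derivative \<Psi>' y) (at y)" for y
    unfolding \<Psi>_def \<Psi>'_def by (intro gm_has_derivative bounded_linear_imp_has_derivative bl b2)
  have h: "\<Psi> (dl a y) = dl a (\<Psi> y)" if a: "a > 0" for a y
  proof -
    have "L (dl a y) = dl a (L y)" by (rule contact_dl[OF L a])
    moreover have "(v \<bullet> dl a y - dl a (L y) $ j) *\<^sub>R ej = dl a ((v \<bullet> y - L y $ j) *\<^sub>R ej)"
      using sj unfolding dl_ej inner_horiz_dl[OF v(1)] by (simp add: right_diff_distrib)
    ultimately show ?thesis using a by (simp add: \<Psi>_def dl_gm[symmetric])
  qed
  have L0: "L 0 = 0" by (rule linear_0[OF lin])
  have lim: "((\<lambda>a. \<Psi>' (dl a y) k) \<longlongrightarrow> \<Psi>' 0 k) (at_right 0)" for y k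
  proof -
    have "((\<lambda>a. L (dl a y)) \<longlongrightarrow> L 0) (at_right 0)" by (rule bounded_linear.tendsto[OF bl dl_tendsto_0])
    moreover have "((\<lambda>a. (v \<bullet> dl a y - L (dl a y) $ j) *\<^sub>R ej) \<longlongrightarrow> (v \<bullet> 0 - L 0 $ j) *\<^sub>R ej) (at_right 0)"
      by (rule bounded_linear.tendsto[OF b2 dl_tendsto_0])
    ultimately show ?thesis unfolding \<Psi>'_def L0 by (intro Dg_tendsto_0[THEN tendsto_eq_rhs]) (simp_all add: L0)
  qed
  define c where "c = det (matrix (\<Psi>' 0))"
  have c: "det (matrix (\<Psi>' y)) = c" for y unfolding c_def by (rule homogeneous_det_const[OF d h lim])
  have P0: "\<Psi>' 0 k = L k + (v \<bullet> k - L k $ j) *\<^sub>R ej" for k by (simp add: \<Psi>'_def L0 Dg_0)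
  \<comment> \<open>At the identity the product differentiates to addition, so the correction along
    X_j overwrites row j of L by v.\<close>
  have M: "matrix (\<Psi>' 0) = (\<chi> r. if r = j then v else matrix L $ r)"
    unfolding P0[abs_def] by (auto simp: vec_eq_iff matrix_def inner_axis) (auto simp: axis_def)
  have "\<bar>c\<bar> \<le> norm v * Jc L" unfolding c_def M det_replace_row by (rule Cauchy_Schwarz_ineq2)
  then have 1: "\<bar>c\<bar> \<le> Jc L" using v(2) by simp
  have 2: "emeasure lborel (\<Psi> ` S) \<le> ennreal \<bar>c\<bar> * emeasure lborel S" if "compact S" for S
    by (rule emeasure_C1_image_le[OF that d]) (simp add: c)
  \<comment> \<open>Such a w is annihilated by \<Psi>' 0. Applied to the quotient of two points of a
    fibre with equal v-coordinate, this shows that a nonzero Jacobian confines the fibre to a single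
    line.\<close>
  have 3: "w = 0" if "c \<noteq> 0" "L w = (L w $ j) *\<^sub>R ej" "v \<bullet> w = 0" for w
  proof -
    have lin0: "linear (\<Psi>' 0)" using d has_derivative_linear by blast
    have "L w + (v \<bullet> w - L w $ j) *\<^sub>R ej = 0" using that(2,3) by (metis add.right_inverse diff_0 scaleR_minus_left)
    then have "matrix (\<Psi>' 0) *v w = 0" using P0[of w] fun_cong[OF matrix_vector_mul(2)[OF lin0], of w] by simp
    moreover have "invertible (matrix (\<Psi>' 0))" using that(1) by (simp add: invertible_det_nz c_def)
    ultimately show ?thesis by (metis matrix_left_invertible_ker invertible_def)
  qed
  show ?thesis using 1 2 3 by (intro exI[of _ c]) blast
qed

text \<open>The tolerance is made part of the parameter, so that upper semicontinuity covers the
  base point and the perturbation at once.\<close>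

lemma model_fibre_closed:
  assumes L: "linear L"
  shows "closed {z. fst z \<in> cB 0 1 \<and> norm (pr (L (fst z)) - fst (snd z)) \<le> snd (snd z)}"
proof -
  have cl: "continuous_on UNIV (\<lambda>z::(real^'n) \<times> (real^'n) \<times> real. L (fst z))"
    by (rule linear_continuous_on_compose[OF continuous_on_fst[OF continuous_on_id] L])
  have 1: "closed {z::(real^'n) \<times> (real^'n) \<times> real. rho 0 (fst z) \<le> 1}"
    by (intro closed_Collect_le continuous_rho continuous_on_const continuous_on_fst continuous_on_id)
  have 2: "closed {z::(real^'n) \<times> (real^'n) \<times> real. norm (pr (L (fst z)) - fst (snd z)) \<le> snd (snd z)}"
    by (intro closed_Collect_le continuous_on_norm continuous_on_diff continuous_pr cl continuous_on_fst continuous_on_snd continuous_on_id)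
  show ?thesis using closed_Int[OF 1 2] unfolding cB_def mem_Collect_eq Collect_conj_eq .
qed

text \<open>Fibres of the projected L with a tolerance \<tau> that will absorb the deviation of
  \<phi> from L. The mesh 2 is coarse on purpose: the unit ball fits into one open ball of radius 2,
  which bounds the value, and rescaling by r turns the mesh into 2 r.\<close>

definition fibre_pre :: "(real^'n \<Rightarrow> real^'n) \<Rightarrow> real \<Rightarrow> real^'n \<Rightarrow> ennreal" where
  "fibre_pre L \<tau> p = 2 * Hpre 2 {y \<in> cB 0 1. norm (pr (L y) - p) \<le> \<tau>}"

lemma fibre_pre_measurable:
  assumes L: "linear L" shows "fibre_pre L \<tau> \<in> borel_measurable borel"
proof -
  have c: "(\<lambda>p. Hpre 2 {y. (y, p) \<in> {z. fst z \<in> cB 0 1 \<and> norm (pr (L (fst z)) - fst (snd z)) \<le> snd (snd z)}}) \<in> borel_measurable borel"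
    by (rule Hpre_fiber_measurable[OF compact_cB[of 0 1] model_fibre_closed[OF L]]) auto
  have p: "(\<lambda>p. (p, \<tau>)) \<in> borel_measurable (borel :: (real^'n) measure)" by (intro borel_measurable_continuous_onI continuous_intros)
  show ?thesis using measurable_compose[OF p c] unfolding fibre_pre_def by (simp add: borel_measurable_times_ennreal)
qed

lemma fibre_pre_le: assumes "p \<in> B \<longleftrightarrow> (\<exists>y\<in>cB 0 1. norm (pr (L y) - p) \<le> \<tau>)" shows "fibre_pre L \<tau> p \<le> 4 * indicator B p"
proof (cases "p \<in> B")
  case True
  have "Hpre 2 {y \<in> cB 0 1. norm (pr (L y) - p) \<le> \<tau>} \<le> ennreal 2" by (rule Hpre_subset_ball[of _ 0]) (auto simp: cB_def cc_ball_def)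
  then have "2 * Hpre 2 {y \<in> cB 0 1. norm (pr (L y) - p) \<le> \<tau>} \<le> 2 * ennreal 2" by (rule mult_left_mono) simp
  then show ?thesis using True by (simp add: fibre_pre_def)
next
  case False
  then have "{y \<in> cB 0 1. norm (pr (L y) - p) \<le> \<tau>} = {}" using assms by auto
  then show ?thesis unfolding fibre_pre_def by (simp only: Hpre_empty) simp
qed

text \<open>The straightening map places each fibre on an integral line of X_j, where its length
  bounds the premeasure. By Fubini these lengths integrate to the measure of the image of the unit
  ball, at most |c| om. A vanishing Jacobian is treated separately.\<close>

lemma model_estimate:
  assumes L: "contactomorphism gm \<sigma> L"
  shows "(\<integral>\<^sup>+p. fibre_pre L 0 p \<partial>Pm) \<le> ennreal (Jc L * om)"
proof -
  have lin: "linear L" and hom: "\<And>x y. L (x \<odot> y) = L x \<odot> L y" using L by (auto simp: contactomorphism_def)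
  have cL: "continuous_on S f \<Longrightarrow> continuous_on S (\<lambda>x. L (f x))" for S :: "(real^'n) set" and f
    by (rule linear_continuous_on_compose[OF _ lin])
  obtain v s where v: "v \<in> layer \<sigma> 1" "norm v = 1" and Lv: "L v = s *\<^sub>R ej" using contact_direction[OF L] by blast
  define \<Psi> where "\<Psi> x = L x \<odot> ((v \<bullet> x - L x $ j) *\<^sub>R ej)" for x
  obtain c where c: "\<bar>c\<bar> \<le> Jc L" "\<And>S. compact S \<Longrightarrow> emeasure lborel (\<Psi> ` S) \<le> ennreal \<bar>c\<bar> * emeasure lborel S"
     "\<And>w. c \<noteq> 0 \<Longrightarrow> L w = (L w $ j) *\<^sub>R ej \<Longrightarrow> v \<bullet> w = 0 \<Longrightarrow> w = 0"
    using straightening_jacobian[OF L v] unfolding \<Psi>_def by blast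
  have Psi: "\<Psi> x = pr (L x) \<odot> ((v \<bullet> x) *\<^sub>R ej)" for x
    unfolding \<Psi>_def pr_eq gm_assoc gm_scaleR by simp
  have vv: "v \<bullet> v = 1" using v(2) by (simp add: norm_eq_1)
  have line: "pr (L (y \<odot> (t *\<^sub>R v))) = pr (L y)" "v \<bullet> (y \<odot> (t *\<^sub>R v)) = v \<bullet> y + t" for y t
    by (simp_all add: hom linear_scale[OF lin] Lv inner_horiz_gm[OF v(1)] vv)
  have Nv: "Nm (t *\<^sub>R v) \<le> \<bar>t\<bar>" for t using Nm_horiz[of "t *\<^sub>R v"] v by (simp add: layer_iff)
  have cPsi: "continuous_on S \<Psi>" for S unfolding \<Psi>_def by (intro continuous_intros cL)
  \<comment> \<open>The section of the straightened set along the integral line through p; for p in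
    the hyperplane it consists of the v-coordinates of the fibre over p.\<close>
  define T where "T K p = {t. p \<odot> (t *\<^sub>R ej) \<in> \<Psi> ` K}" for K p
  have T: "T K p = (\<lambda>y. v \<bullet> y) ` {y \<in> K. pr (L y) = p}" if p: "p $ j = 0" for K p
  proof (intro equalityI subsetI)
    fix t assume "t \<in> T K p"
    then obtain y where y: "y \<in> K" "p \<odot> (t *\<^sub>R ej) = pr (L y) \<odot> ((v \<bullet> y) *\<^sub>R ej)" unfolding T_def Psi by blast
    have "pr (p \<odot> (t *\<^sub>R ej)) = pr (pr (L y) \<odot> ((v \<bullet> y) *\<^sub>R ej))" "(p \<odot> (t *\<^sub>R ej)) $ j = (pr (L y) \<odot> ((v \<bullet> y) *\<^sub>R ej)) $ j"
      using y(2) by simp_all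
    then have "p = pr (L y)" "t = v \<bullet> y" using p by (simp_all add: pr_fix gm_ej_nth)
    then show "t \<in> (\<lambda>y. v \<bullet> y) ` {y \<in> K. pr (L y) = p}" using y(1) by blast
  next
    fix t assume "t \<in> (\<lambda>y. v \<bullet> y) ` {y \<in> K. pr (L y) = p}"
    then show "t \<in> T K p" by (auto simp: T_def Psi)
  qed
  have Tb: "(\<lambda>p. emeasure lborel (T K p)) \<in> borel_measurable borel"
    and Tint: "(\<integral>\<^sup>+p. emeasure lborel (T K p) \<partial>Pm) \<le> ennreal \<bar>c\<bar> * emeasure lborel K" if K: "compact K" for K
  proof -
    have Kb: "\<Psi> ` K \<in> sets borel" by (rule borel_compact[OF compact_continuous_image[OF cPsi K]])
    have mt: "(\<lambda>t. p \<odot> (t *\<^sub>R ej)) \<in> borel_measurable borel" for p by (intro borel_measurable_continuous_onI continuous_intros)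
    have Ts: "T K p \<in> sets borel" for p using measurable_sets[OF mt Kb, of p] by (simp add: T_def vimage_def)
    have eq: "emeasure lborel (T K p) = (\<integral>\<^sup>+t. indicator (\<Psi> ` K) (p \<odot> (t *\<^sub>R ej)) \<partial>lborel)" for p
    proof -
      have "indicator (\<Psi> ` K) (p \<odot> (t *\<^sub>R ej)) = (indicator (T K p) t :: ennreal)" for t by (simp add: T_def indicator_def)
      then show ?thesis using Ts[of p] by simp
    qed
    show "(\<lambda>p. emeasure lborel (T K p)) \<in> borel_measurable borel"
      unfolding eq using Kb by (intro borel_line_integral) simp
    have "(\<integral>\<^sup>+p. emeasure lborel (T K p) \<partial>Pm) = (\<integral>\<^sup>+x. indicator (\<Psi> ` K) x \<partial>lborel)"
      unfolding eq using Kb by (intro fubini_Pm[symmetric]) simp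
    also have "\<dots> = emeasure lborel (\<Psi> ` K)" using Kb by simp
    finally show "(\<integral>\<^sup>+p. emeasure lborel (T K p) \<partial>Pm) \<le> ennreal \<bar>c\<bar> * emeasure lborel K" using c(2)[OF K] by simp
  qed
  show ?thesis
  proof (cases "c = 0")
    case False
    have "(\<integral>\<^sup>+p. fibre_pre L 0 p \<partial>Pm) \<le> (\<integral>\<^sup>+p. emeasure lborel (T (cB 0 1) p) \<partial>Pm)"
    proof (rule nn_integral_Pm_mono[OF fibre_pre_measurable[OF lin] Tb[OF compact_cB]])
      fix p :: "real^'n" assume p: "p $ j = 0"
      let ?F = "{y \<in> cB 0 1. pr (L y) = p}"
      have gF: "fibre_pre L 0 p = 2 * Hpre 2 ?F" by (simp add: fibre_pre_def)
      show "fibre_pre L 0 p \<le> emeasure lborel (T (cB 0 1) p)"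
      proof (cases "?F = {}")
        case True
        show ?thesis unfolding gF True by (simp add: Hpre_empty)
      next
        case ne: False
        then obtain y0 where y0: "y0 \<in> cB 0 1" "pr (L y0) = p" by blast
        \<comment> \<open>The line in direction v through one point of the fibre, parametrised so
          that the v-coordinate of f t is t. As c \<noteq> 0, the whole fibre in the ball lies on
          it.\<close>
        define f where "f t = y0 \<odot> ((t - v \<bullet> y0) *\<^sub>R v)" for t
        have fl: "rho (f a) (f b) \<le> \<bar>a - b\<bar>" for a b
        proof -
          have "rho (f a) (f b) = rho ((a - v \<bullet> y0) *\<^sub>R v) ((b - v \<bullet> y0) *\<^sub>R v)" unfolding f_def by (rule rho_left)
          also have "\<dots> = Nm ((- (a - v \<bullet> y0)) *\<^sub>R v \<odot> ((b - v \<bullet> y0) *\<^sub>R v))" unfolding rho_Nm scaleR_minus_left ..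
          also have "\<dots> = Nm ((b - a) *\<^sub>R v)" unfolding gm_scaleR by simp
          finally show ?thesis using Nv[of "b - a"] by (simp add: abs_minus_commute)
        qed
        have "?F \<subseteq> f ` T (cB 0 1) p"
        proof
          fix y assume y: "y \<in> ?F"
          define w where "w = (- f (v \<bullet> y)) \<odot> y"
          have fy: "y = f (v \<bullet> y) \<odot> w" by (simp add: w_def)
          have pf: "pr (L (f (v \<bullet> y))) = p" "v \<bullet> f (v \<bullet> y) = v \<bullet> y" unfolding f_def using line y0(2) by simp_all
          have "pr (L y) = pr (L (f (v \<bullet> y)))" using y pf(1) by simp
          then obtain t where t: "L y = L (f (v \<bullet> y)) \<odot> (t *\<^sub>R ej)" using pr_eq_iff by blast
          have "L (f (v \<bullet> y)) \<odot> L w = L (f (v \<bullet> y)) \<odot> (t *\<^sub>R ej)" using t hom[of "f (v \<bullet> y)" w] fy by simp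
          then have Lw: "L w = t *\<^sub>R ej" by (metis gm_cancel_left(1))
          have "v \<bullet> y = v \<bullet> f (v \<bullet> y) + v \<bullet> w" using inner_horiz_gm[OF v(1), of "f (v \<bullet> y)" w] fy by simp
          then have "v \<bullet> w = 0" using pf(2) by simp
          then have "w = 0" using c(3)[OF False, of w] Lw by simp
          then have "y = f (v \<bullet> y)" using fy by simp
          moreover have "v \<bullet> y \<in> T (cB 0 1) p" unfolding T[OF p] using y by blast
          ultimately show "y \<in> f ` T (cB 0 1) p" by blast
        qed
        then have "Hpre 2 ?F \<le> Hpre 2 (f ` T (cB 0 1) p)" by (rule Hpre_mono)
        then have "2 * Hpre 2 ?F \<le> 2 * Hpre 2 (f ` T (cB 0 1) p)" by (rule mult_left_mono) simp
        also have "\<dots> \<le> emeasure lborel (T (cB 0 1) p)"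
        proof (rule Hpre_line[OF fl])
          have "compact ?F"
          proof -
            have "?F = cB 0 1 \<inter> {y. pr (L y) = p}" by blast
            moreover have "closed {y. pr (L y) = p}" by (intro closed_Collect_eq continuous_intros cL)
            ultimately show ?thesis using compact_cB by (simp add: compact_Int_closed)
          qed
          then show "compact (T (cB 0 1) p)" unfolding T[OF p] by (intro compact_continuous_image continuous_intros)
        qed simp
        finally show ?thesis unfolding gF .
      qed
    qed
    also have "\<dots> \<le> ennreal \<bar>c\<bar> * emeasure lborel (cB 0 1)" by (rule Tint[OF compact_cB])
    also have "\<dots> = ennreal (\<bar>c\<bar> * om)" using om_pos by (simp add: emeasure_cB ennreal_mult')
    also have "\<dots> \<le> ennreal (Jc L * om)" using c(1) om_pos by (intro ennreal_leI mult_right_mono) auto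
    finally show ?thesis .
  next
    \<comment> \<open>Now a fibre may be larger than a line. But over any p with a nonempty fibre in
      the unit ball, the section of the image of the ball of radius 2 contains an interval of length
      2, while these sections have integral 0. Hence almost every p has an empty fibre; the
      constants match since \<open>fibre_pre\<close> is at most 4.\<close>
    case True
    have "(\<integral>\<^sup>+p. fibre_pre L 0 p \<partial>Pm) \<le> (\<integral>\<^sup>+p. 2 * emeasure lborel (T (cB 0 2) p) \<partial>Pm)"
    proof (rule nn_integral_Pm_mono[OF fibre_pre_measurable[OF lin] borel_measurable_times_ennreal[OF _ Tb[OF compact_cB]]])
      fix p :: "real^'n" assume p: "p $ j = 0"
      have "fibre_pre L 0 p \<le> 4 * indicator (pr ` L ` cB 0 1) p" by (rule fibre_pre_le) auto
      also have "\<dots> \<le> 2 * emeasure lborel (T (cB 0 2) p)"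
      proof (cases "p \<in> pr ` L ` cB 0 1")
        case True
        then obtain y where y: "y \<in> cB 0 1" "p = pr (L y)" by blast
        have "{v \<bullet> y - 1..v \<bullet> y + 1} \<subseteq> T (cB 0 2) p"
        proof
          fix t assume t: "t \<in> {v \<bullet> y - 1..v \<bullet> y + 1}"
          let ?y = "y \<odot> ((t - v \<bullet> y) *\<^sub>R v)"
          have "rho 0 ?y \<le> rho 0 y + rho y ?y" by (rule rho_triangle)
          also have "\<dots> \<le> 1 + 1" using y(1) Nv[of "t - v \<bullet> y"] t by (intro add_mono) (auto simp: cB_def rho_gm_right abs_le_iff)
          finally have "?y \<in> cB 0 2" by (simp add: cB_def)
          moreover have "pr (L ?y) = p" "t = v \<bullet> ?y" using line y(2) by simp_all
          ultimately show "t \<in> T (cB 0 2) p" unfolding T[OF p] by blast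
        qed
        then have "emeasure lborel {v \<bullet> y - 1..v \<bullet> y + 1} \<le> emeasure lborel (T (cB 0 2) p)"
        proof (rule emeasure_mono)
          have "compact {y' \<in> cB 0 2. pr (L y') = p}"
          proof -
            have "{y' \<in> cB 0 2. pr (L y') = p} = cB 0 2 \<inter> {y. pr (L y) = p}" by blast
            moreover have "closed {y. pr (L y) = p}" by (intro closed_Collect_eq continuous_intros cL)
            ultimately show ?thesis using compact_cB by (simp add: compact_Int_closed)
          qed
          then have "compact (T (cB 0 2) p)" unfolding T[OF p] by (intro compact_continuous_image continuous_intros)
          then show "T (cB 0 2) p \<in> sets lborel" by (simp add: borel_compact)
        qed
        then have "2 \<le> emeasure lborel (T (cB 0 2) p)" by simp
        then have "2 * 2 \<le> 2 * emeasure lborel (T (cB 0 2) p)" by (rule mult_left_mono) simp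
        then show ?thesis using True by simp
      qed simp
      finally show "fibre_pre L 0 p \<le> 2 * emeasure lborel (T (cB 0 2) p)" .
    qed simp
    also have "\<dots> = 2 * (\<integral>\<^sup>+p. emeasure lborel (T (cB 0 2) p) \<partial>Pm)" using Tb[OF compact_cB] by (intro nn_integral_cmult) simp
    also have "\<dots> = 0" using Tint[OF compact_cB, of 0 2] True by simp
    finally show ?thesis by simp
  qed
qed

text \<open>As the tolerance 1/(n + 1) decreases, semicontinuity at (p, 0) keeps the infimum below
  the unperturbed value. Monotone convergence downwards requires a finite integral, supplied by the
  compact set of base points with nonempty fibre.\<close>

lemma perturbed_model_estimate:
  assumes L: "contactomorphism gm \<sigma> L" and \<eta>: "\<eta> > 0"
  shows "\<exists>\<tau>>0. (\<integral>\<^sup>+p. fibre_pre L \<tau> p \<partial>Pm) \<le> ennreal (Jc L * om + \<eta>)"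
proof -
  have lin: "linear L" using L by (simp add: contactomorphism_def)
  have cL: "continuous_on S f \<Longrightarrow> continuous_on S (\<lambda>x. L (f x))" for S :: "(real^'n) set" and f
    by (rule linear_continuous_on_compose[OF _ lin])
  define t where "t n = 1 / real (Suc n)" for n
  have tpos: "t n > 0" for n by (simp add: t_def)
  have t0: "t \<longlonglongrightarrow> 0" unfolding t_def by (intro LIMSEQ_Suc lim_1_over_n)
  have dec: "decseq (\<lambda>n. fibre_pre L (t n))"
  proof (rule decseq_SucI, rule le_funI)
    fix n p
    have "t (Suc n) \<le> t n" unfolding t_def by (intro divide_left_mono) auto
    then have "{y \<in> cB 0 1. norm (pr (L y) - p) \<le> t (Suc n)} \<subseteq> {y \<in> cB 0 1. norm (pr (L y) - p) \<le> t n}" by auto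
    then show "fibre_pre L (t (Suc n)) p \<le> fibre_pre L (t n) p" unfolding fibre_pre_def by (intro mult_left_mono Hpre_mono) auto
  qed
  have fin: "(\<integral>\<^sup>+p. fibre_pre L (t n) p \<partial>Pm) < \<infinity>" for n
  proof -
    let ?B = "{p + u |p u. p \<in> (\<lambda>y. pr (L y)) ` cB 0 1 \<and> u \<in> cball 0 (t n)}"
    have Bc: "compact ?B" by (intro compact_sums compact_continuous_image continuous_intros cL compact_cB compact_cball)
    have "(\<integral>\<^sup>+p. fibre_pre L (t n) p \<partial>Pm) \<le> (\<integral>\<^sup>+p. 4 * indicator ?B p \<partial>Pm)"
    proof (rule nn_integral_mono, rule fibre_pre_le)
      fix p
      show "p \<in> ?B \<longleftrightarrow> (\<exists>y\<in>cB 0 1. norm (pr (L y) - p) \<le> t n)"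
      proof
        assume "p \<in> ?B"
        then obtain y u where "y \<in> cB 0 1" "u \<in> cball 0 (t n)" "p = pr (L y) + u" by blast
        then show "\<exists>y\<in>cB 0 1. norm (pr (L y) - p) \<le> t n" by (intro bexI[of _ y]) auto
      next
        assume "\<exists>y\<in>cB 0 1. norm (pr (L y) - p) \<le> t n"
        then obtain y where y: "y \<in> cB 0 1" "norm (pr (L y) - p) \<le> t n" by blast
        have "p = pr (L y) + (p - pr (L y))" "p - pr (L y) \<in> cball 0 (t n)" using y(2) by (simp_all add: norm_minus_commute)
        then show "p \<in> ?B" using y(1) by blast
      qed
    qed
    also have "\<dots> = 4 * emeasure Pm ?B" using Bc by (simp add: nn_integral_cmult_indicator borel_compact)
    also have "\<dots> < \<infinity>" using Pm_compact_finite[OF Bc] by (simp add: ennreal_mult_less_top)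
    finally show ?thesis .
  qed
  have lim: "(INF n. fibre_pre L (t n) p) \<le> fibre_pre L 0 p" for p
  proof (rule dense_ge)
    fix a assume a: "fibre_pre L 0 p < a"
    let ?G = "{z. fst z \<in> cB 0 1 \<and> norm (pr (L (fst z)) - fst (snd z)) \<le> snd (snd z)}"
    let ?h = "\<lambda>q. Hpre 2 {y. (y, q) \<in> ?G}"
    have g: "fibre_pre L \<tau> p = 2 * ?h (p, \<tau>)" for \<tau> by (simp add: fibre_pre_def)
    have half: "2 * x < a \<longleftrightarrow> x < a / 2" for x :: ennreal
    proof -
      have a2: "2 * (a / 2) = a" using mult_divide_eq_ennreal[of 2 a] by (simp add: ennreal_times_divide mult.commute)
      show ?thesis
      proof
        assume "x < a / 2"
        then have "2 * x < 2 * (a / 2)" by (intro ennreal_mult_strict_left_mono) auto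
        then show "2 * x < a" unfolding a2 .
      next
        assume x: "2 * x < a"
        show "x < a / 2"
        proof (rule ccontr)
          assume "\<not> x < a / 2"
          then have "2 * (a / 2) \<le> 2 * x" by (intro mult_left_mono) auto
          then show False using x unfolding a2 by simp
        qed
      qed
    qed
    have "open {q. ?h q < a / 2}" by (rule Hpre_fiber_usc[OF compact_cB[of 0 1] model_fibre_closed[OF lin]]) auto
    moreover have "(p, 0) \<in> {q. ?h q < a / 2}" using a unfolding g half by simp
    moreover have "(\<lambda>n. (p, t n)) \<longlonglongrightarrow> (p, 0)" by (intro tendsto_intros t0)
    ultimately have "\<forall>\<^sub>F n in sequentially. (p, t n) \<in> {q. ?h q < a / 2}" by (rule topological_tendstoD[rotated])
    then obtain n where "?h (p, t n) < a / 2" unfolding eventually_sequentially by auto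
    then have "fibre_pre L (t n) p < a" unfolding g half .
    then show "(INF n. fibre_pre L (t n) p) \<le> a" by (intro INF_lower2[of n]) auto
  qed
  have "(INF n. \<integral>\<^sup>+p. fibre_pre L (t n) p \<partial>Pm) = (\<integral>\<^sup>+p. (INF n. fibre_pre L (t n) p) \<partial>Pm)"
    by (rule nn_integral_monotone_convergence_INF_decseq[symmetric, OF dec _ fin]) (use fibre_pre_measurable[OF lin] in simp)
  also have "\<dots> \<le> (\<integral>\<^sup>+p. fibre_pre L 0 p \<partial>Pm)" by (rule nn_integral_mono[OF lim])
  also have "\<dots> \<le> ennreal (Jc L * om)" by (rule model_estimate[OF L])
  also have "\<dots> < ennreal (Jc L * om + \<eta>)" using \<eta> om_pos by (intro ennreal_lessI) (auto intro!: add_nonneg_pos)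
  finally obtain n where "(\<integral>\<^sup>+p. fibre_pre L (t n) p \<partial>Pm) < ennreal (Jc L * om + \<eta>)" unfolding INF_less_iff by blast
  then show ?thesis using tpos[of n] by (intro exI[of _ "t n"]) simp
qed

end

section \<open>From the Pansu differential to the map at small scales\<close>

context carnot_lip begin

text \<open>Differentiability places the rescaled fibres of \<phi> inside fibres of L with
  tolerance. Scaling back multiplies lengths by r and the measure of base points by r^(nu - 1), so
  the bound is proportional to the volume r^nu om of the ball.\<close>

lemma blow_up_estimate:
  assumes pd: "pansu_diff_with gm \<sigma> E \<phi> x0 L" and \<eta>: "\<eta> > 0" and \<kappa>: "\<kappa> > 0"
  shows "\<exists>r0>0. \<forall>r. 0 < r \<and> r < r0 \<longrightarrow> (\<exists>g\<in>borel_measurable borel.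
     (\<forall>p. p $ j = 0 \<longrightarrow> 2 * Hpre \<kappa> (fib (E \<inter> cB x0 r) p) \<le> g p) \<and> (\<integral>\<^sup>+p. g p \<partial>Pm) \<le> ennreal ((Jc L + \<eta>) * (r ^ nu * om)))"
proof -
  have L: "contactomorphism gm \<sigma> L" using pd by (simp add: pansu_diff_with_def)
  have lin: "linear L" using L by (simp add: contactomorphism_def)
  have cL: "continuous_on S f \<Longrightarrow> continuous_on S (\<lambda>x. L (f x))" for S :: "(real^'n) set" and f
    by (rule linear_continuous_on_compose[OF _ lin])
  obtain \<tau> where \<tau>: "\<tau> > 0" "(\<integral>\<^sup>+p. fibre_pre L \<tau> p \<partial>Pm) \<le> ennreal (Jc L * om + \<eta> * om)"
    using perturbed_model_estimate[OF L, of "\<eta> * om"] \<eta> om_pos by auto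
  \<comment> \<open>Uniform continuity of the projected product turns a small group distance from L
    y into the Euclidean tolerance \<tau>, uniformly over the unit ball.\<close>
  have "\<exists>\<epsilon>>0. \<forall>y\<in>cB 0 1. \<forall>z. rho (L y) z \<le> \<epsilon> \<longrightarrow> norm (pr (L y) - pr z) \<le> \<tau>"
  proof -
    let ?S = "L ` cB 0 1 \<times> cB 0 1"
    have "compact ?S" by (intro compact_Times compact_continuous_image cL continuous_intros compact_cB)
    moreover have "continuous_on ?S (\<lambda>z. pr (fst z \<odot> snd z))" by (intro continuous_intros)
    ultimately have "uniformly_continuous_on ?S (\<lambda>z. pr (fst z \<odot> snd z))" by (intro compact_uniformly_continuous)
    then obtain d where d: "d > 0" "\<And>a b. a \<in> ?S \<Longrightarrow> b \<in> ?S \<Longrightarrow> dist b a < d \<Longrightarrow> dist (pr (fst b \<odot> snd b)) (pr (fst a \<odot> snd a)) < \<tau>"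
      unfolding uniformly_continuous_on_def using \<tau>(1) by meson
    obtain d' where d': "d' > 0" "\<And>x. Nm x < d' \<Longrightarrow> norm x < d" using Nm_small_imp_small[OF d(1)] by blast
    define \<epsilon> where "\<epsilon> = min 1 (d'/2)"
    have \<epsilon>: "\<epsilon> > 0" "\<epsilon> \<le> 1" "\<epsilon> < d'" using d' by (auto simp: \<epsilon>_def)
    have "norm (pr (L y) - pr z) \<le> \<tau>" if y: "y \<in> cB 0 1" and z: "rho (L y) z \<le> \<epsilon>" for y z
    proof -
      define u where "u = (- L y) \<odot> z"
      have zu: "z = L y \<odot> u" by (simp add: u_def)
      have Nu: "Nm u \<le> \<epsilon>" using z by (simp add: zu rho_gm_right)
      have "(L y, u) \<in> ?S" "(L y, 0) \<in> ?S" using y Nu \<epsilon>(2) by (auto simp: cB_def rho_self Nm_def)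
      moreover have "dist (L y, u) (L y, 0) < d" using d'(2)[of u] Nu \<epsilon>(3) by (simp add: dist_Pair_Pair)
      ultimately have "dist (pr (L y \<odot> u)) (pr (L y)) < \<tau>" using d(2)[of "(L y, 0)" "(L y, u)"] by simp
      then show ?thesis unfolding zu by (simp add: dist_norm norm_minus_commute)
    qed
    then show ?thesis using \<epsilon>(1) by blast
  qed
  then obtain \<epsilon> where \<epsilon>: "\<epsilon> > 0" "\<And>y z. y \<in> cB 0 1 \<Longrightarrow> rho (L y) z \<le> \<epsilon> \<Longrightarrow> norm (pr (L y) - pr z) \<le> \<tau>" by blast
  have "\<exists>\<delta>>0. \<forall>x\<in>E. rho x0 x < \<delta> \<longrightarrow> rho ((- \<phi> x0) \<odot> \<phi> x) (L ((- x0) \<odot> x)) \<le> \<epsilon> * rho x0 x"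
    using pd \<epsilon>(1) unfolding pansu_diff_with_def by blast
  then obtain \<delta> where \<delta>: "\<delta> > 0" "\<And>x. x \<in> E \<Longrightarrow> rho x0 x < \<delta> \<Longrightarrow> rho ((- \<phi> x0) \<odot> \<phi> x) (L ((- x0) \<odot> x)) \<le> \<epsilon> * rho x0 x" by blast
  \<comment> \<open>The bound \<kappa>/2 keeps the rescaled mesh 2 r at most \<kappa>.\<close>
  define r0 where "r0 = min \<delta> (\<kappa>/2)"
  have r0: "r0 > 0" using \<delta> \<kappa> by (simp add: r0_def)
  have "\<exists>g\<in>borel_measurable borel.
     (\<forall>p. p $ j = 0 \<longrightarrow> 2 * Hpre \<kappa> (fib (E \<inter> cB x0 r) p) \<le> g p) \<and> (\<integral>\<^sup>+p. g p \<partial>Pm) \<le> ennreal ((Jc L + \<eta>) * (r ^ nu * om))"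
    if r: "0 < r" "r < r0" for r
  proof -
    let ?g = "\<phi> x0"
    have rr: "r < \<delta>" "r * 2 \<le> \<kappa>" using r(2) by (simp_all add: r0_def)
    \<comment> \<open>The base point as seen in the blow-up; on the hyperplane it inverts the
      induced map p \<mapsto> pr (\<phi> x0 \<odot> dl r p).\<close>
    define \<theta> where "\<theta> p = pr (dl (1/r) ((- ?g) \<odot> p))" for p
    have th1: "pr (?g \<odot> dl r (\<theta> p)) = p" if "p $ j = 0" for p
      unfolding \<theta>_def pr_translate_pr[OF r(1)] using r(1) that by (simp add: dl_inverse pr_fix)
    have th2: "\<theta> (pr (?g \<odot> dl r p)) = p" if "p $ j = 0" for p
    proof -
      have "pr (?g \<odot> dl r (\<theta> (pr (?g \<odot> dl r p)))) = pr (?g \<odot> dl r p)" by (rule th1) simp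
      then have "pr (\<theta> (pr (?g \<odot> dl r p))) = pr p" by (rule pr_translate_inj[OF r(1)])
      moreover have "\<theta> (pr (?g \<odot> dl r p)) $ j = 0" by (simp add: \<theta>_def)
      ultimately show ?thesis using that by (simp add: pr_fix)
    qed
    have thb: "\<theta> \<in> borel_measurable borel" unfolding \<theta>_def by (intro borel_measurable_continuous_onI continuous_intros)
    define g where "g p = ennreal r * fibre_pre L \<tau> (\<theta> p)" for p
    have gm: "g \<in> borel_measurable borel" unfolding g_def
      by (intro borel_measurable_times_ennreal measurable_compose[OF thb fibre_pre_measurable[OF lin]]) simp
    have 1: "2 * Hpre \<kappa> (fib (E \<inter> cB x0 r) p) \<le> g p" if p: "p $ j = 0" for p
    proof -
      let ?S = "{y \<in> cB 0 1. norm (pr (L y) - \<theta> p) \<le> \<tau>}"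
      have "fib (E \<inter> cB x0 r) p \<subseteq> (\<lambda>y. x0 \<odot> dl r y) ` ?S"
      proof
        fix x assume "x \<in> fib (E \<inter> cB x0 r) p"
        then have x: "x \<in> E" "rho x0 x \<le> r" "pr (\<phi> x) = p" by (auto simp: fib_def cB_def)
        define y where "y = dl (1/r) ((- x0) \<odot> x)"
        define z where "z = dl (1/r) ((- ?g) \<odot> \<phi> x)"
        have xy: "dl r y = (- x0) \<odot> x" "dl r z = (- ?g) \<odot> \<phi> x" using r by (simp_all add: y_def z_def dl_inverse)
        have "r * rho 0 y = rho (dl r 0) (dl r y)" by (rule rho_dl[OF r(1), symmetric])
        also have "\<dots> = rho x0 x" unfolding xy(1) using rho_left[of x0 0 "(- x0) \<odot> x"] linear_0[OF linear_dl] by simp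
        finally have "r * rho 0 y \<le> r * 1" using x(2) by simp
        then have yK: "y \<in> cB 0 1" using r(1) by (simp add: cB_def)
        have "r * rho (L y) z = rho (dl r (L y)) (dl r z)" by (rule rho_dl[OF r(1), symmetric])
        also have "dl r (L y) = L ((- x0) \<odot> x)" using contact_dl[OF L r(1), of y] xy(1) by simp
        also have "rho (L ((- x0) \<odot> x)) (dl r z) \<le> \<epsilon> * rho x0 x" unfolding xy(2) using \<delta>(2)[OF x(1)] x(2) rr(1) by (simp add: rho_sym)
        also have "\<dots> \<le> \<epsilon> * r" using x(2) \<epsilon>(1) by simp
        finally have "rho (L y) z \<le> \<epsilon>" using r(1) by (simp add: mult.commute)
        then have "norm (pr (L y) - pr z) \<le> \<tau>" by (rule \<epsilon>(2)[OF yK])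
        moreover have "pr z = \<theta> p"
        proof -
          have "pr (?g \<odot> dl r z) = p" unfolding xy(2) using x(3) by simp
          then have "pr (?g \<odot> dl r z) = pr (?g \<odot> dl r (\<theta> p))" using th1[OF p] by simp
          then have "pr z = pr (\<theta> p)" by (rule pr_translate_inj[OF r(1)])
          then show ?thesis by (simp add: \<theta>_def pr_fix)
        qed
        ultimately have "y \<in> ?S" using yK by simp
        moreover have "x = x0 \<odot> dl r y" unfolding xy(1) by simp
        ultimately show "x \<in> (\<lambda>y. x0 \<odot> dl r y) ` ?S" by blast
      qed
      then have "Hpre \<kappa> (fib (E \<inter> cB x0 r) p) \<le> Hpre \<kappa> ((\<lambda>y. x0 \<odot> dl r y) ` ?S)" by (rule Hpre_mono)
      also have "\<dots> \<le> Hpre (r * 2) ((\<lambda>y. x0 \<odot> dl r y) ` ?S)" by (rule Hpre_antimono[OF rr(2)])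
      also have "\<dots> \<le> ennreal r * Hpre 2 ?S" by (rule Hpre_scale[OF r(1)])
      finally have "2 * Hpre \<kappa> (fib (E \<inter> cB x0 r) p) \<le> 2 * (ennreal r * Hpre 2 ?S)" by (rule mult_left_mono) simp
      also have "\<dots> = g p" by (simp add: g_def fibre_pre_def mult.left_commute)
      finally show ?thesis .
    qed
    have "(\<integral>\<^sup>+p. g p \<partial>Pm) = ennreal (r ^ (nu - 1)) * (\<integral>\<^sup>+p. g (pr (?g \<odot> dl r p)) \<partial>Pm)" by (rule nn_integral_Pm_scale[OF gm r(1)])
    also have "(\<integral>\<^sup>+p. g (pr (?g \<odot> dl r p)) \<partial>Pm) \<le> (\<integral>\<^sup>+p. ennreal r * fibre_pre L \<tau> p \<partial>Pm)"
    proof (rule nn_integral_Pm_mono)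
      have "(\<lambda>p. pr (?g \<odot> dl r p)) \<in> borel_measurable borel" by (intro borel_measurable_continuous_onI continuous_intros)
      then show "(\<lambda>p. g (pr (?g \<odot> dl r p))) \<in> borel_measurable borel" by (rule measurable_compose[OF _ gm])
      show "(\<lambda>p. ennreal r * fibre_pre L \<tau> p) \<in> borel_measurable borel" by (intro borel_measurable_times_ennreal fibre_pre_measurable[OF lin]) simp
    qed (simp add: g_def th2)
    also have "\<dots> = ennreal r * (\<integral>\<^sup>+p. fibre_pre L \<tau> p \<partial>Pm)" using fibre_pre_measurable[OF lin] by (intro nn_integral_cmult) simp
    also have "\<dots> \<le> ennreal r * ennreal (Jc L * om + \<eta> * om)" by (rule mult_left_mono[OF \<tau>(2)]) simp
    finally have "(\<integral>\<^sup>+p. g p \<partial>Pm) \<le> ennreal (r ^ (nu - 1)) * (ennreal r * ennreal (Jc L * om + \<eta> * om))" by (simp add: mult_left_mono)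
    also have "\<dots> = ennreal (r ^ (nu - 1) * (r * (Jc L * om + \<eta> * om)))" using r(1) \<eta> om_pos by (simp add: ennreal_mult)
    also have "r ^ (nu - 1) * (r * (Jc L * om + \<eta> * om)) = (Jc L + \<eta>) * (r ^ nu * om)"
    proof -
      have "r ^ nu = r * r ^ (nu - 1)" using nu_pos by (cases nu) auto
      then show ?thesis by (simp add: algebra_simps)
    qed
    finally show ?thesis using gm 1 by blast
  qed
  then show ?thesis using r0 by blast
qed

end

section \<open>The covering argument\<close>

lemma measurable_completion_AE_eq:
  assumes f: "f \<in> M \<rightarrow>\<^sub>M N" and eq: "AE x in M. F x = f x" and F: "\<And>x. x \<in> space M \<Longrightarrow> F x \<in> space N"
  shows "F \<in> completion M \<rightarrow>\<^sub>M N"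
proof (rule measurableI)
  fix S assume S: "S \<in> sets N"
  have fc: "f \<in> completion M \<rightarrow>\<^sub>M N" by (rule measurable_completion[OF f])
  show "F -` S \<inter> space (completion M) \<in> sets (completion M)"
  proof (rule completion.in_sets_AE[OF _ measurable_sets[OF fc S]])
    show "AE x in completion M. (x \<in> f -` S \<inter> space (completion M)) = (x \<in> F -` S \<inter> space (completion M))"
      using AE_completion[OF eq] by eventually_elim auto
  qed simp
qed (use F in simp)

text \<open>For a function that is not measurable the integral is a supremum over simple minorants,
  that is, a lower integral; the supremum of a maximising sequence of minorants attains it.\<close>

lemma nn_integral_attained:
  "\<exists>g\<in>borel_measurable M. (\<forall>x. g x \<le> u x) \<and> (\<integral>\<^sup>+x. g x \<partial>M) = (\<integral>\<^sup>+x. u x \<partial>M)"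
proof -
  let ?A = "{g. simple_function M g \<and> g \<le> u}"
  have "(\<lambda>_. 0) \<in> ?A" by (auto simp: le_fun_def)
  then have ne: "?A \<noteq> {}" by blast
  obtain f :: "nat \<Rightarrow> ennreal" where f: "range f \<subseteq> integral\<^sup>S M ` ?A" "Sup (integral\<^sup>S M ` ?A) = Sup (f ` UNIV)"
    using ennreal_SUP_countable_SUP[OF ne, of "integral\<^sup>S M"] by blast
  have "\<forall>i. \<exists>g. g \<in> ?A \<and> f i = integral\<^sup>S M g" using f(1) by blast
  from choice[OF this] obtain G where G: "\<And>i. simple_function M (G i)" "\<And>i. G i \<le> u" "\<And>i. f i = integral\<^sup>S M (G i)" by blast
  define g where "g x = (SUP i. G i x)" for x
  have gm: "g \<in> borel_measurable M" unfolding g_def using borel_measurable_simple_function[OF G(1)] by measurable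
  have gu: "g x \<le> u x" for x unfolding g_def using G(2) by (intro SUP_least) (simp add: le_fun_def)
  have "(\<integral>\<^sup>+x. u x \<partial>M) = (SUP i. f i)" unfolding nn_integral_def using f(2) by simp
  also have "\<dots> \<le> (\<integral>\<^sup>+x. g x \<partial>M)"
  proof (rule SUP_least)
    fix i
    have "f i = (\<integral>\<^sup>+x. G i x \<partial>M)" using G(3)[of i] nn_integral_eq_simple_integral[OF G(1)[of i]] by simp
    also have "\<dots> \<le> (\<integral>\<^sup>+x. g x \<partial>M)" unfolding g_def by (intro nn_integral_mono SUP_upper) simp
    finally show "f i \<le> (\<integral>\<^sup>+x. g x \<partial>M)" .
  qed
  finally have "(\<integral>\<^sup>+x. g x \<partial>M) = (\<integral>\<^sup>+x. u x \<partial>M)" using nn_integral_mono[of M g u] gu by (intro antisym) auto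
  then show ?thesis using gm gu by blast
qed

section \<open>Bounds for fibre measures from Vitali coverings\<close>

context carnot_lip begin

text \<open>A bound on the upper integral of the fibre measure, phrased through a measurable
  majorant: lower integrals would not be countably subadditive in the set B.\<close>

definition fib_bound :: "(real^'n) set \<Rightarrow> ennreal \<Rightarrow> bool" where
  "fib_bound B X \<longleftrightarrow> (\<exists>h\<in>borel_measurable borel. (AE p in Pm. H1 gm \<sigma> (fib B p) \<le> h p) \<and> (\<integral>\<^sup>+p. h p \<partial>Pm) \<le> X)"

lemma fib_bound_mono: "fib_bound B X \<Longrightarrow> X \<le> Y \<Longrightarrow> fib_bound B Y"
  unfolding fib_bound_def by (meson order_trans)

lemma AE_Pm_hyperplane: "AE p in Pm. p $ j = 0"
  unfolding Pm_def by (subst AE_distr_iff[OF hyp_emb_measurable]) auto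

lemma fib_bound_UN:
  assumes "\<And>m::nat. fib_bound (B m) (X m)" shows "fib_bound (\<Union>m. B m) (\<Sum>m. X m)"
proof -
  have "\<forall>m. \<exists>h. h \<in> borel_measurable borel \<and> (AE p in Pm. H1 gm \<sigma> (fib (B m) p) \<le> h p) \<and> (\<integral>\<^sup>+p. h p \<partial>Pm) \<le> X m"
    using assms unfolding fib_bound_def by blast
  from choice[OF this] obtain h where h: "\<And>m. h m \<in> borel_measurable borel" "\<And>m. AE p in Pm. H1 gm \<sigma> (fib (B m) p) \<le> h m p"
    "\<And>m. (\<integral>\<^sup>+p. h m p \<partial>Pm) \<le> X m" by blast
  have "AE p in Pm. \<forall>m. H1 gm \<sigma> (fib (B m) p) \<le> h m p" using h(2) by (simp add: AE_all_countable)
  then have "AE p in Pm. H1 gm \<sigma> (fib (\<Union>m. B m) p) \<le> (\<Sum>m. h m p)"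
  proof (rule AE_mp, intro AE_I2 impI)
    fix p assume a: "\<forall>m. H1 gm \<sigma> (fib (B m) p) \<le> h m p"
    have "fib (\<Union>m. B m) p = (\<Union>m. fib (B m) p)" by (auto simp: fib_def)
    then have "H1 gm \<sigma> (fib (\<Union>m. B m) p) \<le> (\<Sum>m. H1 gm \<sigma> (fib (B m) p))" using H1_UN by simp
    also have "\<dots> \<le> (\<Sum>m. h m p)" using a by (intro suminf_le) auto
    finally show "H1 gm \<sigma> (fib (\<Union>m. B m) p) \<le> (\<Sum>m. h m p)" .
  qed
  moreover have "(\<integral>\<^sup>+p. (\<Sum>m. h m p) \<partial>Pm) \<le> (\<Sum>m. X m)"
  proof -
    have "(\<integral>\<^sup>+p. (\<Sum>m. h m p) \<partial>Pm) = (\<Sum>m. \<integral>\<^sup>+p. h m p \<partial>Pm)" using h(1) by (intro nn_integral_suminf) simp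
    also have "\<dots> \<le> (\<Sum>m. X m)" using h(3) by (intro suminf_le) auto
    finally show ?thesis .
  qed
  ultimately show ?thesis unfolding fib_bound_def using h(1)
    by (intro bexI[of _ "\<lambda>p. \<Sum>m. h m p"] conjI borel_measurable_suminf_order) auto
qed

text \<open>The set Z of good centres may fail to be measurable. \<open>full\<close> says that it
  has full outer measure in B, so what a Vitali family of balls centred in Z leaves uncovered in B
  is null, and over almost every p the fibre of this remainder is null.\<close>

lemma vitali_fibre_step:
  assumes B: "B \<in> lmeasurable" "B \<subseteq> E" and a: "a \<ge> 0"
    and Z: "Z \<subseteq> B" "\<And>x. x \<in> Z \<Longrightarrow> \<exists>L. pansu_diff_with gm \<sigma> E \<phi> x L \<and> Jc L \<le> a"
    and full: "\<And>S. S \<in> sets lebesgue \<Longrightarrow> S \<subseteq> B \<Longrightarrow> negligible (S \<inter> Z) \<Longrightarrow> negligible S"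
    and \<kappa>: "\<kappa> > 0" and \<eta>: "\<eta> > 0"
  shows "\<exists>G\<in>borel_measurable borel. (AE p in Pm. 2 * Hpre \<kappa> (fib B p) \<le> G p) \<and>
     (\<integral>\<^sup>+p. G p \<partial>Pm) \<le> ennreal ((a + \<eta>) * (measure lebesgue B + \<eta>))"
proof -
  have Bs: "B \<in> sets lebesgue" using B(1) by (rule fmeasurableD)
  obtain U where U: "open U" "B \<subseteq> U" "U - B \<in> lmeasurable" "emeasure lebesgue (U - B) < ennreal \<eta>"
    using sets_lebesgue_outer_open[OF Bs \<eta>] .
  have Ueq: "U = B \<union> (U - B)" using U(2) by blast
  have Ul: "U \<in> lmeasurable" using fmeasurable.Un[OF B(1) U(3)] Ueq by simp
  have Um: "measure lebesgue U \<le> measure lebesgue B + \<eta>"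
  proof -
    have "measure lebesgue (B \<union> (U - B)) \<le> measure lebesgue B + measure lebesgue (U - B)" by (rule measure_Un_le) (use Bs U(3) in auto)
    moreover have "measure lebesgue (U - B) < \<eta>" using U(3,4) \<eta> by (simp add: emeasure_eq_measure2 ennreal_less_iff)
    ultimately show ?thesis using Ueq by simp
  qed
  define good where "good x r g \<longleftrightarrow> g \<in> borel_measurable borel \<and>
     (\<forall>p. p $ j = 0 \<longrightarrow> 2 * Hpre \<kappa> (fib (E \<inter> cB x r) p) \<le> g p) \<and> (\<integral>\<^sup>+p. g p \<partial>Pm) \<le> ennreal ((a + \<eta>) * (r ^ nu * om))"
    for x r and g :: "real^'n \<Rightarrow> ennreal"
  define K where "K = {(x,r). x \<in> Z \<and> 0 < r \<and> cB x r \<subseteq> U \<and> (\<exists>g. good x r g)}"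
  have "\<exists>C\<subseteq>K. countable C \<and> (\<forall>c\<in>C. \<forall>c'\<in>C. c \<noteq> c' \<longrightarrow> case_prod cB c \<inter> case_prod cB c' = {}) \<and>
    negligible (Z - (\<Union>c\<in>C. case_prod cB c))"
  proof (rule vitali_cover[OF Ul])
    show "0 < r \<and> cB x r \<subseteq> U" if "(x,r) \<in> K" for x r using that by (simp add: K_def)
    fix x and d :: real assume x: "x \<in> Z" and d: "d > 0"
    obtain L where L: "pansu_diff_with gm \<sigma> E \<phi> x L" "Jc L \<le> a" using Z(2)[OF x] by blast
    obtain r0 where r0: "r0 > 0" "\<And>r. 0 < r \<Longrightarrow> r < r0 \<Longrightarrow> \<exists>g\<in>borel_measurable borel.
     (\<forall>p. p $ j = 0 \<longrightarrow> 2 * Hpre \<kappa> (fib (E \<inter> cB x r) p) \<le> g p) \<and> (\<integral>\<^sup>+p. g p \<partial>Pm) \<le> ennreal ((Jc L + \<eta>) * (r ^ nu * om))"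
      using blow_up_estimate[OF L(1) \<eta> \<kappa>] by blast
    obtain s where s: "s > 0" "cB x s \<subseteq> U" using open_contains_cB[OF U(1), of x] x Z(1) U(2) by blast
    define r where "r = min d (min r0 s) / 2"
    have m: "min d (min r0 s) > 0" using d r0(1) s(1) by simp
    have r: "r > 0" "r < d" "r < r0" "r \<le> s" using m unfolding r_def by linarith+
    have "cB x r \<subseteq> cB x s" using r(4) by (auto simp: cB_def)
    then have cU: "cB x r \<subseteq> U" using s(2) by blast
    obtain g where g: "g \<in> borel_measurable borel" "\<forall>p. p $ j = 0 \<longrightarrow> 2 * Hpre \<kappa> (fib (E \<inter> cB x r) p) \<le> g p"
      "(\<integral>\<^sup>+p. g p \<partial>Pm) \<le> ennreal ((Jc L + \<eta>) * (r ^ nu * om))" using r0(2)[OF r(1) r(3)] by blast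
    have "(Jc L + \<eta>) * (r ^ nu * om) \<le> (a + \<eta>) * (r ^ nu * om)" using L(2) r(1) om_pos by (intro mult_right_mono) auto
    then have "good x r g" unfolding good_def using g order.trans[OF g(3) ennreal_leI] by blast
    then show "\<exists>r. (x,r) \<in> K \<and> r < d" using x r cU by (intro exI[of _ r]) (auto simp: K_def)
  qed
  then obtain C where C: "C \<subseteq> K" "countable C" "\<forall>c\<in>C. \<forall>c'\<in>C. c \<noteq> c' \<longrightarrow> case_prod cB c \<inter> case_prod cB c' = {}"
    "negligible (Z - (\<Union>c\<in>C. case_prod cB c))" by blast
  let ?N = "B - (\<Union>c\<in>C. case_prod cB c)"
  have "negligible ?N"
  proof (rule full)
    have "(\<Union>c\<in>C. case_prod cB c) \<in> sets lebesgue"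
      by (rule sets.countable_UN'[OF C(2)]) (use cB_lmeasurable in \<open>auto simp: fmeasurable_def\<close>)
    then show "?N \<in> sets lebesgue" using Bs by (intro sets.Diff)
    show "negligible (?N \<inter> Z)" by (rule negligible_subset[OF C(4)]) blast
  qed blast
  then have null: "AE p in Pm. H1 gm \<sigma> (fib ?N p) = 0" by (rule null_fibre) (use B(2) in blast)
  have CK: "fst c \<in> Z" "0 < snd c" "case_prod cB c \<subseteq> U" "\<exists>g. good (fst c) (snd c) g" if "c \<in> C" for c
  proof -
    have "(fst c, snd c) \<in> K" using that C(1) by auto
    then show "fst c \<in> Z" "0 < snd c" "case_prod cB c \<subseteq> U" "\<exists>g. good (fst c) (snd c) g" unfolding K_def by (auto simp: case_prod_beta)
  qed
  have "\<exists>x r. (\<forall>n::nat. r n = 0 \<or> (x n, r n) \<in> C) \<and> (\<forall>c\<in>C. \<exists>n. c = (x n, r n)) \<and>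
     (\<Sum>n. ennreal (r n ^ nu * om)) \<le> ennreal (measure lebesgue U)"
  proof (rule disjoint_cB_sequence[OF Ul])
    show "0 < snd c \<and> case_prod cB c \<subseteq> U" if "c \<in> C" for c using CK(2,3)[OF that] by simp
    show "case_prod cB c \<inter> case_prod cB c' = {}" if "c \<in> C" "c' \<in> C" "c \<noteq> c'" for c c' using C(3) that by simp
  qed
  then obtain x r where r: "\<And>n::nat. r n = 0 \<or> (x n, r n) \<in> C" and xr: "\<And>c. c \<in> C \<Longrightarrow> \<exists>n. c = (x n, r n)"
    and s: "(\<Sum>n. ennreal (r n ^ nu * om)) \<le> ennreal (measure lebesgue U)" by blast
  define D where "D n = (if r n = 0 then {} else E \<inter> cB (x n) (r n))" for n
  have "\<forall>n. \<exists>g. g \<in> borel_measurable borel \<and> (\<forall>p. p $ j = 0 \<longrightarrow> 2 * Hpre \<kappa> (fib (D n) p) \<le> g p) \<and>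
      (\<integral>\<^sup>+p. g p \<partial>Pm) \<le> ennreal (a + \<eta>) * ennreal (r n ^ nu * om)"
  proof
    fix n
    show "\<exists>g. g \<in> borel_measurable borel \<and> (\<forall>p. p $ j = 0 \<longrightarrow> 2 * Hpre \<kappa> (fib (D n) p) \<le> g p) \<and>
      (\<integral>\<^sup>+p. g p \<partial>Pm) \<le> ennreal (a + \<eta>) * ennreal (r n ^ nu * om)"
    proof (cases "r n = 0")
      case True
      have "fib (D n) p = {}" for p using True by (simp add: D_def fib_def)
      then show ?thesis using \<kappa> by (intro exI[of _ "\<lambda>_. 0"]) (simp add: Hpre_empty)
    next
      case False
      then have rn: "(x n, r n) \<in> C" using r[of n] by simp
      obtain g where "good (x n) (r n) g" using CK(4)[OF rn] by auto
      moreover have "ennreal ((a + \<eta>) * (r n ^ nu * om)) = ennreal (a + \<eta>) * ennreal (r n ^ nu * om)"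
        using a \<eta> by (intro ennreal_mult') simp
      ultimately show ?thesis using False unfolding good_def D_def by (intro exI[of _ g]) simp
    qed
  qed
  from choice[OF this] obtain g where g: "\<And>n. g n \<in> borel_measurable borel"
    "\<And>n p. p $ j = 0 \<Longrightarrow> 2 * Hpre \<kappa> (fib (D n) p) \<le> g n p"
    "\<And>n. (\<integral>\<^sup>+p. g n p \<partial>Pm) \<le> ennreal (a + \<eta>) * ennreal (r n ^ nu * om)" by blast
  define G where "G p = (\<Sum>n. g n p)" for p
  have Gm: "G \<in> borel_measurable borel" unfolding G_def using g(1) by measurable
  have "(\<integral>\<^sup>+p. G p \<partial>Pm) = (\<Sum>n. \<integral>\<^sup>+p. g n p \<partial>Pm)" unfolding G_def using g(1) by (intro nn_integral_suminf) simp
  also have "\<dots> \<le> (\<Sum>n. ennreal (a + \<eta>) * ennreal (r n ^ nu * om))" using g(3) by (intro suminf_le) auto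
  also have "\<dots> = ennreal (a + \<eta>) * (\<Sum>n. ennreal (r n ^ nu * om))" by simp
  also have "\<dots> \<le> ennreal (a + \<eta>) * ennreal (measure lebesgue U)" by (rule mult_left_mono[OF s]) simp
  also have "\<dots> \<le> ennreal ((a + \<eta>) * (measure lebesgue B + \<eta>))"
    using a \<eta> Um by (subst ennreal_mult'[symmetric]) (auto intro!: ennreal_leI mult_left_mono)
  finally have Gi: "(\<integral>\<^sup>+p. G p \<partial>Pm) \<le> ennreal ((a + \<eta>) * (measure lebesgue B + \<eta>))" .
  have "AE p in Pm. 2 * Hpre \<kappa> (fib B p) \<le> G p"
    using null AE_Pm_hyperplane
  proof eventually_elim
    case (elim p)
    have "fib B p \<subseteq> (\<Union>n. fib (D n) p) \<union> fib ?N p"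
    proof
      fix y assume y: "y \<in> fib B p"
      show "y \<in> (\<Union>n. fib (D n) p) \<union> fib ?N p"
      proof (cases "y \<in> (\<Union>c\<in>C. case_prod cB c)")
        case True
        then obtain c where c: "c \<in> C" "y \<in> case_prod cB c" by blast
        obtain n where n: "c = (x n, r n)" using xr[OF c(1)] by blast
        have "r n > 0" using CK(2)[OF c(1)] n by simp
        then have "y \<in> fib (D n) p" using y c(2) n B(2) by (auto simp: fib_def D_def)
        then show ?thesis by blast
      next
        case False
        then show ?thesis using y by (auto simp: fib_def)
      qed
    qed
    then have "Hpre \<kappa> (fib B p) \<le> Hpre \<kappa> ((\<Union>n. fib (D n) p) \<union> fib ?N p)" by (rule Hpre_mono)
    also have "\<dots> \<le> Hpre \<kappa> (\<Union>n. fib (D n) p) + Hpre \<kappa> (fib ?N p)" using \<kappa> by (intro Hpre_Un) simp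
    also have "\<dots> \<le> (\<Sum>n. Hpre \<kappa> (fib (D n) p)) + Hpre \<kappa> (fib ?N p)" by (intro add_right_mono Hpre_UN)
    finally have "2 * Hpre \<kappa> (fib B p) \<le> 2 * ((\<Sum>n. Hpre \<kappa> (fib (D n) p)) + Hpre \<kappa> (fib ?N p))" by (rule mult_left_mono) simp
    also have "\<dots> = (\<Sum>n. 2 * Hpre \<kappa> (fib (D n) p)) + 2 * Hpre \<kappa> (fib ?N p)" by (simp add: distrib_left)
    also have "2 * Hpre \<kappa> (fib ?N p) = 0" using Hpre_le_H1[OF \<kappa>, of "fib ?N p"] elim(1) by simp
    also have "(\<Sum>n. 2 * Hpre \<kappa> (fib (D n) p)) + 0 \<le> G p" unfolding G_def add_0_right by (intro suminf_le g(2) elim(2)) auto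
    finally show ?case .
  qed
  then show ?thesis using Gm Gi by blast
qed

lemma vitali_fibre_bound:
  assumes B: "B \<in> lmeasurable" "B \<subseteq> E" and a: "a \<ge> 0"
    and Z: "Z \<subseteq> B" "\<And>x. x \<in> Z \<Longrightarrow> \<exists>L. pansu_diff_with gm \<sigma> E \<phi> x L \<and> Jc L \<le> a"
    and full: "\<And>S. S \<in> sets lebesgue \<Longrightarrow> S \<subseteq> B \<Longrightarrow> negligible (S \<inter> Z) \<Longrightarrow> negligible S"
  shows "fib_bound B (ennreal (a * measure lebesgue B))"
proof -
  let ?t = "\<lambda>n. 1 / real (Suc n)"
  have "\<forall>n. \<exists>G. G \<in> borel_measurable borel \<and> (AE p in Pm. 2 * Hpre (?t n) (fib B p) \<le> G p) \<and>
     (\<integral>\<^sup>+p. G p \<partial>Pm) \<le> ennreal ((a + ?t n) * (measure lebesgue B + ?t n))"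
  proof
    fix n
    have "\<exists>G\<in>borel_measurable borel. (AE p in Pm. 2 * Hpre (?t n) (fib B p) \<le> G p) \<and>
     (\<integral>\<^sup>+p. G p \<partial>Pm) \<le> ennreal ((a + ?t n) * (measure lebesgue B + ?t n))"
      by (rule vitali_fibre_step[OF B a Z(1)]) (assumption | rule Z(2) full | simp)+
    then show "\<exists>G. G \<in> borel_measurable borel \<and> (AE p in Pm. 2 * Hpre (?t n) (fib B p) \<le> G p) \<and>
     (\<integral>\<^sup>+p. G p \<partial>Pm) \<le> ennreal ((a + ?t n) * (measure lebesgue B + ?t n))" by blast
  qed
  from choice[OF this] obtain G where G: "\<And>n. G n \<in> borel_measurable borel" "\<And>n. AE p in Pm. 2 * Hpre (?t n) (fib B p) \<le> G n p"
    "\<And>n. (\<integral>\<^sup>+p. G n p \<partial>Pm) \<le> ennreal ((a + ?t n) * (measure lebesgue B + ?t n))" by blast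
  \<comment> \<open>The majorants for different meshes are unrelated to each other, so their lower
    limit is taken; it dominates the increasing limit of the premeasures.\<close>
  have Gm: "(\<lambda>p. liminf (\<lambda>n. G n p)) \<in> borel_measurable borel" using G(1) by measurable
  have "AE p in Pm. \<forall>n. 2 * Hpre (?t n) (fib B p) \<le> G n p" using G(2) by (simp add: AE_all_countable)
  then have "AE p in Pm. H1 gm \<sigma> (fib B p) \<le> liminf (\<lambda>n. G n p)"
  proof (rule AE_mp, intro AE_I2 impI)
    fix p assume h: "\<forall>n. 2 * Hpre (?t n) (fib B p) \<le> G n p"
    have inc: "incseq (\<lambda>n. 2 * Hpre (?t n) (fib B p))" by (intro incseq_SucI mult_left_mono Hpre_seq_mono) auto
    have "H1 gm \<sigma> (fib B p) = (SUP n. 2 * Hpre (?t n) (fib B p))" by (rule H1_seq)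
    also have "\<dots> = liminf (\<lambda>n. 2 * Hpre (?t n) (fib B p))"
      using LIMSEQ_SUP[OF inc] by (intro lim_imp_Liminf[symmetric]) simp_all
    also have "\<dots> \<le> liminf (\<lambda>n. G n p)" using h by (intro Liminf_mono always_eventually) simp
    finally show "H1 gm \<sigma> (fib B p) \<le> liminf (\<lambda>n. G n p)" .
  qed
  moreover have "(\<integral>\<^sup>+p. liminf (\<lambda>n. G n p) \<partial>Pm) \<le> ennreal (a * measure lebesgue B)"
  proof -
    have "(\<integral>\<^sup>+p. liminf (\<lambda>n. G n p) \<partial>Pm) \<le> liminf (\<lambda>n. \<integral>\<^sup>+p. G n p \<partial>Pm)" using G(1) by (intro nn_integral_liminf) simp
    also have "\<dots> \<le> liminf (\<lambda>n. ennreal ((a + ?t n) * (measure lebesgue B + ?t n)))" using G(3) by (intro Liminf_mono always_eventually) simp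
    also have "\<dots> = ennreal ((a + 0) * (measure lebesgue B + 0))"
      by (intro lim_imp_Liminf tendsto_ennrealI tendsto_intros LIMSEQ_Suc lim_1_over_n) simp
    finally show ?thesis by simp
  qed
  ultimately show ?thesis unfolding fib_bound_def using Gm by (intro bexI[of _ "\<lambda>p. liminf (\<lambda>n. G n p)"] conjI)
qed

abbreviation Jx :: "real^'n \<Rightarrow> real" where "Jx x \<equiv> Jc (pansu_diff gm \<sigma> E \<phi> x)"

lemma pansu_diff_works: "\<exists>L. pansu_diff_with gm \<sigma> E \<phi> x L \<Longrightarrow> pansu_diff_with gm \<sigma> E \<phi> x (pansu_diff gm \<sigma> E \<phi> x)"
  unfolding pansu_diff_def by (rule someI_ex[of "pansu_diff_with gm \<sigma> E \<phi> x"])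

text \<open>The integrand need not be known to be measurable, so the Lebesgue integral is a lower integral here. It is attained
  at a measurable minorant g, and maximality of g shows that the set where the integrand is below \<open>g + \<eta>\<close> has full
  outer measure, which is enough for a Vitali covering.\<close>

lemma bounded_fibre_bound_eta:
  assumes A: "A \<in> lmeasurable" "A \<subseteq> E" and fin: "(\<integral>\<^sup>+x\<in>A. ennreal (Jx x) \<partial>lebesgue) < \<infinity>" and \<eta>: "\<eta> > 0"
  shows "fib_bound A ((\<integral>\<^sup>+x\<in>A. ennreal (Jx x) \<partial>lebesgue) + ennreal (2 * \<eta>) * emeasure lebesgue A)"
proof -
  define u where "u x = ennreal (Jx x) * indicator A x" for x
  have As: "A \<in> sets lebesgue" using A(1) by (rule fmeasurableD)
  obtain g where g: "g \<in> borel_measurable lebesgue" "\<And>x. g x \<le> u x" "(\<integral>\<^sup>+x. g x \<partial>lebesgue) = (\<integral>\<^sup>+x. u x \<partial>lebesgue)"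
    using nn_integral_attained[of lebesgue u] by blast
  have lip': "cc_lipschitz_on gm \<sigma> E \<phi>" unfolding cc_lipschitz_on_def using lip by blast
  have npd: "negligible {x \<in> A. \<not> (\<exists>L. pansu_diff_with gm \<sigma> E \<phi> x L)}" by (rule pansu_ae[OF As A(2) lip'])
  define Z where "Z = {x \<in> A. (\<exists>L. pansu_diff_with gm \<sigma> E \<phi> x L) \<and> u x < g x + ennreal \<eta>}"
  \<comment> \<open>Off Z, at points of differentiability, u exceeds g by at least \<eta>. On a set
    of positive measure missing Z, adding \<eta> to g would give a measurable minorant with larger
    integral.\<close>
  have max: "negligible S" if S: "S \<in> sets lebesgue" "S \<subseteq> A" "negligible (S \<inter> Z)" for S
  proof -
    let ?N = "(S \<inter> Z) \<union> {x \<in> A. \<not> (\<exists>L. pansu_diff_with gm \<sigma> E \<phi> x L)}"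
    have N: "negligible ?N" using S(3) npd by (rule negligible_Un)
    define S' where "S' = S - ?N"
    have S's: "S' \<in> sets lebesgue" unfolding S'_def using S(1) N by (intro sets.Diff) (auto simp: negligible_iff_null_sets)
    have le: "g x + ennreal \<eta> * indicator S' x \<le> u x" for x
    proof (cases "x \<in> S'")
      case True
      then have "x \<in> A" "\<exists>L. pansu_diff_with gm \<sigma> E \<phi> x L" "x \<notin> Z" using S(2) by (auto simp: S'_def)
      then show ?thesis using True unfolding Z_def by (simp add: not_less)
    qed (use g(2) in simp)
    have "(\<integral>\<^sup>+x. u x \<partial>lebesgue) + ennreal \<eta> * emeasure lebesgue S' = (\<integral>\<^sup>+x. g x + ennreal \<eta> * indicator S' x \<partial>lebesgue)"
      using S's g(1) by (subst nn_integral_add) (auto simp: g(3) nn_integral_cmult_indicator)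
    also have "\<dots> \<le> (\<integral>\<^sup>+x. u x \<partial>lebesgue)" by (rule nn_integral_mono[OF le])
    finally have "(\<integral>\<^sup>+x. u x \<partial>lebesgue) + ennreal \<eta> * emeasure lebesgue S' \<le> (\<integral>\<^sup>+x. u x \<partial>lebesgue) + 0" by simp
    moreover have "(\<integral>\<^sup>+x. u x \<partial>lebesgue) \<noteq> \<infinity>" using fin unfolding u_def by (rule less_imp_neq)
    ultimately have "ennreal \<eta> * emeasure lebesgue S' \<le> 0" unfolding ennreal_add_left_cancel_le by blast
    then have "emeasure lebesgue S' = 0" using \<eta> by simp
    then have "negligible S'" using S's by (simp add: negligible_iff_null_sets null_sets_def)
    then have "negligible (S' \<union> ?N)" using N by (rule negligible_Un)
    then show ?thesis by (rule negligible_subset) (auto simp: S'_def)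
  qed
  \<comment> \<open>The slices are cut along g, which is measurable, and not along u. On a slice g <
    (m + 1) \<eta>, and at points of Z moreover u < g + \<eta>, hence the bound (m + 2) \<eta>;
    compared with m \<eta> \<le> g this loses 2 \<eta>.\<close>
  define a where "a m = (real m + 2) * \<eta>" for m :: nat
  define B where "B m = A \<inter> {x. ennreal (real m * \<eta>) \<le> g x \<and> g x < ennreal ((real m + 1) * \<eta>)}" for m :: nat
  have Bs: "B m \<in> sets lebesgue" for m
  proof -
    have "{x \<in> space lebesgue. ennreal (real m * \<eta>) \<le> g x \<and> g x < ennreal ((real m + 1) * \<eta>)} \<in> sets lebesgue" using g(1) by measurable
    then show ?thesis unfolding B_def using As by (intro sets.Int) simp_all
  qed
  have Bl: "B m \<in> lmeasurable" for m by (rule fmeasurableI2[OF A(1) _ Bs]) (simp add: B_def)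
  have piece: "fib_bound (B m) (ennreal (a m * measure lebesgue (B m)))" for m
  proof (rule vitali_fibre_bound[OF Bl])
    show "B m \<subseteq> E" using A(2) by (auto simp: B_def)
    show "a m \<ge> 0" using \<eta> by (simp add: a_def)
    show "Z \<inter> B m \<subseteq> B m" by blast
    show "negligible S" if "S \<in> sets lebesgue" "S \<subseteq> B m" "negligible (S \<inter> (Z \<inter> B m))" for S
    proof (rule max[OF that(1)])
      show "S \<subseteq> A" using that(2) by (auto simp: B_def)
      have "S \<inter> (Z \<inter> B m) = S \<inter> Z" using that(2) by blast
      then show "negligible (S \<inter> Z)" using that(3) by simp
    qed
    fix x assume x: "x \<in> Z \<inter> B m"
    then have pd: "\<exists>L. pansu_diff_with gm \<sigma> E \<phi> x L" and ux: "u x < g x + ennreal \<eta>" and gx: "g x < ennreal ((real m + 1) * \<eta>)" and xA: "x \<in> A"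
      by (simp_all add: Z_def B_def)
    have "ennreal (Jx x) = u x" using xA by (simp add: u_def)
    also have "\<dots> \<le> g x + ennreal \<eta>" using ux by simp
    also have "\<dots> \<le> ennreal ((real m + 1) * \<eta>) + ennreal \<eta>" using gx by (intro add_right_mono) simp
    also have "\<dots> = ennreal (a m)" using \<eta> by (simp add: ennreal_plus[symmetric] a_def algebra_simps del: ennreal_plus)
    finally have "Jx x \<le> a m" using \<eta> by (simp add: a_def)
    then show "\<exists>L. pansu_diff_with gm \<sigma> E \<phi> x L \<and> Jc L \<le> a m" using pansu_diff_works[OF pd] by blast
  qed
  have UB: "(\<Union>m. B m) = A"
  proof (intro equalityI subsetI)
    fix x assume x: "x \<in> A"
    have "g x \<le> ennreal (Jx x)" using g(2)[of x] x by (simp add: u_def)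
    then obtain y where y: "g x = ennreal y" "y \<ge> 0" by (cases "g x") (auto simp: top_unique)
    define m where "m = nat \<lfloor>y / \<eta>\<rfloor>"
    have "real m \<le> y / \<eta>" "y / \<eta> < real m + 1" using y \<eta> unfolding m_def by (simp_all add: floor_less_cancel)
    then have "real m * \<eta> \<le> y" "y < (real m + 1) * \<eta>" using \<eta> by (simp_all add: field_simps)
    then have "x \<in> B m" using x y \<eta> by (simp add: B_def ennreal_less_iff ennreal_leI)
    then show "x \<in> (\<Union>m. B m)" by blast
  qed (auto simp: B_def)
  have dis: "m = m'" if "x \<in> B m" "x \<in> B m'" for x m m'
  proof -
    have lt: "k \<le> l" if "x \<in> B k" "x \<in> B l" for k l :: nat
    proof -
      have "ennreal (real k * \<eta>) < ennreal ((real l + 1) * \<eta>)" using that unfolding B_def by (blast intro: le_less_trans)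
      then have "real k * \<eta> < (real l + 1) * \<eta>" using \<eta> by (simp add: ennreal_less_iff)
      then have "real k < real l + 1" using \<eta> by simp
      then show ?thesis by linarith
    qed
    show ?thesis using lt that by (intro antisym) auto
  qed
  have "fib_bound A (\<Sum>m. ennreal (a m * measure lebesgue (B m)))" using fib_bound_UN[of B, OF piece] unfolding UB .
  moreover have "(\<Sum>m. ennreal (a m * measure lebesgue (B m))) \<le> (\<integral>\<^sup>+x\<in>A. ennreal (Jx x) \<partial>lebesgue) + ennreal (2 * \<eta>) * emeasure lebesgue A"
  proof -
    have "(\<Sum>m. ennreal (a m * measure lebesgue (B m))) = (\<Sum>m. \<integral>\<^sup>+x. ennreal (a m) * indicator (B m) x \<partial>lebesgue)"
    proof (rule suminf_cong)
      fix m
      show "ennreal (a m * measure lebesgue (B m)) = (\<integral>\<^sup>+x. ennreal (a m) * indicator (B m) x \<partial>lebesgue)"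
        using Bs[of m] \<eta> by (simp add: nn_integral_cmult_indicator emeasure_eq_measure2[OF Bl] ennreal_mult' a_def)
    qed
    also have "\<dots> = (\<integral>\<^sup>+x. (\<Sum>m. ennreal (a m) * indicator (B m) x) \<partial>lebesgue)"
      using Bs by (intro nn_integral_suminf[symmetric] borel_measurable_times_ennreal borel_measurable_indicator) auto
    also have "\<dots> \<le> (\<integral>\<^sup>+x. g x + ennreal (2 * \<eta>) * indicator A x \<partial>lebesgue)"
    proof (rule nn_integral_mono)
      fix x
      show "(\<Sum>m. ennreal (a m) * indicator (B m) x) \<le> g x + ennreal (2 * \<eta>) * indicator A x"
      proof (cases "x \<in> A")
        case True
        then obtain m where m: "x \<in> B m" using UB by blast
        have "(\<Sum>k. ennreal (a k) * indicator (B k) x) = (\<Sum>k\<in>{m}. ennreal (a k) * indicator (B k) x)"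
          by (rule suminf_finite) (use dis[OF m] in \<open>auto simp: indicator_def\<close>)
        also have "\<dots> = ennreal (a m)" using m by simp
        also have "\<dots> = ennreal (real m * \<eta>) + ennreal (2 * \<eta>)" using \<eta> by (simp add: ennreal_plus[symmetric] a_def algebra_simps del: ennreal_plus)
        also have "\<dots> \<le> g x + ennreal (2 * \<eta>)" using m by (intro add_right_mono) (simp add: B_def)
        finally show ?thesis using True by simp
      next
        case False
        then have "x \<notin> B m" for m by (simp add: B_def)
        then show ?thesis by simp
      qed
    qed
    also have "\<dots> = (\<integral>\<^sup>+x. g x \<partial>lebesgue) + ennreal (2 * \<eta>) * emeasure lebesgue A"
      using As g(1) by (subst nn_integral_add) (auto simp: nn_integral_cmult_indicator)
    also have "(\<integral>\<^sup>+x. g x \<partial>lebesgue) = (\<integral>\<^sup>+x\<in>A. ennreal (Jx x) \<partial>lebesgue)" unfolding g(3) u_def ..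
    finally show ?thesis .
  qed
  ultimately show ?thesis by (rule fib_bound_mono)
qed

lemma fib_boundD:
  assumes "fib_bound A X" "f \<in> borel_measurable borel" "AE p in Pm. H1 gm \<sigma> (fib A p) = f p"
  shows "(\<integral>\<^sup>+p. f p \<partial>Pm) \<le> X"
proof -
  obtain h where h: "h \<in> borel_measurable borel" "AE p in Pm. H1 gm \<sigma> (fib A p) \<le> h p" "(\<integral>\<^sup>+p. h p \<partial>Pm) \<le> X"
    using assms(1) unfolding fib_bound_def by blast
  have "AE p in Pm. f p \<le> h p" using h(2) assms(3) by eventually_elim simp
  then show ?thesis using nn_integral_mono_AE h(3) order.trans by blast
qed

text \<open>A Borel version f of the fibre measure is fixed first, so that \<eta> can tend to 0 in
  an inequality between numbers; the finite measure of A makes the error vanish.\<close>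

lemma bounded_fibre_bound:
  assumes A: "A \<in> lmeasurable" "A \<subseteq> E"
  shows "fib_bound A (\<integral>\<^sup>+x\<in>A. ennreal (Jx x) \<partial>lebesgue)" (is "fib_bound A ?I")
proof -
  have As: "A \<in> sets lebesgue" using A(1) by (rule fmeasurableD)
  obtain f where f: "f \<in> borel_measurable borel" "AE p in Pm. H1 gm \<sigma> (fib A p) = f p" using H1_fib_ae_borel[OF As A(2)] by blast
  have "(\<integral>\<^sup>+p. f p \<partial>Pm) \<le> ?I"
  proof (cases "?I < \<infinity>")
    case True
    have "(\<integral>\<^sup>+p. f p \<partial>Pm) \<le> ?I + ennreal (2 * (1 / real (Suc n))) * ennreal (measure lebesgue A)" for n
      using fib_boundD[OF bounded_fibre_bound_eta[OF A True, of "1 / real (Suc n)"] f] by (simp add: emeasure_eq_measure2[OF A(1)])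
    moreover have "(\<lambda>n. ?I + ennreal (2 * (1 / real (Suc n))) * ennreal (measure lebesgue A)) \<longlonglongrightarrow> ?I + ennreal (2 * 0) * ennreal (measure lebesgue A)"
      by (intro tendsto_add tendsto_const ennreal_tendsto_cmult tendsto_ennrealI tendsto_intros LIMSEQ_Suc lim_1_over_n tendsto_mult_ennreal) auto
    ultimately have "(\<integral>\<^sup>+p. f p \<partial>Pm) \<le> ?I + ennreal (2 * 0) * ennreal (measure lebesgue A)" by (intro LIMSEQ_le_const) auto
    then show ?thesis by simp
  qed (simp add: less_top[symmetric])
  moreover have "AE p in Pm. H1 gm \<sigma> (fib A p) \<le> f p" using f(2) by eventually_elim simp
  ultimately show ?thesis unfolding fib_bound_def using f(1) by blast
qed

text \<open>Annuli reduce the claim to bounded sets. Lower integrals are superadditive over disjoint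
  pieces, which is the direction wanted here: the sum of minorants on the annuli is a minorant on
  A.\<close>

lemma fibre_bound:
  assumes A: "A \<in> sets lebesgue" "A \<subseteq> E"
  shows "fib_bound A (\<integral>\<^sup>+x\<in>A. ennreal (Jx x) \<partial>lebesgue)"
proof -
  define R where "R m = {x::real^'n. real m \<le> norm x \<and> norm x < real m + 1}" for m :: nat
  have Rb: "R m \<in> sets borel" for m unfolding R_def by measurable
  define B where "B m = A \<inter> R m" for m
  have Bs: "B m \<in> sets lebesgue" for m unfolding B_def using A(1) Rb by (intro sets.Int) auto
  have Bl: "B m \<in> lmeasurable" for m
    by (rule bounded_set_imp_lmeasurable[OF bounded_subset[OF bounded_cball[of 0 "real m + 1"]] Bs]) (auto simp: B_def R_def)
  have dis: "m = m'" if "x \<in> B m" "x \<in> B m'" for x m m' using that by (auto simp: B_def R_def)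
  have UB: "(\<Union>m. B m) = A"
  proof (intro equalityI subsetI)
    fix x assume x: "x \<in> A"
    have "x \<in> R (nat \<lfloor>norm x\<rfloor>)" unfolding R_def by simp
    then show "x \<in> (\<Union>m. B m)" using x by (auto simp: B_def)
  qed (auto simp: B_def)
  have "fib_bound (B m) (\<integral>\<^sup>+x\<in>B m. ennreal (Jx x) \<partial>lebesgue)" for m
    by (rule bounded_fibre_bound[OF Bl]) (use A(2) in \<open>auto simp: B_def\<close>)
  from fib_bound_UN[of B, OF this] have 1: "fib_bound A (\<Sum>m. \<integral>\<^sup>+x\<in>B m. ennreal (Jx x) \<partial>lebesgue)" unfolding UB .
  have "\<forall>m. \<exists>g. g \<in> borel_measurable lebesgue \<and> (\<forall>x. g x \<le> ennreal (Jx x) * indicator (B m) x) \<and>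
      (\<integral>\<^sup>+x. g x \<partial>lebesgue) = (\<integral>\<^sup>+x\<in>B m. ennreal (Jx x) \<partial>lebesgue)"
    using nn_integral_attained[of lebesgue "\<lambda>x. ennreal (Jx x) * indicator (B _) x"] by blast
  from choice[OF this] obtain g where g: "\<And>m. g m \<in> borel_measurable lebesgue" "\<And>m x. g m x \<le> ennreal (Jx x) * indicator (B m) x"
      "\<And>m. (\<integral>\<^sup>+x. g m x \<partial>lebesgue) = (\<integral>\<^sup>+x\<in>B m. ennreal (Jx x) \<partial>lebesgue)" by blast
  have "(\<Sum>m. \<integral>\<^sup>+x\<in>B m. ennreal (Jx x) \<partial>lebesgue) = (\<integral>\<^sup>+x. (\<Sum>m. g m x) \<partial>lebesgue)"
    unfolding g(3)[symmetric] using g(1) by (intro nn_integral_suminf[symmetric])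
  also have "\<dots> \<le> (\<integral>\<^sup>+x\<in>A. ennreal (Jx x) \<partial>lebesgue)"
  proof (rule nn_integral_mono)
    fix x
    have "(\<Sum>m. g m x) \<le> (\<Sum>m. ennreal (Jx x) * indicator (B m) x)" using g(2) by (intro suminf_le) auto
    also have "\<dots> \<le> ennreal (Jx x) * indicator A x"
    proof (cases "x \<in> A")
      case True
      then obtain m where m: "x \<in> B m" using UB by blast
      have "(\<Sum>k. ennreal (Jx x) * indicator (B k) x) = (\<Sum>k\<in>{m}. ennreal (Jx x) * indicator (B k) x)"
        by (rule suminf_finite) (use dis[OF m] in \<open>auto simp: indicator_def\<close>)
      then show ?thesis using m True by simp
    next
      case False
      then have "x \<notin> B m" for m by (simp add: B_def)
      then show ?thesis by simp
    qed
    finally show "(\<Sum>m. g m x) \<le> ennreal (Jx x) * indicator A x" .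
  qed
  finally show ?thesis by (rule fib_bound_mono[OF 1])
qed

end

theorem mainTheorem1:
  fixes gm :: "real^'n::finite \<Rightarrow> real^'n \<Rightarrow> real^'n"
    and \<sigma> :: "'n \<Rightarrow> nat" and j :: 'n
    and E A :: "(real^'n) set" and \<phi> :: "real^'n \<Rightarrow> real^'n"
  assumes "carnot_group gm \<sigma>"
    and "\<sigma> j = 1"
    and "cc_lipschitz_on gm \<sigma> E \<phi>"
    and "A \<in> sets lebesgue" and "A \<subseteq> E"
  shows "(\<lambda>q. H1 gm \<sigma> {x \<in> A. proj gm j (\<phi> x) = hyp_emb j q})
            \<in> borel_measurable (completion (PiM (UNIV - {j}) (\<lambda>_. lborel)))
       \<and> (\<integral>\<^sup>+ q. H1 gm \<sigma> {x \<in> A. proj gm j (\<phi> x) = hyp_emb j q}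
              \<partial>completion (PiM (UNIV - {j}) (\<lambda>_. lborel)))
         \<le> (\<integral>\<^sup>+ x \<in> A. ennreal (norm (adjugate (matrix (pansu_diff gm \<sigma> E \<phi> x)) *v axis j 1)) \<partial>lebesgue)"
proof -
  interpret carnot_proj gm \<sigma> j by unfold_locales (rule assms(1), rule assms(2))
  obtain C where C: "\<forall>x\<in>E. \<forall>y\<in>E. cc_dist gm \<sigma> (\<phi> x) (\<phi> y) \<le> C * cc_dist gm \<sigma> x y"
    using assms(3) unfolding cc_lipschitz_on_def by blast
  \<comment> \<open>The hypothesis does not fix the sign of C, while the locale asks for a
    nonnegative constant.\<close>
  interpret carnot_lip gm \<sigma> j E \<phi> "\<bar>C\<bar>"
  proof unfold_locales
    fix x y assume "x \<in> E" "y \<in> E"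
    then have "cc_dist gm \<sigma> (\<phi> x) (\<phi> y) \<le> C * cc_dist gm \<sigma> x y" using C by blast
    also have "\<dots> \<le> \<bar>C\<bar> * cc_dist gm \<sigma> x y" by (intro mult_right_mono rho_nonneg) simp
    finally show "cc_dist gm \<sigma> (\<phi> x) (\<phi> y) \<le> \<bar>C\<bar> * cc_dist gm \<sigma> x y" .
  qed simp
  let ?P = "PiM (UNIV - {j}) (\<lambda>_. lborel :: real measure)"
  have F: "{x \<in> A. proj gm j (\<phi> x) = hyp_emb j q} = fib A (hyp_emb j q)" for q by (simp add: fib_def)
  obtain f where f: "f \<in> borel_measurable borel" "AE p in Pm. H1 gm \<sigma> (fib A p) = f p" using H1_fib_ae_borel[OF assms(4,5)] by blast
  \<comment> \<open>Transfers the almost-everywhere equality from points of the hyperplane to the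
    coordinate tuples q over which the statement integrates; being an equality off a null set only,
    it gives measurability for the completion.\<close>
  have ae: "AE q in ?P. H1 gm \<sigma> (fib A (hyp_emb j q)) = f (hyp_emb j q)"
    using f(2) unfolding Pm_def by (rule AE_distrD[OF hyp_emb_measurable])
  have 1: "(\<lambda>q. H1 gm \<sigma> (fib A (hyp_emb j q))) \<in> borel_measurable (completion ?P)"
    by (rule measurable_completion_AE_eq[OF measurable_compose[OF hyp_emb_measurable f(1)] ae]) simp
  have "(\<integral>\<^sup>+q. H1 gm \<sigma> (fib A (hyp_emb j q)) \<partial>completion ?P) = (\<integral>\<^sup>+q. f (hyp_emb j q) \<partial>?P)"
    unfolding nn_integral_completion by (rule nn_integral_cong_AE[OF ae])
  also have "\<dots> = (\<integral>\<^sup>+p. f p \<partial>Pm)" by (rule nn_integral_Pm[OF f(1), symmetric])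
  also have "\<dots> \<le> (\<integral>\<^sup>+x\<in>A. ennreal (norm (adjugate (matrix (pansu_diff gm \<sigma> E \<phi> x)) *v axis j 1)) \<partial>lebesgue)"
    by (rule fib_boundD[OF fibre_bound[OF assms(4,5)] f])
  finally show ?thesis using 1 unfolding F by blast
qed

end
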